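(* Let $p,\mu,\alpha$ be given with $1\le p\le\infty$, $\mu\in\mathbb N\cup\{0\}$, and $$-\tfrac12<\alpha-\tfrac\mu2\le 0\ \text{ if } p=1,\qquad -\tfrac1{2p}<\alpha-\tfrac\mu2<\tfrac12-\tfrac1{2p}\ \text{ if } 1<p<\infty,\qquad 0\le\alpha-\tfrac\mu2<\tfrac12\ \text{ if } p=\infty.$$ Let $f\in L_{p,\alpha}$. Then for every natural number $n$ $$C_1E_n(f)_{p,\alpha}\le\hat\omega\left(f,\tfrac1n,\mu\right)_{p,\alpha}\le C_2\frac1{n^2}\sum_{\nu=1}^n\nu E_\nu(f)_{p,\alpha},$$ where the positive constants $C_1$ and $C_2$ do not depend on $f$ and $n$.
   Context: For $1\le p<\infty$, $L_p$ is the set of Lebesgue measurable functions on $[-1,1]$ with $\|f\|_p=(\int_{-1}^1|f(x)|^p\,dx)^{1/p}<\infty$; $L_\infty$ is the set of functions continuous on $[-1,1]$ with $\|f\|_\infty=\max_{-1\le x\le1}|f(x)|$. $L_{p,\alpha}$ is the set of functions $f$ such that $f(x)(1-x^2)^\alpha\in L_p$, with norm $\|f\|_{p,\alpha}=\|f(x)(1-x^2)^\alpha\|_p$. $E_n(f)_{p,\alpha}=\inf_{P_n}\|f-P_n\|_{p,\alpha}$, the infimum being over all algebraic polynomials $P_n$ of degree at most $n-1$. Generalised translation operator: for $\mu\in\mathbb N\cup\{0\}$ and $0\le t<\pi$, $$\hat\tau_t(f,x,\mu)=\frac1{\pi(1-x^2)^{\mu/2}(\cos\frac t2)^{2\mu}}\int_0^\pi(1-R^2)^{\mu/2}f(R)\cos\mu(\varphi_1-\varphi)\,d\varphi_1,$$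 where, for $x=\cos\theta_1$ ($\theta_1\in(0,\pi)$) and $\varphi_1\in[0,\pi]$, the quantities $R=\cos\theta$ ($\theta\in[0,\pi]$) and $\varphi$ are determined by $$R=\cos\theta_1\cos t-\sin\theta_1\sin t\cos\varphi_1,\quad \sin\theta\cos\varphi=\cos\theta_1\sin t+\sin\theta_1\cos t\cos\varphi_1,\quad \sin\theta\sin\varphi=\sin\theta_1\sin\varphi_1$$ ($\varphi$ is determined modulo $2\pi$ when $\sin\theta\neq0$). For $-\pi<t<0$, $\hat\tau_t=\hat\tau_{-t}$. Generalised modulus of smoothness: $\hat\omega(f,\delta,\mu)_{p,\alpha}=\sup_{|t|\le\delta}\|\hat\tau_t(f,x,\mu)-f(x)\|_{p,\alpha}$ (norm in the variable $x$). *)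

theory Defs
  imports "HOL-Analysis.Analysis" "HOL-Computational_Algebra.Polynomial"
begin

text \<open>
  Exponents \<open>p \<in> [1,\<infinity>]\<close> are elements of \<^typ>\<open>ennreal\<close>. Norms, best approximations and moduli take
  values in \<^typ>\<open>ennreal\<close>, so that they are meaningful without any integrability or boundedness
  side conditions.

  For \<open>p = \<infinity>\<close> the supremum ranges over the open interval because the generalised translation and
  the weight (whose value at the end points would be \<open>0\<^sup>0\<close> or require a value of \<open>f\<close> there) are given
  only there; for functions continuous on \<open>[-1,1]\<close> it is the maximum over \<open>[-1,1]\<close>, see
  \<open>Lp_norm_infinity\<close> below.
\<close>

definition Lp_norm :: "ennreal \<Rightarrow> (real \<Rightarrow> real) \<Rightarrow> ennreal" where
  "Lp_norm p g =
    (if p = \<infinity> then (SUP x\<in>{-1<..<1}. ennreal \<bar>g x\<bar>)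
     else (let I = (\<integral>\<^sup>+ x\<in>{-1..1}. ennreal (\<bar>g x\<bar> powr enn2real p) \<partial>lebesgue)
           in if I = \<infinity> then \<infinity> else ennreal (enn2real I powr (1 / enn2real p))))"

definition Lp_space :: "ennreal \<Rightarrow> (real \<Rightarrow> real) set" where
  "Lp_space p =
    (if p = \<infinity> then {g. continuous_on {-1..1} g}
     else {g. g \<in> borel_measurable (lebesgue_on {-1..1}) \<and> Lp_norm p g < \<infinity>})"

lemma Lp_norm_infinity:
  assumes "continuous_on {-1..1} g"
  shows "Lp_norm \<infinity> g = (SUP x\<in>{-1..1}. ennreal \<bar>g x\<bar>)"
proof -
  let ?S = "SUP x\<in>{-1<..<1::real}. ennreal \<bar>g x\<bar>"
  have cont: "continuous_on (closure {-1<..<1::real}) (\<lambda>x. ennreal \<bar>g x\<bar>)"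
    using assms by (auto intro!: continuous_on_ennreal continuous_on_rabs)
  have "(\<lambda>x. ennreal \<bar>g x\<bar>) ` closure {-1<..<1} \<subseteq> {..?S}"
    by (rule image_closure_subset[OF cont]) (auto intro: SUP_upper)
  then have "(SUP x\<in>{-1..1}. ennreal \<bar>g x\<bar>) \<le> ?S"
    by (intro SUP_least) (simp add: image_subset_iff)
  moreover have "?S \<le> (SUP x\<in>{-1..1}. ennreal \<bar>g x\<bar>)"
    by (intro SUP_subset_mono) auto
  ultimately show ?thesis
    by (simp add: Lp_norm_def)
qed

text \<open>
  The product \<open>f(x)(1 - x\<^sup>2)\<^sup>\<alpha>\<close> is determined by \<open>f\<close> on the open interval only. For \<open>p < \<infinity>\<close> the end
  points are immaterial; for \<open>p = \<infinity>\<close> membership means that the product extends to a continuous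
  function on \<open>[-1,1]\<close>.
\<close>

definition Lp_weighted :: "ennreal \<Rightarrow> real \<Rightarrow> (real \<Rightarrow> real) set" where
  "Lp_weighted p \<alpha> = {f. \<exists>g\<in>Lp_space p. \<forall>x\<in>{-1<..<1}. g x = f x * (1 - x\<^sup>2) powr \<alpha>}"

definition Lp_weighted_norm :: "ennreal \<Rightarrow> real \<Rightarrow> (real \<Rightarrow> real) \<Rightarrow> ennreal" where
  "Lp_weighted_norm p \<alpha> f = Lp_norm p (\<lambda>x. f x * (1 - x\<^sup>2) powr \<alpha>)"

definition best_approx :: "nat \<Rightarrow> ennreal \<Rightarrow> real \<Rightarrow> (real \<Rightarrow> real) \<Rightarrow> ennreal" where
  "best_approx n p \<alpha> f =
    (INF P\<in>{P :: real poly. degree P \<le> n - 1}. Lp_weighted_norm p \<alpha> (\<lambda>x. f x - poly P x))"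

definition trans_R :: "real \<Rightarrow> real \<Rightarrow> real \<Rightarrow> real" where
  "trans_R \<theta>\<^sub>1 t \<phi>\<^sub>1 = cos \<theta>\<^sub>1 * cos t - sin \<theta>\<^sub>1 * sin t * cos \<phi>\<^sub>1"

text \<open>
  Any choice of \<open>\<phi>\<close> will do: it only enters through \<open>cos (\<mu> (\<phi>\<^sub>1 - \<phi>))\<close> with an integer \<open>\<mu>\<close>, and where
  \<open>sin \<theta> = 0\<close> (so that \<open>\<phi>\<close> is arbitrary) this cosine is multiplied by \<open>(1 - R\<^sup>2)\<^bsup>\<mu>/2\<^esup> = 0\<close> or \<open>\<mu> = 0\<close>.
\<close>

definition trans_phi :: "real \<Rightarrow> real \<Rightarrow> real \<Rightarrow> real" where
  "trans_phi \<theta>\<^sub>1 t \<phi>\<^sub>1 =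
    (let \<theta> = arccos (trans_R \<theta>\<^sub>1 t \<phi>\<^sub>1)
     in SOME \<phi>. sin \<theta> * cos \<phi> = cos \<theta>\<^sub>1 * sin t + sin \<theta>\<^sub>1 * cos t * cos \<phi>\<^sub>1
              \<and> sin \<theta> * sin \<phi> = sin \<theta>\<^sub>1 * sin \<phi>\<^sub>1)"

lemma trans_sin_sq:
  "1 - (trans_R a t b)\<^sup>2 =
     (cos a * sin t + sin a * cos t * cos b)\<^sup>2 + (sin a * sin b)\<^sup>2"
proof -
  have "(cos a * cos t - sin a * sin t * cos b)\<^sup>2
      + (cos a * sin t + sin a * cos t * cos b)\<^sup>2 + (sin a * sin b)\<^sup>2
      = ((cos a)\<^sup>2 + (sin a)\<^sup>2 * (cos b)\<^sup>2) * ((sin t)\<^sup>2 + (cos t)\<^sup>2) + (sin a)\<^sup>2 * (sin b)\<^sup>2"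
    by (simp only: power2_eq_square) (simp only: algebra_simps)
  also have "\<dots> = (cos a)\<^sup>2 + (sin a)\<^sup>2 * ((sin b)\<^sup>2 + (cos b)\<^sup>2)"
    by (subst sin_cos_squared_add[of t]) (simp only: mult_1_right distrib_left add.assoc add.commute add.left_commute)
  also have "\<dots> = 1"
    by (simp only: sin_cos_squared_add mult_1_right sin_cos_squared_add2)
  finally show ?thesis
    by (simp add: trans_R_def)
qed

lemma trans_phi:
  fixes a t b :: real
  defines "\<theta> \<equiv> arccos (trans_R a t b)" and "\<phi> \<equiv> trans_phi a t b"
  shows "cos \<theta> = trans_R a t b"
    and "sin \<theta> * cos \<phi> = cos a * sin t + sin a * cos t * cos b"
    and "sin \<theta> * sin \<phi> = sin a * sin b"
proof -
  let ?u = "cos a * sin t + sin a * cos t * cos b" and ?v = "sin a * sin b"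
  have "(trans_R a t b)\<^sup>2 \<le> 1"
    using trans_sin_sq[of a t b] by (smt (verit) zero_le_power2)
  then have R: "\<bar>trans_R a t b\<bar> \<le> 1"
    by (simp add: abs_square_le_1)
  then show "cos \<theta> = trans_R a t b"
    by (simp add: \<theta>_def cos_arccos_abs)
  have s: "sin \<theta> = sqrt (?u\<^sup>2 + ?v\<^sup>2)"
    using R by (simp add: \<theta>_def sin_arccos_abs trans_sin_sq)
  have "Complex ?u ?v = rcis (cmod (Complex ?u ?v)) (Arg (Complex ?u ?v))"
    by (simp add: rcis_cmod_Arg)
  then have "?u = sqrt (?u\<^sup>2 + ?v\<^sup>2) * cos (Arg (Complex ?u ?v))"
    and "?v = sqrt (?u\<^sup>2 + ?v\<^sup>2) * sin (Arg (Complex ?u ?v))"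
    by (metis Re_rcis complex.sel(1) complex_norm, metis Im_rcis complex.sel(2) complex_norm)
  then have "\<exists>\<phi>. sin \<theta> * cos \<phi> = ?u \<and> sin \<theta> * sin \<phi> = ?v"
    unfolding s by metis
  from someI_ex[OF this] show "sin \<theta> * cos \<phi> = ?u" "sin \<theta> * sin \<phi> = ?v"
    by (simp_all only: \<phi>_def trans_phi_def \<theta>_def Let_def)
qed

definition gen_translation :: "nat \<Rightarrow> real \<Rightarrow> (real \<Rightarrow> real) \<Rightarrow> real \<Rightarrow> real" where
  "gen_translation \<mu> t f x =
    (let s = \<bar>t\<bar>; \<theta>\<^sub>1 = arccos x in
     1 / (pi * sqrt (1 - x\<^sup>2) ^ \<mu> * cos (s / 2) ^ (2 * \<mu>)) *
     (LINT \<phi>\<^sub>1:{0..pi}|lebesgue.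
        sqrt (1 - (trans_R \<theta>\<^sub>1 s \<phi>\<^sub>1)\<^sup>2) ^ \<mu> * f (trans_R \<theta>\<^sub>1 s \<phi>\<^sub>1)
          * cos (real \<mu> * (\<phi>\<^sub>1 - trans_phi \<theta>\<^sub>1 s \<phi>\<^sub>1))))"

definition gen_modulus :: "nat \<Rightarrow> ennreal \<Rightarrow> real \<Rightarrow> (real \<Rightarrow> real) \<Rightarrow> real \<Rightarrow> ennreal" where
  "gen_modulus \<mu> p \<alpha> f \<delta> =
    (SUP t\<in>{t. -pi < t \<and> t < pi \<and> \<bar>t\<bar> \<le> \<delta>}.
       Lp_weighted_norm p \<alpha> (\<lambda>x. gen_translation \<mu> t f x - f x))"

end

theory Submission imports Defs begin

text \<open>
  Write \<open>q = sin \<theta> e\<^sup>-\<^sup>i\<^sup>\<phi>\<close> and let \<open>G\<^sub>t f (x)\<close> be the average over \<open>\<phi>\<^sub>1\<close> of \<open>Re (e\<^bsup>i\<mu>\<phi>\<^sub>1\<^esup> q\<^sup>\<mu>) f(R)\<close>, divided by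
  \<open>(1 - x\<^sup>2)\<^bsup>\<mu>/2\<^esup>\<close>, so that the translation is \<open>\<tau>\<^sub>t = G\<^sub>t / c(t)\<close> with \<open>c(t) = cos\<^bsup>2\<mu>\<^esup>(t/2)\<close>. The plain average of
  \<open>f(R)\<close> is self-adjoint on \<open>(-1,1)\<close> (a rotation of the disc) and maps \<open>(1 - x\<^sup>2)\<^bsup>-s\<^esup>\<close>, \<open>s < 1/2\<close>, to at most a
  multiple of itself; hence Schur's test bounds \<open>G\<^sub>t\<close> uniformly in \<open>t\<close> on all spaces of the theorem.
  Separation of variables shows that \<open>G\<^sub>t\<close> acts diagonally on the eigenpolynomials of
  \<open>(1 - x\<^sup>2) P'' - 2(\<mu> + 1) x P'\<close>, the multiplier being determined by an ordinary differential
  equation in \<open>t\<close>.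

  Lower estimate: with \<open>w = sin t c\<^sup>2\<close> and \<open>\<delta> = 1/n\<close>, a suitable iterated average
  \<open>g = f + \<kappa>\<inverse> \<integral>\<^sub>0\<^sup>\<delta> w(s)\<inverse> \<integral>\<^sub>0\<^sup>s w(u) (\<tau>\<^sub>u - 1) f\<close> is within the modulus of \<open>f\<close> and satisfies
  \<open>\<kappa> (\<tau>\<^sub>t - 1) g = \<integral>\<^sub>0\<^sup>t w(s)\<inverse> \<integral>\<^sub>0\<^sup>s w(u) \<tau>\<^sub>u (\<tau>\<^sub>\<delta> - 1) f\<close>, which is of second order in \<open>t\<close>; both are
  checked on eigenpolynomials and extended by density. Averaging \<open>\<tau>\<^sub>t g\<close> against a Jackson kernel
  with respect to \<open>w\<close> then gives a polynomial.

  Upper estimate: for a polynomial of degree at most \<open>N\<close>, \<open>G\<^sub>t P\<close> is an even trigonometric polynomial in \<open>t\<close>, so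
  a Riesz interpolation formula for the second derivative gives \<open>\<parallel>G\<^sub>t P - P\<parallel> \<le> C t\<^sup>2 N\<^sup>2 \<parallel>P\<parallel>\<close>, and one sums
  over dyadic best approximations.
\<close>

subsection \<open>Weighted norms\<close>

text \<open>The weight w puts the equation of the multipliers into divergence form: for psi = g / c
  it reads (w psi')' = - lambda w psi, where lambda is the eigenvalue of the polynomial. Integrating
  twice gives 1 - psi(t) = lambda b(t), with b the iterated average of psi. Hence (psi(t) - 1) b(s)
  is symmetric in s and t, and this symmetry is the identity behind the lower estimate. The same
  equation makes psi orthogonal, with respect to w, to polynomials in cos t of degree below that of
  the eigenpolynomial, so a kernel of degree n - 1 cannot see higher components. The obstacle is t =
  pi: for mu > 0 the divisor c vanishes there and the bound on tau_t blows up. The averages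
  therefore pair tau_t with w, whose factor c^2 absorbs the loss. Identities between operators are
  proved once, almost everywhere, in a space containing all those of the theorem: L1 with weight (1
  - x^2)^(mu/2). Bounds in the given norm come separately, by Minkowski's inequality. The ranges of
  \<alpha> provide what Schur's test asks for: two exponents in [0, 1/2).\<close>

lemma young_powr:
  fixes p y m :: real
  assumes p: "1 \<le> p" and y: "0 \<le> y" and m: "0 < m"
  shows "p * m powr (p - 1) * y \<le> y powr p + (p - 1) * m powr p"
proof (cases "p = 1")
  case False
  then have p1: "p > 1" using p by simp
  have e: "1 / p + 1 / (p / (p - 1)) = 1" using p1 by (simp add: field_simps)
  \<comment> \<open>The claim is the tangent line of y^p at m. It is Young's inequality for y and
    m^(p-1), since the conjugate power of m^(p-1) is m^p.\<close>
  have "y * m powr (p - 1) \<le> y powr p / p + (m powr (p - 1)) powr (p / (p - 1)) / (p / (p - 1))"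
    by (rule Youngs_inequality) (use p1 y e in \<open>auto simp: field_simps\<close>)
  also have "(m powr (p - 1)) powr (p / (p - 1)) = m powr p"
    using p1 by (simp add: powr_powr)
  finally show ?thesis using p1 by (simp add: field_simps)
qed (use assms in auto)

text \<open>Jensen's inequality for |Phi| / h against the measure with density h, whose mass is only
  bounded by a. The free density h is the place where Schur weights are inserted later.\<close>

lemma power_mean_integral:
  fixes \<Phi> h :: "'a \<Rightarrow> real" and p a :: real
  assumes [measurable]: "\<Phi> \<in> borel_measurable M" "h \<in> borel_measurable M"
    and h: "\<And>s. 0 \<le> h s" "\<And>s. h s = 0 \<Longrightarrow> \<Phi> s = 0"
    and a: "(\<integral>\<^sup>+s. ennreal (h s) \<partial>M) \<le> ennreal a" "0 < a" and p: "1 \<le> p"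
  shows "ennreal (\<bar>\<integral>s. \<Phi> s \<partial>M\<bar> powr p)
    \<le> ennreal (a powr (p - 1)) * (\<integral>\<^sup>+s. ennreal (\<bar>\<Phi> s\<bar> powr p * h s powr (1 - p)) \<partial>M)"
    (is "_ \<le> _ * ?B")
proof (cases "?B = \<infinity>")
  case True
  then show ?thesis using a by (simp add: ennreal_mult_top)
next
  case False
  then obtain b where b: "?B = ennreal b" "0 \<le> b"
    by (cases ?B rule: ennreal_cases) (auto simp: top_ennreal.rep_eq)
  show ?thesis
  \<comment> \<open>The Bochner integral of a non-integrable function is 0, so only the integrable
    case says anything.\<close>
  proof (cases "integrable M \<Phi>")
    case False
    then show ?thesis using p by (simp add: not_integrable_integral_eq)
  next
    case True
    define A where "A = (\<integral>s. \<bar>\<Phi> s\<bar> \<partial>M)"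
    have AA: "(\<integral>\<^sup>+s. ennreal \<bar>\<Phi> s\<bar> \<partial>M) = ennreal A" "0 \<le> A"
      unfolding A_def using True by (subst nn_integral_eq_integral) auto
    have le: "\<bar>\<integral>s. \<Phi> s \<partial>M\<bar> \<le> A"
      unfolding A_def using integral_abs_bound by blast
    show ?thesis
    proof (cases "A = 0")
      case True
      then show ?thesis using le p by simp
    next
      case False
      then have A0: "A > 0" using AA by simp
      \<comment> \<open>The tangent is taken at the mean value of |Phi| / h; after integration the
        terms with m^p a combine to m^p a <= b.\<close>
      define m where "m = A / a"
      have m: "m > 0" using A0 a by (simp add: m_def)
      have pt: "p * m powr (p - 1) * \<bar>\<Phi> s\<bar> \<le> \<bar>\<Phi> s\<bar> powr p * h s powr (1 - p) + (p - 1) * m powr p * h s" for s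
      proof (cases "h s = 0")
        case False
        then have hs: "h s > 0" using h(1)[of s] by simp
        have "p * m powr (p - 1) * (\<bar>\<Phi> s\<bar> / h s) \<le> (\<bar>\<Phi> s\<bar> / h s) powr p + (p - 1) * m powr p"
          by (rule young_powr) (use p m hs in auto)
        then have "p * m powr (p - 1) * (\<bar>\<Phi> s\<bar> / h s) * h s \<le> ((\<bar>\<Phi> s\<bar> / h s) powr p + (p - 1) * m powr p) * h s"
          using hs by (intro mult_right_mono) auto
        moreover have "(\<bar>\<Phi> s\<bar> / h s) powr p * h s = \<bar>\<Phi> s\<bar> powr p * h s powr (1 - p)"
          using hs by (simp add: powr_divide powr_diff)
        ultimately show ?thesis using hs by (simp add: algebra_simps)
      qed (use h in auto)
      have "ennreal (p * m powr (p - 1) * A) = (\<integral>\<^sup>+s. ennreal (p * m powr (p - 1) * \<bar>\<Phi> s\<bar>) \<partial>M)"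
        using p by (simp add: ennreal_mult' nn_integral_cmult AA)
      also have "\<dots> \<le> (\<integral>\<^sup>+s. ennreal (\<bar>\<Phi> s\<bar> powr p * h s powr (1 - p)) + ennreal ((p - 1) * m powr p) * ennreal (h s) \<partial>M)"
        using p h by (intro nn_integral_mono)
          (simp add: ennreal_mult'[symmetric] ennreal_plus[symmetric] ennreal_leI pt del: ennreal_plus)
      also have "\<dots> = ?B + ennreal ((p - 1) * m powr p) * (\<integral>\<^sup>+s. ennreal (h s) \<partial>M)"
        by (subst nn_integral_add) (auto simp: nn_integral_cmult)
      also have "\<dots> \<le> ennreal b + ennreal ((p - 1) * m powr p) * ennreal a"
        unfolding b by (intro add_left_mono mult_left_mono a) auto
      also have "\<dots> = ennreal (b + (p - 1) * m powr p * a)"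
        using p b a by (simp add: ennreal_mult'[symmetric])
      finally have "p * m powr (p - 1) * A \<le> b + (p - 1) * m powr p * a"
        using p b a by (subst (asm) ennreal_le_iff) auto
      moreover have "m powr (p - 1) * A = m powr p * a"
      proof -
        have "m powr (p - 1) * m = m powr p" using m by (simp add: powr_diff)
        moreover have "m * a = A" using a by (simp add: m_def)
        ultimately show ?thesis by (metis mult.assoc)
      qed
      then have "p * m powr (p - 1) * A = p * (m powr p * a)" by (metis mult.assoc)
      ultimately have "p * (m powr p * a) \<le> b + (p - 1) * m powr p * a" by linarith
      then have "m powr p * a \<le> b" by (simp add: algebra_simps)
      moreover have "m powr p * a = A powr p / a powr (p - 1)"
        using A0 a by (simp add: m_def powr_divide powr_diff)
      ultimately have "A powr p / a powr (p - 1) \<le> b" by linarith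
      then have "A powr p \<le> a powr (p - 1) * b"
        using a by (simp add: pos_divide_le_eq mult.commute)
      moreover have "\<bar>\<integral>s. \<Phi> s \<partial>M\<bar> powr p \<le> A powr p"
        using le p by (intro powr_mono2) auto
      ultimately show ?thesis
        unfolding b by (simp add: ennreal_mult'[symmetric] ennreal_leI)
    qed
  qed
qed

abbreviation Iv :: "real set" where "Iv \<equiv> {-1<..<1}"

text \<open>A relation instead of a norm: it treats finite and infinite p alike and ignores null
  sets in both cases. The essential supremum at p = infinity is turned back into a supremum only at
  the end, by continuity.\<close>

definition norm_le :: "ennreal \<Rightarrow> real \<Rightarrow> (real \<Rightarrow> real) \<Rightarrow> real \<Rightarrow> bool" where
  "norm_le p a h M =
    (if p = \<infinity> then AE x in lborel. x \<in> Iv \<longrightarrow> \<bar>h x\<bar> * (1 - x\<^sup>2) powr a \<le> M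
     else (\<integral>\<^sup>+ x\<in>Iv. ennreal ((\<bar>h x\<bar> * (1 - x\<^sup>2) powr a) powr enn2real p) \<partial>lborel)
        \<le> ennreal (M powr enn2real p))"

lemma exponent_cases:
  assumes "1 \<le> p"
  obtains "p = \<infinity>" | r where "p = ennreal r" "1 \<le> r" "p \<noteq> \<infinity>" "enn2real p = r"
proof (cases p rule: ennreal_cases)
  case (real r)
  then have "1 \<le> r" using assms by (metis ennreal_1 ennreal_le_iff)
  then show ?thesis using real that by auto
qed (use that in auto)

lemma norm_le_mono_AE:
  assumes "1 \<le> p" "norm_le p a g M" "AE x in lborel. x \<in> Iv \<longrightarrow> \<bar>h x\<bar> \<le> \<bar>g x\<bar>" "M \<le> M'" "0 \<le> M"
  shows "norm_le p a h M'"
proof (cases rule: exponent_cases[OF assms(1)])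
  case 1
  from assms(2) have "AE x in lborel. x \<in> Iv \<longrightarrow> \<bar>g x\<bar> * (1 - x\<^sup>2) powr a \<le> M"
    by (simp add: norm_le_def 1)
  with assms(3) have "AE x in lborel. x \<in> Iv \<longrightarrow> \<bar>h x\<bar> * (1 - x\<^sup>2) powr a \<le> M'"
    by eventually_elim (use assms(4) in \<open>auto intro: order_trans[OF mult_right_mono]\<close>)
  then show ?thesis by (simp add: norm_le_def 1)
next
  case (2 r)
  have "(\<integral>\<^sup>+ x\<in>Iv. ennreal ((\<bar>h x\<bar> * (1 - x\<^sup>2) powr a) powr r) \<partial>lborel)
     \<le> (\<integral>\<^sup>+ x\<in>Iv. ennreal ((\<bar>g x\<bar> * (1 - x\<^sup>2) powr a) powr r) \<partial>lborel)"
    apply (rule nn_integral_mono_AE)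
    using assms(3) by eventually_elim
      (use 2 in \<open>auto simp: indicator_def intro!: ennreal_leI powr_mono2 mult_right_mono\<close>)
  also have "\<dots> \<le> ennreal (M powr r)" using assms(2) 2 by (simp add: norm_le_def)
  also have "\<dots> \<le> ennreal (M' powr r)" using 2 assms by (intro ennreal_leI powr_mono2) auto
  finally show ?thesis using 2 by (simp add: norm_le_def)
qed

lemma norm_le_mono: "1 \<le> p \<Longrightarrow> norm_le p a h M \<Longrightarrow> M \<le> M' \<Longrightarrow> 0 \<le> M \<Longrightarrow> norm_le p a h M'"
  by (rule norm_le_mono_AE) auto

lemma norm_le_cong_AE:
  assumes "1 \<le> p" "norm_le p a g M" "AE x in lborel. x \<in> Iv \<longrightarrow> h x = g x" "0 \<le> M"
  shows "norm_le p a h M"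
  by (rule norm_le_mono_AE[OF assms(1,2) _ order_refl assms(4)]) (use assms(3) in \<open>auto elim: eventually_mono\<close>)

lemma norm_le_cmult:
  assumes "1 \<le> p" "norm_le p a h M" "0 \<le> M" and [measurable]: "h \<in> borel_measurable borel"
  shows "norm_le p a (\<lambda>x. k * h x) (\<bar>k\<bar> * M)"
proof (cases rule: exponent_cases[OF assms(1)])
  case 1
  then show ?thesis using assms(2)
    by (auto simp: norm_le_def abs_mult mult.assoc elim!: eventually_mono intro: mult_left_mono)
next
  case (2 r)
  have "(\<integral>\<^sup>+ x\<in>Iv. ennreal ((\<bar>k * h x\<bar> * (1 - x\<^sup>2) powr a) powr r) \<partial>lborel)
     = (\<integral>\<^sup>+ x. ennreal (\<bar>k\<bar> powr r) * (ennreal ((\<bar>h x\<bar> * (1 - x\<^sup>2) powr a) powr r) * indicator Iv x) \<partial>lborel)"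
    by (intro nn_integral_cong)
       (auto simp: abs_mult powr_mult mult.assoc ennreal_mult'[symmetric] indicator_def)
  also have "\<dots> = ennreal (\<bar>k\<bar> powr r) * (\<integral>\<^sup>+ x\<in>Iv. ennreal ((\<bar>h x\<bar> * (1 - x\<^sup>2) powr a) powr r) \<partial>lborel)"
    by (subst nn_integral_cmult) auto
  also have "\<dots> \<le> ennreal (\<bar>k\<bar> powr r) * ennreal (M powr r)"
    by (intro mult_left_mono) (use assms(2) 2 in \<open>auto simp: norm_le_def\<close>)
  also have "\<dots> = ennreal ((\<bar>k\<bar> * M) powr r)"
    using assms(3) by (simp add: powr_mult ennreal_mult'[symmetric])
  finally show ?thesis using 2 by (simp add: norm_le_def)
qed

lemma powr_convex_comb:
  fixes r x y s :: real
  assumes r: "1 \<le> r" and "0 \<le> x" "0 \<le> y" "0 \<le> s" "s \<le> 1"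
  shows "(s * x + (1 - s) * y) powr r \<le> s * x powr r + (1 - s) * y powr r"
proof -
  define m where "m = s * x + (1 - s) * y"
  show ?thesis
  proof (cases "m > 0")
    case True
    have "r * m powr (r - 1) * x \<le> x powr r + (r - 1) * m powr r"
         "r * m powr (r - 1) * y \<le> y powr r + (r - 1) * m powr r"
      using young_powr r True assms by auto
    then have "s * (r * m powr (r - 1) * x) + (1 - s) * (r * m powr (r - 1) * y)
      \<le> s * (x powr r + (r - 1) * m powr r) + (1 - s) * (y powr r + (r - 1) * m powr r)"
      using assms by (intro add_mono mult_left_mono) auto
    moreover have "s * (r * m powr (r - 1) * x) + (1 - s) * (r * m powr (r - 1) * y) = r * (m powr (r - 1) * m)"
      by (simp add: m_def algebra_simps)
    moreover have "m powr (r - 1) * m = m powr r" using True by (simp add: powr_diff)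
    ultimately have "r * m powr r \<le> s * (x powr r + (r - 1) * m powr r) + (1 - s) * (y powr r + (r - 1) * m powr r)"
      by simp
    then show ?thesis unfolding m_def[symmetric] by (simp add: algebra_simps)
  next
    case False
    moreover have "m \<ge> 0" using assms by (simp add: m_def)
    ultimately have "m = 0" by simp
    then show ?thesis using assms unfolding m_def[symmetric] by simp
  qed
qed

text \<open>Minkowski by convexity: with s = M / (M + N) the sum is the convex combination of g / s
  and h / (1 - s), both of norm at most M + N.\<close>

lemma norm_le_add_pos:
  assumes p: "1 \<le> p" and "norm_le p a g M" "norm_le p a h N" "0 < M" "0 < N"
    and [measurable]: "g \<in> borel_measurable borel" "h \<in> borel_measurable borel"
  shows "norm_le p a (\<lambda>x. g x + h x) (M + N)"
proof (cases rule: exponent_cases[OF p])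
  case 1
  have "AE x in lborel. x \<in> Iv \<longrightarrow> \<bar>g x\<bar> * (1 - x\<^sup>2) powr a \<le> M"
       "AE x in lborel. x \<in> Iv \<longrightarrow> \<bar>h x\<bar> * (1 - x\<^sup>2) powr a \<le> N"
    using assms 1 by (auto simp: norm_le_def)
  then have "AE x in lborel. x \<in> Iv \<longrightarrow> \<bar>g x + h x\<bar> * (1 - x\<^sup>2) powr a \<le> M + N"
  proof eventually_elim
    case (elim x)
    have "\<bar>g x + h x\<bar> * (1 - x\<^sup>2) powr a \<le> (\<bar>g x\<bar> + \<bar>h x\<bar>) * (1 - x\<^sup>2) powr a"
      by (intro mult_right_mono) auto
    then show ?case using elim by (auto simp: algebra_simps)
  qed
  then show ?thesis by (simp add: norm_le_def 1)
next
  case (2 r)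
  define s where "s = M / (M + N)"
  have s: "0 \<le> s" "s \<le> 1" "1 - s = N / (M + N)" using assms by (auto simp: s_def field_simps)
  let ?G = "\<lambda>x. \<bar>g x\<bar> * (1 - x\<^sup>2) powr a" and ?H = "\<lambda>x. \<bar>h x\<bar> * (1 - x\<^sup>2) powr a"
  define A where "A = s * ((M + N) / M) powr r"
  define B where "B = (1 - s) * ((M + N) / N) powr r"
  have AB: "0 \<le> A" "0 \<le> B" using s assms by (auto simp: A_def B_def)
  have *: "(\<bar>g x + h x\<bar> * (1 - x\<^sup>2) powr a) powr r \<le> A * ?G x powr r + B * ?H x powr r" for x
  proof -
    have "(\<bar>g x + h x\<bar> * (1 - x\<^sup>2) powr a) powr r \<le> (?G x + ?H x) powr r"
      using 2 mult_right_mono[OF abs_triangle_ineq[of "g x" "h x"], of "(1 - x\<^sup>2) powr a"]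
      by (intro powr_mono2) (auto simp: algebra_simps)
    also have "?G x + ?H x = s * ((M + N) / M * ?G x) + (1 - s) * ((M + N) / N * ?H x)"
    proof -
      have "s * ((M + N) / M) = 1" "(1 - s) * ((M + N) / N) = 1"
        using assms by (simp_all add: s(3)) (simp_all add: s_def)
      then show ?thesis by (metis mult.assoc mult_1)
    qed
    also have "(\<dots>) powr r \<le> s * ((M + N) / M * ?G x) powr r + (1 - s) * ((M + N) / N * ?H x) powr r"
      using 2 s assms by (intro powr_convex_comb) auto
    also have "\<dots> = A * ?G x powr r + B * ?H x powr r"
      using assms powr_mult[of "(M + N) / M" "?G x" r] powr_mult[of "(M + N) / N" "?H x" r]
      by (simp add: A_def B_def del: times_divide_eq_left)
    finally show ?thesis .
  qed
  have "(\<integral>\<^sup>+ x\<in>Iv. ennreal ((\<bar>g x + h x\<bar> * (1 - x\<^sup>2) powr a) powr r) \<partial>lborel)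
     \<le> (\<integral>\<^sup>+ x. ennreal A * (ennreal (?G x powr r) * indicator Iv x) + ennreal B * (ennreal (?H x powr r) * indicator Iv x) \<partial>lborel)"
    using * AB
    by (intro nn_integral_mono)
       (auto simp: indicator_def ennreal_mult'[symmetric] ennreal_plus[symmetric] simp del: ennreal_plus intro!: ennreal_leI)
  also have "\<dots> = ennreal A * (\<integral>\<^sup>+ x\<in>Iv. ennreal (?G x powr r) \<partial>lborel) + ennreal B * (\<integral>\<^sup>+ x\<in>Iv. ennreal (?H x powr r) \<partial>lborel)"
    by (subst nn_integral_add) (auto simp: nn_integral_cmult)
  also have "\<dots> \<le> ennreal A * ennreal (M powr r) + ennreal B * ennreal (N powr r)"
    by (intro add_mono mult_left_mono) (use assms 2 in \<open>auto simp: norm_le_def\<close>)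
  also have "\<dots> = ennreal (A * M powr r + B * N powr r)"
    using AB by (simp add: ennreal_mult'[symmetric])
  also have "A * M powr r + B * N powr r = s * (M + N) powr r + (1 - s) * (M + N) powr r"
    using assms by (simp add: A_def B_def powr_divide)
  also have "\<dots> = (M + N) powr r" by (simp add: algebra_simps)
  finally show ?thesis using 2 by (simp add: norm_le_def)
qed

text \<open>Arguments that divide by a bound are carried out for positive bounds; letting e tend to
  0 recovers the bound 0.\<close>

lemma norm_le_closed:
  assumes p: "1 \<le> p" and M: "0 \<le> M" and "\<And>e. 0 < e \<Longrightarrow> norm_le p a h (M + e)"
  shows "norm_le p a h M"
proof (cases rule: exponent_cases[OF p])
  case 1
  have "AE x in lborel. \<forall>n. x \<in> Iv \<longrightarrow> \<bar>h x\<bar> * (1 - x\<^sup>2) powr a \<le> M + 1 / real (Suc n)"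
    unfolding AE_all_countable using assms(3) 1 by (auto simp: norm_le_def)
  then have "AE x in lborel. x \<in> Iv \<longrightarrow> \<bar>h x\<bar> * (1 - x\<^sup>2) powr a \<le> M"
  proof eventually_elim
    case (elim x)
    have "(\<lambda>n. M + 1 / real (Suc n)) \<longlonglongrightarrow> M + 0"
      by (intro tendsto_add tendsto_const LIMSEQ_Suc[OF lim_1_over_n])
    then show ?case using elim by (auto intro: LIMSEQ_le_const)
  qed
  then show ?thesis by (simp add: norm_le_def 1)
next
  case (2 r)
  have "(\<lambda>n. ennreal ((M + 1 / real (Suc n)) powr r)) \<longlonglongrightarrow> ennreal ((M + 0) powr r)"
    by (intro tendsto_ennrealI tendsto_powr' tendsto_add tendsto_const LIMSEQ_Suc[OF lim_1_over_n])
       (use 2 M in \<open>auto intro!: eventuallyI\<close>)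
  moreover have "(\<integral>\<^sup>+ x\<in>Iv. ennreal ((\<bar>h x\<bar> * (1 - x\<^sup>2) powr a) powr r) \<partial>lborel) \<le> ennreal ((M + 1 / real (Suc n)) powr r)" for n
    using assms(3)[of "1 / real (Suc n)"] 2 by (simp add: norm_le_def)
  ultimately have "(\<integral>\<^sup>+ x\<in>Iv. ennreal ((\<bar>h x\<bar> * (1 - x\<^sup>2) powr a) powr r) \<partial>lborel) \<le> ennreal ((M + 0) powr r)"
    using LIMSEQ_le_const by blast
  then show ?thesis using 2 by (simp add: norm_le_def)
qed

lemma norm_le_add:
  assumes p: "1 \<le> p" and "norm_le p a g M" "norm_le p a h N" "0 \<le> M" "0 \<le> N"
    and [measurable]: "g \<in> borel_measurable borel" "h \<in> borel_measurable borel"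
  shows "norm_le p a (\<lambda>x. g x + h x) (M + N)"
proof (rule norm_le_closed[OF p])
  fix e :: real assume e: "0 < e"
  have "norm_le p a (\<lambda>x. g x + h x) ((M + e / 2) + (N + e / 2))"
    using assms e by (intro norm_le_add_pos norm_le_mono[OF p assms(2)] norm_le_mono[OF p assms(3)]) auto
  then show "norm_le p a (\<lambda>x. g x + h x) (M + N + e)" by (simp add: algebra_simps)
qed (use assms in auto)

lemma norm_le_zero: "1 \<le> p \<Longrightarrow> norm_le p a (\<lambda>x. 0) 0"
  by (simp add: norm_le_def)

lemma norm_le_sum:
  assumes p: "1 \<le> p" and "finite S" "\<And>k. k \<in> S \<Longrightarrow> norm_le p a (g k) (M k)" "\<And>k. k \<in> S \<Longrightarrow> 0 \<le> M k"
    and "\<And>k. k \<in> S \<Longrightarrow> g k \<in> borel_measurable borel"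
  shows "norm_le p a (\<lambda>x. \<Sum>k\<in>S. g k x) (\<Sum>k\<in>S. M k)"
  using assms(2-)
proof (induction S rule: finite_induct)
  case empty
  then show ?case by (simp add: norm_le_zero p)
next
  case (insert k S)
  then show ?case by (simp add: norm_le_add[OF p] sum_nonneg)
qed

lemma norm_le_diff:
  assumes p: "1 \<le> p" and "norm_le p a g M" "norm_le p a h N" "0 \<le> M" "0 \<le> N"
    and [measurable]: "g \<in> borel_measurable borel" "h \<in> borel_measurable borel"
  shows "norm_le p a (\<lambda>x. g x - h x) (M + N)"
  using norm_le_add[OF p assms(2) norm_le_cmult[OF p assms(3,5), of "-1"]] assms by simp

lemma norm_le_eq_0:
  assumes p: "1 \<le> p" and "norm_le p a h 0" and [measurable]: "h \<in> borel_measurable borel"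
  shows "AE x in lborel. x \<in> Iv \<longrightarrow> h x = 0"
proof -
  have pos: "0 < (1 - x\<^sup>2) powr a" if "x \<in> Iv" for x :: real
  proof -
    have "x\<^sup>2 < 1" using that by (simp add: abs_square_less_1 abs_less_iff)
    then show ?thesis by simp
  qed
  show ?thesis
  proof (cases rule: exponent_cases[OF p])
    case 1
    then have "AE x in lborel. x \<in> Iv \<longrightarrow> \<bar>h x\<bar> * (1 - x\<^sup>2) powr a \<le> 0"
      using assms by (simp add: norm_le_def)
    then show ?thesis
    proof eventually_elim
      case (elim x)
      show ?case
      proof
        assume x: "x \<in> Iv"
        show "h x = 0" using elim x pos[OF x] by (simp add: mult_le_0_iff)
      qed
    qed
  next
    case (2 r)
    then have "(\<integral>\<^sup>+ x\<in>Iv. ennreal ((\<bar>h x\<bar> * (1 - x\<^sup>2) powr a) powr r) \<partial>lborel) = 0"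
      using assms by (simp add: norm_le_def)
    then have "AE x in lborel. ennreal ((\<bar>h x\<bar> * (1 - x\<^sup>2) powr a) powr r) * indicator Iv x = 0"
      by (subst (asm) nn_integral_0_iff_AE) auto
    then show ?thesis
    proof eventually_elim
      case (elim x)
      show ?case
      proof
        assume x: "x \<in> Iv"
        have "(\<bar>h x\<bar> * (1 - x\<^sup>2) powr a) powr r \<le> 0" using elim x by (simp add: indicator_def ennreal_eq_0_iff)
        then have "(\<bar>h x\<bar> * (1 - x\<^sup>2) powr a) powr r = 0" by (meson antisym powr_ge_zero)
        then show "h x = 0" using pos[OF x] by (simp only: powr_eq_0_iff) auto
      qed
    qed
  qed
qed

text \<open>Minkowski's integral inequality. For finite p it is Jensen with density k m followed by
  Fubini, where the slice at s contributes m(s)^(1-r) m(s)^r = m(s). Bounds are asked for only where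
  k does not vanish, because the kernels below live on intervals outside of which no bound is
  available.\<close>

lemma norm_le_integral:
  fixes F :: "real \<Rightarrow> real \<Rightarrow> real"
  assumes p: "1 \<le> p" and [measurable]: "case_prod F \<in> borel_measurable (borel \<Otimes>\<^sub>M borel)"
      "k \<in> borel_measurable borel" "m \<in> borel_measurable borel"
    and F: "\<And>s. k s \<noteq> 0 \<Longrightarrow> norm_le p a (F s) (m s)"
    and km: "\<And>s. 0 \<le> k s" "\<And>s. k s \<noteq> 0 \<Longrightarrow> 0 < m s"
    and A: "(\<integral>\<^sup>+ s. ennreal (k s * m s) \<partial>lborel) \<le> ennreal A" "0 < A"
  shows "norm_le p a (\<lambda>x. \<integral>s. k s * F s x \<partial>lborel) A"
proof (cases rule: exponent_cases[OF p])
  case 1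
  have *: "AE s in lborel. AE x in lborel. k s \<noteq> 0 \<longrightarrow> x \<in> Iv \<longrightarrow> \<bar>F s x\<bar> * (1 - x\<^sup>2) powr a \<le> m s"
    using F 1 by (auto simp: norm_le_def)
  \<comment> \<open>The exceptional null set of x depends on s; by Fubini it becomes a null set of s
    for almost every x.\<close>
  have "AE x in lborel. AE s in lborel. k s \<noteq> 0 \<longrightarrow> x \<in> Iv \<longrightarrow> \<bar>F s x\<bar> * (1 - x\<^sup>2) powr a \<le> m s"
  proof (rule iffD1[OF lborel_pair.AE_commute[of "\<lambda>s x. k s \<noteq> 0 \<longrightarrow> x \<in> Iv \<longrightarrow> \<bar>F s x\<bar> * (1 - x\<^sup>2) powr a \<le> m s"] *])
    have [measurable]: "(\<lambda>z. F (fst z) (snd z)) \<in> borel_measurable (lborel \<Otimes>\<^sub>M lborel)"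
      using assms(2) by (simp add: case_prod_beta' cong: measurable_cong_sets)
    show "{x \<in> space (lborel \<Otimes>\<^sub>M lborel). k (fst x) \<noteq> 0 \<longrightarrow> snd x \<in> Iv \<longrightarrow>
        \<bar>F (fst x) (snd x)\<bar> * (1 - (snd x)\<^sup>2) powr a \<le> m (fst x)} \<in> sets (lborel \<Otimes>\<^sub>M lborel)"
      by measurable
  qed
  then have "AE x in lborel. x \<in> Iv \<longrightarrow> \<bar>\<integral>s. k s * F s x \<partial>lborel\<bar> * (1 - x\<^sup>2) powr a \<le> A"
  proof eventually_elim
    case (elim x)
    show ?case
    proof
      assume x: "x \<in> Iv"
      let ?w = "(1 - x\<^sup>2) powr a"
      have "\<bar>\<integral>s. k s * F s x \<partial>lborel\<bar> * ?w = \<bar>\<integral>s. k s * F s x * ?w \<partial>lborel\<bar>"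
        by (simp add: abs_mult)
      also have "ennreal \<dots> \<le> (\<integral>\<^sup>+s. ennreal \<bar>k s * F s x * ?w\<bar> \<partial>lborel)"
        using integral_norm_bound_ennreal[of lborel "\<lambda>s. k s * F s x * ?w"]
        by (cases "integrable lborel (\<lambda>s. k s * F s x * ?w)") (auto simp: not_integrable_integral_eq)
      also have "\<dots> \<le> (\<integral>\<^sup>+ s. ennreal (k s * m s) \<partial>lborel)"
      proof (rule nn_integral_mono_AE)
        show "AE s in lborel. ennreal \<bar>k s * F s x * ?w\<bar> \<le> ennreal (k s * m s)"
          using elim
        proof eventually_elim
          case (elim s)
          show ?case
          proof (cases "k s = 0")
            case False
            then have "k s * (\<bar>F s x\<bar> * ?w) \<le> k s * m s"
              using elim x km by (intro mult_left_mono) auto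
            then show ?thesis using km[of s] by (intro ennreal_leI) (simp add: abs_mult mult.assoc)
          qed simp
        qed
      qed
      also have "\<dots> \<le> ennreal A" by fact
      finally show "\<bar>\<integral>s. k s * F s x \<partial>lborel\<bar> * ?w \<le> A" using A by simp
    qed
  qed
  then show ?thesis by (simp add: norm_le_def 1)
next
  case (2 r)
  let ?w = "\<lambda>x::real. (1 - x\<^sup>2) powr a"
  have pt: "ennreal ((\<bar>\<integral>s. k s * F s x \<partial>lborel\<bar> * ?w x) powr r)
     \<le> (\<integral>\<^sup>+s. ennreal (A powr (r - 1) * (k s * m s powr (1 - r)) * (\<bar>F s x\<bar> * ?w x) powr r) \<partial>lborel)" for x
  proof -
    have "ennreal (\<bar>\<integral>s. k s * F s x \<partial>lborel\<bar> powr r)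
      \<le> ennreal (A powr (r - 1)) * (\<integral>\<^sup>+s. ennreal (\<bar>k s * F s x\<bar> powr r * (k s * m s) powr (1 - r)) \<partial>lborel)"
    proof (rule power_mean_integral)
      show "0 \<le> k s * m s" for s using km[of s] by (cases "k s = 0") auto
      show "k s * F s x = 0" if "k s * m s = 0" for s using km(2)[of s] that by force
    qed (use A 2 in auto)
    also have "\<dots> = ennreal (A powr (r - 1)) * (\<integral>\<^sup>+s. ennreal (k s * m s powr (1 - r) * \<bar>F s x\<bar> powr r) \<partial>lborel)"
    proof -
      have "\<bar>k s * F s x\<bar> powr r * (k s * m s) powr (1 - r) = k s * m s powr (1 - r) * \<bar>F s x\<bar> powr r" for s
      proof (cases "k s = 0")
        case False
        then have "k s > 0" "m s > 0" using km[of s] by auto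
        then have "\<bar>k s * F s x\<bar> powr r * (k s * m s) powr (1 - r) = (k s powr r * k s powr (1 - r)) * m s powr (1 - r) * \<bar>F s x\<bar> powr r"
          by (simp add: abs_mult powr_mult)
        also have "k s powr r * k s powr (1 - r) = k s" using \<open>k s > 0\<close> by (simp add: powr_add[symmetric])
        finally show ?thesis .
      qed simp
      then show ?thesis by simp
    qed
    finally have "ennreal (\<bar>\<integral>s. k s * F s x \<partial>lborel\<bar> powr r) * ennreal (?w x powr r)
      \<le> ennreal (A powr (r - 1)) * (\<integral>\<^sup>+s. ennreal (k s * m s powr (1 - r) * \<bar>F s x\<bar> powr r) \<partial>lborel) * ennreal (?w x powr r)"
      by (rule mult_right_mono) auto
    also have "\<dots> = (\<integral>\<^sup>+s. ennreal (A powr (r - 1) * (k s * m s powr (1 - r)) * (\<bar>F s x\<bar> * ?w x) powr r) \<partial>lborel)"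
      by (subst nn_integral_cmult[symmetric] nn_integral_multc[symmetric], measurable)+
         (use km in \<open>auto intro!: nn_integral_cong simp: ennreal_mult'[symmetric] powr_mult mult_ac\<close>)
    finally show ?thesis by (simp add: ennreal_mult'[symmetric] powr_mult)
  qed
  have Fm [measurable]: "(\<lambda>z. F (fst z) (snd z)) \<in> borel_measurable (borel \<Otimes>\<^sub>M borel)"
    using assms(2) by (simp add: case_prod_beta')
  have "(\<integral>\<^sup>+ x\<in>Iv. ennreal ((\<bar>\<integral>s. k s * F s x \<partial>lborel\<bar> * ?w x) powr r) \<partial>lborel)
    \<le> (\<integral>\<^sup>+ x. (\<integral>\<^sup>+s. ennreal (A powr (r - 1) * (k s * m s powr (1 - r)) * (\<bar>F s x\<bar> * ?w x) powr r) \<partial>lborel) * indicator Iv x \<partial>lborel)"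
    by (intro nn_integral_mono mult_right_mono pt zero_le)
  also have "\<dots> = (\<integral>\<^sup>+ x. (\<integral>\<^sup>+s. ennreal (A powr (r - 1) * (k s * m s powr (1 - r)) * (\<bar>F s x\<bar> * ?w x) powr r) * indicator Iv x \<partial>lborel) \<partial>lborel)"
    by (subst nn_integral_multc) measurable
  also have "\<dots> = (\<integral>\<^sup>+ s. (\<integral>\<^sup>+x. ennreal (A powr (r - 1) * (k s * m s powr (1 - r)) * (\<bar>F s x\<bar> * ?w x) powr r) * indicator Iv x \<partial>lborel) \<partial>lborel)"
    by (rule lborel_pair.Fubini') measurable
  also have "\<dots> = (\<integral>\<^sup>+ s. ennreal (A powr (r - 1) * (k s * m s powr (1 - r))) * (\<integral>\<^sup>+x\<in>Iv. ennreal ((\<bar>F s x\<bar> * ?w x) powr r) \<partial>lborel) \<partial>lborel)"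
  proof (rule nn_integral_cong)
    fix s
    have [measurable]: "(\<lambda>x. F s x) \<in> borel_measurable borel"
      using measurable_compose[OF measurable_Pair1' assms(2)] by simp
    have "(\<integral>\<^sup>+x. ennreal (A powr (r - 1) * (k s * m s powr (1 - r)) * (\<bar>F s x\<bar> * ?w x) powr r) * indicator Iv x \<partial>lborel)
      = (\<integral>\<^sup>+x. ennreal (A powr (r - 1) * (k s * m s powr (1 - r))) * (ennreal ((\<bar>F s x\<bar> * ?w x) powr r) * indicator Iv x) \<partial>lborel)"
      using km by (intro nn_integral_cong) (simp add: ennreal_mult'[symmetric] mult.assoc[symmetric])
    also have "\<dots> = ennreal (A powr (r - 1) * (k s * m s powr (1 - r))) * (\<integral>\<^sup>+x\<in>Iv. ennreal ((\<bar>F s x\<bar> * ?w x) powr r) \<partial>lborel)"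
      by (rule nn_integral_cmult) measurable
    finally show "(\<integral>\<^sup>+x. ennreal (A powr (r - 1) * (k s * m s powr (1 - r)) * (\<bar>F s x\<bar> * ?w x) powr r) * indicator Iv x \<partial>lborel)
      = ennreal (A powr (r - 1) * (k s * m s powr (1 - r))) * (\<integral>\<^sup>+x\<in>Iv. ennreal ((\<bar>F s x\<bar> * ?w x) powr r) \<partial>lborel)" .
  qed
  also have "\<dots> \<le> (\<integral>\<^sup>+ s. ennreal (A powr (r - 1)) * ennreal (k s * m s) \<partial>lborel)"
  proof (intro nn_integral_mono)
    fix s
    show "ennreal (A powr (r - 1) * (k s * m s powr (1 - r))) * (\<integral>\<^sup>+x\<in>Iv. ennreal ((\<bar>F s x\<bar> * ?w x) powr r) \<partial>lborel)
      \<le> ennreal (A powr (r - 1)) * ennreal (k s * m s)"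
    proof (cases "k s = 0")
      case False
      then have m: "m s > 0" using km by auto
      have "(\<integral>\<^sup>+x\<in>Iv. ennreal ((\<bar>F s x\<bar> * ?w x) powr r) \<partial>lborel) \<le> ennreal (m s powr r)"
        using F[OF False] 2 by (simp add: norm_le_def)
      then have "ennreal (A powr (r - 1) * (k s * m s powr (1 - r))) * (\<integral>\<^sup>+x\<in>Iv. ennreal ((\<bar>F s x\<bar> * ?w x) powr r) \<partial>lborel)
        \<le> ennreal (A powr (r - 1) * (k s * m s powr (1 - r))) * ennreal (m s powr r)"
        by (intro mult_left_mono) auto
      also have "\<dots> = ennreal (A powr (r - 1) * (k s * (m s powr (1 - r) * m s powr r)))"
        using km by (simp add: ennreal_mult'[symmetric] mult_ac)
      also have "m s powr (1 - r) * m s powr r = m s" using m by (simp add: powr_add[symmetric])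
      finally show ?thesis by (simp add: ennreal_mult')
    qed simp
  qed
  also have "\<dots> = ennreal (A powr (r - 1)) * (\<integral>\<^sup>+ s. ennreal (k s * m s) \<partial>lborel)"
    by (rule nn_integral_cmult) simp
  also have "\<dots> \<le> ennreal (A powr (r - 1)) * ennreal A"
    by (intro mult_left_mono A) auto
  also have "\<dots> = ennreal (A powr r)"
    using A by (simp add: ennreal_mult'[symmetric] powr_diff)
  finally show ?thesis using 2 by (simp add: norm_le_def)
qed

section \<open>Rotations of the sphere in the coordinates x and phi\<close>

definition rot_R :: "real \<Rightarrow> real \<Rightarrow> real \<Rightarrow> real" where
  "rot_R x t \<phi> = x * cos t - sqrt (1 - x\<^sup>2) * sin t * cos \<phi>"

text \<open>This is sin theta e^(-i phi) for the angles theta and phi of the statement. It carries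
  both without an argument function, and where phi is undetermined it is simply 0.\<close>

definition rot_q :: "real \<Rightarrow> real \<Rightarrow> real \<Rightarrow> complex" where
  "rot_q x t \<phi> = Complex (x * sin t + sqrt (1 - x\<^sup>2) * cos t * cos \<phi>) (- (sqrt (1 - x\<^sup>2) * sin \<phi>))"

text \<open>Equal to (1 - R^2)^(m/2) cos(m (phi_1 - phi)), but polynomial in sines and cosines of t
  and phi_1, hence smooth also where sin theta = 0.\<close>

definition spin_ker :: "nat \<Rightarrow> real \<Rightarrow> real \<Rightarrow> real \<Rightarrow> real" where
  "spin_ker m x t \<phi> = Re (cis (real m * \<phi>) * rot_q x t \<phi> ^ m)"

lemma rot_R_measurable [measurable (raw)]:
  assumes [measurable]: "f \<in> borel_measurable M" "g \<in> borel_measurable M" "h \<in> borel_measurable M"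
  shows "(\<lambda>w. rot_R (f w) (g w) (h w)) \<in> borel_measurable M"
  unfolding rot_R_def by measurable

lemma spin_ker_measurable [measurable (raw)]:
  assumes [measurable]: "f \<in> borel_measurable M" "g \<in> borel_measurable M" "h \<in> borel_measurable M"
  shows "(\<lambda>w. spin_ker m (f w) (g w) (h w)) \<in> borel_measurable M"
  unfolding spin_ker_def rot_q_def cis_conv_exp Complex_eq by measurable

lemma Iv_sq: "x \<in> Iv \<Longrightarrow> x\<^sup>2 < 1"
  by (simp add: abs_square_less_1 abs_less_iff)

lemma Iv_weight_pos: "x \<in> Iv \<Longrightarrow> 0 < 1 - x\<^sup>2"
  using Iv_sq by fastforce

lemma Iv_iff: "x \<in> Iv \<longleftrightarrow> x\<^sup>2 < 1"
  by (auto simp: abs_square_less_1 abs_less_iff)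

text \<open>R and the real and imaginary parts of q are, up to sign, the coordinates of a rotated
  point of the unit sphere, so their squares sum to 1.\<close>

lemma cmod_rot_q:
  assumes "x\<^sup>2 \<le> 1"
  shows "(cmod (rot_q x t \<phi>))\<^sup>2 = 1 - (rot_R x t \<phi>)\<^sup>2"
proof -
  let ?s = "sqrt (1 - x\<^sup>2)"
  have s: "?s\<^sup>2 = 1 - x\<^sup>2" using assms by simp
  have "(x * sin t + ?s * cos t * cos \<phi>)\<^sup>2 + (?s * sin \<phi>)\<^sup>2 + (x * cos t - ?s * sin t * cos \<phi>)\<^sup>2
    = x\<^sup>2 * ((sin t)\<^sup>2 + (cos t)\<^sup>2) + ?s\<^sup>2 * ((cos \<phi>)\<^sup>2 * ((sin t)\<^sup>2 + (cos t)\<^sup>2) + (sin \<phi>)\<^sup>2)"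
    by (simp only: power2_eq_square) (simp only: algebra_simps)
  also have "\<dots> = x\<^sup>2 + ?s\<^sup>2 * ((sin \<phi>)\<^sup>2 + (cos \<phi>)\<^sup>2)" by (simp only: sin_cos_squared_add mult_1_right add.commute[of "(cos \<phi>)\<^sup>2"])
  also have "\<dots> = 1" using s by (simp only: sin_cos_squared_add) simp
  finally show ?thesis by (simp add: cmod_power2 rot_q_def rot_R_def)
qed

text \<open>The rotation fixes the coordinate sqrt(1 - x^2) sin phi, which is thus a lower bound for
  the new distance from the axis.\<close>

lemma rot_R_weight_ge:
  assumes "x\<^sup>2 \<le> 1"
  shows "(1 - x\<^sup>2) * (sin \<phi>)\<^sup>2 \<le> 1 - (rot_R x t \<phi>)\<^sup>2"
proof -
  have "(1 - x\<^sup>2) * (sin \<phi>)\<^sup>2 = (Im (rot_q x t \<phi>))\<^sup>2"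
    using assms by (simp add: rot_q_def power_mult_distrib)
  also have "\<dots> \<le> (cmod (rot_q x t \<phi>))\<^sup>2" by (simp add: cmod_power2)
  finally show ?thesis by (simp add: cmod_rot_q assms)
qed

lemma rot_R_Iv:
  assumes "x \<in> Iv" "\<phi> \<in> {0<..<pi}"
  shows "rot_R x t \<phi> \<in> Iv"
proof -
  have "0 < (1 - x\<^sup>2) * (sin \<phi>)\<^sup>2"
    using Iv_weight_pos[OF assms(1)] sin_gt_zero[of \<phi>] assms(2) by simp
  also have "\<dots> \<le> 1 - (rot_R x t \<phi>)\<^sup>2" using Iv_sq[OF assms(1)] by (intro rot_R_weight_ge) simp
  finally show ?thesis by (subst Iv_iff) simp
qed

lemma rot_R_bound: "x\<^sup>2 \<le> 1 \<Longrightarrow> \<bar>rot_R x t \<phi>\<bar> \<le> 1"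
  using cmod_rot_q[of x t \<phi>] by (metis abs_square_le_1 diff_ge_0_iff_ge zero_le_power2)

lemma spin_ker_le:
  assumes "x\<^sup>2 \<le> 1"
  shows "\<bar>spin_ker m x t \<phi>\<bar> \<le> sqrt (1 - (rot_R x t \<phi>)\<^sup>2) ^ m"
proof -
  have "cmod (rot_q x t \<phi>) = sqrt (1 - (rot_R x t \<phi>)\<^sup>2)"
    using cmod_rot_q[OF assms, of t \<phi>] by (metis norm_ge_zero real_sqrt_abs abs_of_nonneg)
  then show ?thesis
    unfolding spin_ker_def using abs_Re_le_cmod[of "cis (real m * \<phi>) * rot_q x t \<phi> ^ m"]
    by (simp add: norm_mult norm_power)
qed

subsection \<open>The averaging operator is symmetric\<close>

definition circ_avg :: "real \<Rightarrow> (real \<Rightarrow> ennreal) \<Rightarrow> real \<Rightarrow> ennreal" where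
  "circ_avg t F x = (\<integral>\<^sup>+\<phi>\<in>{0<..<pi}. F (rot_R x t \<phi>) \<partial>lborel)"

lemma circ_avg_measurable [measurable (raw)]:
  assumes [measurable]: "F \<in> borel_measurable borel"
  shows "circ_avg t F \<in> borel_measurable borel"
  unfolding circ_avg_def by measurable

lemma nn_integral_cos_substitution:
  fixes h :: "real \<Rightarrow> ennreal"
  assumes [measurable]: "h \<in> borel_measurable borel" and s: "0 < s"
  shows "(\<integral>\<^sup>+\<phi>\<in>{0<..<pi}. h (s * cos \<phi>) \<partial>lborel)
    = (\<integral>\<^sup>+y. h y * ennreal (indicator {y. y\<^sup>2 < s\<^sup>2} y / sqrt (s\<^sup>2 - y\<^sup>2)) \<partial>lborel)"
proof -
  define k :: "real \<Rightarrow> real" where "k y = indicator {y. y\<^sup>2 < s\<^sup>2} y / sqrt (s\<^sup>2 - y\<^sup>2)" for y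
  have [measurable]: "k \<in> borel_measurable borel" unfolding k_def by measurable
  \<comment> \<open>The map from phi to s cos phi is decreasing; reflecting y first makes the
    substitution increasing.\<close>
  have "(\<integral>\<^sup>+y. h y * ennreal (k y) \<partial>lborel) = (\<integral>\<^sup>+y. h (- y) * ennreal (k (- y)) \<partial>lborel)"
    by (subst nn_integral_real_affine[where c = "-1" and t = 0]) auto
  also have "\<dots> = (\<integral>\<^sup>+y. (h (- y) * ennreal (k y)) * indicator {- s * cos 0 .. - s * cos pi} y \<partial>lborel)"
  proof (rule nn_integral_cong)
    fix y
    show "h (- y) * ennreal (k (- y)) = (h (- y) * ennreal (k y)) * indicator {- s * cos 0 .. - s * cos pi} y"
    proof (cases "y\<^sup>2 < s\<^sup>2")
      case True
      then have "\<bar>y\<bar> < s" using s power2_less_imp_less[of "\<bar>y\<bar>" s] by simp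
      then show ?thesis by (auto simp: k_def indicator_def)
    qed (simp add: k_def)
  qed
  also have "\<dots> = (\<integral>\<^sup>+\<phi>. (h (- (- s * cos \<phi>)) * ennreal (k (- s * cos \<phi>))) * ennreal (s * sin \<phi>) * indicator {0..pi} \<phi> \<partial>lborel)"
    using s by (intro nn_integral_substitution_aux[where g = "\<lambda>\<phi>. - s * cos \<phi>" and g' = "\<lambda>\<phi>. s * sin \<phi>"])
       (auto intro!: derivative_eq_intros continuous_intros simp: sin_ge_zero)
  also have "\<dots> = (\<integral>\<^sup>+\<phi>\<in>{0<..<pi}. h (s * cos \<phi>) \<partial>lborel)"
  proof (rule nn_integral_cong_AE)
    have "AE \<phi> in lborel. \<phi> \<noteq> 0 \<and> \<phi> \<noteq> pi"
      using AE_lborel_singleton[of 0] AE_lborel_singleton[of pi] by eventually_elim auto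
    then show "AE \<phi> in lborel. (h (- (- s * cos \<phi>)) * ennreal (k (- s * cos \<phi>))) * ennreal (s * sin \<phi>) * indicator {0..pi} \<phi>
       = h (s * cos \<phi>) * indicator {0<..<pi} \<phi>"
    proof eventually_elim
      case (elim \<phi>)
      show ?case
      proof (cases "\<phi> \<in> {0<..<pi}")
        case True
        then have sp: "sin \<phi> > 0" using sin_gt_zero by auto
        have e: "s\<^sup>2 - (s * cos \<phi>)\<^sup>2 = (s * sin \<phi>)\<^sup>2"
          by (simp add: power_mult_distrib sin_squared_eq algebra_simps)
        have lt: "(s * cos \<phi>)\<^sup>2 < s\<^sup>2"
          using e sp s by (smt (verit) mult_pos_pos zero_less_power2)
        have "k (- s * cos \<phi>) = 1 / (s * sin \<phi>)"
          using e lt sp s by (simp add: k_def)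
        then have "ennreal (k (- s * cos \<phi>)) * ennreal (s * sin \<phi>) = 1"
          using sp s by (simp add: ennreal_mult'[symmetric])
        then show ?thesis using True by (simp add: mult.assoc)
      qed (use elim in \<open>auto simp: indicator_def\<close>)
    qed
  qed
  finally show ?thesis by (simp add: k_def)
qed

text \<open>By Archimedes, dx dphi is the area on a half-sphere. Projected to the disc with
  coordinates x and y = sqrt(1 - x^2) cos phi it has this density, which depends on the radius only
  and is therefore invariant under rotations of the disc.\<close>

definition disc_dens :: "real \<Rightarrow> real \<Rightarrow> ennreal" where
  "disc_dens x y = ennreal (indicator {r. r < 1} (x\<^sup>2 + y\<^sup>2) / sqrt (1 - (x\<^sup>2 + y\<^sup>2)))"

lemma disc_dens_measurable [measurable (raw)]:
  assumes [measurable]: "f \<in> borel_measurable M" "g \<in> borel_measurable M"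
  shows "(\<lambda>w. disc_dens (f w) (g w)) \<in> borel_measurable M"
  unfolding disc_dens_def by measurable

lemma nn_integral_sphere_disc:
  fixes \<Psi> :: "real \<times> real \<Rightarrow> ennreal"
  assumes [measurable]: "\<Psi> \<in> borel_measurable (borel \<Otimes>\<^sub>M borel)"
  shows "(\<integral>\<^sup>+x\<in>Iv. (\<integral>\<^sup>+\<phi>\<in>{0<..<pi}. \<Psi> (x, sqrt (1 - x\<^sup>2) * cos \<phi>) \<partial>lborel) \<partial>lborel)
    = (\<integral>\<^sup>+x. \<integral>\<^sup>+y. \<Psi> (x, y) * disc_dens x y \<partial>lborel \<partial>lborel)"
proof (rule nn_integral_cong)
  fix x :: real
  show "(\<integral>\<^sup>+\<phi>\<in>{0<..<pi}. \<Psi> (x, sqrt (1 - x\<^sup>2) * cos \<phi>) \<partial>lborel) * indicator Iv x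
    = (\<integral>\<^sup>+y. \<Psi> (x, y) * disc_dens x y \<partial>lborel)"
  proof (cases "x \<in> Iv")
    case True
    then have p: "0 < 1 - x\<^sup>2" by (rule Iv_weight_pos)
    have "(\<integral>\<^sup>+\<phi>\<in>{0<..<pi}. \<Psi> (x, sqrt (1 - x\<^sup>2) * cos \<phi>) \<partial>lborel)
      = (\<integral>\<^sup>+y. \<Psi> (x, y) * ennreal (indicator {y. y\<^sup>2 < (sqrt (1 - x\<^sup>2))\<^sup>2} y / sqrt ((sqrt (1 - x\<^sup>2))\<^sup>2 - y\<^sup>2)) \<partial>lborel)"
      by (rule nn_integral_cos_substitution) (use p in auto)
    also have "\<dots> = (\<integral>\<^sup>+y. \<Psi> (x, y) * disc_dens x y \<partial>lborel)"
    proof (rule nn_integral_cong)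
      fix y :: real
      have "(sqrt (1 - x\<^sup>2))\<^sup>2 = 1 - x\<^sup>2" using p by simp
      then show "\<Psi> (x, y) * ennreal (indicator {y. y\<^sup>2 < (sqrt (1 - x\<^sup>2))\<^sup>2} y / sqrt ((sqrt (1 - x\<^sup>2))\<^sup>2 - y\<^sup>2))
         = \<Psi> (x, y) * disc_dens x y"
        by (simp only: disc_dens_def) (simp add: indicator_def less_diff_eq add.commute diff_diff_eq)
    qed
    finally show ?thesis using True by simp
  next
    case False
    then have "1 \<le> x\<^sup>2" unfolding Iv_iff by simp
    then have "disc_dens x y = 0" for y
      using zero_le_power2[of y] by (simp add: disc_dens_def indicator_def not_less add_increasing2)
    then show ?thesis using False by simp
  qed
qed

lemma borel_measurable_case_prod_compose:
  fixes \<Psi> :: "real \<Rightarrow> real \<Rightarrow> 'b::topological_space"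
  assumes M: "case_prod \<Psi> \<in> borel_measurable (borel \<Otimes>\<^sub>M borel)"
    and [measurable]: "f \<in> borel_measurable N" "g \<in> borel_measurable N"
  shows "(\<lambda>z. \<Psi> (f z) (g z)) \<in> borel_measurable N"
proof -
  have "(\<lambda>z. (f z, g z)) \<in> measurable N (borel \<Otimes>\<^sub>M borel)" by measurable
  from measurable_compose[OF this M] show ?thesis by simp
qed

lemma nn_integral_shear1:
  fixes \<Psi> :: "real \<Rightarrow> real \<Rightarrow> ennreal"
  assumes [measurable]: "case_prod \<Psi> \<in> borel_measurable (borel \<Otimes>\<^sub>M borel)"
  shows "(\<integral>\<^sup>+x. \<integral>\<^sup>+y. \<Psi> x (y + b * x) \<partial>lborel \<partial>lborel) = (\<integral>\<^sup>+x. \<integral>\<^sup>+y. \<Psi> x y \<partial>lborel \<partial>lborel)"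
proof (rule nn_integral_cong)
  fix x
  have [measurable]: "\<Psi> x \<in> borel_measurable borel"
    using measurable_compose[OF measurable_Pair1' assms, of x] by simp
  show "(\<integral>\<^sup>+y. \<Psi> x (y + b * x) \<partial>lborel) = (\<integral>\<^sup>+y. \<Psi> x y \<partial>lborel)"
    by (subst nn_integral_real_affine[where c = 1 and t = "b * x" and f = "\<Psi> x"]) (auto simp: add.commute)
qed

lemma nn_integral_shear2:
  fixes \<Psi> :: "real \<Rightarrow> real \<Rightarrow> ennreal"
  assumes M: "case_prod \<Psi> \<in> borel_measurable (borel \<Otimes>\<^sub>M borel)"
  shows "(\<integral>\<^sup>+x. \<integral>\<^sup>+y. \<Psi> (x + a * y) y \<partial>lborel \<partial>lborel) = (\<integral>\<^sup>+x. \<integral>\<^sup>+y. \<Psi> x y \<partial>lborel \<partial>lborel)"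
proof -
  have [measurable]: "(\<lambda>z. \<Psi> (fst z) (snd z)) \<in> borel_measurable (borel \<Otimes>\<^sub>M borel)"
    using M by (simp add: case_prod_beta')
  have 1: "case_prod (\<lambda>x y. \<Psi> (x + a * y) y) \<in> borel_measurable (borel \<Otimes>\<^sub>M borel)"
    unfolding case_prod_beta' by (rule borel_measurable_case_prod_compose[OF M]) measurable
  have 2: "case_prod (\<lambda>y x. \<Psi> x y) \<in> borel_measurable (borel \<Otimes>\<^sub>M borel)"
    unfolding case_prod_beta' by (rule borel_measurable_case_prod_compose[OF M]) measurable
  have "(\<integral>\<^sup>+x. \<integral>\<^sup>+y. \<Psi> (x + a * y) y \<partial>lborel \<partial>lborel) = (\<integral>\<^sup>+y. \<integral>\<^sup>+x. \<Psi> (x + a * y) y \<partial>lborel \<partial>lborel)"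
    by (rule lborel_pair.Fubini') (use 1 2 in \<open>simp cong: measurable_cong_sets\<close>)
  also have "\<dots> = (\<integral>\<^sup>+y. \<integral>\<^sup>+x. \<Psi> x y \<partial>lborel \<partial>lborel)"
    by (rule nn_integral_shear1[OF 2])
  also have "\<dots> = (\<integral>\<^sup>+x. \<integral>\<^sup>+y. \<Psi> x y \<partial>lborel \<partial>lborel)"
    by (rule lborel_pair.Fubini'[symmetric]) (use M 2 in \<open>simp cong: measurable_cong_sets\<close>)
  finally show ?thesis .
qed

lemma nn_integral_reflect2:
  fixes \<Psi> :: "real \<Rightarrow> real \<Rightarrow> ennreal"
  assumes [measurable]: "case_prod \<Psi> \<in> borel_measurable (borel \<Otimes>\<^sub>M borel)"
  shows "(\<integral>\<^sup>+x. \<integral>\<^sup>+y. \<Psi> x (- y) \<partial>lborel \<partial>lborel) = (\<integral>\<^sup>+x. \<integral>\<^sup>+y. \<Psi> x y \<partial>lborel \<partial>lborel)"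
proof (rule nn_integral_cong)
  fix x
  have [measurable]: "\<Psi> x \<in> borel_measurable borel"
    using measurable_compose[OF measurable_Pair1' assms, of x] by simp
  show "(\<integral>\<^sup>+y. \<Psi> x (- y) \<partial>lborel) = (\<integral>\<^sup>+y. \<Psi> x y \<partial>lborel)"
    by (subst nn_integral_real_affine[where c = "-1" and t = 0 and f = "\<Psi> x"]) auto
qed

text \<open>Off the half-turn, a plane rotation is a product of three shears.\<close>

lemma nn_integral_rotate:
  fixes \<Psi> :: "real \<Rightarrow> real \<Rightarrow> ennreal"
  assumes M: "case_prod \<Psi> \<in> borel_measurable (borel \<Otimes>\<^sub>M borel)"
  shows "(\<integral>\<^sup>+x. \<integral>\<^sup>+y. \<Psi> (x * cos t + y * sin t) (y * cos t - x * sin t) \<partial>lborel \<partial>lborel)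
     = (\<integral>\<^sup>+x. \<integral>\<^sup>+y. \<Psi> x y \<partial>lborel \<partial>lborel)"
proof (cases "cos (t / 2) = 0")
  case True
  have c: "cos t = -1" using cos_double_cos[of "t / 2"] True by simp
  have s: "sin t = 0" using sin_double[of "t / 2"] True by simp
  have 2: "case_prod (\<lambda>x y. \<Psi> (- x) y) \<in> borel_measurable (borel \<Otimes>\<^sub>M borel)"
    unfolding case_prod_beta' by (rule borel_measurable_case_prod_compose[OF M]) measurable
  have [measurable]: "(\<lambda>z. \<Psi> (fst z) (snd z)) \<in> borel_measurable (borel \<Otimes>\<^sub>M borel)"
    using M by (simp add: case_prod_beta')
  have "(\<integral>\<^sup>+x. \<integral>\<^sup>+y. \<Psi> (- x) (- y) \<partial>lborel \<partial>lborel) = (\<integral>\<^sup>+x. \<integral>\<^sup>+y. \<Psi> (- x) y \<partial>lborel \<partial>lborel)"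
    by (rule nn_integral_reflect2[OF 2])
  also have "\<dots> = (\<integral>\<^sup>+x. \<integral>\<^sup>+y. \<Psi> x y \<partial>lborel \<partial>lborel)"
    by (subst nn_integral_real_affine[where c = "-1" and t = 0 and f = "\<lambda>x. \<integral>\<^sup>+y. \<Psi> x y \<partial>lborel"]) (use M in auto)
  finally show ?thesis by (simp add: c s)
next
  case False
  \<comment> \<open>The slopes of the shears are tan(t/2), - sin t and tan(t/2) again.\<close>
  define a where "a = sin (t / 2) / cos (t / 2)"
  have st: "sin t = 2 * sin (t / 2) * cos (t / 2)" using sin_double[of "t / 2"] by simp
  have ct: "cos t = 2 * (cos (t / 2))\<^sup>2 - 1" "cos t = 1 - 2 * (sin (t / 2))\<^sup>2"
    using cos_double_cos[of "t / 2"] cos_double_sin[of "t / 2"] by simp_all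
  have as: "a * sin t = 1 - cos t" using False by (simp add: a_def st ct(2) power2_eq_square)
  have ac: "a * (1 + cos t) = sin t" using False by (simp add: a_def st ct(1) power2_eq_square)
  have comp: "case_prod (\<lambda>x y. \<Psi>' (x + a * y) y) \<in> borel_measurable (borel \<Otimes>\<^sub>M borel)"
    "case_prod (\<lambda>x y. \<Psi>' x (y + b * x)) \<in> borel_measurable (borel \<Otimes>\<^sub>M borel)"
    if M': "case_prod \<Psi>' \<in> borel_measurable (borel \<Otimes>\<^sub>M borel)" for \<Psi>' :: "real \<Rightarrow> real \<Rightarrow> ennreal" and b
    unfolding case_prod_beta' by (rule borel_measurable_case_prod_compose[OF M'], measurable)+
  define \<Psi>1 where "\<Psi>1 = (\<lambda>x y. \<Psi> (x + a * y) y)"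
  define \<Psi>2 where "\<Psi>2 = (\<lambda>x y. \<Psi>1 x (y + (- sin t) * x))"
  have M1: "case_prod \<Psi>1 \<in> borel_measurable (borel \<Otimes>\<^sub>M borel)" unfolding \<Psi>1_def by (rule comp(1)[OF M])
  have M2: "case_prod \<Psi>2 \<in> borel_measurable (borel \<Otimes>\<^sub>M borel)" unfolding \<Psi>2_def by (rule comp(2)[OF M1])
  have "\<Psi> (x * cos t + y * sin t) (y * cos t - x * sin t) = \<Psi>2 (x + a * y) y" for x y
  proof -
    have 1: "y + - sin t * (x + a * y) = y * cos t - x * sin t"
    proof -
      have "y + - sin t * (x + a * y) = y * (1 - a * sin t) - x * sin t" by (simp add: algebra_simps)
      then show ?thesis by (simp add: as)
    qed
    have "x + a * y + a * (y * cos t - x * sin t) = x * (1 - a * sin t) + y * (a * (1 + cos t))"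
      by (simp add: algebra_simps)
    also have "\<dots> = x * cos t + y * sin t" by (simp only: as ac) simp
    finally show ?thesis unfolding \<Psi>2_def \<Psi>1_def 1 by simp
  qed
  then show ?thesis
    using nn_integral_shear2[OF M2, of a] nn_integral_shear1[OF M1, of "- sin t"] nn_integral_shear2[OF M, of a]
    by (simp add: \<Psi>2_def \<Psi>1_def)
qed

text \<open>On the disc, F is taken at the first coordinate of the rotated point and H at that of
  the point itself. Rotating back exchanges the two roles but also reverses t; the reflection of y
  restores the sign of t.\<close>

lemma circ_avg_symmetric:
  assumes [measurable]: "F \<in> borel_measurable borel" "H \<in> borel_measurable borel"
  shows "(\<integral>\<^sup>+x\<in>Iv. circ_avg t F x * H x \<partial>lborel) = (\<integral>\<^sup>+x\<in>Iv. F x * circ_avg t H x \<partial>lborel)"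
proof -
  define D1 where "D1 = (\<lambda>x y. F (x * cos t - y * sin t) * H x * disc_dens x y)"
  define D2 where "D2 = (\<lambda>x y. F x * H (x * cos t + y * sin t) * disc_dens x y)"
  have m1: "case_prod D1 \<in> borel_measurable (borel \<Otimes>\<^sub>M borel)"
    unfolding D1_def case_prod_beta' by measurable
  have m2: "case_prod D2 \<in> borel_measurable (borel \<Otimes>\<^sub>M borel)"
    unfolding D2_def case_prod_beta' by measurable
  have "(\<integral>\<^sup>+x\<in>Iv. circ_avg t F x * H x \<partial>lborel)
    = (\<integral>\<^sup>+x\<in>Iv. (\<integral>\<^sup>+\<phi>\<in>{0<..<pi}. (\<lambda>z. F (fst z * cos t - snd z * sin t) * H (fst z)) (x, sqrt (1 - x\<^sup>2) * cos \<phi>) \<partial>lborel) \<partial>lborel)"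
  proof (rule nn_integral_cong)
    fix x
    have "circ_avg t F x * H x = (\<integral>\<^sup>+\<phi>. F (rot_R x t \<phi>) * indicator {0<..<pi} \<phi> * H x \<partial>lborel)"
      unfolding circ_avg_def by (rule nn_integral_multc[symmetric]) measurable
    also have "\<dots> = (\<integral>\<^sup>+\<phi>\<in>{0<..<pi}. (\<lambda>z. F (fst z * cos t - snd z * sin t) * H (fst z)) (x, sqrt (1 - x\<^sup>2) * cos \<phi>) \<partial>lborel)"
      by (simp add: rot_R_def mult_ac)
    finally show "circ_avg t F x * H x * indicator Iv x = (\<integral>\<^sup>+\<phi>\<in>{0<..<pi}. (\<lambda>z. F (fst z * cos t - snd z * sin t) * H (fst z)) (x, sqrt (1 - x\<^sup>2) * cos \<phi>) \<partial>lborel) * indicator Iv x"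
      by (rule arg_cong)
  qed
  also have "\<dots> = (\<integral>\<^sup>+x. \<integral>\<^sup>+y. D1 x y \<partial>lborel \<partial>lborel)"
    by (subst nn_integral_sphere_disc) (auto simp: D1_def)
  also have "\<dots> = (\<integral>\<^sup>+x. \<integral>\<^sup>+y. D1 (x * cos t + y * sin t) (y * cos t - x * sin t) \<partial>lborel \<partial>lborel)"
    by (rule nn_integral_rotate[OF m1, symmetric])
  also have "\<dots> = (\<integral>\<^sup>+x. \<integral>\<^sup>+y. D2 x y \<partial>lborel \<partial>lborel)"
  proof -
    have "(x * cos t + y * sin t) * cos t - (y * cos t - x * sin t) * sin t = x" for x y
    proof -
      have "(x * cos t + y * sin t) * cos t - (y * cos t - x * sin t) * sin t = x * ((sin t)\<^sup>2 + (cos t)\<^sup>2)"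
        by (simp only: power2_eq_square algebra_simps)
      then show ?thesis by simp
    qed
    moreover have "(x * cos t + y * sin t)\<^sup>2 + (y * cos t - x * sin t)\<^sup>2 = x\<^sup>2 + y\<^sup>2" for x y
    proof -
      have "(x * cos t + y * sin t)\<^sup>2 + (y * cos t - x * sin t)\<^sup>2 = (x\<^sup>2 + y\<^sup>2) * ((sin t)\<^sup>2 + (cos t)\<^sup>2)"
        by (simp only: power2_eq_square algebra_simps)
      then show ?thesis by simp
    qed
    ultimately show ?thesis by (simp add: D1_def D2_def disc_dens_def)
  qed
  also have "\<dots> = (\<integral>\<^sup>+x. \<integral>\<^sup>+y. D2 x (- y) \<partial>lborel \<partial>lborel)"
    by (rule nn_integral_reflect2[OF m2, symmetric])
  also have "\<dots> = (\<integral>\<^sup>+x\<in>Iv. (\<integral>\<^sup>+\<phi>\<in>{0<..<pi}. (\<lambda>z. F (fst z) * H (fst z * cos t - snd z * sin t)) (x, sqrt (1 - x\<^sup>2) * cos \<phi>) \<partial>lborel) \<partial>lborel)"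
    by (subst nn_integral_sphere_disc) (auto simp: D2_def disc_dens_def)
  also have "\<dots> = (\<integral>\<^sup>+x\<in>Iv. F x * circ_avg t H x \<partial>lborel)"
  proof (rule nn_integral_cong)
    fix x
    have "F x * circ_avg t H x = (\<integral>\<^sup>+\<phi>. F x * (H (rot_R x t \<phi>) * indicator {0<..<pi} \<phi>) \<partial>lborel)"
      unfolding circ_avg_def by (rule nn_integral_cmult[symmetric]) measurable
    also have "\<dots> = (\<integral>\<^sup>+\<phi>\<in>{0<..<pi}. (\<lambda>z. F (fst z) * H (fst z * cos t - snd z * sin t)) (x, sqrt (1 - x\<^sup>2) * cos \<phi>) \<partial>lborel)"
      by (simp add: rot_R_def mult_ac)
    finally show "(\<integral>\<^sup>+\<phi>\<in>{0<..<pi}. (\<lambda>z. F (fst z) * H (fst z * cos t - snd z * sin t)) (x, sqrt (1 - x\<^sup>2) * cos \<phi>) \<partial>lborel) * indicator Iv x = F x * circ_avg t H x * indicator Iv x"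
      by (rule arg_cong[OF sym])
  qed
  finally show ?thesis .
qed

lemma circ_avg_1: "circ_avg t (\<lambda>_. 1) x = ennreal pi"
  by (simp add: circ_avg_def)

lemma circ_avg_integral:
  assumes [measurable]: "F \<in> borel_measurable borel"
  shows "(\<integral>\<^sup>+x\<in>Iv. circ_avg t F x \<partial>lborel) = ennreal pi * (\<integral>\<^sup>+x\<in>Iv. F x \<partial>lborel)"
proof -
  have "(\<integral>\<^sup>+x\<in>Iv. circ_avg t F x \<partial>lborel) = (\<integral>\<^sup>+x\<in>Iv. F x * ennreal pi \<partial>lborel)"
    using circ_avg_symmetric[of F "\<lambda>_. 1" t] by (simp add: circ_avg_1)
  also have "\<dots> = (\<integral>\<^sup>+x. ennreal pi * (F x * indicator Iv x) \<partial>lborel)"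
    by (simp add: mult_ac)
  also have "\<dots> = ennreal pi * (\<integral>\<^sup>+x\<in>Iv. F x \<partial>lborel)"
    by (rule nn_integral_cmult) measurable
  finally show ?thesis .
qed

text \<open>The circular average preserves integrals up to the factor pi, so the indicator of a null
  set averages to 0 for almost every x. This is what makes the translation well defined on classes
  of functions modulo null sets.\<close>

lemma AE_rot_R:
  assumes P: "AE y in lborel. y \<in> Iv \<longrightarrow> P y"
  shows "AE x in lborel. x \<in> Iv \<longrightarrow> (AE \<phi> in lborel. \<phi> \<in> {0<..<pi} \<longrightarrow> P (rot_R x t \<phi>))"
proof -
  from P obtain N where N: "{y. \<not> (y \<in> Iv \<longrightarrow> P y)} \<subseteq> N" "N \<in> sets lborel" "emeasure lborel N = 0"
    by (auto elim!: AE_E simp: emeasure_eq_measure2)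
  have [measurable]: "N \<in> sets borel" using N by simp
  have "(\<integral>\<^sup>+x\<in>Iv. indicator N x \<partial>lborel) = (0::ennreal)"
  proof -
    have "(\<integral>\<^sup>+x\<in>Iv. indicator N x \<partial>lborel) \<le> (\<integral>\<^sup>+x. indicator N x \<partial>lborel)"
      by (intro nn_integral_mono) (auto simp: indicator_def)
    also have "\<dots> = (0::ennreal)" using N by simp
    finally show ?thesis by simp
  qed
  then have "(\<integral>\<^sup>+x\<in>Iv. circ_avg t (indicator N) x \<partial>lborel) = 0"
    by (subst circ_avg_integral) auto
  then have "AE x in lborel. circ_avg t (indicator N) x * indicator Iv x = 0"
    by (subst (asm) nn_integral_0_iff_AE) auto
  then show ?thesis
  proof eventually_elim
    case (elim x)
    show ?case
    proof
      assume x: "x \<in> Iv"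
      then have "(\<integral>\<^sup>+\<phi>. indicator N (rot_R x t \<phi>) * indicator {0<..<pi} \<phi> \<partial>lborel) = (0::ennreal)"
        using elim by (simp add: circ_avg_def)
      then have "AE \<phi> in lborel. indicator N (rot_R x t \<phi>) * indicator {0<..<pi} \<phi> = (0::ennreal)"
        by (subst (asm) nn_integral_0_iff_AE) auto
      then show "AE \<phi> in lborel. \<phi> \<in> {0<..<pi} \<longrightarrow> P (rot_R x t \<phi>)"
      proof eventually_elim
        case (elim \<phi>)
        show ?case
        proof
          assume \<phi>: "\<phi> \<in> {0<..<pi}"
          then have "rot_R x t \<phi> \<notin> N" using elim by (auto simp: indicator_def split: if_splits)
          then show "P (rot_R x t \<phi>)" using N(1) rot_R_Iv[OF x \<phi>, of t] by blast
        qed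
      qed
    qed
  qed
qed

subsection \<open>Weights\<close>

lemma weight_integrable:
  fixes s :: real
  assumes s: "s < 1"
  shows "(\<integral>\<^sup>+x\<in>Iv. ennreal ((1 - x\<^sup>2) powr (- s)) \<partial>lborel) < \<infinity>"
proof -
  \<comment> \<open>A negative s gives a bounded weight, so s may be replaced by
    \<open>max s 0\<close>. On each half of the interval only one of the factors 1 + x and 1 - x can
    be small.\<close>
  define r where "r = max s 0"
  have r: "0 \<le> r" "r < 1" using s by (auto simp: r_def)
  have hi: "((\<lambda>x::real. x powr (- r)) has_integral (2 powr (- r + 1) / (- r + 1))) {0..2}"
    using has_integral_powr_from_0[of "- r" 2] r by simp
  have nn: "(\<integral>\<^sup>+x. ennreal (indicator {0..2} x * (x powr (- r))) \<partial>lborel) < \<infinity>"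
    using nn_integral_has_integral_lebesgue[OF _ hi] by (simp add: mult.commute nn_integral_completion)
  let ?h = "\<lambda>x::real. ennreal (indicator {0..2} x * (x powr (- r)))"
  have "(\<integral>\<^sup>+x\<in>Iv. ennreal ((1 - x\<^sup>2) powr (- s)) \<partial>lborel) \<le> (\<integral>\<^sup>+x. ?h (1 + x) + ?h (1 - x) \<partial>lborel)"
  proof (intro nn_integral_mono)
    fix x :: real
    show "ennreal ((1 - x\<^sup>2) powr (- s)) * indicator Iv x \<le> ?h (1 + x) + ?h (1 - x)"
    proof (cases "x \<in> Iv")
      case True
      have p: "0 < 1 - x\<^sup>2" "1 - x\<^sup>2 \<le> 1" using Iv_weight_pos[OF True] by auto
      have "(1 - x\<^sup>2) powr (- s) \<le> (1 - x\<^sup>2) powr (- r)"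
        using p by (intro powr_mono') (auto simp: r_def)
      also have "(1 - x\<^sup>2) powr (- r) \<le> (1 + x) powr (- r) + (1 - x) powr (- r)"
      proof (cases "x \<ge> 0")
        case x0: True
        have "(1 - x) * 1 \<le> (1 - x) * (1 + x)" using True x0 by (intro mult_left_mono) auto
        then have "1 - x \<le> 1 - x\<^sup>2" by (simp add: power2_eq_square algebra_simps)
        then have "(1 - x\<^sup>2) powr (- r) \<le> (1 - x) powr (- r)"
          using r True by (intro powr_mono2') auto
        then show ?thesis by (simp add: add_increasing)
      next
        case x0: False
        have "(1 + x) * 1 \<le> (1 + x) * (1 - x)" using True x0 by (intro mult_left_mono) auto
        then have "1 + x \<le> 1 - x\<^sup>2" by (simp add: power2_eq_square algebra_simps)
        then have "(1 - x\<^sup>2) powr (- r) \<le> (1 + x) powr (- r)"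
          using r True by (intro powr_mono2') auto
        then show ?thesis by (simp add: add_increasing2)
      qed
      finally show ?thesis using True by (simp add: ennreal_plus[symmetric] ennreal_leI del: ennreal_plus)
    qed simp
  qed
  also have "\<dots> = (\<integral>\<^sup>+x. ?h (1 + x) \<partial>lborel) + (\<integral>\<^sup>+x. ?h (1 - x) \<partial>lborel)"
    by (rule nn_integral_add) auto
  also have "(\<integral>\<^sup>+x. ?h (1 + x) \<partial>lborel) = (\<integral>\<^sup>+x. ?h x \<partial>lborel)"
    by (subst nn_integral_real_affine[where c = 1 and t = 1 and f = ?h]) auto
  also have "(\<integral>\<^sup>+x. ?h (1 - x) \<partial>lborel) = (\<integral>\<^sup>+x. ?h x \<partial>lborel)"
    by (subst nn_integral_real_affine[where c = "-1" and t = 1 and f = ?h]) auto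
  finally show ?thesis using nn by (auto simp: less_top intro: le_less_trans)
qed

text \<open>Since 1 - R^2 >= (1 - x^2) sin^2 phi, the power of 1 - x^2 factors out and the integral
  of (sin phi)^(-2 s) remains. The substitution y = cos phi costs half a power of the weight, whence
  s < 1/2.\<close>

lemma circ_avg_weight:
  fixes s :: real
  assumes s: "0 \<le> s" "s < 1 / 2"
  obtains C where "0 < C" "\<And>x t. x \<in> Iv \<Longrightarrow>
    (\<integral>\<^sup>+\<phi>\<in>{0<..<pi}. ennreal ((1 - (rot_R x t \<phi>)\<^sup>2) powr (- s)) \<partial>lborel) \<le> ennreal (C * (1 - x\<^sup>2) powr (- s))"
proof -
  define I where "I = (\<integral>\<^sup>+\<phi>\<in>{0<..<pi}. ennreal ((1 - (1 * cos \<phi>)\<^sup>2) powr (- s)) \<partial>lborel)"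
  have "I = (\<integral>\<^sup>+y. ennreal ((1 - y\<^sup>2) powr (- s)) * ennreal (indicator {y. y\<^sup>2 < 1\<^sup>2} y / sqrt (1\<^sup>2 - y\<^sup>2)) \<partial>lborel)"
    unfolding I_def by (rule nn_integral_cos_substitution) auto
  also have "\<dots> = (\<integral>\<^sup>+y\<in>Iv. ennreal ((1 - y\<^sup>2) powr (- (s + 1 / 2))) \<partial>lborel)"
  proof (rule nn_integral_cong)
    fix y :: real
    show "ennreal ((1 - y\<^sup>2) powr (- s)) * ennreal (indicator {y. y\<^sup>2 < 1\<^sup>2} y / sqrt (1\<^sup>2 - y\<^sup>2))
      = ennreal ((1 - y\<^sup>2) powr (- (s + 1 / 2))) * indicator Iv y"
    proof (cases "y \<in> Iv")
      case True
      then have "0 < 1 - y\<^sup>2" by (rule Iv_weight_pos)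
      then have "(1 - y\<^sup>2) powr (- s) * (1 / sqrt (1 - y\<^sup>2)) = (1 - y\<^sup>2) powr (- (s + 1 / 2))"
      proof -
        have "1 / sqrt (1 - y\<^sup>2) = (1 - y\<^sup>2) powr (- (1 / 2))"
          using \<open>0 < 1 - y\<^sup>2\<close> by (simp add: powr_half_sqrt powr_minus_divide)
        then have "(1 - y\<^sup>2) powr (- s) * (1 / sqrt (1 - y\<^sup>2)) = (1 - y\<^sup>2) powr (- s + - (1 / 2))"
          by (simp only: powr_add)
        also have "- s + - (1 / 2) = - (s + 1 / 2)" by simp
        finally show ?thesis .
      qed
      then show ?thesis using True Iv_sq[OF True] by (simp add: ennreal_mult'[symmetric])
    next
      case False
      then have "\<not> y\<^sup>2 < 1" unfolding Iv_iff .
      then show ?thesis using False by simp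
    qed
  qed
  also have "\<dots> < \<infinity>" by (rule weight_integrable) (use s in simp)
  finally obtain c where c: "I = ennreal c" "0 \<le> c" by (cases I rule: ennreal_cases) auto
  have "(\<integral>\<^sup>+\<phi>\<in>{0<..<pi}. ennreal ((1 - (rot_R x t \<phi>)\<^sup>2) powr (- s)) \<partial>lborel) \<le> ennreal ((c + 1) * (1 - x\<^sup>2) powr (- s))"
    if x: "x \<in> Iv" for x t
  proof -
    have "(\<integral>\<^sup>+\<phi>\<in>{0<..<pi}. ennreal ((1 - (rot_R x t \<phi>)\<^sup>2) powr (- s)) \<partial>lborel)
      \<le> (\<integral>\<^sup>+\<phi>. ennreal ((1 - x\<^sup>2) powr (- s)) * (ennreal ((1 - (1 * cos \<phi>)\<^sup>2) powr (- s)) * indicator {0<..<pi} \<phi>) \<partial>lborel)"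
    proof (intro nn_integral_mono)
      fix \<phi> :: real
      show "ennreal ((1 - (rot_R x t \<phi>)\<^sup>2) powr (- s)) * indicator {0<..<pi} \<phi>
        \<le> ennreal ((1 - x\<^sup>2) powr (- s)) * (ennreal ((1 - (1 * cos \<phi>)\<^sup>2) powr (- s)) * indicator {0<..<pi} \<phi>)"
      proof (cases "\<phi> \<in> {0<..<pi}")
        case True
        have p: "0 < (1 - x\<^sup>2) * (sin \<phi>)\<^sup>2" using Iv_weight_pos[OF x] True sin_gt_zero[of \<phi>] by auto
        have "(1 - (rot_R x t \<phi>)\<^sup>2) powr (- s) \<le> ((1 - x\<^sup>2) * (sin \<phi>)\<^sup>2) powr (- s)"
          using p s Iv_sq[OF x] by (intro powr_mono2' rot_R_weight_ge) auto
        also have "\<dots> = (1 - x\<^sup>2) powr (- s) * (1 - (cos \<phi>)\<^sup>2) powr (- s)"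
          using Iv_sq[OF x] by (simp add: powr_mult sin_squared_eq)
        finally show ?thesis using True by (simp add: ennreal_mult'[symmetric] ennreal_leI)
      qed simp
    qed
    also have "\<dots> = ennreal ((1 - x\<^sup>2) powr (- s)) * I"
      unfolding I_def by (rule nn_integral_cmult) measurable
    also have "\<dots> \<le> ennreal ((c + 1) * (1 - x\<^sup>2) powr (- s))"
      unfolding c(1) using c(2) by (subst ennreal_mult'[symmetric]) (auto intro!: ennreal_leI simp: algebra_simps)
    finally show ?thesis .
  qed
  then show ?thesis using that[of "c + 1"] c by auto
qed

text \<open>
  The angle \<open>\<phi>\<close> of the translation is eliminated by \<open>rot_q = sin \<theta> e\<^sup>-\<^sup>i\<^sup>\<phi>\<close>. Without the
  factor \<open>cos\<^bsup>-2\<mu>\<^esup>(t/2)\<close> the operator is bounded uniformly in all real \<open>t\<close>.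
\<close>

definition spin_avg :: "nat \<Rightarrow> real \<Rightarrow> (real \<Rightarrow> real) \<Rightarrow> real \<Rightarrow> real" where
  "spin_avg m t f x =
    (\<integral>\<phi>. indicator {0<..<pi} \<phi> * (spin_ker m x t \<phi> * f (rot_R x t \<phi>)) \<partial>lborel) / (pi * sqrt (1 - x\<^sup>2) ^ m)"

lemma spin_avg_measurable [measurable (raw)]:
  assumes [measurable]: "f \<in> borel_measurable borel" "g \<in> borel_measurable M" "h \<in> borel_measurable M"
  shows "(\<lambda>w. spin_avg m (g w) f (h w)) \<in> borel_measurable M"
  unfolding spin_avg_def by measurable

definition admissible :: "ennreal \<Rightarrow> nat \<Rightarrow> real \<Rightarrow> bool" where
  "admissible p m a \<longleftrightarrow> 1 \<le> p
    \<and> (p = 1 \<longrightarrow> - 1 / 2 < a - real m / 2 \<and> a - real m / 2 \<le> 0)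
    \<and> (1 < p \<longrightarrow> p < \<infinity> \<longrightarrow> - 1 / (2 * enn2real p) < a - real m / 2
         \<and> a - real m / 2 < 1 / 2 - 1 / (2 * enn2real p))
    \<and> (p = \<infinity> \<longrightarrow> 0 \<le> a - real m / 2 \<and> a - real m / 2 < 1 / 2)"

text \<open>The reference space in which all operator identities are proved is itself admissible, so
  the general bound on the averages covers it.\<close>

lemma admissible_L1: "admissible 1 m (real m / 2)"
  by (simp add: admissible_def)

lemma sqrt_power_powr: "0 < w \<Longrightarrow> sqrt w ^ m = w powr (real m / 2)"
  by (simp add: powr_half_sqrt[symmetric] powr_power)

text \<open>With g = a - m/2, the integrand is at most M (1 - R^2)^(-g), and the circular average
  returns this power of the weight up to a constant.\<close>

lemma admissible_infinity_bound:
  assumes "admissible \<infinity> m a"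
  obtains C where "0 < C" "\<And>x t f M. x \<in> Iv \<Longrightarrow> 0 \<le> M \<Longrightarrow> f \<in> borel_measurable borel \<Longrightarrow>
     AE \<phi> in lborel. \<phi> \<in> {0<..<pi} \<longrightarrow> \<bar>f (rot_R x t \<phi>)\<bar> * (1 - (rot_R x t \<phi>)\<^sup>2) powr a \<le> M \<Longrightarrow>
     \<bar>spin_avg m t f x\<bar> * (1 - x\<^sup>2) powr a \<le> C * M"
proof -
  define g where "g = a - real m / 2"
  have g: "0 \<le> g" "g < 1 / 2" using assms by (auto simp: admissible_def g_def)
  obtain C where C: "0 < C" "\<And>x t. x \<in> Iv \<Longrightarrow>
    (\<integral>\<^sup>+\<phi>\<in>{0<..<pi}. ennreal ((1 - (rot_R x t \<phi>)\<^sup>2) powr (- g)) \<partial>lborel) \<le> ennreal (C * (1 - x\<^sup>2) powr (- g))"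
    using circ_avg_weight[OF g] by blast
  have "\<bar>spin_avg m t f x\<bar> * (1 - x\<^sup>2) powr a \<le> C * M"
    if x: "x \<in> Iv" and M: "0 \<le> M" and [measurable]: "f \<in> borel_measurable borel"
      and AEf: "AE \<phi> in lborel. \<phi> \<in> {0<..<pi} \<longrightarrow> \<bar>f (rot_R x t \<phi>)\<bar> * (1 - (rot_R x t \<phi>)\<^sup>2) powr a \<le> M" for x t f M
  proof -
    let ?\<Phi> = "\<lambda>\<phi>. indicator {0<..<pi} \<phi> * (spin_ker m x t \<phi> * f (rot_R x t \<phi>))"
    let ?w = "1 - x\<^sup>2"
    have w: "0 < ?w" using x by (rule Iv_weight_pos)
    have "ennreal \<bar>\<integral>\<phi>. ?\<Phi> \<phi> \<partial>lborel\<bar> \<le> (\<integral>\<^sup>+\<phi>. ennreal \<bar>?\<Phi> \<phi>\<bar> \<partial>lborel)"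
      using integral_norm_bound_ennreal[of lborel ?\<Phi>]
      by (cases "integrable lborel ?\<Phi>") (auto simp: not_integrable_integral_eq)
    also have "\<dots> \<le> (\<integral>\<^sup>+\<phi>. ennreal M * (ennreal ((1 - (rot_R x t \<phi>)\<^sup>2) powr (- g)) * indicator {0<..<pi} \<phi>) \<partial>lborel)"
    proof (rule nn_integral_mono_AE)
      show "AE \<phi> in lborel. ennreal \<bar>?\<Phi> \<phi>\<bar> \<le> ennreal M * (ennreal ((1 - (rot_R x t \<phi>)\<^sup>2) powr (- g)) * indicator {0<..<pi} \<phi>)"
        using AEf
      proof eventually_elim
        case (elim \<phi>)
        show ?case
        proof (cases "\<phi> \<in> {0<..<pi}")
          case True
          let ?v = "1 - (rot_R x t \<phi>)\<^sup>2"
          have v: "0 < ?v" using rot_R_Iv[OF x True] by (rule Iv_weight_pos)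
          have "\<bar>spin_ker m x t \<phi> * f (rot_R x t \<phi>)\<bar> \<le> ?v powr (real m / 2) * \<bar>f (rot_R x t \<phi>)\<bar>"
            using spin_ker_le[of x m t \<phi>] Iv_sq[OF x] v
            by (simp add: abs_mult sqrt_power_powr mult_right_mono)
          also have "?v powr (real m / 2) = ?v powr (- g) * ?v powr a"
            using v by (simp add: powr_add[symmetric] g_def)
          also have "?v powr (- g) * ?v powr a * \<bar>f (rot_R x t \<phi>)\<bar> \<le> ?v powr (- g) * M"
          proof -
            have "?v powr (- g) * (\<bar>f (rot_R x t \<phi>)\<bar> * ?v powr a) \<le> ?v powr (- g) * M"
              using elim True by (intro mult_left_mono) auto
            then show ?thesis by (simp add: mult_ac)
          qed
          finally show ?thesis using True M by (simp add: ennreal_mult'[symmetric] ennreal_leI mult.commute)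
        qed simp
      qed
    qed
    also have "\<dots> = ennreal M * (\<integral>\<^sup>+\<phi>\<in>{0<..<pi}. ennreal ((1 - (rot_R x t \<phi>)\<^sup>2) powr (- g)) \<partial>lborel)"
      by (rule nn_integral_cmult) measurable
    also have "\<dots> \<le> ennreal M * ennreal (C * ?w powr (- g))"
      by (intro mult_left_mono C x) auto
    also have "\<dots> = ennreal (M * (C * ?w powr (- g)))" using M by (simp add: ennreal_mult')
    finally have le: "\<bar>\<integral>\<phi>. ?\<Phi> \<phi> \<partial>lborel\<bar> \<le> M * (C * ?w powr (- g))"
      using M C by (subst (asm) ennreal_le_iff) auto
    have "\<bar>spin_avg m t f x\<bar> * ?w powr a = \<bar>\<integral>\<phi>. ?\<Phi> \<phi> \<partial>lborel\<bar> / pi * (?w powr a / ?w powr (real m / 2))"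
      using w by (simp add: spin_avg_def abs_mult sqrt_power_powr)
    also have "?w powr a / ?w powr (real m / 2) = ?w powr g" using w by (simp add: powr_diff g_def)
    also have "\<bar>\<integral>\<phi>. ?\<Phi> \<phi> \<partial>lborel\<bar> / pi * ?w powr g \<le> \<bar>\<integral>\<phi>. ?\<Phi> \<phi> \<partial>lborel\<bar> * ?w powr g"
      using pi_ge_two by (intro mult_right_mono) (auto simp: divide_le_eq mult_le_cancel_left1)
    also have "\<dots> \<le> M * (C * ?w powr (- g)) * ?w powr g" by (intro mult_right_mono le) auto
    also have "\<dots> = C * M" using w by (simp add: powr_minus)
    finally show ?thesis .
  qed
  then show ?thesis using that C by blast
qed

text \<open>Exponents for Schur's test: c is the one used in Jensen's inequality, b the one left
  over for the dual side, and the relation between them makes the powers of 1 - x^2 match. For a -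
  m/2 >= 0 everything is put into c, otherwise into b.\<close>

lemma admissible_split:
  assumes "admissible p m a" "p = ennreal r" "1 \<le> r"
  obtains c b where "0 \<le> c" "c < 1 / 2" "0 \<le> b" "b < 1 / 2" "b = c * (r - 1) - (a - real m / 2) * r"
proof -
  define g where "g = a - real m / 2"
  have fin: "p < \<infinity>" "enn2real p = r" using assms by auto
  show ?thesis
  proof (cases "r = 1")
    case True
    then have "- 1 / 2 < g" "g \<le> 0" using assms by (auto simp: admissible_def g_def)
    then show ?thesis using that[of 0 "- g * r"] True by (simp add: g_def)
  next
    case False
    then have r: "1 < r" using assms by simp
    then have "1 < p" using assms by (metis ennreal_1 ennreal_less_iff zero_le_one)
    then have g: "- 1 / (2 * r) < g" "g < 1 / 2 - 1 / (2 * r)"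
      using assms(1) fin by (auto simp: admissible_def g_def)
    have g1: "- 1 / 2 < g * r" "g * r < (r - 1) / 2"
      using g r by (simp_all add: field_simps)
    show ?thesis
    proof (cases "g \<ge> 0")
      case True
      have "g * r / (r - 1) < 1 / 2" using g1 r by (simp add: field_simps)
      then show ?thesis using that[of "g * r / (r - 1)" 0] r True by (simp add: g_def)
    next
      case False
      then have "0 \<le> - g * r" using r by (simp add: mult_nonpos_nonneg)
      moreover have "- g * r < 1 / 2" using g1 by simp
      moreover have "- g * r = 0 * (r - 1) - (a - real m / 2) * r" by (simp add: g_def algebra_simps)
      ultimately show ?thesis using that[of 0 "- g * r"] by simp
    qed
  qed
qed

text \<open>Schur's test. Jensen with the density (1 - R^2)^(-c) bounds the r-th power by a circular
  average of \<open>F\<close>; symmetry moves that average onto \<open>H\<close>, a power that it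
  reproduces up to a constant. Uniformity in t is inherited from the weight estimate.\<close>

lemma spin_avg_bound:
  assumes adm: "admissible p m a"
  obtains C where "0 < C" "\<And>t f M. f \<in> borel_measurable borel \<Longrightarrow> 0 \<le> M \<Longrightarrow>
     norm_le p a f M \<Longrightarrow> norm_le p a (spin_avg m t f) (C * M)"
proof -
  have p1: "1 \<le> p" using adm by (simp add: admissible_def)
  show ?thesis
  proof (cases rule: exponent_cases[OF p1])
    case 1
    obtain C where C: "0 < C" "\<And>x t f M. x \<in> Iv \<Longrightarrow> 0 \<le> M \<Longrightarrow> f \<in> borel_measurable borel \<Longrightarrow>
      AE \<phi> in lborel. \<phi> \<in> {0<..<pi} \<longrightarrow> \<bar>f (rot_R x t \<phi>)\<bar> * (1 - (rot_R x t \<phi>)\<^sup>2) powr a \<le> M \<Longrightarrow>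
      \<bar>spin_avg m t f x\<bar> * (1 - x\<^sup>2) powr a \<le> C * M"
      using admissible_infinity_bound adm unfolding 1 by blast
    have "norm_le p a (spin_avg m t f) (C * M)"
      if [measurable]: "f \<in> borel_measurable borel" and M: "0 \<le> M" and f: "norm_le p a f M" for t f M
    proof -
      have "AE x in lborel. x \<in> Iv \<longrightarrow> \<bar>f x\<bar> * (1 - x\<^sup>2) powr a \<le> M"
        using f by (simp add: norm_le_def 1)
      from AE_rot_R[OF this, of t]
      have "AE x in lborel. x \<in> Iv \<longrightarrow> \<bar>spin_avg m t f x\<bar> * (1 - x\<^sup>2) powr a \<le> C * M"
        by eventually_elim (use C(2) M in \<open>auto simp: that(1)\<close>)
      then show ?thesis by (simp add: norm_le_def 1)
    qed
    then show ?thesis using that C by blast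
  next
    case (2 r)
    define g where "g = a - real m / 2"
    obtain c b where cb: "0 \<le> c" "c < 1 / 2" "0 \<le> b" "b < 1 / 2" "b = c * (r - 1) - g * r"
      using admissible_split[OF adm] 2 unfolding g_def by blast
    obtain A where A: "0 < A" "\<And>x t. x \<in> Iv \<Longrightarrow>
      (\<integral>\<^sup>+\<phi>\<in>{0<..<pi}. ennreal ((1 - (rot_R x t \<phi>)\<^sup>2) powr (- c)) \<partial>lborel) \<le> ennreal (A * (1 - x\<^sup>2) powr (- c))"
      using circ_avg_weight[OF cb(1,2)] by blast
    obtain B where B: "0 < B" "\<And>x t. x \<in> Iv \<Longrightarrow>
      (\<integral>\<^sup>+\<phi>\<in>{0<..<pi}. ennreal ((1 - (rot_R x t \<phi>)\<^sup>2) powr (- b)) \<partial>lborel) \<le> ennreal (B * (1 - x\<^sup>2) powr (- b))"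
      using circ_avg_weight[OF cb(3,4)] by blast
    define K where "K = A powr (r - 1) * B"
    have K: "0 < K" using A B by (simp add: K_def)
    have "norm_le p a (spin_avg m t f) (K powr (1 / r) * M)"
      if [measurable]: "f \<in> borel_measurable borel" and M: "0 \<le> M" and f: "norm_le p a f M" for t f M
    proof -
      let ?\<Phi> = "\<lambda>x \<phi>. indicator {0<..<pi} \<phi> * (spin_ker m x t \<phi> * f (rot_R x t \<phi>))"
      \<comment> \<open>\<open>F\<close> absorbs the factor h^(1-r) of the power mean inequality;
        \<open>H\<close> is what the outer weight and the mass bound leave behind.\<close>
      define F where "F y = ennreal ((\<bar>f y\<bar> * (1 - y\<^sup>2) powr (real m / 2)) powr r * (1 - y\<^sup>2) powr (c * (r - 1)))" for y
      define H where "H y = ennreal ((1 - y\<^sup>2) powr (- b))" for y :: real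
      have [measurable]: "F \<in> borel_measurable borel" "H \<in> borel_measurable borel"
        unfolding F_def H_def by measurable
      have pt: "ennreal ((\<bar>spin_avg m t f x\<bar> * (1 - x\<^sup>2) powr a) powr r)
          \<le> ennreal (A powr (r - 1)) * (circ_avg t F x * H x)" if x: "x \<in> Iv" for x
      proof -
        let ?w = "1 - x\<^sup>2"
        have w: "0 < ?w" using x by (rule Iv_weight_pos)
        let ?h = "\<lambda>\<phi>. indicator {0<..<pi} \<phi> * (1 - (rot_R x t \<phi>)\<^sup>2) powr (- c)"
        have "ennreal (\<bar>\<integral>\<phi>. ?\<Phi> x \<phi> \<partial>lborel\<bar> powr r)
          \<le> ennreal ((A * ?w powr (- c)) powr (r - 1)) * (\<integral>\<^sup>+\<phi>. ennreal (\<bar>?\<Phi> x \<phi>\<bar> powr r * ?h \<phi> powr (1 - r)) \<partial>lborel)"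
        proof (rule power_mean_integral)
          show "?\<Phi> x \<phi> = 0" if "?h \<phi> = 0" for \<phi>
          proof (cases "\<phi> \<in> {0<..<pi}")
            case True
            then have "1 - (rot_R x t \<phi>)\<^sup>2 > 0" using Iv_weight_pos rot_R_Iv[OF x True] by blast
            then show ?thesis using that True by (simp add: powr_eq_0_iff)
          qed simp
          have "(\<integral>\<^sup>+\<phi>. ennreal (?h \<phi>) \<partial>lborel) = (\<integral>\<^sup>+\<phi>\<in>{0<..<pi}. ennreal ((1 - (rot_R x t \<phi>)\<^sup>2) powr (- c)) \<partial>lborel)"
            by (intro nn_integral_cong) (simp add: indicator_def)
          then show "(\<integral>\<^sup>+\<phi>. ennreal (?h \<phi>) \<partial>lborel) \<le> ennreal (A * ?w powr (- c))"
            using A(2)[OF x] by simp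
        qed (use 2 A w in auto)
        also have "\<dots> \<le> ennreal ((A * ?w powr (- c)) powr (r - 1)) * circ_avg t F x"
          unfolding circ_avg_def
        proof (intro mult_left_mono nn_integral_mono)
          fix \<phi> :: real
          show "ennreal (\<bar>?\<Phi> x \<phi>\<bar> powr r * ?h \<phi> powr (1 - r)) \<le> F (rot_R x t \<phi>) * indicator {0<..<pi} \<phi>"
          proof (cases "\<phi> \<in> {0<..<pi}")
            case True
            let ?v = "1 - (rot_R x t \<phi>)\<^sup>2"
            have v: "0 < ?v" using rot_R_Iv[OF x True] by (rule Iv_weight_pos)
            have "\<bar>?\<Phi> x \<phi>\<bar> \<le> \<bar>f (rot_R x t \<phi>)\<bar> * ?v powr (real m / 2)"
              using spin_ker_le[of x m t \<phi>] Iv_sq[OF x] v True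
              by (simp add: abs_mult sqrt_power_powr mult.commute[of "\<bar>spin_ker m x t \<phi>\<bar>"] mult_left_mono)
            then have "\<bar>?\<Phi> x \<phi>\<bar> powr r \<le> (\<bar>f (rot_R x t \<phi>)\<bar> * ?v powr (real m / 2)) powr r"
              using 2 by (intro powr_mono2) auto
            moreover have "?h \<phi> powr (1 - r) = ?v powr (c * (r - 1))"
              using True by (simp add: powr_powr algebra_simps)
            ultimately show ?thesis using True
              by (simp add: F_def ennreal_leI mult_right_mono)
          qed simp
        qed simp
        finally have 1: "ennreal (\<bar>\<integral>\<phi>. ?\<Phi> x \<phi> \<partial>lborel\<bar> powr r)
          \<le> ennreal ((A * ?w powr (- c)) powr (r - 1)) * circ_avg t F x" .
        have "\<bar>spin_avg m t f x\<bar> * ?w powr a = \<bar>\<integral>\<phi>. ?\<Phi> x \<phi> \<partial>lborel\<bar> / pi * (?w powr a / ?w powr (real m / 2))"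
          using w by (simp add: spin_avg_def abs_mult sqrt_power_powr)
        also have "?w powr a / ?w powr (real m / 2) = ?w powr g" using w by (simp add: powr_diff g_def)
        also have "\<bar>\<integral>\<phi>. ?\<Phi> x \<phi> \<partial>lborel\<bar> / pi * ?w powr g \<le> \<bar>\<integral>\<phi>. ?\<Phi> x \<phi> \<partial>lborel\<bar> * ?w powr g"
          using pi_ge_two by (intro mult_right_mono) (auto simp: divide_le_eq mult_le_cancel_left1)
        finally have "(\<bar>spin_avg m t f x\<bar> * ?w powr a) powr r \<le> (\<bar>\<integral>\<phi>. ?\<Phi> x \<phi> \<partial>lborel\<bar> * ?w powr g) powr r"
          using 2 by (intro powr_mono2) auto
        also have "\<dots> = \<bar>\<integral>\<phi>. ?\<Phi> x \<phi> \<partial>lborel\<bar> powr r * ?w powr (g * r)"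
          by (simp add: powr_mult powr_powr)
        finally have "ennreal ((\<bar>spin_avg m t f x\<bar> * ?w powr a) powr r)
          \<le> ennreal (\<bar>\<integral>\<phi>. ?\<Phi> x \<phi> \<partial>lborel\<bar> powr r) * ennreal (?w powr (g * r))"
          by (simp add: ennreal_mult'[symmetric] ennreal_leI)
        also have "\<dots> \<le> ennreal ((A * ?w powr (- c)) powr (r - 1)) * circ_avg t F x * ennreal (?w powr (g * r))"
          by (intro mult_right_mono 1) auto
        also have "\<dots> = (ennreal ((A * ?w powr (- c)) powr (r - 1)) * ennreal (?w powr (g * r))) * circ_avg t F x"
          by (simp add: mult_ac)
        also have "ennreal ((A * ?w powr (- c)) powr (r - 1)) * ennreal (?w powr (g * r)) = ennreal (A powr (r - 1)) * H x"
        proof -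
          have "(A * ?w powr (- c)) powr (r - 1) * ?w powr (g * r) = A powr (r - 1) * (?w powr (- c * (r - 1)) * ?w powr (g * r))"
            using A by (simp add: powr_mult powr_powr mult.assoc)
          also have "?w powr (- c * (r - 1)) * ?w powr (g * r) = ?w powr (- b)"
            unfolding cb(5) by (simp add: powr_add[symmetric])
          finally show ?thesis by (simp add: H_def ennreal_mult'[symmetric])
        qed
        finally show ?thesis by (simp add: mult_ac)
      qed
      have "(\<integral>\<^sup>+ x\<in>Iv. ennreal ((\<bar>spin_avg m t f x\<bar> * (1 - x\<^sup>2) powr a) powr r) \<partial>lborel)
        \<le> (\<integral>\<^sup>+ x. ennreal (A powr (r - 1)) * (circ_avg t F x * H x * indicator Iv x) \<partial>lborel)"
        by (intro nn_integral_mono) (use pt in \<open>auto simp: indicator_def\<close>)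
      also have "\<dots> = ennreal (A powr (r - 1)) * (\<integral>\<^sup>+ x\<in>Iv. circ_avg t F x * H x \<partial>lborel)"
        by (rule nn_integral_cmult) measurable
      also have "(\<integral>\<^sup>+ x\<in>Iv. circ_avg t F x * H x \<partial>lborel) = (\<integral>\<^sup>+ x\<in>Iv. F x * circ_avg t H x \<partial>lborel)"
        by (rule circ_avg_symmetric) measurable
      also have "\<dots> \<le> (\<integral>\<^sup>+ x. ennreal B * (ennreal ((\<bar>f x\<bar> * (1 - x\<^sup>2) powr a) powr r) * indicator Iv x) \<partial>lborel)"
      proof (intro nn_integral_mono)
        fix x :: real
        show "F x * circ_avg t H x * indicator Iv x
          \<le> ennreal B * (ennreal ((\<bar>f x\<bar> * (1 - x\<^sup>2) powr a) powr r) * indicator Iv x)"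
        proof (cases "x \<in> Iv")
          case True
          let ?w = "1 - x\<^sup>2"
          have w: "0 < ?w" using True by (rule Iv_weight_pos)
          have "F x * circ_avg t H x \<le> F x * ennreal (B * ?w powr (- b))"
            unfolding circ_avg_def H_def by (intro mult_left_mono B(2) True) auto
          also have "\<dots> = ennreal (B * (\<bar>f x\<bar> powr r * (?w powr (real m / 2 * r) * ?w powr (c * (r - 1)) * ?w powr (- b))))"
            using B by (simp add: F_def ennreal_mult'[symmetric] powr_mult powr_powr mult_ac)
          also have "?w powr (real m / 2 * r) * ?w powr (c * (r - 1)) * ?w powr (- b) = ?w powr (real m / 2 * r + c * (r - 1) + - b)"
            by (simp only: powr_add)
          also have "real m / 2 * r + c * (r - 1) + - b = a * r"
            unfolding cb(5) by (simp add: g_def algebra_simps)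
          also have "\<bar>f x\<bar> powr r * ?w powr (a * r) = (\<bar>f x\<bar> * ?w powr a) powr r"
            by (simp add: powr_mult powr_powr)
          finally show ?thesis using True B by (simp add: ennreal_mult'[symmetric])
        qed simp
      qed
      also have "\<dots> = ennreal B * (\<integral>\<^sup>+ x\<in>Iv. ennreal ((\<bar>f x\<bar> * (1 - x\<^sup>2) powr a) powr r) \<partial>lborel)"
        by (rule nn_integral_cmult) measurable
      also have "\<dots> \<le> ennreal B * ennreal (M powr r)"
        by (intro mult_left_mono) (use f 2 in \<open>auto simp: norm_le_def\<close>)
      also have "ennreal (A powr (r - 1)) * (ennreal B * ennreal (M powr r)) = ennreal (K * M powr r)"
        using B by (simp add: K_def ennreal_mult'[symmetric] mult.assoc)
      also have "K * M powr r = (K powr (1 / r) * M) powr r"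
        using K M 2 by (simp add: powr_mult powr_powr)
      finally show ?thesis using 2 by (simp add: norm_le_def mult_left_mono)
    qed
    then show ?thesis using that[of "K powr (1 / r)"] K by auto
  qed
qed

section \<open>The Jacobi operator and the averages of polynomials\<close>

definition jacobi_op :: "nat \<Rightarrow> real poly \<Rightarrow> real poly" where
  "jacobi_op m P = [:1, 0, -1:] * pderiv (pderiv P) - smult (2 * (real m + 1)) ([:0, 1:] * pderiv P)"

lemma poly_jacobi_op:
  "poly (jacobi_op m P) y = (1 - y\<^sup>2) * poly (pderiv (pderiv P)) y - 2 * (real m + 1) * y * poly (pderiv P) y"
  by (simp add: jacobi_op_def power2_eq_square algebra_simps)

lemma pderiv_map_poly_of_real: "pderiv (map_poly complex_of_real P) = map_poly complex_of_real (pderiv P)"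
  by (simp add: poly_eq_iff coeff_pderiv coeff_map_poly)

lemma poly_map_poly_of_real: "poly (map_poly complex_of_real P) (of_real x) = of_real (poly P x)"
  by (induction P) (auto simp: map_poly_pCons)

text \<open>The average without its normalisation, as a gauge integral over a closed interval: this
  is the form to which differentiation under the integral sign applies.\<close>

definition spin_int :: "nat \<Rightarrow> real \<Rightarrow> real poly \<Rightarrow> real \<Rightarrow> real" where
  "spin_int m x P t = integral {0..pi} (\<lambda>\<phi>. spin_ker m x t \<phi> * poly P (rot_R x t \<phi>))"

lemma continuous_spin_ker [continuous_intros]:
  fixes f g :: "'a::t2_space \<Rightarrow> real"
  assumes "continuous_on S f" "continuous_on S g"
  shows "continuous_on S (\<lambda>w. spin_ker m x (f w) (g w))"
  unfolding spin_ker_def rot_q_def Complex_eq by (intro continuous_intros assms)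

lemma continuous_rot_R [continuous_intros]:
  fixes f g :: "'a::t2_space \<Rightarrow> real"
  assumes "continuous_on S f" "continuous_on S g"
  shows "continuous_on S (\<lambda>w. rot_R x (f w) (g w))"
  unfolding rot_R_def by (intro continuous_intros assms)

lemma spin_int_integrand_integrable [intro]:
  "(\<lambda>\<phi>. spin_ker m x t \<phi> * poly P (rot_R x t \<phi>)) integrable_on {0..pi}"
  by (intro integrable_continuous_interval continuous_intros)

lemma spin_int_smult: "spin_int m x (smult c P) t = c * spin_int m x P t"
  unfolding spin_int_def by (subst integral_mult_right[symmetric]) (simp add: mult_ac)

lemma borel_measurable_poly [measurable (raw)]:
  fixes P :: "real poly"
  assumes "f \<in> borel_measurable M"
  shows "(\<lambda>w. poly P (f w)) \<in> borel_measurable M"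
  by (rule measurable_compose[OF assms borel_measurable_continuous_onI]) (intro continuous_intros)

lemma spin_avg_poly: "spin_avg m t (poly P) x = spin_int m x P t / (pi * sqrt (1 - x\<^sup>2) ^ m)"
proof -
  let ?g = "\<lambda>\<phi>. spin_ker m x t \<phi> * poly P (rot_R x t \<phi>)"
  have "(\<integral>\<phi>. indicator {0<..<pi} \<phi> * ?g \<phi> \<partial>lborel) = (\<integral>\<phi>. indicator {0..pi} \<phi> *\<^sub>R ?g \<phi> \<partial>lborel)"
  proof (rule integral_cong_AE)
    have "AE \<phi> in lborel. \<phi> \<noteq> 0 \<and> \<phi> \<noteq> pi"
      using AE_lborel_singleton[of 0] AE_lborel_singleton[of pi] by eventually_elim auto
    then show "AE \<phi> in lborel. indicator {0<..<pi} \<phi> * ?g \<phi> = indicator {0..pi} \<phi> *\<^sub>R ?g \<phi>"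
      by eventually_elim (auto simp: indicator_def)
  qed measurable
  also have "\<dots> = (LINT \<phi>:{0..pi}|lborel. ?g \<phi>)" by (simp add: set_lebesgue_integral_def)
  also have "\<dots> = integral {0..pi} ?g"
    by (intro set_borel_integral_eq_integral(2) borel_integrable_atLeastAtMost' continuous_intros)
  finally show ?thesis by (simp add: spin_avg_def spin_int_def)
qed

subsection \<open>The differential equation in the translation parameter\<close>

text \<open>
  Below \<open>a\<^sub>0, a\<^sub>1, a\<^sub>2\<close> stand for \<open>q\<^sup>m\<close>, its derivative and its second derivative with respect to
  \<open>q = u - i v\<close>, and \<open>p\<^sub>0, p\<^sub>1, p\<^sub>2\<close> for the values of a polynomial and its derivatives at \<open>R\<close>. The
  identity says that, up to an exact derivative in \<open>\<phi>\<close>, the spherical Laplacian acts on the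
  integrand as a second-order operator in \<open>t\<close>.
\<close>

lemma spin_laplace_identity:
  fixes a0 a1 a2 p0 p1 p2 R u v c S k \<sigma> m :: complex
  assumes q: "a1 * (u - \<i> * v) = m * a0" "a2 * (u - \<i> * v) = (m - 1) * a1"
    and S: "\<sigma> * S = 1" "k * (1 + c) = 1" "S\<^sup>2 + c\<^sup>2 = 1" and R: "R\<^sup>2 + u\<^sup>2 + v\<^sup>2 = 1"
  defines "dq \<equiv> - v * c - \<i> * (u * c - R * S)" and "dv \<equiv> u * c - R * S" and "dR \<equiv> v * S"
  shows "(a2 * R\<^sup>2 * p0 - a1 * u * p0 - 2 * a1 * R * u * p1 - a0 * R * p1 + a0 * u\<^sup>2 * p2)
    + c * \<sigma> * (a1 * R * p0 - a0 * u * p1) - 2 * m\<^sup>2 * k * (a0 * p0)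
    + (\<i> * m * (- \<i> * m * a0 * p0 * k + (\<i> * a1 * R * p0 + a0 * v * p1) * \<sigma>)
       + (- \<i> * m * (a1 * dq * p0 + a0 * p1 * dR) * k
          + (\<i> * (a2 * dq * R * p0 + a1 * dR * p0 + a1 * R * p1 * dR)
             + (a1 * dq * v * p1 + a0 * dv * p1 + a0 * v * p2 * dR)) * \<sigma>))
    = a0 * ((1 - R\<^sup>2) * p2 - 2 * (m + 1) * R * p1 - m * (m + 1) * p0)"
proof -
  have ii: "\<i> * \<i> = -1" by simp
  have S1: "S * \<sigma> = 1" using S(1) by (simp add: mult.commute)
  \<comment> \<open>Here S and c play the sine and cosine of t, while \<open>\<sigma>\<close> and
    \<open>k\<close> are the reciprocals of S and 1 + c. This is (1 - cos t) / sin t = sin t / (1 +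
    cos t).\<close>
  have sk: "\<sigma> * (1 - c) = S * k"
  proof -
    have "\<sigma> * (1 - c) = \<sigma> * (1 - c) * (k * (1 + c))" by (simp add: S)
    also have "\<dots> = \<sigma> * k * (1 - c\<^sup>2)" by (simp add: power2_eq_square algebra_simps)
    also have "1 - c\<^sup>2 = S\<^sup>2" using S(3) by (simp add: algebra_simps)
    also have "\<sigma> * k * S\<^sup>2 = (\<sigma> * S) * (S * k)" by (simp add: power2_eq_square)
    finally show ?thesis by (simp add: S)
  qed
  have dq: "a1 * dq = - \<i> * c * (m * a0) + \<i> * R * S * a1" "a2 * dq = - \<i> * c * ((m - 1) * a1) + \<i> * R * S * a2"
    unfolding q[symmetric] dq_def using ii by (simp_all add: algebra_simps)
  have uv: "a1 * u = m * a0 + \<i> * (a1 * v)" using q(1) by (simp add: algebra_simps)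
  \<comment> \<open>The identity is linear in \<open>p0\<close>, \<open>p1\<close>,
    \<open>p2\<close> and splits into one identity for each of their coefficients.\<close>
  have c2: "a0 * u\<^sup>2 + a0 * v * dR * \<sigma> = a0 * (1 - R\<^sup>2)"
  proof -
    have "a0 * u\<^sup>2 + a0 * v * dR * \<sigma> = a0 * u\<^sup>2 + a0 * v\<^sup>2 * (\<sigma> * S)" by (simp add: dR_def power2_eq_square)
    also have "\<dots> = a0 * (u\<^sup>2 + v\<^sup>2)" unfolding S(1) by (simp add: algebra_simps)
    also have "u\<^sup>2 + v\<^sup>2 = 1 - R\<^sup>2" using R by (simp add: algebra_simps)
    finally show ?thesis .
  qed
  have c1: "- 2 * a1 * R * u - a0 * R - c * \<sigma> * a0 * u + \<i> * m * a0 * v * \<sigma> - \<i> * m * a0 * dR * k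
     + (\<i> * a1 * R * dR + a1 * dq * v + a0 * dv) * \<sigma> = - 2 * (m + 1) * R * a0"
  proof -
    have "(\<i> * a1 * R * dR + a1 * dq * v + a0 * dv) * \<sigma>
      = 2 * \<i> * R * v * a1 * (\<sigma> * S) - \<i> * c * m * a0 * v * \<sigma> + a0 * u * c * \<sigma> - a0 * R * (\<sigma> * S)"
      unfolding dq dv_def dR_def by (simp add: algebra_simps)
    then have "- 2 * a1 * R * u - a0 * R - c * \<sigma> * a0 * u + \<i> * m * a0 * v * \<sigma> - \<i> * m * a0 * dR * k
       + (\<i> * a1 * R * dR + a1 * dq * v + a0 * dv) * \<sigma>
      = - 2 * R * (a1 * u) + 2 * \<i> * R * v * a1 - 2 * a0 * R + \<i> * m * a0 * v * (\<sigma> * (1 - c) - S * k)"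
      unfolding dR_def by (simp add: S S1 algebra_simps)
    also have "\<dots> = - 2 * (m + 1) * R * a0" unfolding uv sk by (simp add: algebra_simps)
    finally show ?thesis .
  qed
  have c0: "a2 * R\<^sup>2 - a1 * u + c * \<sigma> * a1 * R - 2 * m\<^sup>2 * k * a0 + \<i> * m * (- \<i> * m * a0 * k + \<i> * a1 * R * \<sigma>)
     - \<i> * m * (a1 * dq) * k + \<i> * (a2 * dq * R + a1 * dR) * \<sigma> = - m * (m + 1) * a0"
  proof -
    have e1: "\<i> * (a2 * dq * R + a1 * dR) * \<sigma> = c * (m - 1) * a1 * R * \<sigma> - R\<^sup>2 * a2 * (\<sigma> * S) + \<i> * a1 * v * (\<sigma> * S)"
      unfolding dq dR_def using ii by (simp add: algebra_simps power2_eq_square)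
    have e2: "\<i> * m * (a1 * dq) * k = c * m\<^sup>2 * a0 * k - m * R * (S * k) * a1"
      unfolding dq using ii by (simp add: algebra_simps power2_eq_square)
    have e3: "\<i> * m * (- \<i> * m * a0 * k + \<i> * a1 * R * \<sigma>) = m\<^sup>2 * a0 * k - m * a1 * R * \<sigma>"
      by (simp add: algebra_simps power2_eq_square)
    have "a2 * R\<^sup>2 - a1 * u + c * \<sigma> * a1 * R - 2 * m\<^sup>2 * k * a0 + \<i> * m * (- \<i> * m * a0 * k + \<i> * a1 * R * \<sigma>)
     - \<i> * m * (a1 * dq) * k + \<i> * (a2 * dq * R + a1 * dR) * \<sigma>
     = - (a1 * u) + \<i> * a1 * v - m * a1 * R * (\<sigma> * (1 - c)) + m * R * (S * k) * a1 - m\<^sup>2 * a0 * (k * (1 + c))"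
      unfolding e1 e2 e3 S(1) by (simp add: algebra_simps)
    also have "\<dots> = - m * (m + 1) * a0" unfolding sk uv S(2) by (simp add: algebra_simps power2_eq_square)
    finally show ?thesis .
  qed
  have "?thesis \<longleftrightarrow> (a2 * R\<^sup>2 - a1 * u + c * \<sigma> * a1 * R - 2 * m\<^sup>2 * k * a0 + \<i> * m * (- \<i> * m * a0 * k + \<i> * a1 * R * \<sigma>)
     - \<i> * m * (a1 * dq) * k + \<i> * (a2 * dq * R + a1 * dR) * \<sigma>) * p0
     + (- 2 * a1 * R * u - a0 * R - c * \<sigma> * a0 * u + \<i> * m * a0 * v * \<sigma> - \<i> * m * a0 * dR * k
     + (\<i> * a1 * R * dR + a1 * dq * v + a0 * dv) * \<sigma>) * p1
     + (a0 * u\<^sup>2 + a0 * v * dR * \<sigma>) * p2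
     = - m * (m + 1) * a0 * p0 + (- 2 * (m + 1) * R * a0) * p1 + a0 * (1 - R\<^sup>2) * p2"
    by (simp add: algebra_simps)
  then show ?thesis unfolding c0 c1 c2 by simp
qed

context
  fixes m :: nat and x :: real and P :: "real poly"
  assumes x: "x \<in> Iv"
begin

text \<open>All quantities are continued to complex t and phi, so that q^m and the exponential obey
  the algebraic rules of differentiation. The real integrals are recovered as real parts on the real
  axis.\<close>

private definition "X = complex_of_real x"
private definition "sx = complex_of_real (sqrt (1 - x\<^sup>2))"
private definition "Rc t \<phi> = X * cos t - sx * sin t * cos \<phi>" for t \<phi> :: complex
private definition "uc t \<phi> = X * sin t + sx * cos t * cos \<phi>" for t \<phi> :: complex
private definition "vc \<phi> = sx * sin \<phi>" for \<phi> :: complex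
private definition "qc t \<phi> = uc t \<phi> - \<i> * vc \<phi>"
private definition "p0 t \<phi> = poly (map_poly complex_of_real P) (Rc t \<phi>)"
private definition "p1 t \<phi> = poly (map_poly complex_of_real (pderiv P)) (Rc t \<phi>)"
private definition "p2 t \<phi> = poly (map_poly complex_of_real (pderiv (pderiv P))) (Rc t \<phi>)"
private definition "a0 t \<phi> = qc t \<phi> ^ m"
text \<open>For m < 2 the truncated exponents here and in \<open>a2\<close> are harmless, because
  the integer factors in front vanish.\<close>

private definition "a1 t \<phi> = of_nat m * qc t \<phi> ^ (m - 1)"
private definition "a2 t \<phi> = of_nat m * (of_nat (m - 1) * qc t \<phi> ^ (m - 2))"
private definition "ph \<phi> = exp (\<i> * of_nat m * \<phi>)" for \<phi> :: complex
private definition "E0 t \<phi> = ph \<phi> * (a0 t \<phi> * p0 t \<phi>)"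
private definition "E1 t \<phi> = ph \<phi> * (a1 t \<phi> * Rc t \<phi> * p0 t \<phi> - a0 t \<phi> * uc t \<phi> * p1 t \<phi>)"
private definition "E2 t \<phi> = ph \<phi> * (a2 t \<phi> * (Rc t \<phi>)\<^sup>2 * p0 t \<phi> - a1 t \<phi> * uc t \<phi> * p0 t \<phi>
   - 2 * a1 t \<phi> * Rc t \<phi> * uc t \<phi> * p1 t \<phi> - a0 t \<phi> * Rc t \<phi> * p1 t \<phi> + a0 t \<phi> * (uc t \<phi>)\<^sup>2 * p2 t \<phi>)"
text \<open>The primitive in phi of the exact derivative in the pointwise identity; only its
  boundary values will matter.\<close>

private definition "W k \<sigma> t \<phi> = ph \<phi> * (- \<i> * of_nat m * a0 t \<phi> * p0 t \<phi> * k
   + (\<i> * a1 t \<phi> * Rc t \<phi> * p0 t \<phi> + a0 t \<phi> * vc \<phi> * p1 t \<phi>) * \<sigma>)"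

private lemma dt:
  "((\<lambda>t. Rc t \<phi>) has_field_derivative - uc t \<phi>) (at t)"
  "((\<lambda>t. uc t \<phi>) has_field_derivative Rc t \<phi>) (at t)"
  "((\<lambda>t. qc t \<phi>) has_field_derivative Rc t \<phi>) (at t)"
  unfolding Rc_def uc_def qc_def
  by (auto intro!: derivative_eq_intros simp: algebra_simps)

private lemma dt':
  "((\<lambda>t. p0 t \<phi>) has_field_derivative - uc t \<phi> * p1 t \<phi>) (at t)"
  "((\<lambda>t. p1 t \<phi>) has_field_derivative - uc t \<phi> * p2 t \<phi>) (at t)"
  "((\<lambda>t. a0 t \<phi>) has_field_derivative Rc t \<phi> * a1 t \<phi>) (at t)"
  "((\<lambda>t. a1 t \<phi>) has_field_derivative Rc t \<phi> * a2 t \<phi>) (at t)"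
  unfolding p0_def p1_def p2_def a0_def a1_def a2_def
  by (auto intro!: derivative_eq_intros dt DERIV_chain2[OF poly_DERIV dt(1)]
       simp: pderiv_map_poly_of_real mult_ac numeral_2_eq_2)

private lemma dE: "((\<lambda>t. E0 t \<phi>) has_field_derivative E1 t \<phi>) (at t)"
   "((\<lambda>t. E1 t \<phi>) has_field_derivative E2 t \<phi>) (at t)"
proof -
  show "((\<lambda>t. E0 t \<phi>) has_field_derivative E1 t \<phi>) (at t)"
    unfolding E0_def by (rule derivative_eq_intros dt dt' refl)+ (simp only: E1_def, simp add: algebra_simps)
  show "((\<lambda>t. E1 t \<phi>) has_field_derivative E2 t \<phi>) (at t)"
    unfolding E1_def
    by (rule derivative_eq_intros dt dt' refl)+ (simp only: E2_def power2_eq_square, simp add: algebra_simps)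
qed

text \<open>The phi-derivatives of q and v, written through R, u and v because the algebraic
  identity is stated in these variables.\<close>

private definition "dq t \<phi> = - vc \<phi> * cos t - \<i> * (uc t \<phi> * cos t - Rc t \<phi> * sin t)" for t \<phi> :: complex
private definition "dv t \<phi> = uc t \<phi> * cos t - Rc t \<phi> * sin t" for t \<phi> :: complex

private lemma dv_eq: "dv t \<phi> = sx * cos \<phi>"
proof -
  have "dv t \<phi> = sx * cos \<phi> * ((sin t)\<^sup>2 + (cos t)\<^sup>2)"
    unfolding dv_def uc_def Rc_def by (simp only: power2_eq_square) (simp only: algebra_simps)
  then show ?thesis by simp
qed

private lemma d\<phi>:
  "((\<lambda>\<phi>. Rc t \<phi>) has_field_derivative vc \<phi> * sin t) (at \<phi>)"
  "((\<lambda>\<phi>. vc \<phi>) has_field_derivative dv t \<phi>) (at \<phi>)"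
  "((\<lambda>\<phi>. qc t \<phi>) has_field_derivative dq t \<phi>) (at \<phi>)"
  "((\<lambda>\<phi>. ph \<phi>) has_field_derivative \<i> * of_nat m * ph \<phi>) (at \<phi>)"
proof -
  show "((\<lambda>\<phi>. Rc t \<phi>) has_field_derivative vc \<phi> * sin t) (at \<phi>)"
    unfolding Rc_def vc_def by (auto intro!: derivative_eq_intros)
  show v: "((\<lambda>\<phi>. vc \<phi>) has_field_derivative dv t \<phi>) (at \<phi>)"
    unfolding vc_def dv_eq by (auto intro!: derivative_eq_intros)
  have "((\<lambda>\<phi>. uc t \<phi>) has_field_derivative - vc \<phi> * cos t) (at \<phi>)"
    unfolding uc_def vc_def by (auto intro!: derivative_eq_intros)
  then show "((\<lambda>\<phi>. qc t \<phi>) has_field_derivative dq t \<phi>) (at \<phi>)"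
    unfolding qc_def dq_def dv_def[symmetric] by (intro DERIV_diff DERIV_cmult v)
  show "((\<lambda>\<phi>. ph \<phi>) has_field_derivative \<i> * of_nat m * ph \<phi>) (at \<phi>)"
    unfolding ph_def by (auto intro!: derivative_eq_intros)
qed

private lemma d\<phi>':
  "((\<lambda>\<phi>. p0 t \<phi>) has_field_derivative vc \<phi> * sin t * p1 t \<phi>) (at \<phi>)"
  "((\<lambda>\<phi>. p1 t \<phi>) has_field_derivative vc \<phi> * sin t * p2 t \<phi>) (at \<phi>)"
  "((\<lambda>\<phi>. a0 t \<phi>) has_field_derivative dq t \<phi> * a1 t \<phi>) (at \<phi>)"
  "((\<lambda>\<phi>. a1 t \<phi>) has_field_derivative dq t \<phi> * a2 t \<phi>) (at \<phi>)"
  unfolding p0_def p1_def p2_def a0_def a1_def a2_def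
  by (auto intro!: derivative_eq_intros d\<phi> DERIV_chain2[OF poly_DERIV d\<phi>(1)]
       simp: pderiv_map_poly_of_real mult_ac numeral_2_eq_2)

private definition "W' k \<sigma> t \<phi> = ph \<phi> * (\<i> * of_nat m * (- \<i> * of_nat m * a0 t \<phi> * p0 t \<phi> * k + (\<i> * a1 t \<phi> * Rc t \<phi> * p0 t \<phi> + a0 t \<phi> * vc \<phi> * p1 t \<phi>) * \<sigma>)
       + (- \<i> * of_nat m * (a1 t \<phi> * dq t \<phi> * p0 t \<phi> + a0 t \<phi> * p1 t \<phi> * (vc \<phi> * sin t)) * k
          + (\<i> * (a2 t \<phi> * dq t \<phi> * Rc t \<phi> * p0 t \<phi> + a1 t \<phi> * (vc \<phi> * sin t) * p0 t \<phi> + a1 t \<phi> * Rc t \<phi> * p1 t \<phi> * (vc \<phi> * sin t))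
             + (a1 t \<phi> * dq t \<phi> * vc \<phi> * p1 t \<phi> + a0 t \<phi> * dv t \<phi> * p1 t \<phi> + a0 t \<phi> * vc \<phi> * p2 t \<phi> * (vc \<phi> * sin t))) * \<sigma>))"

private lemma dW: "((\<lambda>\<phi>. W k \<sigma> t \<phi>) has_field_derivative W' k \<sigma> t \<phi>) (at \<phi>)"
  unfolding W_def
  by (rule derivative_eq_intros d\<phi>(1) d\<phi>(2)[where t = t] d\<phi>(3,4) d\<phi>' refl)+
     (simp add: W'_def algebra_simps)

private lemma sx2: "sx\<^sup>2 = 1 - X\<^sup>2"
proof -
  have "(sqrt (1 - x\<^sup>2))\<^sup>2 = 1 - x\<^sup>2" using Iv_sq[OF x] by simp
  then have "sx\<^sup>2 = of_real (1 - x\<^sup>2)" unfolding sx_def of_real_power[symmetric] by (rule arg_cong)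
  then show ?thesis by (simp add: X_def)
qed

private lemma sphere: "(Rc t \<phi>)\<^sup>2 + (uc t \<phi>)\<^sup>2 + (vc \<phi>)\<^sup>2 = 1"
proof -
  have "(Rc t \<phi>)\<^sup>2 + (uc t \<phi>)\<^sup>2 + (vc \<phi>)\<^sup>2 = (X\<^sup>2 + sx\<^sup>2 * (cos \<phi>)\<^sup>2) * ((sin t)\<^sup>2 + (cos t)\<^sup>2) + sx\<^sup>2 * (sin \<phi>)\<^sup>2"
    unfolding Rc_def uc_def vc_def by (simp only: power2_eq_square) (simp only: algebra_simps)
  also have "\<dots> = X\<^sup>2 + sx\<^sup>2 * ((sin \<phi>)\<^sup>2 + (cos \<phi>)\<^sup>2)"
    unfolding sin_cos_squared_add[of t] by (simp only: mult_1_right distrib_left add.assoc add.commute add.left_commute)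
  also have "\<dots> = 1" by (simp add: sx2)
  finally show ?thesis .
qed

private lemma pde_pointwise:
  assumes "\<sigma> * sin t = 1" "k * (1 + cos t) = 1"
  shows "E2 t \<phi> + cos t * \<sigma> * E1 t \<phi> - 2 * (of_nat m)\<^sup>2 * k * E0 t \<phi> + W' k \<sigma> t \<phi>
    = ph \<phi> * (a0 t \<phi> * ((1 - (Rc t \<phi>)\<^sup>2) * p2 t \<phi> - 2 * (of_nat m + 1) * Rc t \<phi> * p1 t \<phi> - of_nat m * (of_nat m + 1) * p0 t \<phi>))"
proof -
  have q1: "a1 t \<phi> * (uc t \<phi> - \<i> * vc \<phi>) = of_nat m * a0 t \<phi>"
    unfolding a1_def a0_def qc_def[symmetric] by (cases m) auto
  have q2: "a2 t \<phi> * (uc t \<phi> - \<i> * vc \<phi>) = (of_nat m - 1) * a1 t \<phi>"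
    unfolding a2_def a1_def qc_def[symmetric]
    by (cases m; cases "m - 1") (auto simp: numeral_2_eq_2)
  note * = spin_laplace_identity[OF q1 q2 assms sin_cos_squared_add sphere,
     of "p0 t \<phi>" "p1 t \<phi>" "p2 t \<phi>"]
  show ?thesis
    unfolding *[symmetric] E0_def E1_def E2_def W'_def dq_def dv_def by (simp add: algebra_simps)
qed

private lemma real_R: "Rc (of_real t) (of_real \<phi>) = of_real (rot_R x t \<phi>)"
  by (simp add: Rc_def rot_R_def X_def sx_def sin_of_real cos_of_real)

private lemma real_q: "qc (of_real t) (of_real \<phi>) = rot_q x t \<phi>"
  by (simp add: qc_def uc_def vc_def rot_q_def X_def sx_def sin_of_real cos_of_real Complex_eq)

private lemma real_ph: "ph (of_real \<phi>) = cis (real m * \<phi>)"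
  by (simp add: ph_def cis_conv_exp mult_ac)

private lemma real_p:
  "p0 (of_real t) (of_real \<phi>) = of_real (poly P (rot_R x t \<phi>))"
  "p1 (of_real t) (of_real \<phi>) = of_real (poly (pderiv P) (rot_R x t \<phi>))"
  "p2 (of_real t) (of_real \<phi>) = of_real (poly (pderiv (pderiv P)) (rot_R x t \<phi>))"
  unfolding p0_def p1_def p2_def real_R poly_map_poly_of_real by simp_all

private lemma real_E0: "Re (E0 (of_real t) (of_real \<phi>)) = spin_ker m x t \<phi> * poly P (rot_R x t \<phi>)"
  by (simp add: E0_def a0_def real_q real_ph real_p spin_ker_def mult.assoc[symmetric])

private definition "H1 t = integral {0..pi} (\<lambda>\<phi>. Re (E1 (of_real t) (of_real \<phi>)))" for t :: real
private definition "H2 t = integral {0..pi} (\<lambda>\<phi>. Re (E2 (of_real t) (of_real \<phi>)))" for t :: real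

private lemma cont_aux:
  fixes f g :: "'a::t2_space \<Rightarrow> complex"
  assumes f: "continuous_on S f" and g: "continuous_on S g"
  shows "continuous_on S (\<lambda>z. Rc (f z) (g z))" "continuous_on S (\<lambda>z. uc (f z) (g z))" "continuous_on S (\<lambda>z. vc (g z))"
    "continuous_on S (\<lambda>z. ph (g z))" "continuous_on S (\<lambda>z. qc (f z) (g z))"
    "continuous_on S (\<lambda>z. dq (f z) (g z))" "continuous_on S (\<lambda>z. dv (f z) (g z))"
proof -
  show R: "continuous_on S (\<lambda>z. Rc (f z) (g z))"
    unfolding Rc_def by (intro continuous_intros f g)
  show u: "continuous_on S (\<lambda>z. uc (f z) (g z))"
    unfolding uc_def by (intro continuous_intros f g)
  show v: "continuous_on S (\<lambda>z. vc (g z))"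
    unfolding vc_def by (intro continuous_intros f g)
  show "continuous_on S (\<lambda>z. ph (g z))"
    unfolding ph_def by (intro continuous_intros f g)
  show "continuous_on S (\<lambda>z. qc (f z) (g z))"
    unfolding qc_def by (intro continuous_intros u v)
  show "continuous_on S (\<lambda>z. dq (f z) (g z))" "continuous_on S (\<lambda>z. dv (f z) (g z))"
    unfolding dq_def dv_def by (intro continuous_intros f R u v)+
qed

private lemma cont_aux2:
  fixes f g :: "'a::t2_space \<Rightarrow> complex"
  assumes "continuous_on S f" "continuous_on S g"
  shows "continuous_on S (\<lambda>z. p0 (f z) (g z))" "continuous_on S (\<lambda>z. p1 (f z) (g z))" "continuous_on S (\<lambda>z. p2 (f z) (g z))"
    "continuous_on S (\<lambda>z. a0 (f z) (g z))" "continuous_on S (\<lambda>z. a1 (f z) (g z))" "continuous_on S (\<lambda>z. a2 (f z) (g z))"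
  unfolding p0_def p1_def p2_def a0_def a1_def a2_def
  by (intro continuous_on_poly continuous_on_power continuous_on_mult continuous_on_const cont_aux assms)+

private lemma cont:
  fixes f g :: "'a::t2_space \<Rightarrow> complex"
  assumes "continuous_on S f" "continuous_on S g"
  shows "continuous_on S (\<lambda>z. E0 (f z) (g z))" "continuous_on S (\<lambda>z. E1 (f z) (g z))"
     "continuous_on S (\<lambda>z. E2 (f z) (g z))" "continuous_on S (\<lambda>z. W' k \<sigma> (f z) (g z))"
  unfolding E0_def E1_def E2_def W'_def
  by (intro continuous_on_add continuous_on_diff continuous_on_minus continuous_on_power continuous_on_mult continuous_on_const
      continuous_on_sin cont_aux[OF assms] cont_aux2[OF assms] assms)+

private lemma Re_deriv:
  assumes "(f has_field_derivative f') (at (of_real t))"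
  shows "((\<lambda>t. Re (f (of_real t))) has_real_derivative Re f') (at t)"
  using has_vector_derivative_real_field[OF assms, of UNIV]
  by (simp add: has_real_derivative_iff_has_vector_derivative bounded_linear.has_vector_derivative[OF bounded_linear_Re])

lemma spin_int_DERIV1: "(spin_int m x P has_real_derivative H1 t) (at t)"
proof -
  have "((\<lambda>t. integral (cbox 0 pi) (\<lambda>\<phi>. Re (E0 (of_real t) (of_real \<phi>)))) has_field_derivative
     integral (cbox 0 pi) (\<lambda>\<phi>. Re (E1 (of_real t) (of_real \<phi>)))) (at t within UNIV)"
  proof (rule leibniz_rule_field_derivative)
    show "(\<lambda>\<phi>. Re (E0 (of_real t) (of_real \<phi>))) integrable_on cbox 0 pi" for t
      by (intro integrable_continuous continuous_intros cont)
    show "continuous_on (UNIV \<times> cbox 0 pi) (\<lambda>(t, \<phi>). Re (E1 (complex_of_real t) (complex_of_real \<phi>)))"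
      unfolding case_prod_beta' by (intro continuous_intros cont)
    show "((\<lambda>t. Re (E0 (of_real t) (of_real \<phi>))) has_real_derivative Re (E1 (of_real t) (of_real \<phi>))) (at t within UNIV)" for t \<phi>
      using Re_deriv[OF dE(1)] by simp
  qed auto
  then show ?thesis by (simp add: real_E0 spin_int_def[abs_def] H1_def)
qed

lemma spin_int_DERIV2: "(H1 has_real_derivative H2 t) (at t)"
proof -
  have "((\<lambda>t. integral (cbox 0 pi) (\<lambda>\<phi>. Re (E1 (of_real t) (of_real \<phi>)))) has_field_derivative
     integral (cbox 0 pi) (\<lambda>\<phi>. Re (E2 (of_real t) (of_real \<phi>)))) (at t within UNIV)"
  proof (rule leibniz_rule_field_derivative)
    show "(\<lambda>\<phi>. Re (E1 (of_real t) (of_real \<phi>))) integrable_on cbox 0 pi" for t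
      by (intro integrable_continuous continuous_intros cont)
    show "continuous_on (UNIV \<times> cbox 0 pi) (\<lambda>(t, \<phi>). Re (E2 (complex_of_real t) (complex_of_real \<phi>)))"
      unfolding case_prod_beta' by (intro continuous_intros cont)
    show "((\<lambda>t. Re (E1 (of_real t) (of_real \<phi>))) has_real_derivative Re (E2 (of_real t) (of_real \<phi>))) (at t within UNIV)" for t \<phi>
      using Re_deriv[OF dE(2)] by simp
  qed auto
  then show ?thesis by (simp add: H1_def[abs_def] H2_def)
qed

text \<open>At both end points v vanishes and the exponential and q are real, which leaves
  \<open>W\<close> purely imaginary.\<close>

private lemma W_boundary:
  assumes "\<phi> = 0 \<or> \<phi> = pi"
  shows "Re (W (of_real k) (of_real \<sigma>) (of_real t) (of_real \<phi>)) = 0"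
proof -
  have v: "vc (of_real \<phi>) = 0" using assms by (auto simp: vc_def sin_of_real)
  have "cis (real m * pi) = (- 1) ^ m" 
  proof -
    have "cis pi ^ m = cis (real m * pi)" by (rule Complex.DeMoivre)
    then show ?thesis by (simp only: cis_pi)
  qed
  then have "cis (real m * \<phi>) \<in> \<real>" using assms by auto
  then obtain e where e: "ph (of_real \<phi>) = of_real e" unfolding real_ph by (auto elim: Reals_cases)
  have "rot_q x t \<phi> = of_real (Re (rot_q x t \<phi>))"
    using assms by (auto simp: rot_q_def complex_eq_iff)
  then obtain q where q: "rot_q x t \<phi> = of_real q" by blast
  have "W (of_real k) (of_real \<sigma>) (of_real t) (of_real \<phi>) =
    \<i> * of_real (e * (- real m * q ^ m * poly P (rot_R x t \<phi>) * k + real m * q ^ (m - 1) * rot_R x t \<phi> * poly P (rot_R x t \<phi>) * \<sigma>))"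
    unfolding W_def e v a0_def a1_def real_q real_R real_p q by (simp add: algebra_simps)
  then show ?thesis by simp
qed

text \<open>The pointwise identity is integrated over phi, and the boundary values of
  \<open>W\<close> remove the exact derivative. The singular coefficients restrict t to the open
  interval.\<close>

private lemma spin_int_ode:
  assumes t: "0 < t" "t < pi"
  shows "H2 t + cos t / sin t * H1 t - 2 * (real m)\<^sup>2 / (1 + cos t) * spin_int m x P t
    = spin_int m x (jacobi_op m P) t - real m * (real m + 1) * spin_int m x P t"
proof -
  define \<sigma> where "\<sigma> = 1 / sin t"
  define k where "k = 1 / (1 + cos t)"
  have st: "sin t > 0" using t sin_gt_zero by auto
  have ct: "1 + cos t > 0" using t cos_monotone_0_pi[of t pi] by simp
  let ?w = "\<lambda>\<phi>::real. Re (W' (of_real k) (of_real \<sigma>) (of_real t) (of_real \<phi>))"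
  have "((\<lambda>\<phi>. ?w \<phi>) has_integral (Re (W (of_real k) (of_real \<sigma>) (of_real t) (of_real pi)) - Re (W (of_real k) (of_real \<sigma>) (of_real t) (of_real 0)))) {0..pi}"
    using pi_ge_zero
  proof (rule fundamental_theorem_of_calculus)
    show "((\<lambda>\<phi>. Re (W (of_real k) (of_real \<sigma>) (of_real t) (of_real \<phi>))) has_vector_derivative ?w \<phi>) (at \<phi> within {0..pi})" for \<phi> :: real
      using Re_deriv[OF dW] has_real_derivative_iff_has_vector_derivative has_vector_derivative_at_within by blast
  qed
  then have W0: "(?w has_integral 0) {0..pi}" by (simp only: W_boundary simp_thms) simp
  have i0: "((\<lambda>\<phi>. Re (E0 (of_real t) (of_real \<phi>))) has_integral spin_int m x P t) {0..pi}"
    unfolding real_E0 spin_int_def by (rule integrable_integral) (rule spin_int_integrand_integrable)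
  have i1: "((\<lambda>\<phi>. Re (E1 (of_real t) (of_real \<phi>))) has_integral H1 t) {0..pi}"
    unfolding H1_def by (intro integrable_integral integrable_continuous_interval continuous_intros cont)
  have i2: "((\<lambda>\<phi>. Re (E2 (of_real t) (of_real \<phi>))) has_integral H2 t) {0..pi}"
    unfolding H2_def by (intro integrable_integral integrable_continuous_interval continuous_intros cont)
  have "((\<lambda>\<phi>. Re (E2 (of_real t) (of_real \<phi>)) + cos t / sin t * Re (E1 (of_real t) (of_real \<phi>))
      - 2 * (real m)\<^sup>2 / (1 + cos t) * Re (E0 (of_real t) (of_real \<phi>)) + ?w \<phi>) has_integral
      (H2 t + cos t / sin t * H1 t - 2 * (real m)\<^sup>2 / (1 + cos t) * spin_int m x P t + 0)) {0..pi}"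
    by (intro has_integral_add has_integral_diff has_integral_mult_right i0 i1 i2 W0)
  moreover have "Re (E2 (of_real t) (of_real \<phi>)) + cos t / sin t * Re (E1 (of_real t) (of_real \<phi>))
      - 2 * (real m)\<^sup>2 / (1 + cos t) * Re (E0 (of_real t) (of_real \<phi>)) + ?w \<phi>
      = spin_ker m x t \<phi> * poly (jacobi_op m P) (rot_R x t \<phi>)
        - real m * (real m + 1) * (spin_ker m x t \<phi> * poly P (rot_R x t \<phi>))" for \<phi>
  proof -
    have "of_real \<sigma> * sin (complex_of_real t) = 1" "of_real k * (1 + cos (complex_of_real t)) = 1"
    proof -
      have "\<sigma> * sin t = 1" "k * (1 + cos t) = 1" using st ct by (simp_all add: \<sigma>_def k_def)
      then have "complex_of_real (\<sigma> * sin t) = 1" "complex_of_real (k * (1 + cos t)) = 1" by simp_all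
      then show "of_real \<sigma> * sin (complex_of_real t) = 1" "of_real k * (1 + cos (complex_of_real t)) = 1"
        by (simp_all only: of_real_mult of_real_add of_real_1 sin_of_real cos_of_real)
    qed
    note eq = arg_cong[OF pde_pointwise[OF this, of "of_real \<phi>"], of Re]
    have 1: "Re (ph (of_real \<phi>) * (a0 (of_real t) (of_real \<phi>) * of_real r)) = spin_ker m x t \<phi> * r" for r
      by (simp add: a0_def real_q real_ph spin_ker_def mult.assoc[symmetric])
    have 2: "(1 - (Rc (of_real t) (of_real \<phi>))\<^sup>2) * p2 (of_real t) (of_real \<phi>) - 2 * (of_nat m + 1) * Rc (of_real t) (of_real \<phi>) * p1 (of_real t) (of_real \<phi>) - of_nat m * (of_nat m + 1) * p0 (of_real t) (of_real \<phi>)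
      = of_real (poly (jacobi_op m P) (rot_R x t \<phi>) - real m * (real m + 1) * poly P (rot_R x t \<phi>))"
      unfolding poly_jacobi_op real_p real_R by simp
    have 3: "Re (cos (of_real t) * of_real \<sigma> * z) = cos t / sin t * Re z" for z
      by (simp add: cos_of_real \<sigma>_def flip: of_real_mult)
    have 4: "Re (2 * (of_nat m)\<^sup>2 * of_real k * z) = 2 * (real m)\<^sup>2 / (1 + cos t) * Re z" for z
    proof -
      have Re_complex_of_real_times: "Re (of_real r * z) = r * Re z" for r by simp
      have "2 * (of_nat m)\<^sup>2 * complex_of_real k = of_real (2 * (real m)\<^sup>2 / (1 + cos t))" by (simp add: k_def)
      then show ?thesis by (simp only: Re_complex_of_real_times)
    qed
    show ?thesis using eq unfolding 2 1 plus_complex.sel minus_complex.sel 3 4 by (simp add: algebra_simps)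
  qed
  ultimately have "((\<lambda>\<phi>. spin_ker m x t \<phi> * poly (jacobi_op m P) (rot_R x t \<phi>)
        - real m * (real m + 1) * (spin_ker m x t \<phi> * poly P (rot_R x t \<phi>))) has_integral
      (H2 t + cos t / sin t * H1 t - 2 * (real m)\<^sup>2 / (1 + cos t) * spin_int m x P t)) {0..pi}"
    by simp
  moreover have "((\<lambda>\<phi>. spin_ker m x t \<phi> * poly (jacobi_op m P) (rot_R x t \<phi>)
        - real m * (real m + 1) * (spin_ker m x t \<phi> * poly P (rot_R x t \<phi>))) has_integral
      (spin_int m x (jacobi_op m P) t - real m * (real m + 1) * spin_int m x P t)) {0..pi}"
    unfolding spin_int_def
    by (intro has_integral_diff has_integral_mult_right integrable_integral spin_int_integrand_integrable)
  ultimately show ?thesis using has_integral_unique by blast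
qed

lemma spin_int_ode_ex:
  obtains H1 H2 where "\<And>t. (spin_int m x P has_real_derivative H1 t) (at t)"
    "\<And>t. (H1 has_real_derivative H2 t) (at t)"
    "\<And>t. 0 < t \<Longrightarrow> t < pi \<Longrightarrow> H2 t + cos t / sin t * H1 t - 2 * (real m)\<^sup>2 / (1 + cos t) * spin_int m x P t
    = spin_int m x (jacobi_op m P) t - real m * (real m + 1) * spin_int m x P t"
  using spin_int_DERIV1 spin_int_DERIV2 spin_int_ode by blast

end

section \<open>The reference space L1 with weight (1 - x^2)^(m/2)\<close>

abbreviation norm1_le :: "nat \<Rightarrow> (real \<Rightarrow> real) \<Rightarrow> real \<Rightarrow> bool" where
  "norm1_le m \<equiv> norm_le 1 (real m / 2)"

definition L1_space :: "nat \<Rightarrow> (real \<Rightarrow> real) set" where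
  "L1_space m = {f. f \<in> borel_measurable borel \<and> (\<exists>M\<ge>0. norm1_le m f M)}"

lemma L1_spaceD [measurable_dest]: "f \<in> L1_space m \<Longrightarrow> f \<in> borel_measurable borel"
  by (simp add: L1_space_def)

lemma L1_spaceE:
  assumes "f \<in> L1_space m" obtains M where "0 \<le> M" "norm1_le m f M"
  using assms by (auto simp: L1_space_def)

lemma L1_spaceI: "f \<in> borel_measurable borel \<Longrightarrow> norm1_le m f M \<Longrightarrow> 0 \<le> M \<Longrightarrow> f \<in> L1_space m"
  by (auto simp: L1_space_def)

lemma norm_le_1_iff:
  assumes "0 \<le> M"
  shows "norm_le 1 a h M \<longleftrightarrow> (\<integral>\<^sup>+ x\<in>Iv. ennreal (\<bar>h x\<bar> * (1 - x\<^sup>2) powr a) \<partial>lborel) \<le> ennreal M"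
  using assms by (simp add: norm_le_def)

lemma L1_space_finite:
  assumes "f \<in> L1_space m"
  shows "(\<integral>\<^sup>+ x\<in>Iv. ennreal (\<bar>f x\<bar> * (1 - x\<^sup>2) powr (real m / 2)) \<partial>lborel) < \<infinity>"
  using assms by (auto elim!: L1_spaceE simp: norm_le_1_iff intro: le_less_trans)

lemma L1_space_lincomb:
  assumes "f \<in> L1_space m" "g \<in> L1_space m"
  shows "(\<lambda>x. a * f x + b * g x) \<in> L1_space m"
proof -
  obtain M N where "0 \<le> M" "norm1_le m f M" "0 \<le> N" "norm1_le m g N"
    using assms by (auto elim!: L1_spaceE)
  then have "norm1_le m (\<lambda>x. a * f x + b * g x) (\<bar>a\<bar> * M + \<bar>b\<bar> * N)"
    using assms by (intro norm_le_add norm_le_cmult) auto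
  moreover have "(\<lambda>x. a * f x + b * g x) \<in> borel_measurable borel"
    using assms by measurable
  ultimately show ?thesis using \<open>0 \<le> M\<close> \<open>0 \<le> N\<close> by (auto intro!: L1_spaceI)
qed

lemma L1_space_diff: "f \<in> L1_space m \<Longrightarrow> g \<in> L1_space m \<Longrightarrow> (\<lambda>x. f x - g x) \<in> L1_space m"
  using L1_space_lincomb[of f m g 1 "-1"] by simp

lemma L1_space_cmult: "f \<in> L1_space m \<Longrightarrow> (\<lambda>x. c * f x) \<in> L1_space m"
  using L1_space_lincomb[of f m f c 0] by simp

lemma L1_space_bounded:
  assumes [measurable]: "f \<in> borel_measurable borel" and B: "\<And>x. x \<in> Iv \<Longrightarrow> \<bar>f x\<bar> \<le> B"
  shows "norm1_le m f (2 * B)"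
proof -
  have B0: "0 \<le> B" using B[of 0] by simp
  have "(\<integral>\<^sup>+ x\<in>Iv. ennreal (\<bar>f x\<bar> * (1 - x\<^sup>2) powr (real m / 2)) \<partial>lborel) \<le> (\<integral>\<^sup>+ x\<in>Iv. ennreal B \<partial>lborel)"
  proof (intro nn_integral_mono)
    fix x :: real
    show "ennreal (\<bar>f x\<bar> * (1 - x\<^sup>2) powr (real m / 2)) * indicator Iv x \<le> ennreal B * indicator Iv x"
    proof (cases "x \<in> Iv")
      case True
      have "(1 - x\<^sup>2) powr (real m / 2) \<le> 1 powr (real m / 2)"
        using Iv_weight_pos[OF True] by (intro powr_mono2) auto
      then have "\<bar>f x\<bar> * (1 - x\<^sup>2) powr (real m / 2) \<le> B * 1"
        using B[OF True] B0 by (intro mult_mono) auto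
      then show ?thesis using True by (simp add: ennreal_leI)
    qed simp
  qed
  also have "\<dots> = ennreal (2 * B)" using B0 by (simp add: nn_integral_cmult_indicator ennreal_mult' mult.commute)
  finally show ?thesis using B0 by (simp add: norm_le_1_iff)
qed

lemma poly_bounded_Iv:
  obtains B where "0 \<le> B" "\<And>x. x \<in> Iv \<Longrightarrow> \<bar>poly P x\<bar> \<le> (B::real)"
proof -
  have "compact (poly P ` {-1..1})"
    by (intro compact_continuous_image continuous_intros compact_Icc)
  then obtain B where "0 < B" "\<forall>y\<in>poly P ` {-1..1}. norm y \<le> B"
    using compact_imp_bounded bounded_pos by metis
  then show ?thesis using that[of B] by auto
qed

lemma poly_in_L1_space: "poly P \<in> L1_space m"
proof -
  obtain B where "0 \<le> B" "\<And>x. x \<in> Iv \<Longrightarrow> \<bar>poly P x\<bar> \<le> B" using poly_bounded_Iv[of P] by blast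
  then show ?thesis using L1_space_bounded[of "poly P" B m]
    by (intro L1_spaceI[of _ _ "2 * B"]) (auto intro: borel_measurable_continuous_onI continuous_intros)
qed

text \<open>Hoelder in the pointwise form of Young's inequality. With g = a - m/2 the dual weight is
  (1 - x^2)^(- g r / (r - 1)), and the upper bound on g makes it integrable.\<close>

lemma admissible_in_L1_space:
  assumes adm: "admissible p m a" and [measurable]: "f \<in> borel_measurable borel" and f: "norm_le p a f M"
  shows "f \<in> L1_space m"
proof -
  have p1: "1 \<le> p" using adm by (simp add: admissible_def)
  define g where "g = a - real m / 2"
  have split: "\<bar>f x\<bar> * (1 - x\<^sup>2) powr (real m / 2) = (\<bar>f x\<bar> * (1 - x\<^sup>2) powr a) * (1 - x\<^sup>2) powr (- g)" for x
    by (simp add: g_def powr_add[symmetric] mult.assoc)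
  have "(\<integral>\<^sup>+ x\<in>Iv. ennreal (\<bar>f x\<bar> * (1 - x\<^sup>2) powr (real m / 2)) \<partial>lborel) < \<infinity>"
  proof (cases rule: exponent_cases[OF p1])
    case 1
    have "AE x in lborel. x \<in> Iv \<longrightarrow> \<bar>f x\<bar> * (1 - x\<^sup>2) powr a \<le> M"
      using f by (simp add: norm_le_def 1)
    then have "(\<integral>\<^sup>+ x\<in>Iv. ennreal (\<bar>f x\<bar> * (1 - x\<^sup>2) powr (real m / 2)) \<partial>lborel)
      \<le> (\<integral>\<^sup>+ x. ennreal \<bar>M\<bar> * (ennreal ((1 - x\<^sup>2) powr (- g)) * indicator Iv x) \<partial>lborel)"
      unfolding split
      by (intro nn_integral_mono_AE, eventually_elim)
         (auto simp: indicator_def ennreal_mult'[symmetric] intro!: ennreal_leI mult_right_mono)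
    also have "\<dots> = ennreal \<bar>M\<bar> * (\<integral>\<^sup>+ x\<in>Iv. ennreal ((1 - x\<^sup>2) powr (- g)) \<partial>lborel)"
      by (rule nn_integral_cmult) measurable
    also have "\<dots> < \<infinity>"
      using weight_integrable[of g] adm 1 by (auto simp: admissible_def g_def less_top[symmetric] ennreal_mult_eq_top_iff)
    finally show ?thesis .
  next
    case (2 r)
    let ?Y = "\<lambda>x. \<bar>f x\<bar> * (1 - x\<^sup>2) powr a"
    have fin: "(\<integral>\<^sup>+ x\<in>Iv. ennreal (?Y x powr r) \<partial>lborel) < \<infinity>"
      using f 2 by (auto simp: norm_le_def intro: le_less_trans)
    obtain e where e: "e < 1" and pt: "\<And>x. x \<in> Iv \<Longrightarrow> ?Y x * (1 - x\<^sup>2) powr (- g) \<le> ?Y x powr r + (r - 1) * (1 - x\<^sup>2) powr (- e)"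
    proof (cases "r = 1")
      case True
      have "g \<le> 0" using adm 2 True by (auto simp: admissible_def g_def)
      moreover have "?Y x * (1 - x\<^sup>2) powr (- g) \<le> ?Y x powr r + (r - 1) * (1 - x\<^sup>2) powr (- 0)" if "x \<in> Iv" for x
      proof -
        have "(1 - x\<^sup>2) powr (- g) \<le> 1 powr (- g)"
          using Iv_weight_pos[OF that] \<open>g \<le> 0\<close> by (intro powr_mono2) auto
        then show ?thesis using True by (simp add: mult_left_le)
      qed
      ultimately show ?thesis using that[of 0] by simp
    next
      case False
      then have r: "1 < r" using 2 by simp
      then have "1 < p" using 2 by (metis ennreal_1 ennreal_less_iff zero_le_one)
      then have "g < 1 / 2 - 1 / (2 * r)"
        using adm 2 by (auto simp: admissible_def g_def)
      then have "g * r / (r - 1) < 1" using r by (simp add: field_simps)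
      moreover have "?Y x * (1 - x\<^sup>2) powr (- g) \<le> ?Y x powr r + (r - 1) * (1 - x\<^sup>2) powr (- (g * r / (r - 1)))" if x: "x \<in> Iv" for x
      proof -
        have w: "0 < 1 - x\<^sup>2" using x by (rule Iv_weight_pos)
        \<comment> \<open>Chosen so that n^(r-1) is the weight ratio (1 - x^2)^(-g).\<close>
        define n where "n = (1 - x\<^sup>2) powr (- (g / (r - 1)))"
        have "r * n powr (r - 1) * ?Y x \<le> ?Y x powr r + (r - 1) * n powr r"
          by (rule young_powr) (use r w in \<open>auto simp: n_def\<close>)
        moreover have "n powr (r - 1) = (1 - x\<^sup>2) powr (- g)" using r by (simp add: n_def powr_powr)
        moreover have "n powr r = (1 - x\<^sup>2) powr (- (g * r / (r - 1)))" by (simp add: n_def powr_powr)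
        moreover have "1 * (n powr (r - 1) * ?Y x) \<le> r * (n powr (r - 1) * ?Y x)"
          using r by (intro mult_right_mono) auto
        ultimately show ?thesis by (simp add: mult_ac)
      qed
      ultimately show ?thesis using that by blast
    qed
    have "(\<integral>\<^sup>+ x\<in>Iv. ennreal (\<bar>f x\<bar> * (1 - x\<^sup>2) powr (real m / 2)) \<partial>lborel)
      \<le> (\<integral>\<^sup>+ x. ennreal (?Y x powr r) * indicator Iv x + ennreal (r - 1) * (ennreal ((1 - x\<^sup>2) powr (- e)) * indicator Iv x) \<partial>lborel)"
      unfolding split using pt 2
      by (intro nn_integral_mono)
         (auto simp: indicator_def ennreal_mult'[symmetric] ennreal_plus[symmetric] simp del: ennreal_plus intro!: ennreal_leI)
    also have "\<dots> = (\<integral>\<^sup>+ x\<in>Iv. ennreal (?Y x powr r) \<partial>lborel) + ennreal (r - 1) * (\<integral>\<^sup>+ x\<in>Iv. ennreal ((1 - x\<^sup>2) powr (- e)) \<partial>lborel)"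
      by (subst nn_integral_add) (auto simp: nn_integral_cmult)
    also have "\<dots> < \<infinity>"
      using fin weight_integrable[OF e] by (auto simp: less_top[symmetric] ennreal_mult_eq_top_iff)
    finally show ?thesis .
  qed
  then obtain c where c: "0 \<le> c" "(\<integral>\<^sup>+ x\<in>Iv. ennreal (\<bar>f x\<bar> * (1 - x\<^sup>2) powr (real m / 2)) \<partial>lborel) = ennreal c"
    by (cases "\<integral>\<^sup>+ x\<in>Iv. ennreal (\<bar>f x\<bar> * (1 - x\<^sup>2) powr (real m / 2)) \<partial>lborel" rule: ennreal_cases) auto
  then show ?thesis by (intro L1_spaceI[of _ _ c]) (auto simp: norm_le_1_iff)
qed

subsection \<open>Density of polynomials\<close>

lemma norm1_le_limit:
  assumes g: "\<And>k. g k \<in> borel_measurable borel" and w[measurable]: "w \<in> borel_measurable borel"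
    and le: "\<And>k x. x \<in> Iv \<Longrightarrow> \<bar>g k x\<bar> \<le> w x"
    and fin: "(\<integral>\<^sup>+ x\<in>Iv. ennreal (w x * (1 - x\<^sup>2) powr (real m / 2)) \<partial>lborel) < \<infinity>"
    and lim: "AE x in lborel. x \<in> Iv \<longrightarrow> (\<lambda>k. g k x) \<longlonglongrightarrow> 0" and e: "0 < e"
  shows "\<exists>k. norm1_le m (g k) e"
proof -
  note [measurable] = g
  have "(\<lambda>k. \<integral>\<^sup>+ x\<in>Iv. ennreal (\<bar>g k x\<bar> * (1 - x\<^sup>2) powr (real m / 2)) \<partial>lborel) \<longlonglongrightarrow> (\<integral>\<^sup>+ x. 0 \<partial>(lborel :: real measure))"
  proof (rule nn_integral_dominated_convergence[where w = "\<lambda>x. ennreal (w x * (1 - x\<^sup>2) powr (real m / 2)) * indicator Iv x"])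
    show "AE x in lborel. ennreal (\<bar>g k x\<bar> * (1 - x\<^sup>2) powr (real m / 2)) * indicator Iv x
      \<le> ennreal (w x * (1 - x\<^sup>2) powr (real m / 2)) * indicator Iv x" for k
      using le by (intro AE_I2) (auto simp: indicator_def intro!: ennreal_leI mult_right_mono)
    show "AE x in lborel. (\<lambda>k. ennreal (\<bar>g k x\<bar> * (1 - x\<^sup>2) powr (real m / 2)) * indicator Iv x) \<longlonglongrightarrow> 0"
      using lim
    proof eventually_elim
      case (elim x)
      show ?case
      proof (cases "x \<in> Iv")
        case True
        then have "(\<lambda>k. ennreal (\<bar>g k x\<bar> * (1 - x\<^sup>2) powr (real m / 2))) \<longlonglongrightarrow> ennreal (\<bar>0\<bar> * (1 - x\<^sup>2) powr (real m / 2))"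
          using elim by (intro tendsto_ennrealI tendsto_intros) auto
        then show ?thesis using True by simp
      qed simp
    qed
  qed (use fin in auto)
  then have "\<forall>\<^sub>F k in sequentially. (\<integral>\<^sup>+ x\<in>Iv. ennreal (\<bar>g k x\<bar> * (1 - x\<^sup>2) powr (real m / 2)) \<partial>lborel) < ennreal e"
    using e by (intro order_tendstoD) auto
  then obtain k where "(\<integral>\<^sup>+ x\<in>Iv. ennreal (\<bar>g k x\<bar> * (1 - x\<^sup>2) powr (real m / 2)) \<partial>lborel) < ennreal e"
    by (auto simp: eventually_sequentially)
  then show ?thesis using e by (intro exI[of _ k]) (simp add: norm_le_1_iff)
qed

text \<open>Three steps at a cost of e / 3 each: truncation of the values, replacement by a
  continuous function, and the theorem of Weierstrass.\<close>

lemma polynomials_dense: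
  assumes f: "f \<in> L1_space m" and e: "0 < e"
  shows "\<exists>P. norm1_le m (\<lambda>x. f x - poly P x) e"
proof -
  have [measurable]: "f \<in> borel_measurable borel" by (rule L1_spaceD[OF f])
  define cl where "cl K y = max (- K) (min K y)" for K y :: real
  have cl_cont: "continuous_on UNIV (cl K)" for K
    unfolding cl_def by (intro continuous_intros)
  have [measurable]: "cl K \<in> borel_measurable borel" for K
    by (rule borel_measurable_continuous_onI[OF cl_cont])
  have "\<exists>k. norm1_le m (\<lambda>x. f x - cl (real k) (f x)) (e / 3)"
  proof (rule norm1_le_limit[where w = "\<lambda>x. \<bar>f x\<bar>"])
    show "AE x in lborel. x \<in> Iv \<longrightarrow> (\<lambda>k. f x - cl (real k) (f x)) \<longlonglongrightarrow> 0"
    proof (intro AE_I2 impI)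
      fix x
      obtain N :: nat where N: "\<bar>f x\<bar> \<le> real N" using real_arch_simple by blast
      have "\<forall>\<^sub>F k in sequentially. f x - cl (real k) (f x) = 0"
        using eventually_ge_at_top[of N] by eventually_elim (use N in \<open>auto simp: cl_def\<close>)
      then show "(\<lambda>k. f x - cl (real k) (f x)) \<longlonglongrightarrow> 0" by (rule tendsto_eventually)
    qed
  qed (use e L1_space_finite[OF f] in \<open>auto simp: cl_def\<close>)
  then obtain k :: nat where k: "norm1_le m (\<lambda>x. f x - cl (real k) (f x)) (e / 3)" by blast
  have "(\<lambda>x. cl (real k) (f x)) measurable_on UNIV"
    by (rule lebesgue_measurable_imp_measurable_on) (auto intro!: measurable_completion simp: measurable_lborel1)
  then obtain N h where N: "negligible N" and h: "\<And>n. continuous_on UNIV (h n)"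
    and lim: "\<And>x. x \<notin> N \<Longrightarrow> (\<lambda>n. h n x) \<longlonglongrightarrow> cl (real k) (f x)"
    unfolding measurable_on_def by auto
  have [measurable]: "h n \<in> borel_measurable borel" for n
    by (rule borel_measurable_continuous_onI[OF h])
  \<comment> \<open>The continuous functions \<open>h n\<close> converge only almost everywhere;
    truncating them as well gives a constant majorant and does not change the limit, which is
    already truncated.\<close>
  have "\<exists>n. norm1_le m (\<lambda>x. cl (real k) (f x) - cl (real k) (h n x)) (e / 3)"
  proof (rule norm1_le_limit[where w = "\<lambda>x. 2 * real k"])
    have "AE x in lebesgue. x \<notin> N"
      using N by (auto simp: negligible_iff_null_sets intro: AE_not_in)
    then have "AE x in lborel. x \<notin> N" by (rule AE_completion_iff[THEN iffD1, rotated]) 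
    then show "AE x in lborel. x \<in> Iv \<longrightarrow> (\<lambda>n. cl (real k) (f x) - cl (real k) (h n x)) \<longlonglongrightarrow> 0"
    proof eventually_elim
      case (elim x)
      have "(\<lambda>n. cl (real k) (h n x)) \<longlonglongrightarrow> cl (real k) (cl (real k) (f x))"
        using continuous_on_tendsto_compose[OF cl_cont lim[OF elim]] by simp
      then have "(\<lambda>n. cl (real k) (f x) - cl (real k) (h n x)) \<longlonglongrightarrow> cl (real k) (f x) - cl (real k) (cl (real k) (f x))"
        by (intro tendsto_diff tendsto_const)
      then show ?case by (simp add: cl_def)
    qed
    have "norm1_le m (\<lambda>x. 2 * real k) (2 * (2 * real k))" by (rule L1_space_bounded) auto
    then show "(\<integral>\<^sup>+ x\<in>Iv. ennreal (2 * real k * (1 - x\<^sup>2) powr (real m / 2)) \<partial>lborel) < \<infinity>"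
      by (simp add: norm_le_1_iff le_less_trans)
  qed (use e in \<open>auto simp: cl_def\<close>)
  then obtain n where n: "norm1_le m (\<lambda>x. cl (real k) (f x) - cl (real k) (h n x)) (e / 3)" by blast
  have "continuous_on {-1..1} (\<lambda>x. cl (real k) (h n x))"
    using continuous_on_compose2[OF cl_cont h] by (rule continuous_on_subset) auto
  \<comment> \<open>A uniform bound is multiplied by the length 2 of the interval, hence e /
    6.\<close>
  then obtain g where g: "polynomial_function g" "\<forall>x\<in>{-1..1}. norm (cl (real k) (h n x) - g x) < e / 6"
    using Stone_Weierstrass_polynomial_function[OF compact_Icc, of "-1" 1 "\<lambda>x. cl (real k) (h n x)" "e / 6"] e by auto
  then obtain a d where "g = (\<lambda>x. \<Sum>i\<le>d. a i * x ^ i)"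
    unfolding real_polynomial_function_eq[symmetric] real_polynomial_function_iff_sum by blast
  then have gp: "g = poly (\<Sum>i\<le>d. monom (a i) i)"
    by (auto simp: poly_sum poly_monom)
  define P where "P = (\<Sum>i\<le>d. monom (a i) i)"
  have "norm1_le m (\<lambda>x. cl (real k) (h n x) - poly P x) (2 * (e / 6))"
    using g(2) unfolding gp P_def[symmetric] by (intro L1_space_bounded) (auto intro: less_imp_le)
  from norm_le_add[OF _ norm_le_add[OF _ k n] this]
  have "norm1_le m (\<lambda>x. f x - cl (real k) (f x) + (cl (real k) (f x) - cl (real k) (h n x)) + (cl (real k) (h n x) - poly P x)) (e / 3 + e / 3 + 2 * (e / 6))"
    using e by simp
  then show ?thesis by (intro exI[of _ P]) simp
qed

subsection \<open>Bounded operators\<close>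

text \<open>Linearity is only required almost everywhere because Bochner integrals of non-integrable functions are junk.\<close>

definition bop :: "nat \<Rightarrow> ((real \<Rightarrow> real) \<Rightarrow> real \<Rightarrow> real) \<Rightarrow> real \<Rightarrow> bool" where
  "bop m A C \<longleftrightarrow> 0 < C \<and> (\<forall>f\<in>L1_space m. A f \<in> borel_measurable borel)
    \<and> (\<forall>f\<in>L1_space m. \<forall>M\<ge>0. norm1_le m f M \<longrightarrow> norm1_le m (A f) (C * M))
    \<and> (\<forall>f\<in>L1_space m. \<forall>g\<in>L1_space m. \<forall>a b.
         AE x in lborel. x \<in> Iv \<longrightarrow> A (\<lambda>x. a * f x + b * g x) x = a * A f x + b * A g x)"

lemma bop_pos: "bop m A C \<Longrightarrow> 0 < C"
  and bop_measurable: "bop m A C \<Longrightarrow> f \<in> L1_space m \<Longrightarrow> A f \<in> borel_measurable borel"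
  and bop_norm: "bop m A C \<Longrightarrow> f \<in> L1_space m \<Longrightarrow> 0 \<le> M \<Longrightarrow> norm1_le m f M \<Longrightarrow> norm1_le m (A f) (C * M)"
  and bop_linear: "bop m A C \<Longrightarrow> f \<in> L1_space m \<Longrightarrow> g \<in> L1_space m \<Longrightarrow>
     AE x in lborel. x \<in> Iv \<longrightarrow> A (\<lambda>x. a * f x + b * g x) x = a * A f x + b * A g x"
  by (auto simp: bop_def)

lemma bop_in:
  assumes "bop m A C" "f \<in> L1_space m" shows "A f \<in> L1_space m"
  using assms(2)
proof (rule L1_spaceE)
  fix M assume "0 \<le> M" "norm1_le m f M"
  then show ?thesis
    using bop_norm[OF assms] bop_measurable[OF assms] bop_pos[OF assms(1)] by (intro L1_spaceI[of _ _ "C * M"]) auto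
qed

lemma bop_diff:
  "bop m A C \<Longrightarrow> f \<in> L1_space m \<Longrightarrow> g \<in> L1_space m \<Longrightarrow>
     AE x in lborel. x \<in> Iv \<longrightarrow> A (\<lambda>x. f x - g x) x = A f x - A g x"
  using bop_linear[of m A C f g 1 "-1"] by simp

text \<open>The difference of f and g has norm 0, hence so has its image. It lets identities that
  hold almost everywhere be inserted under an operator, as compositions require.\<close>

lemma bop_cong:
  assumes A: "bop m A C" and f: "f \<in> L1_space m" and g: "g \<in> L1_space m"
    and eq: "AE x in lborel. x \<in> Iv \<longrightarrow> f x = g x"
  shows "AE x in lborel. x \<in> Iv \<longrightarrow> A f x = A g x"
proof -
  have fg: "(\<lambda>x. f x - g x) \<in> L1_space m" by (rule L1_space_diff[OF f g])
  have "norm1_le m (\<lambda>x. f x - g x) 0"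
    by (rule norm_le_cong_AE[OF _ norm_le_zero]) (use eq in \<open>auto elim: eventually_mono\<close>)
  from bop_norm[OF A fg _ this] have "norm1_le m (A (\<lambda>x. f x - g x)) 0" by simp
  then have "AE x in lborel. x \<in> Iv \<longrightarrow> A (\<lambda>x. f x - g x) x = 0"
    by (rule norm_le_eq_0[rotated]) (auto intro: bop_measurable[OF A fg])
  with bop_diff[OF A f g] show ?thesis by eventually_elim auto
qed

lemma bop_compose:
  assumes A: "bop m A C" and B: "bop m B D"
  shows "bop m (\<lambda>f. A (B f)) (C * D)"
  unfolding bop_def
proof (intro conjI ballI allI impI)
  show "0 < C * D" using bop_pos[OF A] bop_pos[OF B] by simp
  show "A (B f) \<in> borel_measurable borel" if "f \<in> L1_space m" for f
    using bop_measurable[OF A bop_in[OF B that]] .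
  show "norm1_le m (A (B f)) (C * D * M)" if "f \<in> L1_space m" "0 \<le> M" "norm1_le m f M" for f M
    using bop_norm[OF A bop_in[OF B that(1)] _ bop_norm[OF B that]] bop_pos[OF B] that by (simp add: mult.assoc)
  show "AE x in lborel. x \<in> Iv \<longrightarrow> A (B (\<lambda>x. a * f x + b * g x)) x = a * A (B f) x + b * A (B g) x"
    if f: "f \<in> L1_space m" and g: "g \<in> L1_space m" for f g a b
  proof -
    have "AE x in lborel. x \<in> Iv \<longrightarrow> A (B (\<lambda>x. a * f x + b * g x)) x = A (\<lambda>x. a * B f x + b * B g x) x"
      by (rule bop_cong[OF A _ _ bop_linear[OF B f g]])
         (auto intro!: bop_in[OF B] L1_space_lincomb f g)
    with bop_linear[OF A bop_in[OF B f] bop_in[OF B g], of a b] show ?thesis by eventually_elim auto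
  qed
qed

lemma bop_id: "bop m (\<lambda>f. f) 1"
  by (auto simp: bop_def L1_space_def)

text \<open>The summand 1 keeps the constant positive when r = s = 0.\<close>

lemma bop_lincomb:
  assumes A: "bop m A C" and B: "bop m B D"
  shows "bop m (\<lambda>f x. r * A f x + s * B f x) (\<bar>r\<bar> * C + \<bar>s\<bar> * D + 1)"
  unfolding bop_def
proof (intro conjI ballI allI impI)
  have pos: "0 < C" "0 < D" using bop_pos[OF A] bop_pos[OF B] by auto
  show "0 < \<bar>r\<bar> * C + \<bar>s\<bar> * D + 1" using pos by (simp add: add_nonneg_pos)
  show "(\<lambda>x. r * A f x + s * B f x) \<in> borel_measurable borel" if "f \<in> L1_space m" for f
    using bop_measurable[OF A that] bop_measurable[OF B that] by measurable
  show "norm1_le m (\<lambda>x. r * A f x + s * B f x) ((\<bar>r\<bar> * C + \<bar>s\<bar> * D + 1) * M)" if "f \<in> L1_space m" "0 \<le> M" "norm1_le m f M" for f M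
  proof -
    have "norm1_le m (\<lambda>x. r * A f x + s * B f x) (\<bar>r\<bar> * (C * M) + \<bar>s\<bar> * (D * M))"
      using bop_measurable[OF A that(1)] bop_measurable[OF B that(1)] pos that(2)
      by (intro norm_le_add norm_le_cmult bop_norm[OF A that] bop_norm[OF B that]) auto
    then show ?thesis by (rule norm_le_mono[rotated]) (use pos that(2) in \<open>auto simp: algebra_simps\<close>)
  qed
  show "AE x in lborel. x \<in> Iv \<longrightarrow> r * A (\<lambda>x. a * f x + b * g x) x + s * B (\<lambda>x. a * f x + b * g x) x
     = a * (r * A f x + s * B f x) + b * (r * A g x + s * B g x)"
    if f: "f \<in> L1_space m" and g: "g \<in> L1_space m" for f g a b
    using bop_linear[OF A f g, of a b] bop_linear[OF B f g, of a b]
    by eventually_elim (auto simp: algebra_simps)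
qed

text \<open>The integrand is dominated by |f| (1 - y^2)^(m/2) taken at y = R, and circular averages
  preserve the integral of that function up to the factor pi.\<close>

lemma spin_avg_integrable:
  assumes f: "f \<in> L1_space m"
  shows "AE x in lborel. x \<in> Iv \<longrightarrow> integrable lborel (\<lambda>\<phi>. indicator {0<..<pi} \<phi> * (spin_ker m x t \<phi> * f (rot_R x t \<phi>)))"
proof -
  have [measurable]: "f \<in> borel_measurable borel" by (rule L1_spaceD[OF f])
  define F where "F y = ennreal (\<bar>f y\<bar> * (1 - y\<^sup>2) powr (real m / 2))" for y
  have [measurable]: "F \<in> borel_measurable borel" unfolding F_def by measurable
  have "(\<integral>\<^sup>+x\<in>Iv. circ_avg t F x \<partial>lborel) \<noteq> \<infinity>"
    using L1_space_finite[OF f] unfolding circ_avg_integral[OF \<open>F \<in> _\<close>] F_def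
    by (auto simp: ennreal_mult_eq_top_iff less_top)
  then have "AE x in lborel. circ_avg t F x * indicator Iv x \<noteq> \<infinity>"
    by (intro nn_integral_noteq_infinite) auto
  then show ?thesis
  proof eventually_elim
    case (elim x)
    show ?case
    proof
      assume x: "x \<in> Iv"
      show "integrable lborel (\<lambda>\<phi>. indicator {0<..<pi} \<phi> * (spin_ker m x t \<phi> * f (rot_R x t \<phi>)))"
      proof (rule integrableI_bounded)
        have "(\<integral>\<^sup>+\<phi>. ennreal (norm (indicator {0<..<pi} \<phi> * (spin_ker m x t \<phi> * f (rot_R x t \<phi>)))) \<partial>lborel) \<le> circ_avg t F x"
          unfolding circ_avg_def
        proof (intro nn_integral_mono)
          fix \<phi> :: real
          show "ennreal (norm (indicator {0<..<pi} \<phi> * (spin_ker m x t \<phi> * f (rot_R x t \<phi>)))) \<le> F (rot_R x t \<phi>) * indicator {0<..<pi} \<phi>"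
          proof (cases "\<phi> \<in> {0<..<pi}")
            case True
            let ?v = "1 - (rot_R x t \<phi>)\<^sup>2"
            have v: "0 < ?v" using rot_R_Iv[OF x True] by (rule Iv_weight_pos)
            have "\<bar>spin_ker m x t \<phi>\<bar> * \<bar>f (rot_R x t \<phi>)\<bar> \<le> ?v powr (real m / 2) * \<bar>f (rot_R x t \<phi>)\<bar>"
              using spin_ker_le[of x m t \<phi>] Iv_sq[OF x] v
              by (intro mult_right_mono) (auto simp: sqrt_power_powr)
            then show ?thesis using True by (simp add: F_def abs_mult ennreal_leI mult.commute)
          qed simp
        qed
        also have "\<dots> < \<infinity>" using elim x by (simp add: less_top)
        finally show "(\<integral>\<^sup>+\<phi>. ennreal (norm (indicator {0<..<pi} \<phi> * (spin_ker m x t \<phi> * f (rot_R x t \<phi>)))) \<partial>lborel) < \<infinity>" .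
      qed measurable
    qed
  qed
qed

lemma bop_spin_avg:
  obtains C where "0 < C" "\<And>t. bop m (spin_avg m t) C"
proof -
  obtain C where C: "0 < C" "\<And>t f M. f \<in> borel_measurable borel \<Longrightarrow> 0 \<le> M \<Longrightarrow>
     norm1_le m f M \<Longrightarrow> norm1_le m (spin_avg m t f) (C * M)"
    using spin_avg_bound[OF admissible_L1] by blast
  have "bop m (spin_avg m t) C" for t
    unfolding bop_def
  proof (intro conjI ballI allI impI)
    show "AE x in lborel. x \<in> Iv \<longrightarrow> spin_avg m t (\<lambda>x. a * f x + b * g x) x = a * spin_avg m t f x + b * spin_avg m t g x"
      if f: "f \<in> L1_space m" and g: "g \<in> L1_space m" for f g a b
      using spin_avg_integrable[OF f, of t] spin_avg_integrable[OF g, of t]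
    proof eventually_elim
      case (elim x)
      show ?case
      proof
        assume x: "x \<in> Iv"
        let ?I = "\<lambda>f. \<integral>\<phi>. indicator {0<..<pi} \<phi> * (spin_ker m x t \<phi> * f (rot_R x t \<phi>)) \<partial>lborel"
        have "?I (\<lambda>x. a * f x + b * g x) = (\<integral>\<phi>. a * (indicator {0<..<pi} \<phi> * (spin_ker m x t \<phi> * f (rot_R x t \<phi>)))
            + b * (indicator {0<..<pi} \<phi> * (spin_ker m x t \<phi> * g (rot_R x t \<phi>))) \<partial>lborel)"
          by (intro Bochner_Integration.integral_cong) (auto simp: algebra_simps)
        also have "\<dots> = a * ?I f + b * ?I g" using elim x by simp
        finally show "spin_avg m t (\<lambda>x. a * f x + b * g x) x = a * spin_avg m t f x + b * spin_avg m t g x"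
          by (simp add: spin_avg_def add_divide_distrib)
      qed
    qed
    show "spin_avg m t f \<in> borel_measurable borel" if "f \<in> L1_space m" for f
      using L1_spaceD[OF that] by measurable
    show "norm1_le m (spin_avg m t f) (C * M)" if "f \<in> L1_space m" "0 \<le> M" "norm1_le m f M" for f M
      by (rule C(2)) (use that L1_spaceD[OF that(1)] in auto)
  qed (use C in auto)
  then show ?thesis using that C by blast
qed

text \<open>Tonelli applied to the norms shows that the s-integral converges absolutely for almost
  every x. Only there is the Bochner integral additive, and this is the source of linearity almost
  everywhere. The norm bound is Minkowski's integral inequality.\<close>

lemma bop_integral:
  fixes A :: "real \<Rightarrow> (real \<Rightarrow> real) \<Rightarrow> real \<Rightarrow> real"
  assumes meas: "\<And>f. f \<in> borel_measurable borel \<Longrightarrow> (\<lambda>z. A (fst z) f (snd z)) \<in> borel_measurable (borel \<Otimes>\<^sub>M borel)"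
    and [measurable]: "k \<in> borel_measurable borel" "c \<in> borel_measurable borel"
    and A: "\<And>s. k s \<noteq> 0 \<Longrightarrow> bop m (A s) (c s)" and k0: "\<And>s. 0 \<le> k s"
    and D: "(\<integral>\<^sup>+ s. ennreal (k s * c s) \<partial>lborel) \<le> ennreal D" "0 < D"
  shows "bop m (\<lambda>f x. \<integral>s. k s * A s f x \<partial>lborel) D"
proof -
  have m1: "(\<lambda>z. A (fst z) f (snd z)) \<in> borel_measurable (borel \<Otimes>\<^sub>M borel)" if "f \<in> L1_space m" for f
    by (intro meas L1_spaceD[OF that])
  have m2: "case_prod (\<lambda>s. A s f) \<in> borel_measurable (borel \<Otimes>\<^sub>M borel)" if "f \<in> L1_space m" for f
    using m1[OF that] by (simp add: case_prod_beta')
  have mf: "A s f \<in> borel_measurable borel" if "f \<in> L1_space m" for s f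
    using measurable_compose[OF measurable_Pair1' m1[OF that], of s] by simp
  have int: "AE x in lborel. x \<in> Iv \<longrightarrow> integrable lborel (\<lambda>s. k s * A s f x)" if f: "f \<in> L1_space m" for f
  proof -
    note [measurable] = m2[OF f] m1[OF f]
    obtain M where M: "0 \<le> M" "norm1_le m f M" using f by (rule L1_spaceE)
    let ?w = "\<lambda>x::real. (1 - x\<^sup>2) powr (real m / 2)"
    have "(\<integral>\<^sup>+x. (\<integral>\<^sup>+s. ennreal \<bar>k s * A s f x\<bar> * (ennreal (?w x) * indicator Iv x) \<partial>lborel) \<partial>lborel)
       = (\<integral>\<^sup>+s. (\<integral>\<^sup>+x. ennreal \<bar>k s * A s f x\<bar> * (ennreal (?w x) * indicator Iv x) \<partial>lborel) \<partial>lborel)"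
      by (rule lborel_pair.Fubini') measurable
    also have "\<dots> \<le> (\<integral>\<^sup>+s. ennreal (k s * c s) * ennreal M \<partial>lborel)"
    proof (rule nn_integral_mono)
      fix s
      note [measurable] = mf[OF f, of s]
      show "(\<integral>\<^sup>+x. ennreal \<bar>k s * A s f x\<bar> * (ennreal (?w x) * indicator Iv x) \<partial>lborel) \<le> ennreal (k s * c s) * ennreal M"
      proof (cases "k s = 0")
        case False
        have "(\<integral>\<^sup>+x. ennreal \<bar>k s * A s f x\<bar> * (ennreal (?w x) * indicator Iv x) \<partial>lborel)
          = (\<integral>\<^sup>+x. ennreal (k s) * (ennreal (\<bar>A s f x\<bar> * ?w x) * indicator Iv x) \<partial>lborel)"
          using k0[of s] by (intro nn_integral_cong) (auto simp: indicator_def abs_mult ennreal_mult'[symmetric] mult.assoc)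
        also have "\<dots> = ennreal (k s) * (\<integral>\<^sup>+x\<in>Iv. ennreal (\<bar>A s f x\<bar> * ?w x) \<partial>lborel)"
          by (rule nn_integral_cmult) measurable
        also have "\<dots> \<le> ennreal (k s) * ennreal (c s * M)"
          using bop_norm[OF A[OF False] f M] bop_pos[OF A[OF False]] M(1)
          by (intro mult_left_mono) (auto simp: norm_le_1_iff)
        also have "\<dots> = ennreal (k s * c s) * ennreal M"
          using k0[of s] bop_pos[OF A[OF False]] M(1) by (simp add: ennreal_mult'[symmetric] mult.assoc)
        finally show ?thesis .
      qed simp
    qed
    also have "\<dots> = (\<integral>\<^sup>+s. ennreal (k s * c s) \<partial>lborel) * ennreal M" by (rule nn_integral_multc) measurable
    also have "\<dots> \<le> ennreal D * ennreal M" by (intro mult_right_mono D) auto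
    also have "\<dots> < \<infinity>" by (simp add: ennreal_mult_less_top)
    finally have "AE x in lborel. (\<integral>\<^sup>+s. ennreal \<bar>k s * A s f x\<bar> * (ennreal (?w x) * indicator Iv x) \<partial>lborel) \<noteq> \<infinity>"
      by (intro nn_integral_noteq_infinite) auto
    then show ?thesis
    proof eventually_elim
      case (elim x)
      show ?case
      proof
        assume x: "x \<in> Iv"
        have [measurable]: "(\<lambda>s. A s f x) \<in> borel_measurable borel"
          using measurable_compose[OF measurable_Pair2' m1[OF f], of x] by simp
        have w: "0 < ?w x" using Iv_weight_pos[OF x] by simp
        have "(\<integral>\<^sup>+s. ennreal \<bar>k s * A s f x\<bar> \<partial>lborel) * ennreal (?w x) \<noteq> \<infinity>"
          using elim x by (simp add: nn_integral_multc)
        then have "(\<integral>\<^sup>+s. ennreal \<bar>k s * A s f x\<bar> \<partial>lborel) \<noteq> \<infinity>"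
          using w by (auto simp: ennreal_mult_eq_top_iff)
        then show "integrable lborel (\<lambda>s. k s * A s f x)"
          by (intro integrableI_bounded) (auto simp: less_top)
      qed
    qed
  qed
  show ?thesis
    unfolding bop_def
  proof (intro conjI ballI allI impI)
    show "(\<lambda>x. \<integral>s. k s * A s f x \<partial>lborel) \<in> borel_measurable borel" if f: "f \<in> L1_space m" for f
    proof -
      have [measurable]: "(\<lambda>(x, s). A s f x) \<in> borel_measurable (borel \<Otimes>\<^sub>M borel)"
        using borel_measurable_case_prod_compose[OF m2[OF f], of "\<lambda>z. snd z" "borel \<Otimes>\<^sub>M borel" "\<lambda>z. fst z"] by (simp add: case_prod_beta')
      show ?thesis by measurable
    qed
    show "norm1_le m (\<lambda>x. \<integral>s. k s * A s f x \<partial>lborel) (D * M)"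
      if f: "f \<in> L1_space m" and M: "0 \<le> M" "norm1_le m f M" for f M
    proof (rule norm_le_closed)
      fix e :: real assume e: "0 < e"
      \<comment> \<open>Minkowski's inequality above asks for positive bounds; raising M by e / D
        costs exactly e in the result.\<close>
      define M' where "M' = M + e / D"
      have M': "0 < M'" "norm1_le m f M'" using e D M by (auto simp: M'_def intro: norm_le_mono add_nonneg_pos)
      have "norm1_le m (\<lambda>x. \<integral>s. k s * A s f x \<partial>lborel) (D * M')"
      proof (rule norm_le_integral[where m = "\<lambda>s. c s * M'"])
        show "(\<integral>\<^sup>+ s. ennreal (k s * (c s * M')) \<partial>lborel) \<le> ennreal (D * M')"
        proof -
          have "(\<integral>\<^sup>+ s. ennreal (k s * (c s * M')) \<partial>lborel) = (\<integral>\<^sup>+ s. ennreal (k s * c s) * ennreal M' \<partial>lborel)"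
            using M' by (intro nn_integral_cong) (simp add: ennreal_mult''[symmetric] mult.assoc)
          also have "\<dots> = (\<integral>\<^sup>+s. ennreal (k s * c s) \<partial>lborel) * ennreal M'" by (rule nn_integral_multc) measurable
          also have "\<dots> \<le> ennreal D * ennreal M'" by (intro mult_right_mono D) auto
          finally show ?thesis using D M' by (simp add: ennreal_mult')
        qed
        show "norm1_le m (A s f) (c s * M')" if "k s \<noteq> 0" for s
          using bop_norm[OF A[OF that] f _ M'(2)] M' by simp
        show "0 < c s * M'" if "k s \<noteq> 0" for s using bop_pos[OF A[OF that]] M' by simp
      qed (use m2[OF f] k0 D M' in auto)
      then show "norm1_le m (\<lambda>x. \<integral>s. k s * A s f x \<partial>lborel) (D * M + e)"
        using D by (simp add: M'_def distrib_left)
    qed (use D M in auto)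
    show "AE x in lborel. x \<in> Iv \<longrightarrow> (\<integral>s. k s * A s (\<lambda>x. a * f x + b * g x) x \<partial>lborel)
        = a * (\<integral>s. k s * A s f x \<partial>lborel) + b * (\<integral>s. k s * A s g x \<partial>lborel)"
      if f: "f \<in> L1_space m" and g: "g \<in> L1_space m" for f g a b
    proof -
      define h where "h = (\<lambda>x. a * f x + b * g x)"
      have h: "h \<in> L1_space m" unfolding h_def by (rule L1_space_lincomb[OF f g])
      have [measurable]: "(\<lambda>z. A (fst z) f (snd z)) \<in> borel_measurable (lborel \<Otimes>\<^sub>M lborel)"
        "(\<lambda>z. A (fst z) g (snd z)) \<in> borel_measurable (lborel \<Otimes>\<^sub>M lborel)"
        "(\<lambda>z. A (fst z) h (snd z)) \<in> borel_measurable (lborel \<Otimes>\<^sub>M lborel)"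
        using m1[OF f] m1[OF g] m1[OF h] by (simp_all cong: measurable_cong_sets)
      have *: "AE s in lborel. AE x in lborel. k s \<noteq> 0 \<longrightarrow> x \<in> Iv \<longrightarrow> A s h x = a * A s f x + b * A s g x"
      proof (rule AE_I2)
        fix s
        show "AE x in lborel. k s \<noteq> 0 \<longrightarrow> x \<in> Iv \<longrightarrow> A s h x = a * A s f x + b * A s g x"
        proof (cases "k s = 0")
          case False
          show ?thesis using bop_linear[OF A[OF False] f g, of a b] unfolding h_def by eventually_elim auto
        qed simp
      qed
      have "AE x in lborel. AE s in lborel. k s \<noteq> 0 \<longrightarrow> x \<in> Iv \<longrightarrow> A s h x = a * A s f x + b * A s g x"
      proof (rule iffD1[OF lborel_pair.AE_commute[of "\<lambda>s x. k s \<noteq> 0 \<longrightarrow> x \<in> Iv \<longrightarrow> A s h x = a * A s f x + b * A s g x"] *])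
        show "{z \<in> space (lborel \<Otimes>\<^sub>M lborel). k (fst z) \<noteq> 0 \<longrightarrow> snd z \<in> Iv \<longrightarrow>
           A (fst z) h (snd z) = a * A (fst z) f (snd z) + b * A (fst z) g (snd z)} \<in> sets (lborel \<Otimes>\<^sub>M lborel)"
          by measurable
      qed
      then show ?thesis using int[OF f] int[OF g]
      proof eventually_elim
        case (elim x)
        show ?case
        proof
          assume x: "x \<in> Iv"
          have mx: "(\<lambda>s. A s f x) \<in> borel_measurable borel" if "f \<in> L1_space m" for f
            using measurable_compose[OF measurable_Pair2' m1[OF that], of x] by simp
          note [measurable] = mx[OF f] mx[OF g] mx[OF h]
          have "(\<integral>s. k s * A s h x \<partial>lborel) = (\<integral>s. a * (k s * A s f x) + b * (k s * A s g x) \<partial>lborel)"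
          proof (rule integral_cong_AE)
            show "AE s in lborel. k s * A s h x = a * (k s * A s f x) + b * (k s * A s g x)"
              using elim(1)
            proof eventually_elim
              case (elim s)
              then show ?case using x by (cases "k s = 0") (auto simp: algebra_simps)
            qed
          qed measurable
          also have "\<dots> = a * (\<integral>s. k s * A s f x \<partial>lborel) + b * (\<integral>s. k s * A s g x \<partial>lborel)"
            using elim(2,3) x by simp
          finally show "(\<integral>s. k s * A s (\<lambda>x. a * f x + b * g x) x \<partial>lborel)
            = a * (\<integral>s. k s * A s f x \<partial>lborel) + b * (\<integral>s. k s * A s g x \<partial>lborel)" by (simp add: h_def)
        qed
      qed
    qed
  qed (use D in auto)
qed

text \<open>If f is at distance d from a polynomial P, the difference of the two operators at f has
  norm at most (C + D) d, since they agree at P.\<close>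

lemma bop_agree:
  assumes A: "bop m A C" and B: "bop m B D"
    and P: "\<And>P. AE x in lborel. x \<in> Iv \<longrightarrow> A (poly P) x = B (poly P) x" and f: "f \<in> L1_space m"
  shows "AE x in lborel. x \<in> Iv \<longrightarrow> A f x = B f x"
proof -
  have pos: "0 < C" "0 < D" using bop_pos[OF A] bop_pos[OF B] by auto
  have [measurable]: "A f \<in> borel_measurable borel" "B f \<in> borel_measurable borel"
    using bop_measurable[OF A f] bop_measurable[OF B f] by auto
  have "norm1_le m (\<lambda>x. A f x - B f x) (0 + e)" if e: "0 < e" for e
  proof -
    define d where "d = e / (C + D)"
    have d: "0 < d" using e pos by (simp add: d_def)
    obtain P where P: "norm1_le m (\<lambda>x. f x - poly P x) d" using polynomials_dense[OF f d] by blast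
    have fP: "(\<lambda>x. f x - poly P x) \<in> L1_space m" by (intro L1_space_diff f poly_in_L1_space)
    have n1: "norm1_le m (\<lambda>x. A (\<lambda>x. f x - poly P x) x - B (\<lambda>x. f x - poly P x) x) (C * d + D * d)"
      using d pos bop_measurable[OF A fP] bop_measurable[OF B fP]
      by (intro norm_le_diff bop_norm[OF A fP _ P] bop_norm[OF B fP _ P]) auto
    have ae: "AE x in lborel. x \<in> Iv \<longrightarrow> A f x - B f x = A (\<lambda>x. f x - poly P x) x - B (\<lambda>x. f x - poly P x) x"
      using bop_diff[OF A f poly_in_L1_space[of P]] bop_diff[OF B f poly_in_L1_space[of P]] assms(3)[of P]
      by eventually_elim auto
    have eq: "C * d + D * d = 0 + e" proof -
      have "C * d + D * d = (C + D) * d" by (simp only: distrib_right)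
      then show ?thesis using pos by (simp add: d_def)
    qed
    have "norm1_le m (\<lambda>x. A f x - B f x) (C * d + D * d)"
      by (rule norm_le_cong_AE[OF order_refl n1 ae]) (use pos d in simp)
    then show ?thesis by (simp only: eq)
  qed
  then have "norm1_le m (\<lambda>x. A f x - B f x) 0" by (rule norm_le_closed[OF order_refl order_refl])
  then have "AE x in lborel. x \<in> Iv \<longrightarrow> A f x - B f x = 0" by (rule norm_le_eq_0[rotated]) auto
  then show ?thesis by eventually_elim auto
qed

section \<open>Limits of polynomials of bounded degree\<close>

lemma lagrange_interpolation_ex:
  fixes T :: "real set" and v :: "real \<Rightarrow> real"
  assumes "finite T" "card T = Suc d"
  obtains L where "\<And>x. x \<in> T \<Longrightarrow> degree (L x) \<le> d"
    "\<And>q z. degree q \<le> d \<Longrightarrow> poly q z = (\<Sum>x\<in>T. poly q x * poly (L x) z)"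
proof -
  define L where "L x = smult (1 / (\<Prod>y\<in>T - {x}. x - y)) (\<Prod>y\<in>T - {x}. [:- y, 1:])" for x
  have dL: "degree (L x) \<le> d" if "x \<in> T" for x
  proof -
    have "degree (\<Prod>y\<in>T - {x}. [:- y, 1:]) \<le> (\<Sum>y\<in>T - {x}. degree [:- y, 1:])"
      using degree_prod_sum_le[of "T - {x}" "\<lambda>y. [:- y, 1:]"] assms by (simp add: o_def)
    also have "\<dots> = d" using assms that by simp
    finally show ?thesis unfolding L_def by (rule order_trans[OF degree_smult_le])
  qed
  have LT: "poly (L x) z = (if x = z then 1 else 0)" if "x \<in> T" "z \<in> T" for x z
  proof (cases "x = z")
    case True
    have "(\<Prod>y\<in>T - {x}. x - y) \<noteq> 0" using assms by auto
    then show ?thesis using True by (simp add: L_def poly_prod)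
  next
    case False
    then have "(\<Prod>y\<in>T - {x}. z - y) = 0" using assms that by (intro prod_zero) auto
    then show ?thesis using False by (simp add: L_def poly_prod)
  qed
  have "poly q z = (\<Sum>x\<in>T. poly q x * poly (L x) z)" if q: "degree q \<le> d" for q z
  proof -
    have "q = (\<Sum>x\<in>T. smult (poly q x) (L x))"
    proof (rule poly_eqI_degree)
      show "poly q y = poly (\<Sum>x\<in>T. smult (poly q x) (L x)) y" if "y \<in> T" for y
        using that assms by (simp add: poly_sum LT if_distrib[of "\<lambda>z. _ * z"] cong: if_cong)
      show "card T > degree q" using q assms by simp
      have "degree (\<Sum>x\<in>T. smult (poly q x) (L x)) \<le> d"
        by (rule degree_sum_le) (use assms dL in \<open>auto intro: order_trans[OF degree_smult_le]\<close>)
      then show "card T > degree (\<Sum>x\<in>T. smult (poly q x) (L x))" using assms by simp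
    qed
    then have "poly q z = poly (\<Sum>x\<in>T. smult (poly q x) (L x)) z" by simp
    then show ?thesis by (simp add: poly_sum)
  qed
  then show ?thesis using that dL by blast
qed

text \<open>Polynomials of degree at most d form a closed subspace. The approximating polynomials
  converge almost everywhere, in particular at d + 1 points; interpolation at these points expresses
  all of them through their values there and so identifies the limit.\<close>

lemma bop_limit_poly:
  assumes A: "bop m A C" and P: "\<And>P. \<exists>Q. degree Q \<le> d \<and> (AE x in lborel. x \<in> Iv \<longrightarrow> A (poly P) x = poly Q x)"
    and f: "f \<in> L1_space m"
  shows "\<exists>Q. degree Q \<le> d \<and> (AE x in lborel. x \<in> Iv \<longrightarrow> A f x = poly Q x)"
proof -
  have C: "0 < C" by (rule bop_pos[OF A])
  have [measurable]: "A f \<in> borel_measurable borel" by (rule bop_measurable[OF A f])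
  \<comment> \<open>Geometric errors are summable, so the sum of the errors is finite almost
    everywhere and convergence follows without passing to a subsequence.\<close>
  have "\<forall>k::nat. \<exists>P. norm1_le m (\<lambda>x. f x - poly P x) ((1 / 2) ^ k)"
    using polynomials_dense[OF f] by simp
  then obtain p where p: "\<And>k::nat. norm1_le m (\<lambda>x. f x - poly (p k) x) ((1 / 2) ^ k)" by metis
  define q where "q k = (SOME Q. degree Q \<le> d \<and> (AE x in lborel. x \<in> Iv \<longrightarrow> A (poly (p k)) x = poly Q x))" for k
  have q: "degree (q k) \<le> d" "AE x in lborel. x \<in> Iv \<longrightarrow> A (poly (p k)) x = poly (q k) x" for k
    using someI_ex[OF P[of "p k"]] unfolding q_def by blast+
  have nq: "norm1_le m (\<lambda>x. A f x - poly (q k) x) (C * (1 / 2) ^ k)" for k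
  proof -
    have fP: "(\<lambda>x. f x - poly (p k) x) \<in> L1_space m" by (intro L1_space_diff f poly_in_L1_space)
    have "AE x in lborel. x \<in> Iv \<longrightarrow> A f x - poly (q k) x = A (\<lambda>x. f x - poly (p k) x) x"
      using bop_diff[OF A f poly_in_L1_space[of "p k"]] q(2)[of k] by eventually_elim auto
    then show ?thesis using C by (intro norm_le_cong_AE[OF _ bop_norm[OF A fP _ p]]) auto
  qed
  let ?h = "\<lambda>k x. ennreal (\<bar>A f x - poly (q k) x\<bar> * (1 - x\<^sup>2) powr (real m / 2)) * indicator Iv x"
  have "(\<integral>\<^sup>+x. (\<Sum>k. ?h k x) \<partial>lborel) = (\<Sum>k. \<integral>\<^sup>+x. ?h k x \<partial>lborel)"
    by (rule nn_integral_suminf) measurable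
  also have "\<dots> \<le> (\<Sum>k. ennreal (C * (1 / 2) ^ k))"
    using nq C by (intro suminf_le) (auto simp: norm_le_1_iff)
  also have "\<dots> = ennreal (\<Sum>k. C * (1 / 2) ^ k)"
    using C by (intro suminf_ennreal2) (auto intro!: summable_mult summable_geometric)
  also have "\<dots> < \<infinity>" by simp
  finally have "AE x in lborel. (\<Sum>k. ?h k x) \<noteq> \<infinity>"
    by (intro nn_integral_noteq_infinite) auto
  then have lim: "AE x in lborel. x \<in> Iv \<longrightarrow> (\<lambda>k. poly (q k) x) \<longlonglongrightarrow> A f x"
  proof eventually_elim
    case (elim x)
    show ?case
    proof
      assume x: "x \<in> Iv"
      have w: "0 < (1 - x\<^sup>2) powr (real m / 2)" using Iv_weight_pos[OF x] by simp
      have "summable (\<lambda>k. \<bar>A f x - poly (q k) x\<bar> * (1 - x\<^sup>2) powr (real m / 2))"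
        using elim x by (intro summable_suminf_not_top) auto
      then have "(\<lambda>k. \<bar>A f x - poly (q k) x\<bar> * (1 - x\<^sup>2) powr (real m / 2) / (1 - x\<^sup>2) powr (real m / 2)) \<longlonglongrightarrow> 0 / (1 - x\<^sup>2) powr (real m / 2)"
        using w by (intro tendsto_divide summable_LIMSEQ_zero tendsto_const) auto
      then have "(\<lambda>k. \<bar>A f x - poly (q k) x\<bar>) \<longlonglongrightarrow> 0" using w by simp
      then have "(\<lambda>k. A f x - poly (q k) x) \<longlonglongrightarrow> 0" by (simp add: tendsto_rabs_zero_iff)
      then have "(\<lambda>k. A f x - (A f x - poly (q k) x)) \<longlonglongrightarrow> A f x - 0"
        by (intro tendsto_diff tendsto_const)
      then show "(\<lambda>k. poly (q k) x) \<longlonglongrightarrow> A f x" by simp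
    qed
  qed
  define S where "S = {x \<in> Iv. (\<lambda>k. poly (q k) x) \<longlonglongrightarrow> A f x}"
  have "infinite S"
  proof
    assume "finite S"
    then have "AE x in lborel. x \<notin> S" 
      by (intro AE_not_in finite_imp_null_set_lborel)
    with lim have "AE x in lborel. x \<notin> Iv" by eventually_elim (auto simp: S_def)
    from AE_E[OF this] obtain N where N0: "{x \<in> space lborel. \<not> x \<notin> Iv} \<subseteq> N"
      and N: "emeasure lborel N = 0" "N \<in> sets lborel" by blast
    have N1: "Iv \<subseteq> N" using N0 by (auto simp: subset_eq)
    have "emeasure lborel Iv \<le> emeasure lborel N" using N N1 by (intro emeasure_mono) auto
    then have "emeasure lborel Iv = 0" using N by simp
    moreover have "emeasure lborel Iv = ennreal 2" by (subst emeasure_lborel_Ioo) auto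
    ultimately show False by (metis ennreal_eq_0_iff not_numeral_le_zero)
  qed
  then obtain T where T: "finite T" "card T = Suc d" "T \<subseteq> S"
    using infinite_arbitrarily_large by blast
  obtain L where L: "\<And>x. x \<in> T \<Longrightarrow> degree (L x) \<le> d"
    "\<And>q z. degree q \<le> d \<Longrightarrow> poly q z = (\<Sum>x\<in>T. poly q x * poly (L x) z)"
    using lagrange_interpolation_ex[OF T(1,2)] by metis
  define Q where "Q = (\<Sum>x\<in>T. smult (A f x) (L x))"
  have "degree Q \<le> d"
    unfolding Q_def by (rule degree_sum_le) (use T L in \<open>auto intro: order_trans[OF degree_smult_le]\<close>)
  moreover have "A f z = poly Q z" if "(\<lambda>k. poly (q k) z) \<longlonglongrightarrow> A f z" for z
  proof -
    have "(\<lambda>k. \<Sum>x\<in>T. poly (q k) x * poly (L x) z) \<longlonglongrightarrow> (\<Sum>x\<in>T. A f x * poly (L x) z)"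
      using T(3) by (intro tendsto_sum tendsto_mult tendsto_const) (auto simp: S_def)
    then have "(\<lambda>k. poly (q k) z) \<longlonglongrightarrow> poly Q z"
      unfolding Q_def L(2)[OF q(1), symmetric] by (simp add: poly_sum)
    then show ?thesis using that LIMSEQ_unique by blast
  qed
  ultimately show ?thesis using lim by (intro exI[of _ Q]) (auto elim: eventually_mono)
qed

section \<open>Eigenpolynomials of the Jacobi operator\<close>

definition lam :: "nat \<Rightarrow> nat \<Rightarrow> real" where
  "lam m k = real k * (real k + 2 * real m + 1)"

lemma lam_strict_mono: "j < k \<Longrightarrow> lam m j < lam m k"
proof -
  assume "j < k"
  then have "real j < real k" by simp
  then show ?thesis unfolding lam_def by (intro mult_strict_mono') auto
qed

lemma lam_pos: "0 < k \<Longrightarrow> 0 < lam m k"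
  by (auto simp: lam_def intro!: mult_pos_pos)

lemma coeff_jacobi_op:
  "coeff (jacobi_op m P) j = (real j + 2) * (real j + 1) * coeff P (j + 2) - lam m j * coeff P j"
proof (cases j)
  case 0
  then show ?thesis
    by (simp add: jacobi_op_def lam_def coeff_pderiv coeff_pCons numeral_2_eq_2 algebra_simps)
next
  case (Suc i)
  then show ?thesis
    by (cases i) (simp_all add: jacobi_op_def lam_def coeff_pderiv coeff_pCons numeral_2_eq_2 algebra_simps)
qed

text \<open>In the basis of monomials the operator is triangular with diagonal entries
  \<open>- lam m j\<close>. For j < n <= k these differ from \<open>- lam m k\<close>, so the
  coefficients of r can be determined from the top downwards.\<close>

lemma jacobi_resolvent:
  assumes "n \<le> k" "\<And>j. n \<le> j \<Longrightarrow> coeff q j = 0"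
  shows "\<exists>r. (\<forall>j\<ge>n. coeff r j = 0) \<and> jacobi_op m r + smult (lam m k) r = q"
  using assms
proof (induction n arbitrary: q)
  case 0
  then have "q = 0" by (simp add: poly_eq_iff)
  then show ?case by (intro exI[of _ 0]) (simp add: jacobi_op_def)
next
  case (Suc n)
  have ne: "lam m k - lam m n \<noteq> 0" using lam_strict_mono[of n k m] Suc.prems(1) by simp
  define a where "a = coeff q n / (lam m k - lam m n)"
  have a: "(lam m k - lam m n) * a = coeff q n" using ne by (simp add: a_def)
  define r0 where "r0 = monom a n"
  define q' where "q' = q - (jacobi_op m r0 + smult (lam m k) r0)"
  have "coeff q' j = 0" if "n \<le> j" for j
  proof (cases "j = n")
    case True
    have "coeff q' n = coeff q n - (lam m k - lam m n) * a"
      by (simp add: q'_def r0_def coeff_jacobi_op algebra_simps)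
    then show ?thesis using a True by simp
  next
    case False
    then show ?thesis using Suc.prems(2)[of j] that by (simp add: q'_def r0_def coeff_jacobi_op)
  qed
  then obtain r1 where r1: "\<forall>j\<ge>n. coeff r1 j = 0" "jacobi_op m r1 + smult (lam m k) r1 = q'"
    using Suc.IH[of q'] Suc.prems(1) by auto
  have "jacobi_op m (r0 + r1) = jacobi_op m r0 + jacobi_op m r1"
    by (simp add: poly_eq_iff coeff_jacobi_op algebra_simps)
  then have "jacobi_op m (r0 + r1) + smult (lam m k) (r0 + r1) = q"
    using r1(2) by (simp add: q'_def smult_add_right algebra_simps)
  moreover have "\<forall>j\<ge>Suc n. coeff (r0 + r1) j = 0" using r1(1) by (simp add: r0_def)
  ultimately show ?case by blast
qed

text \<open>The monic Jacobi polynomial of degree k with both parameters equal to m, or equivalently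
  the Gegenbauer polynomial of parameter m + 1/2 up to a factor.\<close>

definition eigpoly :: "nat \<Rightarrow> nat \<Rightarrow> real poly" where
  "eigpoly m k = (SOME \<phi>. jacobi_op m \<phi> = smult (- lam m k) \<phi> \<and> coeff \<phi> k = 1 \<and> (\<forall>j>k. coeff \<phi> j = 0))"

lemma eigpoly: "jacobi_op m (eigpoly m k) = smult (- lam m k) (eigpoly m k)"
  "coeff (eigpoly m k) k = 1" "j > k \<Longrightarrow> coeff (eigpoly m k) j = 0"
proof -
  let ?q = "- (jacobi_op m (monom 1 k) + smult (lam m k) (monom 1 k))"
  have "coeff ?q j = 0" if "k \<le> j" for j
    using that by (cases "j = k") (simp_all add: coeff_jacobi_op)
  then obtain r where r: "\<forall>j\<ge>k. coeff r j = 0" "jacobi_op m r + smult (lam m k) r = ?q"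
    using jacobi_resolvent[of k k ?q m] by auto
  have "jacobi_op m (monom 1 k + r) = jacobi_op m (monom 1 k) + jacobi_op m r"
    by (simp add: poly_eq_iff coeff_jacobi_op algebra_simps)
  then have "jacobi_op m (monom 1 k + r) = smult (- lam m k) (monom 1 k + r)"
    using r(2) by (simp add: smult_add_right algebra_simps)
  then have "\<exists>\<phi>. jacobi_op m \<phi> = smult (- lam m k) \<phi> \<and> coeff \<phi> k = 1 \<and> (\<forall>j>k. coeff \<phi> j = 0)"
    using r(1) by (intro exI[of _ "monom 1 k + r"]) simp
  from someI_ex[OF this] show "jacobi_op m (eigpoly m k) = smult (- lam m k) (eigpoly m k)"
    "coeff (eigpoly m k) k = 1" "j > k \<Longrightarrow> coeff (eigpoly m k) j = 0"
    unfolding eigpoly_def by auto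
qed

lemma degree_eigpoly: "degree (eigpoly m k) \<le> k"
  using eigpoly(3) by (auto intro: degree_le)

lemma eigpoly_0: "eigpoly m 0 = 1"
proof (rule poly_eqI)
  show "coeff (eigpoly m 0) n = coeff 1 n" for n
    using eigpoly(2)[of m 0] eigpoly(3)[of 0 n m] by (cases n) (auto simp: one_pCons)
qed

text \<open>One monic eigenpolynomial in each degree spans everything: subtracting the multiple
  given by the top coefficient lowers the degree. Almost everywhere linearity is then enough to
  reduce operator identities to eigenpolynomials.\<close>

lemma eigpoly_induct [case_names zero step]:
  assumes "S 0" "\<And>P c k. S P \<Longrightarrow> S (P + smult c (eigpoly m k))"
  shows "S P"
proof -
  have "\<forall>P. (\<forall>j\<ge>n. coeff P j = 0) \<longrightarrow> S P" for n
  proof (induction n)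
    case 0
    then show ?case using assms(1) by (auto simp: poly_eq_iff[of _ 0, simplified, symmetric])
  next
    case (Suc n)
    show ?case
    proof (intro allI impI)
      fix P :: "real poly" assume P: "\<forall>j\<ge>Suc n. coeff P j = 0"
      define Q where "Q = P - smult (coeff P n) (eigpoly m n)"
      have "\<forall>j\<ge>n. coeff Q j = 0"
      proof (intro allI impI)
        fix j assume "n \<le> j"
        then show "coeff Q j = 0"
          using P eigpoly(2)[of m n] eigpoly(3)[of n j m] by (cases "j = n") (auto simp: Q_def)
      qed
      then have "S Q" using Suc.IH by blast
      then have "S (Q + smult (coeff P n) (eigpoly m n))" by (rule assms(2))
      then show "S P" by (simp add: Q_def)
    qed
  qed
  moreover have "\<forall>j\<ge>Suc (degree P). coeff P j = 0" by (auto intro: coeff_eq_0)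
  ultimately show ?thesis by blast
qed

text \<open>Replacing phi by pi - phi undoes the sign of t in R and turns both q and the exponential
  into minus their conjugates. The two signs cancel in the m-th powers, and conjugation leaves the
  real part alone.\<close>

lemma spin_avg_even: "spin_avg m (- t) f x = spin_avg m t f x"
proof -
  let ?F = "\<lambda>t \<phi>. indicator {0<..<pi} \<phi> * (spin_ker m x t \<phi> * f (rot_R x t \<phi>))"
  have R: "rot_R x (- t) (pi - \<phi>) = rot_R x t \<phi>" for \<phi>
    by (simp add: rot_R_def)
  have q: "rot_q x (- t) (pi - \<phi>) = - cnj (rot_q x t \<phi>)" for \<phi>
    by (simp add: rot_q_def complex_eq_iff)
  have K: "spin_ker m x (- t) (pi - \<phi>) = spin_ker m x t \<phi>" for \<phi>
  proof -
    have "cis (real m * (pi - \<phi>)) = cis (pi - \<phi>) ^ m" by (simp only: Complex.DeMoivre)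
    also have "cis (pi - \<phi>) = - cnj (cis \<phi>)" by (simp add: complex_eq_iff)
    finally have "cis (real m * (pi - \<phi>)) * rot_q x (- t) (pi - \<phi>) ^ m = (- cnj (cis \<phi>) * - cnj (rot_q x t \<phi>)) ^ m"
      by (simp only: q power_mult_distrib)
    also have "\<dots> = cnj (cis \<phi> ^ m * rot_q x t \<phi> ^ m)" by (simp add: power_mult_distrib)
    also have "cis \<phi> ^ m = cis (real m * \<phi>)" by (rule Complex.DeMoivre)
    finally have eq: "cis (real m * (pi - \<phi>)) * rot_q x (- t) (pi - \<phi>) ^ m = cnj (cis (real m * \<phi>) * rot_q x t \<phi> ^ m)" .
    have Re_cnj: "Re (cnj z) = Re z" for z by simp
    show ?thesis by (simp only: spin_ker_def eq Re_cnj)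
  qed
  have "(\<integral>\<phi>. ?F (- t) \<phi> \<partial>lborel) = (\<integral>\<phi>. ?F (- t) (pi + (- 1) * \<phi>) \<partial>lborel)"
    using lborel_integral_real_affine[of "-1" "?F (- t)" pi] by simp
  also have "\<dots> = (\<integral>\<phi>. ?F t \<phi> \<partial>lborel)"
    by (intro Bochner_Integration.integral_cong) (auto simp: R K indicator_def)
  finally show ?thesis by (simp add: spin_avg_def)
qed

lemma spin_avg_0:
  assumes x: "x \<in> Iv"
  shows "spin_avg m 0 f x = f x"
proof -
  have s: "sqrt (1 - x\<^sup>2) > 0" using Iv_weight_pos[OF x] by simp
  have "spin_ker m x 0 \<phi> = sqrt (1 - x\<^sup>2) ^ m" for \<phi>
  proof -
    have q: "rot_q x 0 \<phi> = of_real (sqrt (1 - x\<^sup>2)) * cis (- \<phi>)"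
      by (simp add: rot_q_def complex_eq_iff)
    have "cis (real m * \<phi>) * rot_q x 0 \<phi> ^ m = of_real (sqrt (1 - x\<^sup>2) ^ m) * (cis (real m * \<phi>) * cis (real m * (- \<phi>)))"
      unfolding q power_mult_distrib Complex.DeMoivre by simp
    also have "cis (real m * \<phi>) * cis (real m * (- \<phi>)) = 1" by (simp add: cis_mult)
    finally show ?thesis by (simp add: spin_ker_def)
  qed
  then have "(\<integral>\<phi>. indicator {0<..<pi} \<phi> * (spin_ker m x 0 \<phi> * f (rot_R x 0 \<phi>)) \<partial>lborel)
    = (\<integral>\<phi>. indicator {0<..<pi} \<phi> * (sqrt (1 - x\<^sup>2) ^ m * f x) \<partial>lborel)"
    by (simp add: rot_R_def)
  also have "\<dots> = pi * (sqrt (1 - x\<^sup>2) ^ m * f x)" by simp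
  finally show ?thesis using s by (simp add: spin_avg_def)
qed

subsection \<open>Uniqueness for the differential equation\<close>

text \<open>An energy estimate: \<open>y'\<^sup>2 + y\<^sup>2\<close> grows at most exponentially away from the singular point \<open>t = \<pi>\<close>.\<close>

lemma spin_ode_unique:
  fixes y y1 y2 :: "real \<Rightarrow> real"
  assumes d: "\<And>t. (y has_real_derivative y1 t) (at t)" "\<And>t. (y1 has_real_derivative y2 t) (at t)"
    and ode: "\<And>t. 0 < t \<Longrightarrow> t < pi \<Longrightarrow> y2 t + cos t / sin t * y1 t - 2 * (real m)\<^sup>2 / (1 + cos t) * y t = - L * y t"
    and init: "y 0 = 0" "y1 0 = 0" and t: "0 \<le> t" "t < pi"
  shows "y t = 0"
proof (cases "t = 0")
  case False
  then have t0: "0 < t" using t by simp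
  define K where "K = 2 * \<bar>cos t / sin t\<bar> + (2 * (real m)\<^sup>2 / (1 + cos t) + \<bar>L\<bar> + 1)"
  define E where "E s = (y1 s)\<^sup>2 + (y s)\<^sup>2" for s
  have dE: "(E has_real_derivative 2 * y1 s * y2 s + 2 * y s * y1 s) (at s)" for s
    unfolding E_def[abs_def] by (auto intro!: derivative_eq_intros d)
  have le: "2 * y1 s * y2 s + 2 * y s * y1 s \<le> K * E s" if s: "0 < s" "s < t" for s
  proof -
    have ss: "sin s > 0" "sin t > 0" using s t sin_gt_zero by auto
    have cs: "cos t \<le> cos s" using s t by (intro cos_monotone_0_pi_le) auto
    have ct: "0 < 1 + cos t" using t0 t cos_monotone_0_pi[of t pi] by simp
    \<comment> \<open>The cotangent decreases, so on (0, t) the damping coefficient is bounded below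
      by its value at t. Its singularity at 0 has the favourable sign, which is why the data at the
      singular point 0 determine the solution.\<close>
    have cot: "cos t / sin t \<le> cos s / sin s"
    proof -
      have "0 \<le> sin (t - s)" using s t by (intro sin_ge_zero) auto
      then have "cos t * sin s \<le> cos s * sin t" by (simp add: sin_diff algebra_simps)
      then show ?thesis using ss by (simp add: divide_simps mult.commute)
    qed
    define A where "A = 2 * (real m)\<^sup>2 / (1 + cos s) - L + 1"
    have "2 * (real m)\<^sup>2 / (1 + cos s) \<le> 2 * (real m)\<^sup>2 / (1 + cos t)" "0 \<le> 2 * (real m)\<^sup>2 / (1 + cos s)"
      using cs ct by (auto intro!: divide_left_mono divide_nonneg_nonneg)
    then have A: "\<bar>A\<bar> \<le> 2 * (real m)\<^sup>2 / (1 + cos t) + \<bar>L\<bar> + 1" unfolding A_def by linarith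
    have y2: "y2 s = - (cos s / sin s) * y1 s + (A - 1) * y s"
      using ode[of s] s t unfolding A_def by (simp add: algebra_simps)
    have "2 * y1 s * y2 s + 2 * y s * y1 s = - 2 * (cos s / sin s) * (y1 s)\<^sup>2 + A * (2 * (y1 s * y s))"
      unfolding y2 by (simp add: power2_eq_square algebra_simps)
    also have "- 2 * (cos s / sin s) * (y1 s)\<^sup>2 \<le> 2 * \<bar>cos t / sin t\<bar> * (y1 s)\<^sup>2"
    proof -
      have "- 2 * (cos s / sin s) \<le> 2 * \<bar>cos t / sin t\<bar>"
        using cot abs_ge_minus_self[of "cos t / sin t"] by linarith
      then show ?thesis by (rule mult_right_mono) simp
    qed
    also have "A * (2 * (y1 s * y s)) \<le> \<bar>A\<bar> * ((y1 s)\<^sup>2 + (y s)\<^sup>2)"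
    proof -
      have "\<bar>2 * (y1 s * y s)\<bar> \<le> (y1 s)\<^sup>2 + (y s)\<^sup>2"
        using zero_le_power2[of "y1 s + y s"] zero_le_power2[of "y1 s - y s"] by (simp add: power2_eq_square algebra_simps abs_le_iff)
      then have "\<bar>A * (2 * (y1 s * y s))\<bar> \<le> \<bar>A\<bar> * ((y1 s)\<^sup>2 + (y s)\<^sup>2)"
        unfolding abs_mult by (intro mult_left_mono) (auto simp: abs_mult)
      then show ?thesis by linarith
    qed
    also have "2 * \<bar>cos t / sin t\<bar> * (y1 s)\<^sup>2 + \<bar>A\<bar> * ((y1 s)\<^sup>2 + (y s)\<^sup>2)
      \<le> 2 * \<bar>cos t / sin t\<bar> * E s + (2 * (real m)\<^sup>2 / (1 + cos t) + \<bar>L\<bar> + 1) * E s"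
      unfolding E_def by (intro add_mono mult_left_mono mult_right_mono A) auto
    finally show ?thesis by (simp add: K_def algebra_simps)
  qed
  define F where "F s = exp (- K * s) * E s" for s
  have "F t \<le> F 0"
  proof (rule DERIV_nonpos_imp_decreasing_open[of 0 t F])
    show "0 \<le> t" by fact
    fix s assume s: "0 < s" "s < t"
    have "(F has_real_derivative exp (- K * s) * ((2 * y1 s * y2 s + 2 * y s * y1 s) - K * E s)) (at s)"
      unfolding F_def[abs_def] by (auto intro!: derivative_eq_intros dE simp: algebra_simps)
    moreover have "exp (- K * s) * ((2 * y1 s * y2 s + 2 * y s * y1 s) - K * E s) \<le> 0"
      using le[OF s] by (intro mult_nonneg_nonpos) auto
    ultimately show "\<exists>z. (F has_real_derivative z) (at s) \<and> z \<le> 0" by blast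
  next
    have "(F has_real_derivative exp (- K * s) * ((2 * y1 s * y2 s + 2 * y s * y1 s) - K * E s)) (at s)" for s
      unfolding F_def[abs_def] by (auto intro!: derivative_eq_intros dE simp: algebra_simps)
    then show "continuous_on {0..t} F" by (meson DERIV_isCont continuous_at_imp_continuous_on)
  qed
  then have "exp (- K * t) * E t \<le> 0" by (simp add: F_def E_def init)
  then have "E t \<le> 0" by (simp add: mult_le_0_iff)
  then have "(y t)\<^sup>2 \<le> 0" unfolding E_def using zero_le_power2[of "y1 t"] by linarith
  then show ?thesis by simp
qed (use init in simp)

section \<open>Lebesgue integrals of continuous functions over open intervals\<close>

lemma lborel_integral_continuous:
  fixes F :: "real \<Rightarrow> real"
  assumes "continuous_on {a..b} F"
  shows "(\<integral>s. indicator {a<..<b} s * F s \<partial>lborel) = integral {a..b} F"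
    and "integrable lborel (\<lambda>s. indicator {a<..<b} s * F s)"
proof -
  have si: "set_integrable lborel {a..b} F" by (rule borel_integrable_atLeastAtMost'[OF assms])
  have [measurable]: "(\<lambda>s. indicator {a..b} s * F s) \<in> borel_measurable borel"
    using si by (auto simp: set_integrable_def dest: borel_measurable_integrable)
  have eq: "indicator {a<..<b} s * F s = indicator {a<..<b} s * (indicator {a..b} s * F s)" for s
    by (auto simp: indicator_def)
  have "AE s in lborel. s \<noteq> a \<and> s \<noteq> b"
    using AE_lborel_singleton[of a] AE_lborel_singleton[of b] by eventually_elim auto
  then have ae: "AE s in lborel. indicator {a<..<b} s * F s = indicator {a..b} s *\<^sub>R F s"
    by eventually_elim (auto simp: indicator_def)
  have "(\<integral>s. indicator {a<..<b} s * F s \<partial>lborel) = (\<integral>s. indicator {a..b} s *\<^sub>R F s \<partial>lborel)"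
    by (rule integral_cong_AE) (use ae in \<open>auto simp: eq\<close>)
  also have "\<dots> = integral {a..b} F"
    using set_borel_integral_eq_integral(2)[OF si] by (simp add: set_lebesgue_integral_def)
  finally show "(\<integral>s. indicator {a<..<b} s * F s \<partial>lborel) = integral {a..b} F" .
  show "integrable lborel (\<lambda>s. indicator {a<..<b} s * F s)"
    using si unfolding set_integrable_def
    by (rule integrable_cong_AE_imp) (use ae in \<open>auto simp: eq elim: eventually_mono\<close>)
qed

lemma lborel_integral_FTC:
  fixes F f :: "real \<Rightarrow> real"
  assumes ab: "a \<le> b" and F: "continuous_on {a..b} F" and f: "continuous_on {a..b} f"
    and d: "\<And>s. a < s \<Longrightarrow> s < b \<Longrightarrow> (F has_real_derivative f s) (at s)"
  shows "(\<integral>s. indicator {a<..<b} s * f s \<partial>lborel) = F b - F a"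
proof -
  have "(f has_integral (F b - F a)) {a..b}"
    by (rule fundamental_theorem_of_calculus_interior[OF ab F])
       (use d in \<open>auto simp: has_real_derivative_iff_has_vector_derivative[symmetric]\<close>)
  then show ?thesis using lborel_integral_continuous(1)[OF f] by (simp add: integral_unique)
qed

subsection \<open>Eigenfunctions\<close>

definition cw :: "nat \<Rightarrow> real \<Rightarrow> real" where "cw m t = cos (t / 2) ^ (2 * m)"

definition multiplier :: "nat \<Rightarrow> nat \<Rightarrow> (real \<Rightarrow> real) \<Rightarrow> bool" where
  "multiplier m k g \<longleftrightarrow> continuous_on UNIV g \<and> g 0 = 1
    \<and> (\<forall>x\<in>Iv. \<forall>t. 0 \<le> t \<longrightarrow> t < pi \<longrightarrow> spin_avg m t (poly (eigpoly m k)) x = g t * poly (eigpoly m k) x)"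

lemma tan_half_identities:
  fixes t :: real
  assumes "cos (t / 2) \<noteq> 0"
  defines "\<theta> \<equiv> sin (t / 2) / cos (t / 2)"
  shows "sin t * \<theta> = 1 - cos t" "\<theta> * (1 + cos t) = sin t"
proof -
  have st: "sin t = 2 * sin (t / 2) * cos (t / 2)" using sin_double[of "t / 2"] by simp
  have ct: "cos t = 2 * (cos (t / 2))\<^sup>2 - 1" "cos t = 1 - 2 * (sin (t / 2))\<^sup>2"
    using cos_double_cos[of "t / 2"] cos_double_sin[of "t / 2"] by simp_all
  show "sin t * \<theta> = 1 - cos t" using assms by (simp add: \<theta>_def st ct(2) power2_eq_square)
  show "\<theta> * (1 + cos t) = sin t" using assms by (simp add: \<theta>_def st ct(1) power2_eq_square)
qed

lemma cos_half_pos: "0 \<le> t \<Longrightarrow> t < pi \<Longrightarrow> 0 < cos (t / 2)"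
  by (rule cos_gt_zero_pi) auto

lemma cw_pos: "0 \<le> t \<Longrightarrow> t < pi \<Longrightarrow> 0 < cw m t"
  using cos_half_pos by (simp add: cw_def)

lemma cw_nonneg: "0 \<le> cw m t"
  by (simp add: cw_def power_mult)

lemma cw_le_1: "cw m t \<le> 1"
  unfolding cw_def power_mult by (rule power_le_one) (auto simp: abs_square_le_1)

lemma cw_DERIV:
  assumes "cos (t / 2) \<noteq> 0"
  shows "(cw m has_real_derivative - (real m * (sin (t / 2) / cos (t / 2)) * cw m t)) (at t)"
proof -
  have "cos (t / 2) ^ (2 * m) = cos (t / 2) * cos (t / 2) ^ (2 * m - 1)" if "m > 0"
    using that by (simp flip: power_Suc)
  then show ?thesis unfolding cw_def[abs_def]
    by (cases "m = 0") (auto intro!: derivative_eq_intros simp: assms field_simps)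
qed

lemma continuous_cw [continuous_intros]:
  fixes f :: "'a::t2_space \<Rightarrow> real"
  shows "continuous_on S f \<Longrightarrow> continuous_on S (\<lambda>x. cw m (f x))"
  unfolding cw_def by (intro continuous_intros) auto

text \<open>Separation of variables: for every x the average of the eigenpolynomial solves the same
  equation in t, starts at the value of the polynomial and has slope 0 by evenness. Uniqueness makes
  it the multiple of one solution g, which is read off at a point where the polynomial does not
  vanish.\<close>

lemma eigen_multiplier_ex:
  obtains g g1 g2 where "multiplier m k g" "\<And>t. (g has_real_derivative g1 t) (at t)"
    "\<And>t. (g1 has_real_derivative g2 t) (at t)"
    "\<And>t. 0 < t \<Longrightarrow> t < pi \<Longrightarrow> g2 t + cos t / sin t * g1 t - 2 * (real m)\<^sup>2 / (1 + cos t) * g t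
       = - (lam m k + real m * (real m + 1)) * g t"
proof -
  let ?\<phi> = "eigpoly m k" and ?L = "lam m k + real m * (real m + 1)"
  have "\<exists>h1 h2. (\<forall>t. ((\<lambda>t. spin_avg m t (poly ?\<phi>) x) has_real_derivative h1 t) (at t)) \<and> (\<forall>t. (h1 has_real_derivative h2 t) (at t))
     \<and> (\<forall>t. 0 < t \<longrightarrow> t < pi \<longrightarrow> h2 t + cos t / sin t * h1 t - 2 * (real m)\<^sup>2 / (1 + cos t) * spin_avg m t (poly ?\<phi>) x
       = - ?L * spin_avg m t (poly ?\<phi>) x)" if x: "x \<in> Iv" for x
  proof -
    obtain H1 H2 where H: "\<And>t. (spin_int m x ?\<phi> has_real_derivative H1 t) (at t)"
      "\<And>t. (H1 has_real_derivative H2 t) (at t)"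
      "\<And>t. 0 < t \<Longrightarrow> t < pi \<Longrightarrow> H2 t + cos t / sin t * H1 t - 2 * (real m)\<^sup>2 / (1 + cos t) * spin_int m x ?\<phi> t
      = spin_int m x (jacobi_op m ?\<phi>) t - real m * (real m + 1) * spin_int m x ?\<phi> t"
      using spin_int_ode_ex[OF x, of m ?\<phi>] by blast
    define d where "d = 1 / (pi * sqrt (1 - x\<^sup>2) ^ m)"
    have e: "spin_avg m t (poly ?\<phi>) x = d * spin_int m x ?\<phi> t" for t by (simp add: spin_avg_poly d_def)
    show ?thesis unfolding e
    proof (intro exI conjI allI impI)
      show "((\<lambda>t. d * spin_int m x ?\<phi> t) has_real_derivative d * H1 t) (at t)"
        "((\<lambda>t. d * H1 t) has_real_derivative d * H2 t) (at t)" for t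
        by (intro DERIV_cmult H)+
      fix t :: real assume t: "0 < t" "t < pi"
      have "d * H2 t + cos t / sin t * (d * H1 t) - 2 * (real m)\<^sup>2 / (1 + cos t) * (d * spin_int m x ?\<phi> t)
        = d * (H2 t + cos t / sin t * H1 t - 2 * (real m)\<^sup>2 / (1 + cos t) * spin_int m x ?\<phi> t)"
        by (simp add: algebra_simps)
      also have "\<dots> = - ?L * (d * spin_int m x ?\<phi> t)"
        unfolding H(3)[OF t] eigpoly(1) spin_int_smult by (simp add: algebra_simps)
      finally show "d * H2 t + cos t / sin t * (d * H1 t) - 2 * (real m)\<^sup>2 / (1 + cos t) * (d * spin_int m x ?\<phi> t) = - ?L * (d * spin_int m x ?\<phi> t)" .
    qed
  qed
  then obtain h1 h2 where h: "\<And>x t. x \<in> Iv \<Longrightarrow> ((\<lambda>t. spin_avg m t (poly ?\<phi>) x) has_real_derivative h1 x t) (at t)"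
    "\<And>x t. x \<in> Iv \<Longrightarrow> (h1 x has_real_derivative h2 x t) (at t)"
    "\<And>x t. x \<in> Iv \<Longrightarrow> 0 < t \<Longrightarrow> t < pi \<Longrightarrow> h2 x t + cos t / sin t * h1 x t - 2 * (real m)\<^sup>2 / (1 + cos t) * spin_avg m t (poly ?\<phi>) x
       = - ?L * spin_avg m t (poly ?\<phi>) x"
    by metis
  have h10: "h1 x 0 = 0" if x: "x \<in> Iv" for x
  proof -
    have d: "((\<lambda>t. spin_avg m t (poly ?\<phi>) x) has_real_derivative h1 x 0) (at (- 0))" using h(1)[OF x, of 0] by simp
    have "((\<lambda>t. spin_avg m (- t) (poly ?\<phi>) x) has_real_derivative h1 x 0 * (- 1)) (at 0)"
      by (rule DERIV_chain2[where f = "\<lambda>t. spin_avg m t (poly ?\<phi>) x" and g = "\<lambda>t. - t", OF d])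
         (auto intro!: derivative_eq_intros)
    then have "((\<lambda>t. spin_avg m t (poly ?\<phi>) x) has_real_derivative - h1 x 0) (at 0)" by (simp add: spin_avg_even)
    with h(1)[OF x, of 0] have "h1 x 0 = - h1 x 0" by (rule DERIV_unique)
    then show ?thesis by simp
  qed
  have "?\<phi> \<noteq> 0" using eigpoly(2)[of m k] by auto
  then have "finite {x. poly ?\<phi> x = 0}" by (rule poly_roots_finite)
  moreover have "infinite Iv" by (simp add: infinite_Ioo)
  ultimately obtain x0 where x0: "x0 \<in> Iv" "poly ?\<phi> x0 \<noteq> 0"
    by (metis (mono_tags, lifting) finite_subset mem_Collect_eq subsetI)
  let ?c = "poly ?\<phi> x0"
  define g where "g t = spin_avg m t (poly ?\<phi>) x0 / ?c" for t
  define g1 where "g1 t = h1 x0 t / ?c" for t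
  define g2 where "g2 t = h2 x0 t / ?c" for t
  have dg: "(g has_real_derivative g1 t) (at t)" "(g1 has_real_derivative g2 t) (at t)" for t
    unfolding g_def[abs_def] g1_def[abs_def] g2_def by (intro DERIV_cdivide h x0)+
  have odeg: "g2 t + cos t / sin t * g1 t - 2 * (real m)\<^sup>2 / (1 + cos t) * g t = - ?L * g t" if t: "0 < t" "t < pi" for t
  proof -
    have "g2 t + cos t / sin t * g1 t - 2 * (real m)\<^sup>2 / (1 + cos t) * g t
      = (h2 x0 t + cos t / sin t * h1 x0 t - 2 * (real m)\<^sup>2 / (1 + cos t) * spin_avg m t (poly ?\<phi>) x0) / ?c"
      by (simp add: g_def g1_def g2_def add_divide_distrib diff_divide_distrib)
    then show ?thesis unfolding h(3)[OF x0(1) t] g_def by simp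
  qed
  have "multiplier m k g"
    unfolding multiplier_def
  proof (intro conjI ballI allI impI)
    show "continuous_on UNIV g" by (meson DERIV_isCont continuous_at_imp_continuous_on dg(1))
    show "g 0 = 1" using x0 by (simp add: g_def spin_avg_0)
    fix x t :: real assume x: "x \<in> Iv" and t: "0 \<le> t" "t < pi"
    define y where "y t = spin_avg m t (poly ?\<phi>) x - poly ?\<phi> x * g t" for t
    have "y t = 0"
    proof (rule spin_ode_unique[of y "\<lambda>t. h1 x t - poly ?\<phi> x * g1 t" "\<lambda>t. h2 x t - poly ?\<phi> x * g2 t"])
      show "(y has_real_derivative h1 x t - poly ?\<phi> x * g1 t) (at t)"
        "((\<lambda>t. h1 x t - poly ?\<phi> x * g1 t) has_real_derivative h2 x t - poly ?\<phi> x * g2 t) (at t)" for t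
        unfolding y_def[abs_def] by (intro DERIV_diff DERIV_cmult h x dg)+
      show "y 0 = 0" using x x0 by (simp add: y_def g_def spin_avg_0)
      show "h1 x 0 - poly ?\<phi> x * g1 0 = 0" using x x0 by (simp add: h10 g1_def)
      fix t :: real assume t: "0 < t" "t < pi"
      have "h2 x t - poly ?\<phi> x * g2 t + cos t / sin t * (h1 x t - poly ?\<phi> x * g1 t) - 2 * (real m)\<^sup>2 / (1 + cos t) * y t
        = (h2 x t + cos t / sin t * h1 x t - 2 * (real m)\<^sup>2 / (1 + cos t) * spin_avg m t (poly ?\<phi>) x)
          - poly ?\<phi> x * (g2 t + cos t / sin t * g1 t - 2 * (real m)\<^sup>2 / (1 + cos t) * g t)"
        by (simp add: y_def algebra_simps)
      also have "\<dots> = - ?L * y t" unfolding h(3)[OF x t] odeg[OF t] by (simp add: y_def algebra_simps)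
      finally show "h2 x t - poly ?\<phi> x * g2 t + cos t / sin t * (h1 x t - poly ?\<phi> x * g1 t) - 2 * (real m)\<^sup>2 / (1 + cos t) * y t = - ?L * y t" .
    qed (use t in auto)
    then show "spin_avg m t (poly ?\<phi>) x = g t * poly ?\<phi> x" by (simp add: y_def)
  qed
  then show ?thesis using that dg odeg by blast
qed

text \<open>
  With \<open>\<psi> = g / c\<close> and \<open>w = sin t c\<^sup>2\<close>, the function \<open>V\<close> below is \<open>w \<psi>'\<close>, written without
  a denominator so that it is continuous up to \<open>t = \<pi>\<close>.
\<close>

lemma eigen_multiplier:
  obtains g where "multiplier m k g"
    "\<And>t. 0 < k \<Longrightarrow> 0 < t \<Longrightarrow> t < pi \<Longrightarrow>
      (\<integral>s. indicator {0<..<t} s * (1 / (sin s * (cw m s)\<^sup>2) * (\<integral>u. indicator {0<..<s} u * (sin u * cw m u * g u) \<partial>lborel)) \<partial>lborel)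
       = (1 - g t / cw m t) / lam m k"
    "\<And>t. k = 0 \<Longrightarrow> 0 \<le> t \<Longrightarrow> t < pi \<Longrightarrow> g t = cw m t"
    "\<And>K. degree K < k \<Longrightarrow> (\<integral>t. indicator {0<..<pi} t * (poly K (cos t) * (sin t * cw m t * g t)) \<partial>lborel) = 0"
proof -
  obtain g g1 g2 where g: "multiplier m k g" and dg: "\<And>t. (g has_real_derivative g1 t) (at t)"
    "\<And>t. (g1 has_real_derivative g2 t) (at t)" and
    ode: "\<And>t. 0 < t \<Longrightarrow> t < pi \<Longrightarrow> g2 t + cos t / sin t * g1 t - 2 * (real m)\<^sup>2 / (1 + cos t) * g t
       = - (lam m k + real m * (real m + 1)) * g t"
    using eigen_multiplier_ex by metis
  have cg [continuous_intros]: "continuous_on S g" "continuous_on S g1" for S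
    by (meson DERIV_isCont continuous_at_imp_continuous_on dg)+
  have g0: "g 0 = 1" using g by (simp add: multiplier_def)
  define \<theta> where "\<theta> t = sin (t / 2) / cos (t / 2)" for t :: real
  define V where "V t = cw m t * (sin t * g1 t + real m * (1 - cos t) * g t)" for t
  have dV: "(V has_real_derivative - lam m k * (sin t * cw m t * g t)) (at t)" if t: "0 < t" "t < pi" for t
  proof -
    have ch: "cos (t / 2) \<noteq> 0" using cos_half_pos[of t] t by simp
    note th = tan_half_identities[OF ch, folded \<theta>_def]
    have st: "sin t > 0" using t sin_gt_zero by auto
    have ct: "1 + cos t > 0" using t cos_monotone_0_pi[of t pi] by simp
    have "sin t * (g2 t + cos t / sin t * g1 t - 2 * (real m)\<^sup>2 / (1 + cos t) * g t)
      = sin t * g2 t + cos t * g1 t - 2 * (real m)\<^sup>2 * \<theta> t * g t"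
    proof -
      have gen: "s * (a + c * b - M * d) = s * a + (s * c) * b - (s * M) * d" for s a b c d M :: real
        by (simp add: algebra_simps)
      have "sin t * (cos t / sin t) = cos t" using st by simp
      moreover have "sin t * (2 * (real m)\<^sup>2 / (1 + cos t)) = 2 * (real m)\<^sup>2 * \<theta> t"
        using ct by (simp add: mult.assoc flip: th(2))
      ultimately show ?thesis unfolding gen by simp
    qed
    then have od: "sin t * g2 t + cos t * g1 t = 2 * (real m)\<^sup>2 * \<theta> t * g t - (lam m k + real m * (real m + 1)) * (sin t * g t)"
      unfolding ode[OF t] by (simp add: algebra_simps)
    have "(V has_real_derivative
      - (real m * \<theta> t * cw m t) * (sin t * g1 t + real m * (1 - cos t) * g t)
       + cw m t * (cos t * g1 t + sin t * g2 t + (real m * sin t * g t + real m * (1 - cos t) * g1 t))) (at t)"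
      unfolding V_def[abs_def] \<theta>_def
      by (rule derivative_eq_intros cw_DERIV[OF ch] dg refl)+ (simp add: algebra_simps)
    moreover have "- (real m * \<theta> t * cw m t) * (sin t * g1 t + real m * (1 - cos t) * g t)
       + cw m t * (cos t * g1 t + sin t * g2 t + (real m * sin t * g t + real m * (1 - cos t) * g1 t))
       = - lam m k * (sin t * cw m t * g t)"
    proof -
      have "- (real m * \<theta> t * cw m t) * (sin t * g1 t + real m * (1 - cos t) * g t)
       + cw m t * (cos t * g1 t + sin t * g2 t + (real m * sin t * g t + real m * (1 - cos t) * g1 t))
       = cw m t * ((sin t * g2 t + cos t * g1 t) + real m * sin t * g t + real m * (1 - cos t - sin t * \<theta> t) * g1 t
          - (real m)\<^sup>2 * (\<theta> t * 2 - \<theta> t * (1 + cos t)) * g t)"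
        by (simp add: power2_eq_square algebra_simps)
      also have "\<dots> = - lam m k * (sin t * cw m t * g t)"
        unfolding od th by (simp add: power2_eq_square algebra_simps)
      finally show ?thesis .
    qed
    ultimately show ?thesis by simp
  qed
  have contV: "continuous_on S V" for S unfolding V_def[abs_def] by (intro continuous_intros)
  have V0: "V 0 = 0" by (simp add: V_def)
  \<comment> \<open>For m = 0 the sine and the factor m vanish at pi, for m > 0 the factor
    \<open>cw m pi\<close> does.\<close>
  have Vpi: "V pi = 0" by (cases m) (auto simp: V_def cw_def)
  have J: "lam m k * (\<integral>u. indicator {0<..<s} u * (sin u * cw m u * g u) \<partial>lborel) = - V s" if s: "0 \<le> s" "s < pi" for s
  proof -
    have "(\<integral>u. indicator {0<..<s} u * (- lam m k * (sin u * cw m u * g u)) \<partial>lborel) = V s - V 0"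
      using s by (intro lborel_integral_FTC contV continuous_intros dV) auto
    also have "(\<integral>u. indicator {0<..<s} u * (- lam m k * (sin u * cw m u * g u)) \<partial>lborel)
      = - lam m k * (\<integral>u. indicator {0<..<s} u * (sin u * cw m u * g u) \<partial>lborel)"
      by (subst integral_mult_right_zero[symmetric]) (simp add: mult_ac)
    finally show ?thesis using V0 by simp
  qed
  \<comment> \<open>The derivative of psi = g / c, using that c' = - m tan(t/2) c.\<close>
  define \<psi>1 where "\<psi>1 s = (g1 s + real m * \<theta> s * g s) / cw m s" for s
  have d\<psi>: "((\<lambda>t. g t / cw m t) has_real_derivative \<psi>1 t) (at t)" if t: "0 \<le> t" "t < pi" for t
  proof -
    have ch: "cos (t / 2) \<noteq> 0" using cos_half_pos[of t] t by simp
    have c: "cw m t \<noteq> 0" using cw_pos[OF t, of m] by simp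
    have "((\<lambda>t. g t / cw m t) has_real_derivative (g1 t * cw m t - g t * - (real m * (sin (t / 2) / cos (t / 2)) * cw m t)) / (cw m t * cw m t)) (at t)"
      by (rule DERIV_divide[OF dg(1) cw_DERIV[OF ch] c])
    also have "(g1 t * cw m t - g t * - (real m * (sin (t / 2) / cos (t / 2)) * cw m t)) / (cw m t * cw m t) = \<psi>1 t"
      using c unfolding \<psi>1_def \<theta>_def[symmetric] by (simp add: divide_simps) (simp add: algebra_simps)
    finally show ?thesis .
  qed
  have V\<psi>: "V s = sin s * (cw m s)\<^sup>2 * \<psi>1 s" if s: "0 \<le> s" "s < pi" for s
  proof -
    have ch: "cos (s / 2) \<noteq> 0" using cos_half_pos[of s] s by simp
    have c: "cw m s \<noteq> 0" using cw_pos[OF s, of m] by simp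
    have "sin s * (cw m s)\<^sup>2 * \<psi>1 s = cw m s * (sin s * g1 s + real m * (sin s * \<theta> s) * g s)"
    proof -
      have "cw m s * \<psi>1 s = g1 s + real m * \<theta> s * g s" using c by (simp add: \<psi>1_def)
      moreover have "sin s * (cw m s)\<^sup>2 * \<psi>1 s = sin s * cw m s * (cw m s * \<psi>1 s)" by (simp add: power2_eq_square)
      ultimately show ?thesis by (simp add: algebra_simps)
    qed
    then show ?thesis unfolding tan_half_identities(1)[OF ch, folded \<theta>_def] V_def by simp
  qed
  have cont\<psi>: "continuous_on {0..t} \<psi>1" if "t < pi" for t
    unfolding \<psi>1_def[abs_def] \<theta>_def[abs_def]
    by (intro continuous_intros) (use that cos_half_pos cw_pos[of _ m] in force)+
  have cont\<psi>0: "continuous_on {0..t} (\<lambda>t. g t / cw m t)" if "t < pi" for t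
    by (intro continuous_intros) (use that cw_pos[of _ m] in force)+
  have 1: "(\<integral>s. indicator {0<..<t} s * (1 / (sin s * (cw m s)\<^sup>2) * (\<integral>u. indicator {0<..<s} u * (sin u * cw m u * g u) \<partial>lborel)) \<partial>lborel)
       = (1 - g t / cw m t) / lam m k" if k: "0 < k" and t: "0 < t" "t < pi" for t
  proof -
    have l: "lam m k \<noteq> 0" using lam_pos[OF k, of m] by simp
    have "(\<integral>s. indicator {0<..<t} s * (1 / (sin s * (cw m s)\<^sup>2) * (\<integral>u. indicator {0<..<s} u * (sin u * cw m u * g u) \<partial>lborel)) \<partial>lborel)
      = (\<integral>s. (- 1 / lam m k) * (indicator {0<..<t} s * \<psi>1 s) \<partial>lborel)"
    proof (intro Bochner_Integration.integral_cong refl)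
      fix s
      show "indicator {0<..<t} s * (1 / (sin s * (cw m s)\<^sup>2) * (\<integral>u. indicator {0<..<s} u * (sin u * cw m u * g u) \<partial>lborel))
        = (- 1 / lam m k) * (indicator {0<..<t} s * \<psi>1 s)"
      proof (cases "s \<in> {0<..<t}")
        case True
        then have s: "0 \<le> s" "s < pi" "sin s \<noteq> 0" "cw m s \<noteq> 0" using t sin_gt_zero[of s] cw_pos[of s m] by auto
        have "(\<integral>u. indicator {0<..<s} u * (sin u * cw m u * g u) \<partial>lborel) = - V s / lam m k"
          using J[OF s(1,2)] l by (simp add: field_simps)
        then show ?thesis using True s V\<psi>[OF s(1,2)] by simp
      qed simp
    qed
    also have "\<dots> = (- 1 / lam m k) * (\<integral>s. indicator {0<..<t} s * \<psi>1 s \<partial>lborel)" by simp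
    also have "(\<integral>s. indicator {0<..<t} s * \<psi>1 s \<partial>lborel) = g t / cw m t - g 0 / cw m 0"
      using t by (intro lborel_integral_FTC[of _ _ "\<lambda>t. g t / cw m t"] cont\<psi> cont\<psi>0 d\<psi>) auto
    finally show ?thesis by (simp add: g0 cw_def diff_divide_distrib)
  qed
  have 2: "g t = cw m t" if k: "k = 0" and t: "0 \<le> t" "t < pi" for t
  proof -
    have z: "\<psi>1 s = 0" if s: "0 < s" "s < pi" for s
    proof -
      have "V s = 0" using J[of s] s k by (simp add: lam_def)
      then show ?thesis using V\<psi>[of s] s sin_gt_zero[of s] cw_pos[of s m] by simp
    qed
    have "(\<integral>s. indicator {0<..<t} s * \<psi>1 s \<partial>lborel) = g t / cw m t - g 0 / cw m 0"
      using t by (intro lborel_integral_FTC[of _ _ "\<lambda>t. g t / cw m t"] cont\<psi> cont\<psi>0 d\<psi>) auto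
    moreover have "(\<integral>s. indicator {0<..<t} s * \<psi>1 s \<partial>lborel) = (\<integral>s. 0 \<partial>(lborel :: real measure))"
      by (intro Bochner_Integration.integral_cong) (use z t in \<open>auto simp: indicator_def\<close>)
    ultimately have "g t / cw m t - g 0 / cw m 0 = 0" by (simp only: integral_zero)
    moreover have "cw m 0 = 1" by (simp add: cw_def)
    ultimately have "g t / cw m t = 1" by (simp add: g0)
    then show ?thesis using cw_pos[OF t, of m] by (simp only: divide_eq_1_iff)
  qed
  define I where "I j = (\<integral>t. indicator {0<..<pi} t * (cos t ^ j * (sin t * cw m t * g t)) \<partial>lborel)" for j
  have Iint: "integrable lborel (\<lambda>t. indicator {0<..<pi} t * (cos t ^ j * (sin t * cw m t * g t)))" for j
    by (intro lborel_integral_continuous continuous_intros)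
  \<comment> \<open>Green's formula: the operator is moved from psi to the power cos^j, on which it
    acts triangularly with diagonal entry \<open>- lam m j\<close>. \<open>Y\<close> collects the
    boundary terms of the two integrations by parts. For j < k the factor on the left is not 0, so
    all the moments vanish by induction.\<close>
  have rec: "(lam m j - lam m k) * I j = 2 * real m * real j * I (j - 1) + real j * (real j - 1) * I (j - 2)" for j
  proof -
    define A where "A t = cw m t * g t" for t
    define Y where "Y t = cos t ^ j * V t + real j * (cos t ^ (j - 1) * ((sin t)\<^sup>2 * A t))" for t
    let ?y = "\<lambda>t. (lam m j - lam m k) * (cos t ^ j * (sin t * cw m t * g t))
      - (2 * real m * real j * (cos t ^ (j - 1) * (sin t * cw m t * g t)) + real j * (real j - 1) * (cos t ^ (j - 2) * (sin t * cw m t * g t)))"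
    have dY: "(Y has_real_derivative ?y t) (at t)" if t: "0 < t" "t < pi" for t
    proof -
      have ch: "cos (t / 2) \<noteq> 0" using cos_half_pos[of t] t by simp
      note th = tan_half_identities[OF ch, folded \<theta>_def]
      define A' where "A' = - (real m * \<theta> t * cw m t) * g t + cw m t * g1 t"
      have dA: "(A has_real_derivative A') (at t)"
        unfolding A_def[abs_def] A'_def \<theta>_def by (rule derivative_eq_intros cw_DERIV[OF ch] dg refl)+ simp
      have sA: "sin t * A' = V t - 2 * real m * (1 - cos t) * A t"
      proof -
        have "sin t * A' = cw m t * (sin t * g1 t) - real m * (sin t * \<theta> t) * A t"
          by (simp add: A'_def A_def algebra_simps)
        then show ?thesis unfolding th(1) by (simp add: V_def A_def algebra_simps)
      qed
      have pj: "real j * cos t ^ (j - 1) * cos t = real j * cos t ^ j" by (cases j) auto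
      have pj2: "real j * (real j - 1) * cos t ^ (j - 2) * (cos t)\<^sup>2 = real j * (real j - 1) * cos t ^ j"
        by (cases j; cases "j - 1") (auto simp: power2_eq_square numeral_2_eq_2)
      have dc: "((\<lambda>t. real j * cos t ^ (j - 1)) has_real_derivative - (real j * (real j - 1) * cos t ^ (j - 2) * sin t)) (at t)"
        by (cases j) (auto intro!: derivative_eq_intros simp: numeral_2_eq_2)
      have "(Y has_real_derivative
         (real j * cos t ^ (j - 1) * (- sin t)) * V t + cos t ^ j * (- lam m k * (sin t * cw m t * g t))
         + (- (real j * (real j - 1) * cos t ^ (j - 2) * sin t) * ((sin t)\<^sup>2 * A t)
           + real j * cos t ^ (j - 1) * (2 * sin t * cos t * A t + (sin t)\<^sup>2 * A'))) (at t)"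
        unfolding Y_def[abs_def] mult.assoc[symmetric, of "real j" "cos _ ^ (j - 1)"]
        by (rule derivative_eq_intros dV[OF t] dA dc refl)+ (simp add: algebra_simps)
      moreover have "(real j * cos t ^ (j - 1) * (- sin t)) * V t + cos t ^ j * (- lam m k * (sin t * cw m t * g t))
         + (- (real j * (real j - 1) * cos t ^ (j - 2) * sin t) * ((sin t)\<^sup>2 * A t)
           + real j * cos t ^ (j - 1) * (2 * sin t * cos t * A t + (sin t)\<^sup>2 * A')) = ?y t"
      proof -
        have s2: "(sin t)\<^sup>2 = 1 - (cos t)\<^sup>2" by (simp add: sin_squared_eq)
        have sA2: "(sin t)\<^sup>2 * A' = sin t * (V t - 2 * real m * (1 - cos t) * A t)"
          by (simp only: power2_eq_square mult.assoc sA)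
        have "(real j * cos t ^ (j - 1) * (- sin t)) * V t + cos t ^ j * (- lam m k * (sin t * cw m t * g t))
         + (- (real j * (real j - 1) * cos t ^ (j - 2) * sin t) * ((sin t)\<^sup>2 * A t)
           + real j * cos t ^ (j - 1) * (2 * sin t * cos t * A t + (sin t)\<^sup>2 * A'))
         = sin t * A t * (- lam m k * cos t ^ j - (real j * (real j - 1) * cos t ^ (j - 2) - real j * (real j - 1) * cos t ^ (j - 2) * (cos t)\<^sup>2)
             + 2 * (real j * cos t ^ (j - 1) * cos t) - 2 * real m * (real j * cos t ^ (j - 1)) + 2 * real m * (real j * cos t ^ (j - 1) * cos t))"
          unfolding sA2 unfolding s2 by (simp add: A_def algebra_simps)
        also have "\<dots> = sin t * A t * ((lam m j - lam m k) * cos t ^ j - 2 * real m * (real j * cos t ^ (j - 1)) - real j * (real j - 1) * cos t ^ (j - 2))"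
          unfolding pj pj2 lam_def by (simp add: algebra_simps)
        also have "\<dots> = ?y t" by (simp add: A_def algebra_simps)
        finally show ?thesis .
      qed
      ultimately show ?thesis by simp
    qed
    have "(\<integral>t. indicator {0<..<pi} t * ?y t \<partial>lborel) = Y pi - Y 0"
      by (intro lborel_integral_FTC dY) (auto simp: Y_def[abs_def] A_def intro!: continuous_intros contV)
    also have "\<dots> = 0" by (simp add: Y_def V0 Vpi)
    also have "(\<integral>t. indicator {0<..<pi} t * ?y t \<partial>lborel)
      = (\<integral>t. (lam m j - lam m k) * (indicator {0<..<pi} t * (cos t ^ j * (sin t * cw m t * g t)))
        - (2 * real m * real j * (indicator {0<..<pi} t * (cos t ^ (j - 1) * (sin t * cw m t * g t)))
         + real j * (real j - 1) * (indicator {0<..<pi} t * (cos t ^ (j - 2) * (sin t * cw m t * g t)))) \<partial>lborel)"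
      by (intro Bochner_Integration.integral_cong refl) (simp add: algebra_simps)
    also have "\<dots> = (lam m j - lam m k) * I j - (2 * real m * real j * I (j - 1) + real j * (real j - 1) * I (j - 2))"
      unfolding I_def using Iint by simp
    finally show ?thesis by simp
  qed
  have I0: "I j = 0" if "j < k" for j
    using that
  proof (induction j rule: less_induct)
    case (less j)
    have A: "real j * I (j - 1) = 0" using less by (cases j) auto
    have B: "real j * (real j - 1) * I (j - 2) = 0"
      using less by (cases j; cases "j - 1") auto
    have "(lam m j - lam m k) * I j = 2 * real m * (real j * I (j - 1)) + real j * (real j - 1) * I (j - 2)"
      unfolding rec by (simp only: mult.assoc)
    then have "(lam m j - lam m k) * I j = 0" unfolding A B by simp
    then show ?case using lam_strict_mono[OF less.prems, of m] by simp
  qed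
  have 3: "(\<integral>t. indicator {0<..<pi} t * (poly K (cos t) * (sin t * cw m t * g t)) \<partial>lborel) = 0" if "degree K < k" for K
  proof -
    have "(\<integral>t. indicator {0<..<pi} t * (poly K (cos t) * (sin t * cw m t * g t)) \<partial>lborel)
      = (\<integral>t. (\<Sum>j\<le>degree K. coeff K j * (indicator {0<..<pi} t * (cos t ^ j * (sin t * cw m t * g t)))) \<partial>lborel)"
      by (intro Bochner_Integration.integral_cong refl) (simp add: poly_altdef sum_distrib_left sum_distrib_right mult_ac)
    also have "\<dots> = (\<Sum>j\<le>degree K. coeff K j * I j)"
      unfolding I_def using Iint by (subst Bochner_Integration.integral_sum) auto
    also have "\<dots> = 0" using I0 that by (intro sum.neutral) auto
    finally show ?thesis .
  qed
  show ?thesis using that g 1 2 3 by blast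
qed

subsection \<open>A Riesz-type interpolation formula\<close>

lemma sum_cis_roots:
  fixes l n :: nat
  assumes "0 < l" "l < n"
  shows "(\<Sum>k<n. cis (2 * pi * real l / real n * real k)) = 0"
proof -
  define z where "z = cis (2 * pi * real l / real n)"
  have n: "0 < n" using assms by simp
  have "z ^ n = cis (real n * (2 * pi * real l / real n))" unfolding z_def by (rule Complex.DeMoivre)
  also have "real n * (2 * pi * real l / real n) = 2 * pi * real l" using n by simp
  also have "cis (2 * pi * real l) = 1"
    by (simp add: complex_eq_iff)
  finally have zn: "z ^ n = 1" .
  have "z \<noteq> 1"
  proof
    assume "z = 1"
    then have "cos (2 * pi * real l / real n) = 1" unfolding z_def by (metis cis.sel(1) one_complex.sel(1))
    then obtain i :: int where i: "2 * pi * real l / real n = real_of_int i * (2 * pi)"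
      by (auto simp: cos_one_2pi_int)
    then have "real l = real_of_int i * real n" using n by (simp add: field_simps)
    then have "int l = i * int n" by (metis of_int_mult of_int_of_nat_eq of_int_eq_iff)
    then have "n dvd l" by (metis dvd_triv_right int_dvd_int_iff)
    then show False using assms by (auto dest: dvd_imp_le)
  qed
  have "(\<Sum>k<n. cis (2 * pi * real l / real n * real k)) = (\<Sum>k<n. z ^ k)"
    unfolding z_def Complex.DeMoivre by (simp add: mult.commute)
  also have "\<dots> = 0" using geometric_sum[OF \<open>z \<noteq> 1\<close>, of n] zn by simp
  finally show ?thesis .
qed

text \<open>M. Riesz's interpolation formula for the second derivative at 0 of even trigonometric
  polynomials of order M, with nodes k pi / M. The weights at k > 0 are chosen so that the sums
  \<open>B j\<close> have constant second difference -2 in j, hence \<open>B j = B 0 - j^2\<close>;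
  the weight at k = 0 removes \<open>B 0\<close>.\<close>

lemma riesz_coefficients:
  assumes M: "0 < M"
  obtains b :: "nat \<Rightarrow> real" where "(\<Sum>k<2*M. \<bar>b k\<bar>) \<le> 2 * (real M)\<^sup>2"
    "\<And>j. j \<le> M \<Longrightarrow> (\<Sum>k<2*M. b k * cos (real j * (real k * pi / real M))) = - (real j)\<^sup>2"
proof -
  define r where "r k = real k * pi / real M" for k
  define d where "d k = (- 1) ^ Suc k / (2 * (sin (r k / 2))\<^sup>2)" for k :: nat
  define B where "B j = (\<Sum>k=1..<2*M. d k * cos (real j * r k))" for j
  have spos: "0 < sin (r k / 2)" if "k \<in> {1..<2*M}" for k
  proof -
    have "real k < 2 * real M" using that by (metis atLeastLessThan_iff of_nat_less_iff of_nat_mult of_nat_numeral)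
    then have "r k / 2 < pi" using M by (simp add: r_def field_simps)
    moreover have "0 < r k / 2" using that M by (simp add: r_def)
    ultimately show ?thesis by (rule sin_gt_zero[rotated])
  qed
  have zero_split: "(\<Sum>k<2*M. f k) = f 0 + (\<Sum>k=1..<2*M. f k)" for f :: "nat \<Rightarrow> real"
    using M by (simp add: lessThan_atLeast0 sum.atLeast_Suc_lessThan)
  have csum: "(\<Sum>k=1..<2*M. cos (real l * r k)) = - 1" if "0 < l" "l < 2 * M" for l
  proof -
    have "(\<Sum>k<2*M. cos (real l * r k)) = Re (\<Sum>k<2*M. cis (2 * pi * real l / real (2 * M) * real k))"
      using M by (simp add: r_def mult_ac)
    also have "\<dots> = 0" unfolding sum_cis_roots[OF that] by simp
    finally show ?thesis by (simp add: zero_split r_def)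
  qed
  have sgn: "cos (real M * r k) = (- 1) ^ k" "sin (real M * r k) = 0" for k
    using M by (simp_all add: r_def)
  have alt: "(\<Sum>k=1..<2*M. (- 1) ^ k * cos (real j * r k)) = - 1" if "j < M" for j
  proof -
    have "(- 1) ^ k * cos (real j * r k) = cos (real (j + M) * r k)" for k
      by (simp only: of_nat_add distrib_right cos_add sgn) simp
    then show ?thesis using csum[of "j + M"] that M by simp
  qed
  have d2: "2 * (cos (r k) - 1) * d k = 2 * (- 1) ^ k" if "k \<in> {1..<2*M}" for k
  proof -
    have "cos (r k) = 1 - 2 * (sin (r k / 2))\<^sup>2" using cos_double_sin[of "r k / 2"] by simp
    then show ?thesis using spos[OF that] by (simp add: d_def)
  qed
  \<comment> \<open>At j = 0 the term B(-1) is B(1), the cosine being even.\<close>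
  have rec: "B (Suc j) + (if j = 0 then B 1 else B (j - 1)) - 2 * B j = - 2" if "j < M" for j
  proof -
    have "B (Suc j) + (if j = 0 then B 1 else B (j - 1)) - 2 * B j = (\<Sum>k=1..<2*M. 2 * ((- 1) ^ k * cos (real j * r k)))"
    proof -
      have e: "B (Suc j) + (if j = 0 then B 1 else B (j - 1)) = (\<Sum>k=1..<2*M. d k * (cos ((real j + 1) * r k) + cos ((real j - 1) * r k)))"
        by (cases "j = 0") (auto simp: B_def sum.distrib[symmetric] distrib_left of_nat_diff add.commute intro!: sum.cong)
      have c: "cos ((real j + 1) * r k) + cos ((real j - 1) * r k) = 2 * cos (real j * r k) * cos (r k)" for k
        by (simp add: distrib_right left_diff_distrib cos_add cos_diff)
      have "B (Suc j) + (if j = 0 then B 1 else B (j - 1)) - 2 * B j = (\<Sum>k=1..<2*M. 2 * (cos (r k) - 1) * d k * cos (real j * r k))"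
        unfolding e c by (simp add: B_def sum_distrib_left sum_subtractf[symmetric] algebra_simps)
      also have "\<dots> = (\<Sum>k=1..<2*M. 2 * ((- 1) ^ k * cos (real j * r k)))"
        by (intro sum.cong refl) (subst d2, assumption, simp only: mult.assoc)
      finally show ?thesis .
    qed
    also have "\<dots> = - 2" by (simp only: sum_distrib_left[symmetric] alt[OF that])
    finally show ?thesis .
  qed
  have Bj: "B j = B 0 - (real j)\<^sup>2" if "j \<le> M" for j
    using that
  proof (induction j rule: less_induct)
    case (less j)
    show ?case
    proof (cases j)
      case (Suc i)
      then have i: "i < M" "B i = B 0 - (real i)\<^sup>2"
        using less.prems less.IH[of i] by simp_all
      show ?thesis
      proof (cases "i = 0")
        case True
        then show ?thesis using rec[of 0] M Suc by simp
      next
        case False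
        then have "B (i - 1) = B 0 - (real (i - 1))\<^sup>2"
          using less.prems less.IH[of "i - 1"] Suc by simp
        then show ?thesis using rec[OF i(1)] i(2) False Suc
          by (simp add: of_nat_diff power2_eq_square algebra_simps)
      qed
    qed simp
  qed
  \<comment> \<open>Over a full period the values \<open>B j\<close> sum to 0, while
    \<open>B 0\<close> is the largest of them.\<close>
  have B0: "0 \<le> B 0"
  proof -
    have le: "B j \<le> B 0" if "j < 2 * M" for j
    proof (cases "j \<le> M")
      case True
      then show ?thesis using Bj[OF True] by simp
    next
      case False
      have "cos (real j * r k) = cos (real (2 * M - j) * r k)" for k
      proof -
        have "real (2 * M - j) * r k = 2 * pi * real k - real j * r k"
          using that M by (simp add: of_nat_diff r_def field_simps)
        moreover have "cos (2 * pi * real k) = 1" "sin (2 * pi * real k) = 0"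
          by (metis cos_int_2pin of_int_of_nat_eq, metis sin_int_2pin of_int_of_nat_eq)
        ultimately show ?thesis by (simp add: cos_diff)
      qed
      then have "B j = B (2 * M - j)" by (simp add: B_def)
      then show ?thesis using Bj[of "2 * M - j"] False by simp
    qed
    have "(\<Sum>j<2*M. B j) = (\<Sum>k=1..<2*M. d k * (\<Sum>j<2*M. cos (real j * r k)))"
      unfolding B_def by (subst sum.swap) (simp add: sum_distrib_left)
    also have "\<dots> = 0"
    proof (intro sum.neutral ballI)
      fix k assume k: "k \<in> {1..<2*M}"
      have "(\<Sum>j<2*M. cos (real j * r k)) = Re (\<Sum>j<2*M. cis (2 * pi * real k / real (2 * M) * real j))"
        using M by (simp add: r_def mult_ac)
      also have "\<dots> = 0" using sum_cis_roots[of k "2 * M"] k by simp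
      finally show "d k * (\<Sum>j<2*M. cos (real j * r k)) = 0" by simp
    qed
    finally have "0 = (\<Sum>j<2*M. B j)" by simp
    also have "\<dots> \<le> (\<Sum>j<2*M. B 0)" by (intro sum_mono le) simp
    also have "\<dots> = 2 * real M * B 0" by simp
    finally show ?thesis using M by (simp add: zero_le_mult_iff)
  qed
  define b where "b k = (if k = 0 then - B 0 else d k)" for k
  \<comment> \<open>At j = M the cosines are \<open>(- 1) ^ k\<close>, which cancels the alternating
    sign of \<open>d k\<close>.\<close>
  have "(\<Sum>k=1..<2*M. \<bar>d k\<bar>) = - B M"
  proof -
    have "\<bar>d k\<bar> = - (d k * cos (real M * r k))" for k
      unfolding sgn by (simp add: d_def abs_mult power_mult_distrib[symmetric])
    then show ?thesis by (simp add: B_def sum_negf)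
  qed
  then have sd: "(\<Sum>k=1..<2*M. \<bar>d k\<bar>) = (real M)\<^sup>2 - B 0" using Bj[of M] by simp
  moreover have "B 0 \<le> (\<Sum>k=1..<2*M. \<bar>d k\<bar>)" unfolding B_def by (intro sum_mono) auto
  ultimately have "B 0 \<le> (real M)\<^sup>2" using B0 by simp
  have "(\<Sum>k<2*M. \<bar>b k\<bar>) = B 0 + (\<Sum>k=1..<2*M. \<bar>d k\<bar>)"
    using B0 by (subst zero_split) (simp add: b_def)
  then have "(\<Sum>k<2*M. \<bar>b k\<bar>) \<le> 2 * (real M)\<^sup>2" using sd by simp
  moreover have "(\<Sum>k<2*M. b k * cos (real j * (real k * pi / real M))) = - (real j)\<^sup>2" if "j \<le> M" for j
  proof -
    have "(\<Sum>k<2*M. b k * cos (real j * r k)) = - B 0 + B j"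
      by (subst zero_split) (simp add: b_def B_def r_def)
    then show ?thesis using Bj[OF that] by (simp add: r_def)
  qed
  ultimately show ?thesis using that by blast
qed

text \<open>A shifted ordinary polynomial in \<open>cis t\<close>, so that closure under products
  and the count of orders come from polynomial multiplication.\<close>

definition trig_poly :: "nat \<Rightarrow> (real \<Rightarrow> complex) \<Rightarrow> bool" where
  "trig_poly M F \<longleftrightarrow> (\<exists>q. degree q \<le> 2 * M \<and> (\<forall>t. F t = cis (- (real M * t)) * poly q (cis t)))"

lemma trig_poly_const: "trig_poly 0 (\<lambda>t. a)"
  unfolding trig_poly_def by (intro exI[of _ "[:a:]"]) simp

lemma trig_poly_add:
  assumes "trig_poly M F" "trig_poly M G" shows "trig_poly M (\<lambda>t. F t + G t)"
proof -
  obtain p q where "degree p \<le> 2 * M" "\<forall>t. F t = cis (- (real M * t)) * poly p (cis t)"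
    "degree q \<le> 2 * M" "\<forall>t. G t = cis (- (real M * t)) * poly q (cis t)"
    using assms unfolding trig_poly_def by blast
  then show ?thesis unfolding trig_poly_def
    by (intro exI[of _ "p + q"]) (auto simp: distrib_left intro: degree_add_le)
qed

lemma trig_poly_mult:
  assumes "trig_poly M F" "trig_poly N G" shows "trig_poly (M + N) (\<lambda>t. F t * G t)"
proof -
  obtain p q where pq: "degree p \<le> 2 * M" "\<forall>t. F t = cis (- (real M * t)) * poly p (cis t)"
    "degree q \<le> 2 * N" "\<forall>t. G t = cis (- (real N * t)) * poly q (cis t)"
    using assms unfolding trig_poly_def by blast
  have "degree (p * q) \<le> 2 * (M + N)"
    using degree_mult_le[of p q] pq by simp
  moreover have "cis (- (real (M + N) * t)) = cis (- (real M * t)) * cis (- (real N * t))" for t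
    by (simp add: cis_mult algebra_simps)
  ultimately show ?thesis unfolding trig_poly_def
    by (intro exI[of _ "p * q"]) (use pq in \<open>simp add: mult_ac\<close>)
qed

lemma trig_poly_linear: "trig_poly 1 (\<lambda>t. a + b * of_real (cos t) + c * of_real (sin t))"
proof -
  have "a + b * of_real (cos t) + c * of_real (sin t)
    = cis (- (real 1 * t)) * poly [:(b + \<i> * c) / 2, a, (b - \<i> * c) / 2:] (cis t)" for t
  proof -
    have i: "cis (- t) * cis t = 1" by (simp add: cis_mult)
    have c2: "complex_of_real (cos t) = (cis t + cis (- t)) / 2" "complex_of_real (sin t) = - \<i> * (cis t - cis (- t)) / 2"
      by (simp_all add: complex_eq_iff)
    have "cis (- (real 1 * t)) * poly [:(b + \<i> * c) / 2, a, (b - \<i> * c) / 2:] (cis t)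
      = (b + \<i> * c) / 2 * cis (- t) + (cis (- t) * cis t) * (a + (b - \<i> * c) / 2 * cis t)"
      by (simp add: algebra_simps)
    then show ?thesis unfolding i c2 by (simp add: algebra_simps add_divide_distrib diff_divide_distrib)
  qed
  then show ?thesis unfolding trig_poly_def
    by (intro exI[of _ "[:(b + \<i> * c) / 2, a, (b - \<i> * c) / 2:]"]) auto
qed

lemma trig_poly_mono:
  assumes "trig_poly M F" "M \<le> N" shows "trig_poly N F"
proof -
  have "trig_poly n (\<lambda>t. 1)" for n
  proof (induction n)
    case (Suc n)
    then show ?case using trig_poly_mult[OF Suc trig_poly_linear[of 1 0 0]] by simp
  qed (simp add: trig_poly_const)
  from trig_poly_mult[OF assms(1) this[of "N - M"]] show ?thesis using assms(2) by simp
qed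

lemma trig_poly_power: "trig_poly M F \<Longrightarrow> trig_poly (n * M) (\<lambda>t. F t ^ n)"
proof (induction n)
  case (Suc n)
  then show ?case using trig_poly_mult[of M F "n * M" "\<lambda>t. F t ^ n"] by simp
qed (simp add: trig_poly_const)

lemma trig_poly_poly:
  assumes "trig_poly 1 (\<lambda>t. of_real (F t))"
  shows "trig_poly (degree P) (\<lambda>t. of_real (poly P (F t)))"
proof (induction P)
  case (pCons a P)
  show ?case
  proof (cases "P = 0")
    case True
    then show ?thesis by (simp add: trig_poly_const)
  next
    case False
    have "trig_poly (degree P + 1) (\<lambda>t. of_real a + of_real (F t) * of_real (poly P (F t)))"
      using trig_poly_mult[OF assms pCons.IH]
      by (intro trig_poly_add) (auto intro: trig_poly_mono[OF trig_poly_const] simp: add.commute)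
    then show ?thesis using False by simp
  qed
qed (simp add: trig_poly_const)

text \<open>The interpolation formula for the second derivative of F(r) + F(-r). The nodes enter
  with both signs, so that only cosines survive and the formula extends from even to arbitrary
  trigonometric polynomials.\<close>

definition riesz_sum :: "nat \<Rightarrow> (nat \<Rightarrow> real) \<Rightarrow> (real \<Rightarrow> 'a::real_vector) \<Rightarrow> real \<Rightarrow> 'a" where
  "riesz_sum M b F r = (\<Sum>k<2*M. (b k / 2) *\<^sub>R
     (F (r + real k * pi / real M) + F (r - real k * pi / real M) + F (- r + real k * pi / real M) + F (- r - real k * pi / real M)))"

lemma riesz_sum_add: "riesz_sum M b (\<lambda>t. F t + G t) r = riesz_sum M b F r + riesz_sum M b G r"
  unfolding riesz_sum_def sum.distrib[symmetric] scaleR_add_right[symmetric]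
  by (intro sum.cong refl arg_cong2[where f = scaleR]) (simp add: algebra_simps)

lemma riesz_sum_cmult:
  fixes F :: "real \<Rightarrow> 'a::real_algebra"
  shows "riesz_sum M b (\<lambda>t. c * F t) r = c * riesz_sum M b F r"
  unfolding riesz_sum_def sum_distrib_left by (intro sum.cong refl) (simp add: distrib_left)

lemma riesz_sum_sum:
  fixes F :: "'i \<Rightarrow> real \<Rightarrow> 'a::real_algebra"
  assumes "finite S"
  shows "riesz_sum M b (\<lambda>t. \<Sum>i\<in>S. c i * F i t) r = (\<Sum>i\<in>S. c i * riesz_sum M b (F i) r)"
  using assms
proof (induction S rule: finite_induct)
  case empty
  then show ?case by (simp add: riesz_sum_def)
next
  case (insert i S)
  then show ?case by (simp add: riesz_sum_add riesz_sum_cmult)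
qed

text \<open>Taylor's formula with integral remainder for F(t) + F(-t), whose slope at 0 is 0; it
  suffices to verify it on exponentials.\<close>

lemma trig_poly_second_difference:
  assumes b: "\<And>j. j \<le> M \<Longrightarrow> (\<Sum>k<2*M. b k * cos (real j * (real k * pi / real M))) = - (real j)\<^sup>2"
    and F: "trig_poly M F" and t: "0 \<le> t"
  shows "((\<lambda>r. (t - r) *\<^sub>R riesz_sum M b F r) has_integral (F t + F (- t) - 2 * F 0)) {0..t}"
proof -
  have bj: "(\<Sum>k<2*M. b k * cos (j * (real k * pi / real M))) = - j\<^sup>2" if "\<bar>j\<bar> = real l" "l \<le> M" for j l
  proof -
    have "j = real l \<or> j = - real l" using that by linarith
    then show ?thesis using b[OF that(2)] by auto
  qed
  have mono: "((\<lambda>r. (t - r) *\<^sub>R riesz_sum M b (\<lambda>t. cis (j * t)) r) has_integral (cis (j * t) + cis (j * - t) - 2 * cis (j * 0))) {0..t}"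
    if j: "\<bar>j\<bar> = real l" "l \<le> M" for j l
  proof -
    have S: "riesz_sum M b (\<lambda>t. cis (j * t)) r = of_real (- 2 * j\<^sup>2 * cos (j * r))" for r
    proof -
      have 1: "cis (j * (r + a)) + cis (j * (r - a)) + cis (j * (- r + a)) + cis (j * (- r - a))
        = of_real (4 * cos (j * r) * cos (j * a))" for a
        by (simp add: complex_eq_iff cos_add cos_diff sin_add sin_diff algebra_simps)
      have "riesz_sum M b (\<lambda>t. cis (j * t)) r = of_real (2 * cos (j * r) * (\<Sum>k<2*M. b k * cos (j * (real k * pi / real M))))"
        unfolding riesz_sum_def 1 by (simp add: scaleR_conv_of_real sum_distrib_left mult_ac)
      then show ?thesis unfolding bj[OF j] by (simp add: mult_ac)
    qed
    have "((\<lambda>r. (t - r) * (- 2 * j\<^sup>2 * cos (j * r))) has_integral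
       ((t - t) * (- 2 * j * sin (j * t)) + 2 * cos (j * t) - ((t - 0) * (- 2 * j * sin (j * 0)) + 2 * cos (j * 0)))) {0..t}"
      using t
    proof (rule fundamental_theorem_of_calculus)
      fix r assume "r \<in> {0..t}"
      have "((\<lambda>r. (t - r) * (- 2 * j * sin (j * r)) + 2 * cos (j * r)) has_real_derivative
         (t - r) * (- 2 * j\<^sup>2 * cos (j * r))) (at r within {0..t})"
        by (auto intro!: derivative_eq_intros simp: power2_eq_square algebra_simps)
      then show "((\<lambda>r. (t - r) * (- 2 * j * sin (j * r)) + 2 * cos (j * r)) has_vector_derivative
         (t - r) * (- 2 * j\<^sup>2 * cos (j * r))) (at r within {0..t})"
        by (simp add: has_real_derivative_iff_has_vector_derivative)
    qed
    then have "((\<lambda>r. (t - r) * (- 2 * j\<^sup>2 * cos (j * r))) has_integral (2 * cos (j * t) - 2)) {0..t}" by simp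
    from has_integral_of_real[OF this] have "((\<lambda>r. complex_of_real ((t - r) * (- 2 * j\<^sup>2 * cos (j * r)))) has_integral of_real (2 * cos (j * t) - 2)) {0..t}" .
    moreover have "complex_of_real (2 * cos (j * t) - 2) = cis (j * t) + cis (j * - t) - 2 * cis (j * 0)"
      by (simp add: complex_eq_iff)
    ultimately show ?thesis unfolding S by (simp add: scaleR_conv_of_real)
  qed
  obtain q where q: "degree q \<le> 2 * M" "\<And>t. F t = cis (- (real M * t)) * poly q (cis t)"
    using F unfolding trig_poly_def by blast
  have Fs: "F t = (\<Sum>i\<le>2*M. coeff q i * cis ((real i - real M) * t))" for t
  proof -
    have "F t = (\<Sum>i\<le>2*M. coeff q i * (cis (- (real M * t)) * cis t ^ i))"
    proof -
      have "poly q z = (\<Sum>i\<le>2*M. coeff q i * z ^ i)" for z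
        unfolding poly_altdef by (rule sum.mono_neutral_left) (use q(1) in \<open>auto simp: coeff_eq_0\<close>)
      then show ?thesis unfolding q(2) by (simp add: sum_distrib_left mult_ac)
    qed
    moreover have "cis (- (real M * t)) * cis t ^ i = cis ((real i - real M) * t)" for i
      unfolding Complex.DeMoivre by (simp add: cis_mult algebra_simps)
    ultimately show ?thesis by (simp only:)
  qed
  have lin: "riesz_sum M b F r = (\<Sum>i\<le>2*M. coeff q i * riesz_sum M b (\<lambda>t. cis ((real i - real M) * t)) r)" for r
    unfolding ext[OF Fs] by (rule riesz_sum_sum) simp
  have "((\<lambda>r. \<Sum>i\<le>2*M. coeff q i * ((t - r) *\<^sub>R riesz_sum M b (\<lambda>t. cis ((real i - real M) * t)) r)) has_integral
     (\<Sum>i\<le>2*M. coeff q i * (cis ((real i - real M) * t) + cis ((real i - real M) * - t) - 2 * cis ((real i - real M) * 0)))) {0..t}"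
  proof (intro has_integral_sum has_integral_mult_right)
    fix i assume i: "i \<in> {..2*M}"
    define l where "l = (if i \<le> M then M - i else i - M)"
    have "\<bar>real i - real M\<bar> = real l" "l \<le> M" using i by (auto simp: l_def of_nat_diff)
    then show "((\<lambda>r. (t - r) *\<^sub>R riesz_sum M b (\<lambda>t. cis ((real i - real M) * t)) r) has_integral
       (cis ((real i - real M) * t) + cis ((real i - real M) * - t) - 2 * cis ((real i - real M) * 0))) {0..t}"
      by (rule mono)
  qed auto
  also have "(\<Sum>i\<le>2*M. coeff q i * (cis ((real i - real M) * t) + cis ((real i - real M) * - t) - 2 * cis ((real i - real M) * 0)))
     = F t + F (- t) - 2 * F 0"
    unfolding Fs by (simp add: sum.distrib[symmetric] sum_subtractf[symmetric] sum_distrib_left algebra_simps)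
  finally show ?thesis unfolding lin by (simp add: scaleR_sum_right)
qed

subsection \<open>A Bernstein-type inequality\<close>

lemma spin_trig_poly:
  "trig_poly (m + degree P) (\<lambda>t. cis (real m * \<phi>) * rot_q x t \<phi> ^ m * of_real (poly P (rot_R x t \<phi>)))"
proof -
  have "trig_poly 1 (\<lambda>t. rot_q x t \<phi>)"
  proof -
    have "rot_q x t \<phi> = - \<i> * of_real (sqrt (1 - x\<^sup>2) * sin \<phi>) + of_real (sqrt (1 - x\<^sup>2) * cos \<phi>) * of_real (cos t) + of_real x * of_real (sin t)" for t
      by (simp add: rot_q_def complex_eq_iff)
    then show ?thesis using trig_poly_linear by presburger
  qed
  from trig_poly_power[OF this, of m] have 1: "trig_poly m (\<lambda>t. rot_q x t \<phi> ^ m)" by simp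
  have "trig_poly 1 (\<lambda>t. complex_of_real (rot_R x t \<phi>))"
  proof -
    have "complex_of_real (rot_R x t \<phi>) = 0 + of_real x * of_real (cos t) + of_real (- (sqrt (1 - x\<^sup>2) * cos \<phi>)) * of_real (sin t)" for t
      by (simp add: rot_R_def mult_ac)
    then show ?thesis using trig_poly_linear by presburger
  qed
  from trig_poly_poly[OF this] have 2: "trig_poly (degree P) (\<lambda>t. of_real (poly P (rot_R x t \<phi>)))" .
  show ?thesis using trig_poly_mult[OF trig_poly_mult[OF trig_poly_const[of "cis (real m * \<phi>)"] 1] 2] by simp
qed

text \<open>For fixed phi the integrand is a trigonometric polynomial in t of order m +
  \<open>degree P\<close>; its second difference is integrated over phi. Evenness of the average in
  t makes the second difference twice the difference to P.\<close>

lemma spin_avg_second_difference: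
  assumes b: "\<And>j. j \<le> M \<Longrightarrow> (\<Sum>k<2*M. b k * cos (real j * (real k * pi / real M))) = - (real j)\<^sup>2"
    and M: "m + degree P \<le> M" and t: "0 \<le> t" and x: "x \<in> Iv"
  shows "spin_avg m t (poly P) x - poly P x
    = (\<integral>r. (indicator {0<..<t} r * (t - r)) * (riesz_sum M b (\<lambda>r. spin_avg m r (poly P) x) r / 2) \<partial>lborel)"
proof -
  define e where "e \<phi> r = spin_ker m x r \<phi> * poly P (rot_R x r \<phi>)" for \<phi> r
  have cont_e: "continuous_on S (\<lambda>z. e (f z) (g z))" if "continuous_on S f" "continuous_on S g" for S and f g :: "'b::t2_space \<Rightarrow> real"
    unfolding e_def by (intro continuous_intros that)
  have cont_S: "continuous_on S (\<lambda>z. riesz_sum M b (e (f z)) (g z))" if "continuous_on S f" "continuous_on S g" for S and f g :: "'b::t2_space \<Rightarrow> real"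
    unfolding riesz_sum_def by (intro continuous_intros cont_e that)
  have e: "((\<lambda>r. (t - r) * riesz_sum M b (e \<phi>) r) has_integral (e \<phi> t + e \<phi> (- t) - 2 * e \<phi> 0)) {0..t}" for \<phi>
  proof -
    let ?F = "\<lambda>t. cis (real m * \<phi>) * rot_q x t \<phi> ^ m * of_real (poly P (rot_R x t \<phi>))"
    have ReF: "Re (?F t) = e \<phi> t" for t by (simp add: e_def spin_ker_def)
    have "((\<lambda>r. (t - r) *\<^sub>R riesz_sum M b ?F r) has_integral (?F t + ?F (- t) - 2 * ?F 0)) {0..t}"
      by (rule trig_poly_second_difference[OF b trig_poly_mono[OF spin_trig_poly M] t])
    from has_integral_linear[OF this bounded_linear_Re]
    have "((\<lambda>r. Re ((t - r) *\<^sub>R riesz_sum M b ?F r)) has_integral Re (?F t + ?F (- t) - 2 * ?F 0)) {0..t}"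
      by (simp only: o_def)
    moreover have "Re ((t - r) *\<^sub>R riesz_sum M b ?F r) = (t - r) * riesz_sum M b (e \<phi>) r" for r
      unfolding riesz_sum_def scaleR_complex.sel Re_sum plus_complex.sel ReF by simp
    moreover have "Re (?F t + ?F (- t) - 2 * ?F 0) = e \<phi> t + e \<phi> (- t) - 2 * e \<phi> 0"
    proof -
      have "2 * ?F 0 = ?F 0 + ?F 0" by (rule mult_2)
      then show ?thesis by (simp only: plus_complex.sel minus_complex.sel ReF mult_2)
    qed
    ultimately show ?thesis by (simp only:)
  qed
  have si: "spin_int m x P r = integral {0..pi} (\<lambda>\<phi>. e \<phi> r)" for r by (simp add: spin_int_def e_def)
  have ii: "(\<lambda>\<phi>. e \<phi> r) integrable_on {0..pi}" for r
    by (intro integrable_continuous_interval cont_e continuous_intros)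
  have Ssi: "integral {0..pi} (\<lambda>\<phi>. riesz_sum M b (e \<phi>) r) = riesz_sum M b (spin_int m x P) r" for r
  proof -
    have hi: "((\<lambda>\<phi>. e \<phi> s) has_integral spin_int m x P s) {0..pi}" for s
      unfolding si by (rule integrable_integral[OF ii])
    have "((\<lambda>\<phi>. riesz_sum M b (e \<phi>) r) has_integral riesz_sum M b (spin_int m x P) r) {0..pi}"
      unfolding riesz_sum_def by (intro has_integral_sum has_integral_cmul has_integral_add hi) auto
    then show ?thesis by (rule integral_unique)
  qed
  have "spin_int m x P t + spin_int m x P (- t) - 2 * spin_int m x P 0 = integral {0..pi} (\<lambda>\<phi>. e \<phi> t + e \<phi> (- t) - 2 * e \<phi> 0)"
    unfolding si by (subst integral_diff integral_add integral_mult_right, auto intro!: integrable_add integrable_on_mult_right ii)+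
  also have "\<dots> = integral {0..pi} (\<lambda>\<phi>. integral {0..t} (\<lambda>r. (t - r) * riesz_sum M b (e \<phi>) r))"
    by (simp only: integral_unique[OF e])
  also have "\<dots> = integral {0..t} (\<lambda>r. integral {0..pi} (\<lambda>\<phi>. (t - r) * riesz_sum M b (e \<phi>) r))"
    using integral_swap_continuous[of 0 0 pi t "\<lambda>\<phi> r. (t - r) * riesz_sum M b (e \<phi>) r"]
    by (simp add: case_prod_beta' continuous_intros cont_S)
  also have "\<dots> = integral {0..t} (\<lambda>r. (t - r) * riesz_sum M b (spin_int m x P) r)"
    by (simp only: integral_mult_right Ssi)
  finally have I: "spin_int m x P t + spin_int m x P (- t) - 2 * spin_int m x P 0 = integral {0..t} (\<lambda>r. (t - r) * riesz_sum M b (spin_int m x P) r)" .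
  define d where "d = 1 / (pi * sqrt (1 - x\<^sup>2) ^ m)"
  have a: "spin_avg m r (poly P) x = d * spin_int m x P r" for r by (simp add: spin_avg_poly d_def)
  have Sa: "riesz_sum M b (\<lambda>r. spin_avg m r (poly P) x) r = d * riesz_sum M b (spin_int m x P) r" for r
    unfolding riesz_sum_def a by (simp add: sum_distrib_left algebra_simps)
  have cont_si: "continuous_on S (\<lambda>r. spin_int m x P (f r))" if "continuous_on S f" for S and f :: "real \<Rightarrow> real"
  proof -
    obtain H1 where "\<And>t. (spin_int m x P has_real_derivative H1 t) (at t)" using spin_int_ode_ex[OF x] by metis
    then have "continuous_on UNIV (spin_int m x P)" by (meson DERIV_isCont continuous_at_imp_continuous_on)
    from continuous_on_compose2[OF this that] show ?thesis by simp
  qed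
  have "2 * (spin_avg m t (poly P) x - poly P x) = spin_avg m t (poly P) x + spin_avg m (- t) (poly P) x - 2 * spin_avg m 0 (poly P) x"
    by (simp add: spin_avg_even spin_avg_0[OF x])
  also have "\<dots> = d * integral {0..t} (\<lambda>r. (t - r) * riesz_sum M b (spin_int m x P) r)"
    unfolding a I[symmetric] by (simp add: algebra_simps)
  also have "\<dots> = integral {0..t} (\<lambda>r. 2 * ((t - r) * (riesz_sum M b (\<lambda>r. spin_avg m r (poly P) x) r / 2)))"
    unfolding Sa by (subst integral_mult_right[symmetric]) (simp add: mult_ac)
  also have "\<dots> = 2 * integral {0..t} (\<lambda>r. (t - r) * (riesz_sum M b (\<lambda>r. spin_avg m r (poly P) x) r / 2))"
    by (rule integral_mult_right)
  also have "integral {0..t} (\<lambda>r. (t - r) * (riesz_sum M b (\<lambda>r. spin_avg m r (poly P) x) r / 2))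
    = (\<integral>r. indicator {0<..<t} r * ((t - r) * (riesz_sum M b (\<lambda>r. spin_avg m r (poly P) x) r / 2)) \<partial>lborel)"
  proof (rule lborel_integral_continuous(1)[symmetric])
    have "continuous_on {0..t} (riesz_sum M b (spin_int m x P))"
      unfolding riesz_sum_def
      by (intro continuous_on_sum continuous_on_scaleR continuous_on_add continuous_on_diff continuous_on_minus
          continuous_on_const continuous_on_id cont_si)
    then have "continuous_on {0..t} (\<lambda>r. (t - r) * (d * riesz_sum M b (spin_int m x P) r / 2))"
      by (intro continuous_on_mult continuous_on_divide continuous_on_diff continuous_on_const continuous_on_id) auto
    then show "continuous_on {0..t} (\<lambda>r. (t - r) * (riesz_sum M b (\<lambda>r. spin_avg m r (poly P) x) r / 2))"
      by (simp only: Sa)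
  qed
  finally show ?thesis by (simp add: mult.assoc)
qed

text \<open>The averages are bounded uniformly in the real parameter, so each shifted term of the
  interpolation formula costs the same constant and the whole has size M^2. The integral of t - r
  over (0, t) supplies t^2 / 2.\<close>

lemma bernstein_spin_avg:
  assumes adm: "admissible p m a"
  obtains C where "0 < C" "\<And>P n t B. degree P \<le> n \<Longrightarrow> 0 < n \<Longrightarrow> 0 < t \<Longrightarrow> 0 \<le> B \<Longrightarrow> norm_le p a (poly P) B \<Longrightarrow>
     norm_le p a (\<lambda>x. spin_avg m t (poly P) x - poly P x) (C * (t * real n)\<^sup>2 * B)"
proof -
  have p1: "1 \<le> p" using adm by (simp add: admissible_def)
  obtain C where C: "0 < C" "\<And>t f M. f \<in> borel_measurable borel \<Longrightarrow> 0 \<le> M \<Longrightarrow>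
     norm_le p a f M \<Longrightarrow> norm_le p a (spin_avg m t f) (C * M)"
    using spin_avg_bound[OF adm] by blast
  \<comment> \<open>The order M = m + n of the integrand is at most (1 + m) n, because n >=
    1.\<close>
  define D where "D = C * (1 + real m)\<^sup>2"
  have D: "0 < D" using C by (simp add: D_def)
  have main: "norm_le p a (\<lambda>x. spin_avg m t (poly P) x - poly P x) (D * (t * real n)\<^sup>2 * B)"
    if P: "degree P \<le> n" and n: "0 < n" and t: "0 < t" and B: "0 < B" "norm_le p a (poly P) B" for P n t B
  proof -
    define M where "M = m + n"
    have M: "0 < M" "m + degree P \<le> M" using n P by (auto simp: M_def)
    obtain b :: "nat \<Rightarrow> real" where b: "(\<Sum>k<2*M. \<bar>b k\<bar>) \<le> 2 * (real M)\<^sup>2"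
      "\<And>j. j \<le> M \<Longrightarrow> (\<Sum>k<2*M. b k * cos (real j * (real k * pi / real M))) = - (real j)\<^sup>2"
      using riesz_coefficients[OF M(1)] by blast
    have [measurable]: "poly P \<in> borel_measurable borel" by (rule borel_measurable_poly) simp
    define F where "F r x = riesz_sum M b (\<lambda>r. spin_avg m r (poly P) x) r / 2" for r x
    define K where "K = 2 * (real M)\<^sup>2 * (C * B)"
    have K: "0 < K" using M C B by (simp add: K_def)
    have F: "norm_le p a (F r) K" for r
    proof -
      have 1: "norm_le p a (spin_avg m s (poly P)) (C * B)" for s
        using C(2)[OF _ _ B(2)] B by simp
      have "norm_le p a (\<lambda>x. \<Sum>k<2*M. (b k / 4) * (spin_avg m (r + real k * pi / real M) (poly P) x + spin_avg m (r - real k * pi / real M) (poly P) x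
         + spin_avg m (- r + real k * pi / real M) (poly P) x + spin_avg m (- r - real k * pi / real M) (poly P) x))
         (\<Sum>k<2*M. \<bar>b k / 4\<bar> * (C * B + C * B + C * B + C * B))"
        using C B by (intro norm_le_sum[OF p1] norm_le_cmult[OF p1] norm_le_add[OF p1] 1) auto
      also have "(\<Sum>k<2*M. \<bar>b k / 4\<bar> * (C * B + C * B + C * B + C * B)) = (\<Sum>k<2*M. \<bar>b k\<bar>) * (C * B)"
        by (simp add: sum_distrib_right sum_distrib_left algebra_simps)
      finally have "norm_le p a (F r) ((\<Sum>k<2*M. \<bar>b k\<bar>) * (C * B))"
        unfolding F_def[abs_def] riesz_sum_def by (simp add: sum_divide_distrib)
      then show ?thesis unfolding K_def
        by (rule norm_le_mono[OF p1]) (use b(1) C B in \<open>auto intro!: mult_right_mono mult_nonneg_nonneg sum_nonneg\<close>)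
    qed
    have "norm_le p a (\<lambda>x. \<integral>r. (indicator {0<..<t} r * (t - r)) * F r x \<partial>lborel) (t\<^sup>2 / 2 * K)"
    proof (rule norm_le_integral[OF p1, where m = "\<lambda>_. K"])
      show "case_prod F \<in> borel_measurable (borel \<Otimes>\<^sub>M borel)"
        unfolding F_def[abs_def] riesz_sum_def case_prod_beta' by measurable
      have "(\<integral>r. indicator {0<..<t} r * (t - r) \<partial>lborel) = (t * t - t\<^sup>2 / 2) - (t * 0 - 0\<^sup>2 / 2)"
        using t by (intro lborel_integral_FTC[where F = "\<lambda>r. t * r - r\<^sup>2 / 2"])
          (auto intro!: continuous_intros derivative_eq_intros)
      then have "(\<integral>r. indicator {0<..<t} r * (t - r) \<partial>lborel) = t\<^sup>2 / 2" by (simp add: power2_eq_square)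
      moreover have "integrable lborel (\<lambda>r. indicator {0<..<t} r * (t - r))"
        by (intro lborel_integral_continuous(2) continuous_intros)
      ultimately have nn: "(\<integral>\<^sup>+r. ennreal (indicator {0<..<t} r * (t - r)) \<partial>lborel) = ennreal (t\<^sup>2 / 2)"
        by (subst nn_integral_eq_integral) (auto simp: indicator_def)
      have "(\<integral>\<^sup>+r. ennreal (indicator {0<..<t} r * (t - r) * K) \<partial>lborel) = (\<integral>\<^sup>+r. ennreal (indicator {0<..<t} r * (t - r)) * ennreal K \<partial>lborel)"
        using K by (intro nn_integral_cong) (simp add: ennreal_mult''[symmetric])
      also have "\<dots> = ennreal (t\<^sup>2 / 2) * ennreal K" by (subst nn_integral_multc) (auto simp: nn)
      finally show "(\<integral>\<^sup>+r. ennreal (indicator {0<..<t} r * (t - r) * K) \<partial>lborel) \<le> ennreal (t\<^sup>2 / 2 * K)"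
        by (subst ennreal_mult') auto
    qed (use F K t in \<open>auto simp: indicator_def\<close>)
    then have "norm_le p a (\<lambda>x. spin_avg m t (poly P) x - poly P x) (t\<^sup>2 / 2 * K)"
    proof (rule norm_le_cong_AE[OF p1])
      show "AE x in lborel. x \<in> Iv \<longrightarrow> spin_avg m t (poly P) x - poly P x = (\<integral>r. (indicator {0<..<t} r * (t - r)) * F r x \<partial>lborel)"
        unfolding F_def using spin_avg_second_difference[OF b(2) M(2)] t by (intro AE_I2) auto
    qed (use K in auto)
    then show ?thesis
    proof (rule norm_le_mono[OF p1])
      have "real M \<le> (1 + real m) * real n"
        using n by (simp add: M_def algebra_simps) (metis Suc_leI mult_le_mono2 mult_1_right of_nat_le_iff of_nat_mult One_nat_def)
      then have "(real M)\<^sup>2 \<le> ((1 + real m) * real n)\<^sup>2" by (intro power_mono) auto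
      then have "t\<^sup>2 * (C * B) * (real M)\<^sup>2 \<le> t\<^sup>2 * (C * B) * ((1 + real m) * real n)\<^sup>2"
        using C B by (intro mult_left_mono) auto
      then show "t\<^sup>2 / 2 * K \<le> D * (t * real n)\<^sup>2 * B"
        by (simp add: K_def D_def power_mult_distrib mult_ac)
    qed (use K in auto)
  qed
  have "norm_le p a (\<lambda>x. spin_avg m t (poly P) x - poly P x) (D * (t * real n)\<^sup>2 * B)"
    if P: "degree P \<le> n" "0 < n" "0 < t" and B: "0 \<le> B" "norm_le p a (poly P) B" for P n t B
  proof (rule norm_le_closed[OF p1])
    fix e :: real assume e: "0 < e"
    define f where "f = e / (D * (t * real n)\<^sup>2)"
    have f: "0 < f" using e D P by (simp add: f_def)
    have "norm_le p a (\<lambda>x. spin_avg m t (poly P) x - poly P x) (D * (t * real n)\<^sup>2 * (B + f))"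
      using B f by (intro main P norm_le_mono[OF p1 B(2)]) auto
    moreover have "D * (t * real n)\<^sup>2 * f = e" using D P by (simp add: f_def)
    ultimately show "norm_le p a (\<lambda>x. spin_avg m t (poly P) x - poly P x) (D * (t * real n)\<^sup>2 * B + e)"
      by (simp add: distrib_left)
  qed (use D B in auto)
  then show ?thesis using that D by blast
qed

subsection \<open>A Jackson kernel\<close>

lemma cos_ge_half: "0 \<le> z \<Longrightarrow> z \<le> 1 \<Longrightarrow> 1 / 2 \<le> cos (z::real)"
proof -
  assume z: "0 \<le> z" "z \<le> 1"
  have "sin (z / 2) \<le> z / 2" using z by (intro sin_x_le_x) auto
  moreover have "0 \<le> sin (z / 2)" using z pi_ge_two by (intro sin_ge_zero) auto
  ultimately have "(sin (z / 2))\<^sup>2 \<le> (1 / 2)\<^sup>2" using z by (intro power_mono) auto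
  then show ?thesis using cos_double_sin[of "z / 2"] by (simp add: power2_eq_square)
qed

lemma sin_ge_half:
  assumes "0 \<le> z" "z \<le> 1" shows "z / 2 \<le> sin (z::real)"
proof -
  have "sin 0 - 0 / 2 \<le> sin z - z / 2"
  proof (rule DERIV_nonneg_imp_nondecreasing[of 0 z "\<lambda>z. sin z - z / 2"])
    fix y assume y: "0 \<le> y" "y \<le> z"
    have "((\<lambda>z. sin z - z / 2) has_real_derivative cos y - 1 / 2) (at y)"
      by (auto intro!: derivative_eq_intros)
    moreover have "0 \<le> cos y - 1 / 2" using cos_ge_half[of y] y assms by simp
    ultimately show "\<exists>d. ((\<lambda>z. sin z - z / 2) has_real_derivative d) (at y) \<and> 0 \<le> d" by blast
  qed (use assms in auto)
  then show ?thesis by simp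
qed

lemma sin_half_ge:
  assumes "0 \<le> t" "t \<le> pi" shows "t / 8 \<le> sin (t / 2)"
proof (cases "t / 2 \<le> 1")
  case True
  then show ?thesis using sin_ge_half[of "t / 2"] assms by simp
next
  case False
  have "1 / 2 \<le> sin (1::real)" using sin_ge_half[of 1] by simp
  also have "\<dots> \<le> sin (t / 2)" using False assms by (intro sin_monotone_2pi_le) auto
  finally show ?thesis using assms pi_less_4 by simp
qed

text \<open>The Chebyshev polynomials, by their three-term recursion.\<close>

lemma cos_mult_poly: "\<exists>T :: real poly. degree T \<le> j \<and> (\<forall>t. cos (real j * t) = poly T (cos t))"
proof (induction j rule: less_induct)
  case (less j)
  consider "j = 0" | "j = 1" | i where "j = Suc (Suc i)" by (metis One_nat_def old.nat.exhaust)
  then show ?case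
  proof cases
    case 1 then show ?thesis by (intro exI[of _ 1]) simp
  next
    case 2 then show ?thesis by (intro exI[of _ "[:0, 1:]"]) simp
  next
    case 3
    obtain T where T: "degree T \<le> Suc i" "\<And>t. cos (real (Suc i) * t) = poly T (cos t)" using less.IH[of "Suc i"] 3 by auto
    obtain S where S: "degree S \<le> i" "\<And>t. cos (real i * t) = poly S (cos t)" using less.IH[of i] 3 by auto
    have "degree ([:0, 2:] * T - S) \<le> j"
      using 3 T S degree_mult_le[of "[:0, 2:]" T] by (intro degree_diff_le) auto
    moreover have "cos (real j * t) = poly ([:0, 2:] * T - S) (cos t)" for t
    proof -
      have "cos (real j * t) + cos (real i * t) = 2 * cos t * cos (real (Suc i) * t)"
      proof -
        have "real j * t = real (Suc i) * t + t" "real i * t = real (Suc i) * t - t" using 3 by (simp_all add: algebra_simps)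
        then show ?thesis by (simp add: cos_add cos_diff)
      qed
      then show ?thesis using T(2)[of t] S(2)[of t] by (simp add: algebra_simps)
    qed
    ultimately show ?thesis by blast
  qed
qed

text \<open>N times the Fejer kernel. As a squared modulus it is nonnegative and needs no quotient
  of sines at t = 0; expanding the square shows that it is a polynomial in cos t.\<close>

definition fejer :: "nat \<Rightarrow> real \<Rightarrow> real" where
  "fejer N t = (cmod (\<Sum>j<N. cis (real j * t)))\<^sup>2"

lemma fejer_poly: "\<exists>q :: real poly. degree q \<le> N - 1 \<and> (\<forall>t. fejer N t = poly q (cos t))"
proof -
  obtain T :: "nat \<Rightarrow> real poly" where T: "\<And>j. degree (T j) \<le> j" "\<And>j t. cos (real j * t) = poly (T j) (cos t)"
    using cos_mult_poly by metis
  define q where "q = (\<Sum>j<N. \<Sum>k<N. T (if j \<le> k then k - j else j - k))"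
  have "degree q \<le> N - 1"
    unfolding q_def
  proof (intro degree_sum_le finite_lessThan)
    fix j k assume "j \<in> {..<N}" "k \<in> {..<N}"
    then have "(if j \<le> k then k - j else j - k) \<le> N - 1" by auto
    then show "degree (T (if j \<le> k then k - j else j - k)) \<le> N - 1" using T(1) order_trans by blast
  qed
  moreover have "fejer N t = poly q (cos t)" for t
  proof -
    have "complex_of_real (fejer N t) = (\<Sum>j<N. cis (real j * t)) * cnj (\<Sum>j<N. cis (real j * t))"
      unfolding fejer_def by (rule complex_norm_square)
    also have "\<dots> = (\<Sum>j<N. \<Sum>k<N. cis (real j * t) * cis (- (real k * t)))"
      by (simp add: sum_product cis_cnj)
    finally have "fejer N t = Re (\<Sum>j<N. \<Sum>k<N. cis (real j * t) * cis (- (real k * t)))"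
      by (metis Re_complex_of_real)
    also have "\<dots> = (\<Sum>j<N. \<Sum>k<N. cos (real (if j \<le> k then k - j else j - k) * t))"
    proof -
      have "Re (cis (real j * t) * cis (- (real k * t))) = cos (real (if j \<le> k then k - j else j - k) * t)" for j k :: nat
      proof -
        have "Re (cis (real j * t) * cis (- (real k * t))) = cos (real j * t - real k * t)" by (simp add: cis_mult)
        moreover have "cos (real j * t - real k * t) = cos (real k * t - real j * t)"
          by (metis cos_minus minus_diff_eq)
        ultimately show ?thesis by (simp add: of_nat_diff left_diff_distrib)
      qed
      then show ?thesis by (simp only: Re_sum)
    qed
    also have "\<dots> = poly q (cos t)" unfolding q_def by (simp add: poly_sum T(2))
    finally show ?thesis .
  qed
  ultimately show ?thesis by blast
qed

text \<open>The third bound sums the geometric series, with |1 - cis t| = 2 |sin(t/2)|. In the last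
  one all angles j t stay below 1, so every cosine is at least 1/2.\<close>

lemma fejer_bounds:
  shows "0 \<le> fejer N t" "fejer N t \<le> (real N)\<^sup>2" "fejer N t * (sin (t / 2))\<^sup>2 \<le> 1"
    "0 < N \<Longrightarrow> 0 \<le> t \<Longrightarrow> t \<le> 1 / real N \<Longrightarrow> (real N)\<^sup>2 / 4 \<le> fejer N t"
proof -
  let ?D = "\<Sum>j<N. cis (real j * t)"
  show "0 \<le> fejer N t" by (simp add: fejer_def)
  have "cmod ?D \<le> (\<Sum>j<N. cmod (cis (real j * t)))" by (rule norm_sum)
  then have "cmod ?D \<le> real N" by simp
  then show "fejer N t \<le> (real N)\<^sup>2" unfolding fejer_def by (intro power_mono) auto
  have "?D = (\<Sum>j<N. cis t ^ j)" by (simp add: Complex.DeMoivre)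
  then have "(1 - cis t) * ?D = 1 - cis t ^ N" by (simp add: one_diff_power_eq)
  then have "cmod (1 - cis t) * cmod ?D = cmod (1 - cis t ^ N)" by (metis norm_mult)
  also have "\<dots> \<le> cmod 1 + cmod (cis t ^ N)" by (rule norm_triangle_ineq4)
  also have "\<dots> = 2" by (simp add: norm_power)
  finally have "(cmod (1 - cis t) * cmod ?D)\<^sup>2 \<le> 2\<^sup>2" by (intro power_mono) auto
  moreover have "(cmod (1 - cis t))\<^sup>2 = 4 * (sin (t / 2))\<^sup>2"
  proof -
    have "(cmod (1 - cis t))\<^sup>2 = (1 - cos t)\<^sup>2 + (sin t)\<^sup>2" by (simp add: cmod_power2)
    also have "\<dots> = 1 - 2 * cos t + ((cos t)\<^sup>2 + (sin t)\<^sup>2)" by (simp add: power2_eq_square algebra_simps)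
    also have "\<dots> = 2 * (1 - cos t)" by simp
    also have "\<dots> = 4 * (sin (t / 2))\<^sup>2" using cos_double_sin[of "t / 2"] by simp
    finally show ?thesis .
  qed
  ultimately show "fejer N t * (sin (t / 2))\<^sup>2 \<le> 1"
    by (simp add: fejer_def power_mult_distrib mult_ac)
  assume N: "0 < N" and t: "0 \<le> t" "t \<le> 1 / real N"
  have "real N * (1 / 2) = (\<Sum>j<N. 1 / 2)" by simp
  also have "\<dots> \<le> (\<Sum>j<N. cos (real j * t))"
  proof (intro sum_mono cos_ge_half)
    fix j assume "j \<in> {..<N}"
    then have "real j * t \<le> real N * (1 / real N)" using t N by (intro mult_mono) auto
    then show "real j * t \<le> 1" using N by simp
  qed (use t in auto)
  also have "\<dots> = Re ?D" by simp
  also have "\<dots> \<le> cmod ?D" by (rule complex_Re_le_cmod)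
  finally have "(real N * (1 / 2))\<^sup>2 \<le> fejer N t" unfolding fejer_def by (intro power_mono) auto
  then show "(real N)\<^sup>2 / 4 \<le> fejer N t" by (simp add: power2_eq_square)
qed

lemma cw_antimono: "0 \<le> s \<Longrightarrow> s \<le> t \<Longrightarrow> t \<le> pi \<Longrightarrow> cw m t \<le> cw m s"
  unfolding cw_def by (intro power_mono cos_monotone_0_pi_le cos_ge_zero) auto

text \<open>The normalised cube of a Fejer kernel of order about n / 3. Against w, of size t near 0,
  its mass is at least of order N^4; the tail of the moment behaves like t^(-6) t^3 and gives N^2.
  The square of the Fejer kernel would leave t^(-1) and hence a logarithm.\<close>

lemma jackson_kernel:
  obtains C where "0 < C" "\<And>n. 0 < n \<Longrightarrow> \<exists>K :: real poly. degree K \<le> n - 1 \<and> (\<forall>t. 0 \<le> poly K (cos t))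
    \<and> (\<integral>t. indicator {0<..<pi} t * (poly K (cos t) * (sin t * (cw m t)\<^sup>2)) \<partial>lborel) = 1
    \<and> (\<integral>t. indicator {0<..<pi} t * (poly K (cos t) * (4 * sin (t / 2) ^ 3)) \<partial>lborel) \<le> C / (real n)\<^sup>2"
proof -
  \<comment> \<open>256 = 64 * 4: the cube of the 4 in \<open>fejer_bounds\<close>, and the integral
    of t / 2 up to 1 / N.\<close>
  define c where "c = (cw m 1)\<^sup>2 / 256"
  have c1: "0 < cw m 1" using cw_pos[of 1 m] pi_ge_two by simp
  have c: "0 < c" using c1 by (simp add: c_def)
  \<comment> \<open>257 = 1 + 256 from the ranges below and above 1 / N, where 256 is half of 8^3
    and 8 comes from sin(t/2) >= t / 8; 9 comes from n <= 3 N.\<close>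
  define C where "C = 4 * 257 / c * 9"
  have "\<exists>K :: real poly. degree K \<le> n - 1 \<and> (\<forall>t. 0 \<le> poly K (cos t))
    \<and> (\<integral>t. indicator {0<..<pi} t * (poly K (cos t) * (sin t * (cw m t)\<^sup>2)) \<partial>lborel) = 1
    \<and> (\<integral>t. indicator {0<..<pi} t * (poly K (cos t) * (4 * sin (t / 2) ^ 3)) \<partial>lborel) \<le> C / (real n)\<^sup>2"
    if n: "0 < n" for n
  proof -
    \<comment> \<open>The largest N for which the cube, of degree at most 3 (N - 1), stays within
      degree n - 1.\<close>
    define N where "N = (n - 1) div 3 + 1"
    have N: "0 < N" "3 * (N - 1) \<le> n - 1" by (auto simp: N_def)
    have nN: "real n \<le> 3 * real N"
    proof -
      have "n \<le> 3 * N" using n unfolding N_def by presburger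
      then show ?thesis by (metis of_nat_le_iff of_nat_mult of_nat_numeral)
    qed
    have Npi: "1 / real N \<le> 1" "1 / real N < pi" using N pi_ge_two by (auto simp: divide_le_eq) (smt (verit) divide_le_eq_1 of_nat_1 of_nat_le_iff Suc_leI One_nat_def)
    obtain q :: "real poly" where q: "degree q \<le> N - 1" "\<And>t. fejer N t = poly q (cos t)" using fejer_poly by blast
    define K0 where "K0 = q ^ 3"
    have K0: "poly K0 (cos t) = fejer N t ^ 3" for t by (simp add: K0_def q(2))
    have dK0: "degree K0 \<le> n - 1"
    proof -
      have "degree K0 \<le> degree q * 3" unfolding K0_def by (rule degree_power_le)
      then show ?thesis using q(1) N by linarith
    qed
    have cont: "continuous_on S (\<lambda>t. fejer N t)" for S unfolding q(2) by (intro continuous_intros)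
    define L where "L = (\<integral>t. indicator {0<..<pi} t * (poly K0 (cos t) * (sin t * (cw m t)\<^sup>2)) \<partial>lborel)"
    define U where "U = (\<integral>t. indicator {0<..<pi} t * (poly K0 (cos t) * (4 * sin (t / 2) ^ 3)) \<partial>lborel)"
    have Lge: "c * real N ^ 4 \<le> L"
    proof -
      have "(\<integral>t. indicator {0<..<1 / real N} t * ((real N)\<^sup>2 ^ 3 / 64 * ((cw m 1)\<^sup>2 * (t / 2))) \<partial>lborel)
        = (real N)\<^sup>2 ^ 3 / 64 * ((cw m 1)\<^sup>2 * ((1 / real N)\<^sup>2 / 4)) - (real N)\<^sup>2 ^ 3 / 64 * ((cw m 1)\<^sup>2 * (0\<^sup>2 / 4))"
        by (rule lborel_integral_FTC[where F = "\<lambda>t. (real N)\<^sup>2 ^ 3 / 64 * ((cw m 1)\<^sup>2 * (t\<^sup>2 / 4))"])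
           (auto intro!: continuous_intros derivative_eq_intros)
      also have "\<dots> = c * real N ^ 4" using N by (simp add: c_def field_simps power2_eq_square power_numeral_reduce)
      finally have "c * real N ^ 4 = (\<integral>t. indicator {0<..<1 / real N} t * ((real N)\<^sup>2 ^ 3 / 64 * ((cw m 1)\<^sup>2 * (t / 2))) \<partial>lborel)" by simp
      also have "\<dots> \<le> L"
        unfolding L_def
      proof (rule integral_mono)
        show "integrable lborel (\<lambda>t. indicator {0<..<1 / real N} t * ((real N)\<^sup>2 ^ 3 / 64 * ((cw m 1)\<^sup>2 * (t / 2))))"
          "integrable lborel (\<lambda>t. indicator {0<..<pi} t * (poly K0 (cos t) * (sin t * (cw m t)\<^sup>2)))"
          by ((intro lborel_integral_continuous(2) continuous_intros; simp)+)
        fix t :: real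
        show "indicator {0<..<1 / real N} t * ((real N)\<^sup>2 ^ 3 / 64 * ((cw m 1)\<^sup>2 * (t / 2)))
          \<le> indicator {0<..<pi} t * (poly K0 (cos t) * (sin t * (cw m t)\<^sup>2))"
        proof (cases "t \<in> {0<..<1 / real N}")
          case True
          then have t: "0 < t" "t < 1 / real N" "t \<le> 1" "t < pi" using Npi by auto
          have f1: "((real N)\<^sup>2 / 4) ^ 3 \<le> fejer N t ^ 3" using fejer_bounds(4)[of N t] N t by (intro power_mono) auto
          have "(cw m 1)\<^sup>2 \<le> (cw m t)\<^sup>2"
            using t cw_antimono[of t 1 m] pi_ge_two c1 by (intro power_mono) auto
          moreover have "t / 2 \<le> sin t" using t sin_ge_half[of t] by simp
          ultimately have f2: "(cw m 1)\<^sup>2 * (t / 2) \<le> (cw m t)\<^sup>2 * sin t"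
            using t by (intro mult_mono) simp_all
          have "((real N)\<^sup>2 / 4) ^ 3 * ((cw m 1)\<^sup>2 * (t / 2)) \<le> fejer N t ^ 3 * ((cw m t)\<^sup>2 * sin t)"
            by (rule mult_mono[OF f1 f2]) (use t fejer_bounds(1)[of N t] in auto)
          then show ?thesis using True t by (simp add: K0 power_divide mult_ac)
        next
          case False
          have "0 \<le> sin t" if "0 < t" "t < pi" using that by (simp add: sin_ge_zero)
          then have "0 \<le> indicator {0<..<pi} t * (poly K0 (cos t) * (sin t * (cw m t)\<^sup>2))"
            using fejer_bounds(1)[of N t] by (auto simp: K0 indicator_def)
          then show ?thesis using False by simp
        qed
      qed
      finally show ?thesis .
    qed
    have Ule: "U \<le> 4 * 257 * (real N)\<^sup>2"
    proof -
      have i1: "(\<integral>t. indicator {0<..<1 / real N} t * (real N ^ 3) \<partial>lborel) = real N ^ 3 * (1 / real N) - real N ^ 3 * 0"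
        by (rule lborel_integral_FTC) (auto intro!: continuous_intros derivative_eq_intros)
      have i2: "(\<integral>t. indicator {1 / real N<..<pi} t * (512 / t ^ 3) \<partial>lborel) = - 256 / pi\<^sup>2 - (- 256 / (1 / real N)\<^sup>2)"
      proof (rule lborel_integral_FTC[where F = "\<lambda>t. - 256 / t\<^sup>2"])
        fix t :: real assume "1 / real N < t"
        then have t: "0 < t" using N by (smt (verit) divide_pos_pos of_nat_0_less_iff)
        have "((\<lambda>t. - 256 / t\<^sup>2) has_real_derivative (0 * t\<^sup>2 - (- 256) * (2 * t)) / (t\<^sup>2 * t\<^sup>2)) (at t)"
          using t by (intro DERIV_divide) (auto intro!: derivative_eq_intros)
        also have "(0 * t\<^sup>2 - (- 256) * (2 * t)) / (t\<^sup>2 * t\<^sup>2) = 512 / t ^ 3"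
          using t by (simp add: power2_eq_square power3_eq_cube field_simps)
        finally show "((\<lambda>t. - 256 / t\<^sup>2) has_real_derivative 512 / t ^ 3) (at t)" .
      next
        have z: "t \<noteq> 0" if "t \<in> {1 / real N..pi}" for t
          using that N by (smt (verit) atLeastAtMost_iff divide_pos_pos of_nat_0_less_iff)
        show "continuous_on {1 / real N..pi} (\<lambda>t. - 256 / t\<^sup>2)" "continuous_on {1 / real N..pi} (\<lambda>t. 512 / t ^ 3)"
          using z by (auto intro!: continuous_intros)
      qed (use Npi in auto)
      have ig: "integrable lborel (\<lambda>t. indicator {0<..<1 / real N} t * (real N ^ 3))"
        by (intro lborel_integral_continuous(2) continuous_intros)
      have ig2: "integrable lborel (\<lambda>t. indicator {1 / real N<..<pi} t * (512 / t ^ 3))"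
      proof (intro lborel_integral_continuous(2) continuous_intros ballI)
        fix t assume "t \<in> {1 / real N..pi}"
        then show "t ^ 3 \<noteq> 0" using N by (smt (verit) atLeastAtMost_iff divide_pos_pos of_nat_0_less_iff zero_less_power)
      qed
      have "U \<le> (\<integral>t. 4 * (indicator {0<..<1 / real N} t * (real N ^ 3) + indicator {1 / real N<..<pi} t * (512 / t ^ 3)) \<partial>lborel)"
        unfolding U_def
      proof (rule integral_mono_AE)
        show "integrable lborel (\<lambda>t. indicator {0<..<pi} t * (poly K0 (cos t) * (4 * sin (t / 2) ^ 3)))"
          by (intro lborel_integral_continuous(2) continuous_intros) auto
        show "integrable lborel (\<lambda>t. 4 * (indicator {0<..<1 / real N} t * (real N ^ 3) + indicator {1 / real N<..<pi} t * (512 / t ^ 3)))"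
          by (intro integrable_mult_right Bochner_Integration.integrable_add ig ig2)
        show "AE t in lborel. indicator {0<..<pi} t * (poly K0 (cos t) * (4 * sin (t / 2) ^ 3))
          \<le> 4 * (indicator {0<..<1 / real N} t * (real N ^ 3) + indicator {1 / real N<..<pi} t * (512 / t ^ 3))"
          using AE_lborel_singleton[of "1 / real N"]
        proof eventually_elim
          case (elim t)
          consider "t \<notin> {0<..<pi}" | "0 < t" "t < 1 / real N" | "1 / real N < t" "t < pi" using elim Npi by force
          then show ?case
          proof cases
            case 1
            then show ?thesis using Npi N by (auto simp: indicator_def intro!: add_nonneg_nonneg) (smt (verit) divide_pos_pos of_nat_0_less_iff)+
          next
            case 2
            have s: "0 \<le> sin (t / 2)" "sin (t / 2) \<le> t / 2"
              using 2 Npi sin_x_le_x[of "t / 2"] by (auto intro!: sin_ge_zero)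
            have tN: "t * real N \<le> 1" using 2 N by (simp add: field_simps)
            have "fejer N t ^ 3 * sin (t / 2) ^ 3 \<le> ((real N)\<^sup>2) ^ 3 * t ^ 3"
              using fejer_bounds(1,2)[of N t] s 2 by (intro mult_mono power_mono) auto
            also have "\<dots> = real N ^ 3 * (t * real N) ^ 3" by (simp add: power_mult_distrib power2_eq_square power3_eq_cube)
            also have "\<dots> \<le> real N ^ 3 * 1" using tN 2 by (intro mult_left_mono power_le_one) auto
            finally show ?thesis using 2 Npi by (simp add: K0)
          next
            case 3
            have t: "0 < t" using 3(1) N by (smt (verit) divide_pos_pos of_nat_0_less_iff)
            have s: "t / 8 \<le> sin (t / 2)" using sin_half_ge[of t] t 3 by simp
            then have s0: "0 < sin (t / 2)" using t by simp
            have "fejer N t ^ 3 * sin (t / 2) ^ 3 = (fejer N t * (sin (t / 2))\<^sup>2) ^ 3 / sin (t / 2) ^ 3"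
              using s0 by (simp add: power_mult_distrib field_simps power2_eq_square power3_eq_cube)
            also have "\<dots> \<le> 1 / (t / 8) ^ 3"
              using fejer_bounds(1,3)[of N t] s t s0 by (intro frac_le power_le_one power_mono) auto
            also have "\<dots> = 512 / t ^ 3" by (simp add: power_divide)
            finally show ?thesis using 3 t by (simp add: K0)
          qed
        qed
      qed
      also have "\<dots> = 4 * (real N ^ 3 * (1 / real N) - real N ^ 3 * 0 + (- 256 / pi\<^sup>2 - (- 256 / (1 / real N)\<^sup>2)))"
        unfolding i1[symmetric] i2[symmetric] Bochner_Integration.integral_add[OF ig ig2, symmetric]
        by (rule integral_mult_right_zero)
      also have "\<dots> \<le> 4 * 257 * (real N)\<^sup>2" using N by (simp add: power2_eq_square power3_eq_cube field_simps)
      finally show ?thesis .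
    qed
    have L: "0 < L" using Lge c N by (smt (verit) mult_pos_pos of_nat_0_less_iff zero_less_power)
    have "U / L \<le> C / (real n)\<^sup>2"
    proof -
      have "U / L \<le> 4 * 257 * (real N)\<^sup>2 / (c * real N ^ 4)"
        using Ule Lge c N L by (intro frac_le) auto
      also have "\<dots> = 4 * 257 / c * (1 / (real N)\<^sup>2)" using N c by (simp add: field_simps power2_eq_square power_numeral_reduce)
      finally have 1: "U / L \<le> 4 * 257 / c * (1 / (real N)\<^sup>2)" .
      have "1 / (real N)\<^sup>2 \<le> 9 / (real n)\<^sup>2"
      proof -
        have "(real n)\<^sup>2 \<le> (3 * real N)\<^sup>2" using nN by (intro power_mono) auto
        then show ?thesis using N n by (simp add: divide_simps power_mult_distrib)
      qed
      then have "4 * 257 / c * (1 / (real N)\<^sup>2) \<le> 4 * 257 / c * (9 / (real n)\<^sup>2)"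
        using c by (intro mult_left_mono) auto
      with 1 show ?thesis by (simp add: C_def)
    qed
    moreover have "(\<integral>t. indicator {0<..<pi} t * (poly (smult (1 / L) K0) (cos t) * F t) \<partial>lborel)
      = (\<integral>t. indicator {0<..<pi} t * (poly K0 (cos t) * F t) \<partial>lborel) / L" for F
      by (subst integral_divide_zero[symmetric]) (simp add: mult_ac)
    ultimately show ?thesis
      using L fejer_bounds(1)[of N] dK0 unfolding U_def L_def
      by (intro exI[of _ "smult (1 / L) K0"]) (simp add: K0 L_def U_def)
  qed
  then show ?thesis using that[of C] c by (simp add: C_def)
qed

subsection \<open>Averages of translations\<close>

definition tau :: "nat \<Rightarrow> real \<Rightarrow> (real \<Rightarrow> real) \<Rightarrow> real \<Rightarrow> real" where
  "tau m t f x = spin_avg m t f x / cw m t"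

definition dif :: "nat \<Rightarrow> real \<Rightarrow> (real \<Rightarrow> real) \<Rightarrow> real \<Rightarrow> real" where
  "dif m t f x = tau m t f x - f x"

lemma cw_measurable [measurable (raw)]: "f \<in> borel_measurable M \<Longrightarrow> (\<lambda>w. cw m (f w)) \<in> borel_measurable M"
  by (rule measurable_compose[OF _ borel_measurable_continuous_onI[OF continuous_cw[OF continuous_on_id]]])

lemma tau_measurable [measurable (raw)]:
  assumes [measurable]: "f \<in> borel_measurable borel" "g \<in> borel_measurable M" "h \<in> borel_measurable M"
  shows "(\<lambda>w. tau m (g w) f (h w)) \<in> borel_measurable M"
  unfolding tau_def by measurable

lemma dif_measurable [measurable (raw)]:
  assumes [measurable]: "f \<in> borel_measurable borel" "g \<in> borel_measurable M" "h \<in> borel_measurable M"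
  shows "(\<lambda>w. dif m (g w) f (h w)) \<in> borel_measurable M"
  unfolding dif_def by measurable

text \<open>The weight w as it meets the undivided average: tau is the average divided by c, so only
  one factor c is left and the integrand stays regular up to pi.\<close>

definition in_w1 :: "nat \<Rightarrow> real \<Rightarrow> real \<Rightarrow> real" where
  "in_w1 m s u = indicator {0<..<s} u * (sin u * cw m u)"

definition in_w2 :: "nat \<Rightarrow> real \<Rightarrow> real \<Rightarrow> real" where
  "in_w2 m s u = indicator {0<..<s} u * (sin u * (cw m u)\<^sup>2)"

definition out_w :: "nat \<Rightarrow> real \<Rightarrow> real \<Rightarrow> real" where
  "out_w m t s = indicator {0<..<t} s * (1 / (sin s * (cw m s)\<^sup>2))"

lemma w_measurable [measurable (raw)]:
  assumes [measurable]: "g \<in> borel_measurable M" "h \<in> borel_measurable M"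
  shows "(\<lambda>w. in_w1 m (g w) (h w)) \<in> borel_measurable M" "(\<lambda>w. in_w2 m (g w) (h w)) \<in> borel_measurable M"
    "(\<lambda>w. out_w m (g w) (h w)) \<in> borel_measurable M"
  unfolding in_w1_def in_w2_def out_w_def indicator_def greaterThanLessThan_iff of_bool_def by measurable

definition inner1 :: "nat \<Rightarrow> real \<Rightarrow> (real \<Rightarrow> real) \<Rightarrow> real \<Rightarrow> real" where
  "inner1 m s f x = (\<integral>u. in_w1 m s u * spin_avg m u f x \<partial>lborel)"

definition inner2 :: "nat \<Rightarrow> real \<Rightarrow> (real \<Rightarrow> real) \<Rightarrow> real \<Rightarrow> real" where
  "inner2 m s f x = (\<integral>u. in_w2 m s u * dif m u f x \<partial>lborel)"

definition outer1 :: "nat \<Rightarrow> real \<Rightarrow> (real \<Rightarrow> real) \<Rightarrow> real \<Rightarrow> real" where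
  "outer1 m t f x = (\<integral>s. out_w m t s * inner1 m s f x \<partial>lborel)"

definition outer2 :: "nat \<Rightarrow> real \<Rightarrow> (real \<Rightarrow> real) \<Rightarrow> real \<Rightarrow> real" where
  "outer2 m t f x = (\<integral>s. out_w m t s * inner2 m s f x \<partial>lborel)"

definition w_mass :: "nat \<Rightarrow> real \<Rightarrow> real" where
  "w_mass m s = (\<integral>u. in_w2 m s u \<partial>lborel)"

definition kap :: "nat \<Rightarrow> real \<Rightarrow> real" where
  "kap m t = (\<integral>s. out_w m t s * w_mass m s \<partial>lborel)"

text \<open>A majorant for the iterated integral of w, of order t^2 at 0, in such a form that its
  product with w is exactly 4 sin^3(t/2).\<close>

definition rho :: "nat \<Rightarrow> real \<Rightarrow> real" where
  "rho m t = 2 * (sin (t / 2))\<^sup>2 / (cos (t / 2) * (cw m t)\<^sup>2)"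

lemma inner_measurable [measurable (raw)]:
  assumes [measurable]: "f \<in> borel_measurable borel" "g \<in> borel_measurable M" "h \<in> borel_measurable M"
  shows "(\<lambda>w. inner1 m (g w) f (h w)) \<in> borel_measurable M" "(\<lambda>w. inner2 m (g w) f (h w)) \<in> borel_measurable M"
  unfolding inner1_def inner2_def by measurable

lemma outer_measurable [measurable (raw)]:
  assumes [measurable]: "f \<in> borel_measurable borel" "g \<in> borel_measurable M" "h \<in> borel_measurable M"
  shows "(\<lambda>w. outer1 m (g w) f (h w)) \<in> borel_measurable M" "(\<lambda>w. outer2 m (g w) f (h w)) \<in> borel_measurable M"
  unfolding outer1_def outer2_def by measurable

lemma w_mass_measurable [measurable]: "w_mass m \<in> borel_measurable borel"
  unfolding w_mass_def by measurable

lemma nn_integral_indicator_continuous: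
  fixes F :: "real \<Rightarrow> real"
  assumes "continuous_on {a..b} F" "\<And>s. a < s \<Longrightarrow> s < b \<Longrightarrow> 0 \<le> F s"
  shows "(\<integral>\<^sup>+s. ennreal (indicator {a<..<b} s * F s) \<partial>lborel) = ennreal (\<integral>s. indicator {a<..<b} s * F s \<partial>lborel)"
  by (rule nn_integral_eq_integral[OF lborel_integral_continuous(2)[OF assms(1)]])
     (use assms(2) in \<open>auto simp: indicator_def\<close>)

lemma integral_sin_const:
  fixes s c :: real
  assumes "0 \<le> s"
  shows "(\<integral>u. indicator {0<..<s} u * (sin u * c) \<partial>lborel) = (1 - cos s) * c"
proof -
  have "(\<integral>u. indicator {0<..<s} u * (sin u * c) \<partial>lborel) = - cos s * c - (- cos 0 * c)"
    using assms by (intro lborel_integral_FTC[where F = "\<lambda>u. - cos u * c"])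
      (auto intro!: continuous_intros derivative_eq_intros)
  then show ?thesis by (simp add: algebra_simps)
qed

lemma nn_integral_sin_const:
  fixes s c :: real
  assumes "0 \<le> s" "s \<le> pi" "0 \<le> c"
  shows "(\<integral>\<^sup>+u. ennreal (indicator {0<..<s} u * (sin u * c)) \<partial>lborel) = ennreal ((1 - cos s) * c)"
  using assms by (subst nn_integral_indicator_continuous)
    (auto intro!: continuous_intros mult_nonneg_nonneg sin_ge_zero simp: integral_sin_const)

lemma one_minus_cos_pos: "0 < s \<Longrightarrow> s < pi \<Longrightarrow> 0 < 1 - cos s"
  using cos_monotone_0_pi[of 0 s] by simp

lemma rho_pos: "0 < t \<Longrightarrow> t < pi \<Longrightarrow> 0 < rho m t"
  using cos_half_pos[of t] cw_pos[of t m] sin_gt_zero[of "t / 2"] by (simp add: rho_def)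

lemma out_w_nonneg: "t < pi \<Longrightarrow> 0 \<le> out_w m t s"
  by (auto simp: out_w_def indicator_def intro!: mult_nonneg_nonneg sin_ge_zero)

lemma in_w_nonneg: "s \<le> pi \<Longrightarrow> 0 \<le> in_w1 m s u" "s \<le> pi \<Longrightarrow> 0 \<le> in_w2 m s u"
  by (auto simp: in_w1_def in_w2_def indicator_def intro!: mult_nonneg_nonneg sin_ge_zero cw_nonneg)

text \<open>Here (1 - cos s) / sin s is tan(s/2), and the remaining factor 1 / (cos(s/2) c^2)
  increases, so that it can be frozen at t. The last step uses 1 - cos(t/2) <= sin^2(t/2).\<close>

lemma out_w_integral:
  assumes t: "0 < t" "t < pi" and C: "0 \<le> C"
  shows "(\<integral>\<^sup>+s. ennreal (out_w m t s * (C * (1 - cos s))) \<partial>lborel) \<le> ennreal (C * rho m t)"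
proof -
  define e where "e = C / (cos (t / 2) * (cw m t)\<^sup>2)"
  have ct: "0 < cos (t / 2)" "0 < cw m t" using cos_half_pos[of t] cw_pos[of t m] t by auto
  then have e: "0 \<le> e" using C by (simp add: e_def)
  have "(\<integral>\<^sup>+s. ennreal (out_w m t s * (C * (1 - cos s))) \<partial>lborel) \<le> (\<integral>\<^sup>+s. ennreal (indicator {0<..<t} s * (sin (s / 2) * e)) \<partial>lborel)"
  proof (intro nn_integral_mono ennreal_leI)
    fix s
    show "out_w m t s * (C * (1 - cos s)) \<le> indicator {0<..<t} s * (sin (s / 2) * e)"
    proof (cases "s \<in> {0<..<t}")
      case True
      then have s: "0 < s" "s < t" "s < pi" using t by auto
      have cs: "0 < cos (s / 2)" "0 < cw m s" "0 < sin s" "0 \<le> sin (s / 2)"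
        using cos_half_pos[of s] cw_pos[of s m] sin_gt_zero[of s] sin_ge_zero[of "s / 2"] s by auto
      have mono: "cos (t / 2) \<le> cos (s / 2)" "cw m t \<le> cw m s"
        using s t cw_antimono[of s t m] by (auto intro!: cos_monotone_0_pi_le)
      have X: "(1 - cos s) / sin s = sin (s / 2) / cos (s / 2)"
        using tan_half_identities(1)[of s] cs by (simp add: field_simps)
      have "out_w m t s * (C * (1 - cos s)) = C * ((1 - cos s) / sin s / (cw m s)\<^sup>2)"
        using True by (simp add: out_w_def)
      also have "\<dots> = C * (sin (s / 2) / (cos (s / 2) * (cw m s)\<^sup>2))" unfolding X by simp
      also have "\<dots> \<le> C * (sin (s / 2) / (cos (t / 2) * (cw m t)\<^sup>2))"
        using cs ct mono C by (intro mult_left_mono divide_left_mono mult_mono power_mono mult_pos_pos) auto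
      finally show ?thesis using True by (simp add: e_def mult.commute[of C])
    qed (simp add: out_w_def)
  qed
  also have "\<dots> = ennreal (\<integral>s. indicator {0<..<t} s * (sin (s / 2) * e) \<partial>lborel)"
    using t e by (intro nn_integral_indicator_continuous) (auto intro!: continuous_intros mult_nonneg_nonneg sin_ge_zero divide_nonneg_nonneg)
  also have "(\<integral>s. indicator {0<..<t} s * (sin (s / 2) * e) \<partial>lborel) = - 2 * cos (t / 2) * e - (- 2 * cos (0 / 2) * e)"
    using t by (intro lborel_integral_FTC[where F = "\<lambda>s. - 2 * cos (s / 2) * e"])
      (auto intro!: continuous_intros derivative_eq_intros)
  also have "\<dots> = 2 * (1 - cos (t / 2)) * e" by (simp add: algebra_simps)
  also have "ennreal \<dots> \<le> ennreal (C * rho m t)"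
  proof (rule ennreal_leI)
    have "cos (t / 2) * cos (t / 2) \<le> 1 * cos (t / 2)" using ct by (intro mult_right_mono) auto
    then have "2 * (1 - cos (t / 2)) \<le> 2 * (1 - cos (t / 2) * cos (t / 2))" by simp
    also have "1 - cos (t / 2) * cos (t / 2) = (sin (t / 2))\<^sup>2"
      unfolding sin_squared_eq by (simp only: power2_eq_square)
    finally have "2 * (1 - cos (t / 2)) \<le> 2 * (sin (t / 2))\<^sup>2" .
    then have "2 * (1 - cos (t / 2)) * e \<le> 2 * (sin (t / 2))\<^sup>2 * e" using e by (intro mult_right_mono) auto
    then show "2 * (1 - cos (t / 2)) * e \<le> C * rho m t" by (simp add: rho_def e_def mult_ac)
  qed
  finally show ?thesis .
qed

lemma out_w_integrable:
  assumes t: "0 < t" "t < pi" and [measurable]: "h \<in> borel_measurable borel"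
    and h: "\<And>s. 0 < s \<Longrightarrow> s < t \<Longrightarrow> \<bar>h s\<bar> \<le> G * (1 - cos s)" and G: "0 \<le> G"
  shows "integrable lborel (\<lambda>s. out_w m t s * h s)"
proof (rule integrableI_bounded)
  have "(\<integral>\<^sup>+s. ennreal (norm (out_w m t s * h s)) \<partial>lborel) \<le> (\<integral>\<^sup>+s. ennreal (out_w m t s * (G * (1 - cos s))) \<partial>lborel)"
  proof (intro nn_integral_mono ennreal_leI)
    fix s
    show "norm (out_w m t s * h s) \<le> out_w m t s * (G * (1 - cos s))"
    proof (cases "s \<in> {0<..<t}")
      case True
      then have "out_w m t s * \<bar>h s\<bar> \<le> out_w m t s * (G * (1 - cos s))"
        using h[of s] out_w_nonneg[OF t(2), of m s] by (intro mult_left_mono) auto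
      then show ?thesis using out_w_nonneg[OF t(2), of m s] by (simp add: abs_mult)
    qed (simp add: out_w_def)
  qed
  also have "\<dots> \<le> ennreal (G * rho m t)" by (rule out_w_integral[OF t G])
  finally show "(\<integral>\<^sup>+s. ennreal (norm (out_w m t s * h s)) \<partial>lborel) < \<infinity>" by (simp add: le_less_trans)
qed measurable

lemma abs_integral_sin_le:
  assumes s: "0 \<le> s" "s \<le> pi" and h: "continuous_on {0..s} h" "\<And>u. 0 \<le> u \<Longrightarrow> u \<le> s \<Longrightarrow> \<bar>h u\<bar> \<le> G"
  shows "\<bar>\<integral>u. indicator {0<..<s} u * (sin u * h u) \<partial>lborel\<bar> \<le> G * (1 - cos s)"
proof -
  have "\<bar>\<integral>u. indicator {0<..<s} u * (sin u * h u) \<partial>lborel\<bar> \<le> (\<integral>u. \<bar>indicator {0<..<s} u * (sin u * h u)\<bar> \<partial>lborel)"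
    by (rule integral_abs_bound)
  also have "\<dots> \<le> (\<integral>u. indicator {0<..<s} u * (sin u * G) \<partial>lborel)"
  proof (rule integral_mono)
    show "integrable lborel (\<lambda>u. \<bar>indicator {0<..<s} u * (sin u * h u)\<bar>)"
      by (intro integrable_abs lborel_integral_continuous(2) continuous_intros h)
    show "integrable lborel (\<lambda>u. indicator {0<..<s} u * (sin u * G))"
      by (intro lborel_integral_continuous(2) continuous_intros)
    show "\<bar>indicator {0<..<s} u * (sin u * h u)\<bar> \<le> indicator {0<..<s} u * (sin u * G)" for u
      using h(2)[of u] s sin_ge_zero[of u] by (auto simp: indicator_def abs_mult intro!: mult_left_mono)
  qed
  also have "\<dots> = G * (1 - cos s)" using s by (simp add: integral_sin_const)
  finally show ?thesis .
qed

lemma w_mass_bounds: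
  assumes s: "0 \<le> s" "s \<le> pi"
  shows "0 \<le> w_mass m s" "w_mass m s \<le> 1 - cos s" "s \<le> 1 \<Longrightarrow> (cw m 1)\<^sup>2 * (1 - cos s) \<le> w_mass m s"
proof -
  show "0 \<le> w_mass m s" unfolding w_mass_def using in_w_nonneg(2)[OF s(2)] by (rule Bochner_Integration.integral_nonneg)
  have b: "\<bar>(cw m u)\<^sup>2\<bar> \<le> 1" for u using cw_nonneg[of m u] cw_le_1[of m u] by (simp add: power_le_one)
  have "\<bar>w_mass m s\<bar> \<le> 1 * (1 - cos s)"
    unfolding w_mass_def in_w2_def by (intro abs_integral_sin_le s continuous_intros b)
  then show "w_mass m s \<le> 1 - cos s" by simp
  assume s1: "s \<le> 1"
  have "(\<integral>u. indicator {0<..<s} u * (sin u * (cw m 1)\<^sup>2) \<partial>lborel) \<le> w_mass m s"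
    unfolding w_mass_def in_w2_def
  proof (rule integral_mono)
    show "indicator {0<..<s} u * (sin u * (cw m 1)\<^sup>2) \<le> indicator {0<..<s} u * (sin u * (cw m u)\<^sup>2)" for u
      using s s1 cw_antimono[of u 1 m] cw_nonneg[of m 1] pi_ge_two sin_ge_zero[of u]
      by (auto simp: indicator_def intro!: mult_left_mono power_mono)
  qed (intro lborel_integral_continuous(2) continuous_intros)+
  then show "(cw m 1)\<^sup>2 * (1 - cos s) \<le> w_mass m s" using s by (simp add: integral_sin_const mult.commute)
qed

lemma out_w_mass_integrable:
  assumes "0 < t" "t < pi" shows "integrable lborel (\<lambda>s. out_w m t s * w_mass m s)"
  by (rule out_w_integrable[OF assms, where G = 1]) (use w_mass_bounds(1,2)[of _ m] assms in auto)

text \<open>For t <= 1 the factor c is bounded below and (1 - cos s) / sin s = tan(s/2) >= s / 8;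
  integrating gives t^2 / 16. The order t^2 must match the second moment of the Jackson
  kernel.\<close>

lemma kap_ge:
  obtains c where "0 < c" "\<And>t. 0 < t \<Longrightarrow> t \<le> 1 \<Longrightarrow> c * t\<^sup>2 \<le> kap m t"
proof -
  define c where "c = (cw m 1)\<^sup>2 / 16"
  have c1: "0 < cw m 1" using cw_pos[of 1 m] pi_ge_two by simp
  have "c * t\<^sup>2 \<le> kap m t" if t: "0 < t" "t \<le> 1" for t
  proof -
    have tp: "t < pi" using t pi_ge_two by simp
    have "(\<integral>s. indicator {0<..<t} s * ((cw m 1)\<^sup>2 * (s / 8)) \<partial>lborel) = (cw m 1)\<^sup>2 * (t\<^sup>2 / 16) - (cw m 1)\<^sup>2 * (0\<^sup>2 / 16)"
      using t by (intro lborel_integral_FTC[where F = "\<lambda>s. (cw m 1)\<^sup>2 * (s\<^sup>2 / 16)"]) (auto intro!: continuous_intros derivative_eq_intros)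
    also have "\<dots> = c * t\<^sup>2" by (simp add: c_def)
    finally have "c * t\<^sup>2 = (\<integral>s. indicator {0<..<t} s * ((cw m 1)\<^sup>2 * (s / 8)) \<partial>lborel)" by (rule sym)
    also have "\<dots> \<le> kap m t"
      unfolding kap_def
    proof (rule integral_mono[OF _ out_w_mass_integrable[OF t(1) tp]])
      show "integrable lborel (\<lambda>s. indicator {0<..<t} s * ((cw m 1)\<^sup>2 * (s / 8)))"
        by (intro lborel_integral_continuous(2) continuous_intros) auto
      fix s
      show "indicator {0<..<t} s * ((cw m 1)\<^sup>2 * (s / 8)) \<le> out_w m t s * w_mass m s"
      proof (cases "s \<in> {0<..<t}")
        case True
        then have s: "0 < s" "s < t" "s \<le> 1" "s < pi" using t tp by auto
        have cs: "0 < cos (s / 2)" "0 < cw m s" "0 < sin s" "0 \<le> sin (s / 2)"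
          using cos_half_pos[of s] cw_pos[of s m] sin_gt_zero[of s] sin_ge_zero[of "s / 2"] s by auto
        have "s / 8 \<le> sin (s / 2) / 1" using sin_half_ge[of s] s by simp
        also have "\<dots> \<le> sin (s / 2) / cos (s / 2)" using cs by (intro divide_left_mono) auto
        also have "\<dots> = (1 - cos s) / sin s"
          using tan_half_identities(1)[of s] cs by (simp add: field_simps)
        finally have 1: "(cw m 1)\<^sup>2 * (s / 8) \<le> (cw m 1)\<^sup>2 * ((1 - cos s) / sin s)" by (intro mult_left_mono) auto
        have "(cw m 1)\<^sup>2 * ((1 - cos s) / sin s) = 1 / sin s * ((cw m 1)\<^sup>2 * (1 - cos s))" by simp
        also have "\<dots> \<le> 1 / sin s * w_mass m s"
          using w_mass_bounds(3)[of s m] s cs by (intro mult_left_mono) auto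
        also have "\<dots> \<le> 1 / (sin s * (cw m s)\<^sup>2) * w_mass m s"
        proof (intro mult_right_mono divide_left_mono)
          have "(cw m s)\<^sup>2 \<le> 1" using cs cw_le_1[of m s] by (intro power_le_one) auto
          then show "sin s * (cw m s)\<^sup>2 \<le> sin s" using cs by (simp add: mult_left_le)
        qed (use cs w_mass_bounds(1)[of s m] s in auto)
        finally have "(cw m 1)\<^sup>2 * (s / 8) \<le> 1 / (sin s * (cw m s)\<^sup>2) * w_mass m s" by (rule order_trans[OF 1])
        moreover have "indicator {0<..<t} s = (1::real)" using True by simp
        ultimately show ?thesis unfolding out_w_def by (simp only: mult_1_left)
      qed (simp add: out_w_def)
    qed
    finally show ?thesis .
  qed
  then show ?thesis using that[of c] c1 by (simp add: c_def)
qed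

lemma out_w_nonzero: "t < pi \<Longrightarrow> out_w m t s \<noteq> 0 \<Longrightarrow> 0 < s \<and> s < pi"
  by (auto simp: out_w_def indicator_def split: if_splits)

text \<open>Kappa times the smoothed function g; dividing by kappa is postponed to the end. The
  factor 1 gives it the shape of \<open>bop_lincomb\<close>.\<close>

definition smooth_op :: "nat \<Rightarrow> real \<Rightarrow> (real \<Rightarrow> real) \<Rightarrow> real \<Rightarrow> real" where
  "smooth_op m d f x = kap m d * f x + 1 * outer2 m d f x"

text \<open>It averages tau_t - 1 instead of tau_t: for a kernel of mass 1, adding the function
  gives the averaged translate, while the operator itself is the approximation error.\<close>

definition kernel_op :: "nat \<Rightarrow> real poly \<Rightarrow> (real \<Rightarrow> real) \<Rightarrow> real \<Rightarrow> real" where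
  "kernel_op m K f x = (\<integral>t. (indicator {0<..<pi} t * (poly K (cos t) * (sin t * (cw m t)\<^sup>2))) * dif m t f x \<partial>lborel)"

section \<open>Bounds and eigenvalues of the averaging operators\<close>

context
  fixes m :: nat and C0 :: real
  assumes C0: "0 < C0" "\<And>t. bop m (spin_avg m t) C0"
begin

text \<open>The 2 is the norm of the identity plus the slack in \<open>bop_lincomb\<close>. Where c
  vanishes, division by zero gives 0 on both sides, so t is arbitrary.\<close>

lemma bop_dif:
  "bop m (dif m t) (\<bar>1 / cw m t\<bar> * C0 + 2)"
proof -
  have "bop m (\<lambda>f x. 1 / cw m t * spin_avg m t f x + (- 1) * f x) (\<bar>1 / cw m t\<bar> * C0 + \<bar>- 1\<bar> * 1 + 1)"
    by (rule bop_lincomb[OF C0(2) bop_id])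
  moreover have "(\<lambda>f x. 1 / cw m t * spin_avg m t f x + (- 1) * f x) = dif m t"
    by (simp add: fun_eq_iff dif_def tau_def)
  moreover have "\<bar>1 / cw m t\<bar> * C0 + \<bar>- 1\<bar> * 1 + 1 = \<bar>1 / cw m t\<bar> * C0 + 2" by simp
  ultimately show ?thesis by (simp only:)
qed

lemma bop_inner1:
  assumes "0 < s" "s < pi"
  shows "bop m (inner1 m s) (C0 * (1 - cos s))"
  unfolding inner1_def[abs_def]
proof (rule bop_integral[where c = "\<lambda>_. C0"])
  have "(\<integral>\<^sup>+u. ennreal (in_w1 m s u * C0) \<partial>lborel) \<le> (\<integral>\<^sup>+u. ennreal (indicator {0<..<s} u * (sin u * C0)) \<partial>lborel)"
    using assms C0 cw_le_1[of m] sin_ge_zero cw_nonneg[of m]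
    by (intro nn_integral_mono ennreal_leI) (auto simp: in_w1_def indicator_def mult_left_le intro!: mult_right_mono)
  also have "\<dots> = ennreal ((1 - cos s) * C0)" using assms C0 by (intro nn_integral_sin_const) auto
  finally show "(\<integral>\<^sup>+u. ennreal (in_w1 m s u * C0) \<partial>lborel) \<le> ennreal (C0 * (1 - cos s))" by (simp add: mult.commute)
qed (use assms C0 one_minus_cos_pos[of s] in_w_nonneg in auto)

text \<open>The bound for tau_u - 1 blows up like 1 / c, and one of the two factors c in w absorbs
  it; the result is again a multiple of 1 - cos s.\<close>

lemma bop_inner2:
  assumes "0 < s" "s < pi"
  shows "bop m (inner2 m s) ((C0 + 2) * (1 - cos s))"
  unfolding inner2_def[abs_def]
proof (rule bop_integral[where c = "\<lambda>u. \<bar>1 / cw m u\<bar> * C0 + 2"])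
  have "(\<integral>\<^sup>+u. ennreal (in_w2 m s u * (\<bar>1 / cw m u\<bar> * C0 + 2)) \<partial>lborel) \<le> (\<integral>\<^sup>+u. ennreal (indicator {0<..<s} u * (sin u * (C0 + 2))) \<partial>lborel)"
  proof (intro nn_integral_mono ennreal_leI)
    fix u
    show "in_w2 m s u * (\<bar>1 / cw m u\<bar> * C0 + 2) \<le> indicator {0<..<s} u * (sin u * (C0 + 2))"
    proof (cases "u \<in> {0<..<s}")
      case True
      then have u: "0 < cw m u" "0 \<le> sin u" "cw m u \<le> 1" using assms cw_pos[of u m] sin_ge_zero[of u] cw_le_1 by auto
      have "(cw m u)\<^sup>2 * (\<bar>1 / cw m u\<bar> * C0 + 2) = cw m u * C0 + (cw m u)\<^sup>2 * 2"
        using u by (simp add: power2_eq_square algebra_simps)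
      also have "\<dots> \<le> 1 * C0 + 1 * 2" using u C0 by (intro add_mono mult_right_mono power_le_one) auto
      finally have "sin u * ((cw m u)\<^sup>2 * (\<bar>1 / cw m u\<bar> * C0 + 2)) \<le> sin u * (C0 + 2)"
        using u by (intro mult_left_mono) auto
      then show ?thesis using True by (simp add: in_w2_def mult.assoc)
    qed (simp add: in_w2_def)
  qed
  also have "\<dots> = ennreal ((1 - cos s) * (C0 + 2))" using assms C0 by (intro nn_integral_sin_const) auto
  finally show "(\<integral>\<^sup>+u. ennreal (in_w2 m s u * (\<bar>1 / cw m u\<bar> * C0 + 2)) \<partial>lborel) \<le> ennreal ((C0 + 2) * (1 - cos s))" by (simp add: mult.commute)
qed (use assms C0 one_minus_cos_pos[of s] in_w_nonneg bop_dif in auto)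

lemma bop_outer1:
  assumes t: "0 < t" "t < pi"
  shows "bop m (outer1 m t) (C0 * rho m t)"
  unfolding outer1_def[abs_def]
  by (rule bop_integral[where c = "\<lambda>s. C0 * (1 - cos s)"])
     (use C0 t rho_pos out_w_nonneg out_w_nonzero bop_inner1 out_w_integral[OF t, of C0 m] in auto)

lemma bop_outer2:
  assumes t: "0 < t" "t < pi"
  shows "bop m (outer2 m t) ((C0 + 2) * rho m t)"
  unfolding outer2_def[abs_def]
  by (rule bop_integral[where c = "\<lambda>s. (C0 + 2) * (1 - cos s)"])
     (use C0 t rho_pos out_w_nonneg out_w_nonzero bop_inner2 out_w_integral[OF t, of "C0 + 2" m] in auto)

lemma bop_smooth_op:
  assumes t: "0 < t" "t < pi"
  shows "bop m (smooth_op m t) (\<bar>kap m t\<bar> * 1 + \<bar>1\<bar> * ((C0 + 2) * rho m t) + 1)"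
  unfolding smooth_op_def[abs_def] by (rule bop_lincomb[OF bop_id bop_outer2[OF t]])

lemma bop_kernel_op:
  assumes K: "\<And>t. 0 \<le> poly K (cos t)"
  obtains D where "bop m (kernel_op m K) D"
proof -
  define D where "D = (\<integral>t. indicator {0<..<pi} t * (poly K (cos t) * (sin t * (C0 + 2))) \<partial>lborel)"
  have D: "0 \<le> D" unfolding D_def using K C0 sin_ge_zero by (intro Bochner_Integration.integral_nonneg) (auto simp: indicator_def)
  have "bop m (kernel_op m K) (D + 1)"
    unfolding kernel_op_def[abs_def]
  proof (rule bop_integral[where c = "\<lambda>u. \<bar>1 / cw m u\<bar> * C0 + 2"])
    have "(\<integral>\<^sup>+t. ennreal (indicator {0<..<pi} t * (poly K (cos t) * (sin t * (cw m t)\<^sup>2)) * (\<bar>1 / cw m t\<bar> * C0 + 2)) \<partial>lborel)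
      \<le> (\<integral>\<^sup>+t. ennreal (indicator {0<..<pi} t * (poly K (cos t) * (sin t * (C0 + 2)))) \<partial>lborel)"
    proof (intro nn_integral_mono ennreal_leI)
      fix t
      show "indicator {0<..<pi} t * (poly K (cos t) * (sin t * (cw m t)\<^sup>2)) * (\<bar>1 / cw m t\<bar> * C0 + 2) \<le> indicator {0<..<pi} t * (poly K (cos t) * (sin t * (C0 + 2)))"
      proof (cases "t \<in> {0<..<pi}")
        case True
        then have u: "0 < cw m t" "0 \<le> sin t" "cw m t \<le> 1" using cw_pos[of t m] sin_ge_zero[of t] cw_le_1 by auto
        have "(cw m t)\<^sup>2 * (\<bar>1 / cw m t\<bar> * C0 + 2) = cw m t * C0 + (cw m t)\<^sup>2 * 2"
          using u by (simp add: power2_eq_square algebra_simps)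
        also have "\<dots> \<le> 1 * C0 + 1 * 2" using u C0 by (intro add_mono mult_right_mono power_le_one) auto
        finally have "poly K (cos t) * (sin t * ((cw m t)\<^sup>2 * (\<bar>1 / cw m t\<bar> * C0 + 2))) \<le> poly K (cos t) * (sin t * (C0 + 2))"
          using u K by (intro mult_left_mono) auto
        then show ?thesis using True by (simp add: mult.assoc)
      qed simp
    qed
    also have "\<dots> = ennreal D"
      unfolding D_def using K C0 sin_ge_zero by (intro nn_integral_indicator_continuous continuous_intros) auto
    also have "\<dots> \<le> ennreal (D + 1)" by (intro ennreal_leI) simp
    finally show "(\<integral>\<^sup>+t. ennreal (indicator {0<..<pi} t * (poly K (cos t) * (sin t * (cw m t)\<^sup>2)) * (\<bar>1 / cw m t\<bar> * C0 + 2)) \<partial>lborel) \<le> ennreal (D + 1)" .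
    show "0 \<le> indicator {0<..<pi} t * (poly K (cos t) * (sin t * (cw m t)\<^sup>2))" for t
      using K sin_ge_zero[of t] by (auto simp: indicator_def)
  qed (use D bop_dif in auto)
  then show ?thesis using that by blast
qed

text \<open>On an eigenpolynomial all operators are scalars. \<open>outer1\<close> and
  \<open>smooth_op\<close> share the eigenvalue b, because kappa cancels in kappa + (b - kappa). For
  k > 0 the symmetry follows from b = (1 - psi) / lambda; for k = 0, where lambda = 0, psi is 1 and
  both sides vanish.\<close>

lemma eigen_values:
  obtains b \<psi> where "\<And>t x. 0 \<le> t \<Longrightarrow> t < pi \<Longrightarrow> x \<in> Iv \<Longrightarrow> dif m t (poly (eigpoly m k)) x = (\<psi> t - 1) * poly (eigpoly m k) x"
    "\<And>t x. 0 < t \<Longrightarrow> t < pi \<Longrightarrow> x \<in> Iv \<Longrightarrow> outer1 m t (poly (eigpoly m k)) x = b t * poly (eigpoly m k) x"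
    "\<And>t x. 0 < t \<Longrightarrow> t < pi \<Longrightarrow> x \<in> Iv \<Longrightarrow> smooth_op m t (poly (eigpoly m k)) x = b t * poly (eigpoly m k) x"
    "\<And>s t. 0 < s \<Longrightarrow> s < pi \<Longrightarrow> 0 < t \<Longrightarrow> t < pi \<Longrightarrow> (\<psi> t - 1) * b s = (\<psi> s - 1) * b t"
    "\<And>K x. x \<in> Iv \<Longrightarrow> (\<integral>t. indicator {0<..<pi} t * (poly K (cos t) * (sin t * (cw m t)\<^sup>2)) \<partial>lborel) = 1 \<Longrightarrow>
       degree K < k \<Longrightarrow> kernel_op m K (poly (eigpoly m k)) x = - poly (eigpoly m k) x"
    "\<And>K. \<exists>e. \<forall>x\<in>Iv. kernel_op m K (poly (eigpoly m k)) x = e * poly (eigpoly m k) x"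
proof -
  let ?\<phi> = "poly (eigpoly m k)"
  obtain g where g: "multiplier m k g"
    "\<And>t. 0 < k \<Longrightarrow> 0 < t \<Longrightarrow> t < pi \<Longrightarrow>
      (\<integral>s. indicator {0<..<t} s * (1 / (sin s * (cw m s)\<^sup>2) * (\<integral>u. indicator {0<..<s} u * (sin u * cw m u * g u) \<partial>lborel)) \<partial>lborel)
       = (1 - g t / cw m t) / lam m k"
    "\<And>t. k = 0 \<Longrightarrow> 0 \<le> t \<Longrightarrow> t < pi \<Longrightarrow> g t = cw m t"
    "\<And>K. degree K < k \<Longrightarrow> (\<integral>t. indicator {0<..<pi} t * (poly K (cos t) * (sin t * cw m t * g t)) \<partial>lborel) = 0"
    by (rule eigen_multiplier[of m k]) (rule that, assumption+)
  have cg: "continuous_on S g" for S using g(1) unfolding multiplier_def by (auto intro: continuous_on_subset)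
  have ga: "spin_avg m t ?\<phi> x = g t * ?\<phi> x" if "0 \<le> t" "t < pi" "x \<in> Iv" for t x
    using g(1) that unfolding multiplier_def by blast
  define \<psi> where "\<psi> t = g t / cw m t" for t
  define J where "J s = (\<integral>u. indicator {0<..<s} u * (sin u * (cw m u * g u)) \<partial>lborel)" for s
  define b where "b t = (\<integral>s. out_w m t s * J s \<partial>lborel)" for t
  have [measurable]: "g \<in> borel_measurable borel" by (rule borel_measurable_continuous_onI[OF cg])
  have [measurable]: "J \<in> borel_measurable borel"
    unfolding J_def indicator_def greaterThanLessThan_iff of_bool_def by measurable
  have dif: "dif m t ?\<phi> x = (\<psi> t - 1) * ?\<phi> x" if "0 \<le> t" "t < pi" "x \<in> Iv" for t x
    using ga[OF that] by (simp add: dif_def tau_def \<psi>_def algebra_simps)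
  have in1: "inner1 m s ?\<phi> x = J s * ?\<phi> x" if s: "0 < s" "s < pi" and x: "x \<in> Iv" for s x
  proof -
    have "inner1 m s ?\<phi> x = (\<integral>u. (indicator {0<..<s} u * (sin u * (cw m u * g u))) * ?\<phi> x \<partial>lborel)"
      unfolding inner1_def
      by (intro Bochner_Integration.integral_cong refl) (use s x ga in \<open>auto simp: in_w1_def indicator_def\<close>)
    then show ?thesis by (simp add: J_def)
  qed
  have wg: "sin u * (cw m u)\<^sup>2 * \<psi> u = sin u * (cw m u * g u)" if "0 \<le> u" "u < pi" for u
    using cw_pos[OF that, of m] by (simp add: \<psi>_def power2_eq_square)
  have iJ: "integrable lborel (\<lambda>u. indicator {0<..<s} u * (sin u * (cw m u * g u)))" for s
    by (intro lborel_integral_continuous(2) continuous_intros cg)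
  have iW: "integrable lborel (\<lambda>u. in_w2 m s u)" for s
    unfolding in_w2_def by (intro lborel_integral_continuous(2) continuous_intros)
  have in2: "inner2 m s ?\<phi> x = (J s - w_mass m s) * ?\<phi> x" if s: "0 < s" "s < pi" and x: "x \<in> Iv" for s x
  proof -
    have "inner2 m s ?\<phi> x = (\<integral>u. (indicator {0<..<s} u * (sin u * (cw m u * g u)) - in_w2 m s u) * ?\<phi> x \<partial>lborel)"
      unfolding inner2_def
    proof (intro Bochner_Integration.integral_cong refl)
      fix u
      show "in_w2 m s u * dif m u ?\<phi> x = (indicator {0<..<s} u * (sin u * (cw m u * g u)) - in_w2 m s u) * ?\<phi> x"
      proof (cases "u \<in> {0<..<s}")
        case True
        have "sin u * (cw m u)\<^sup>2 * ((\<psi> u - 1) * ?\<phi> x) = (sin u * (cw m u)\<^sup>2 * \<psi> u - sin u * (cw m u)\<^sup>2) * ?\<phi> x"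
          by (simp add: algebra_simps)
        also have "sin u * (cw m u)\<^sup>2 * \<psi> u = sin u * (cw m u * g u)" using wg[of u] True s by auto
        finally have e: "sin u * (cw m u)\<^sup>2 * ((\<psi> u - 1) * ?\<phi> x) = (sin u * (cw m u * g u) - sin u * (cw m u)\<^sup>2) * ?\<phi> x" .
        have D: "dif m u ?\<phi> x = (\<psi> u - 1) * ?\<phi> x" using dif[of u x] x True s by auto
        have "indicator {0<..<s} u = (1::real)" using True by simp
        then show ?thesis unfolding in_w2_def D using e by (simp only: mult_1_left)
      qed (simp add: in_w2_def)
    qed
    also have "\<dots> = (\<integral>u. indicator {0<..<s} u * (sin u * (cw m u * g u)) - in_w2 m s u \<partial>lborel) * ?\<phi> x" by simp
    also have "(\<integral>u. indicator {0<..<s} u * (sin u * (cw m u * g u)) - in_w2 m s u \<partial>lborel) = J s - w_mass m s"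
      unfolding J_def w_mass_def by (rule Bochner_Integration.integral_diff[OF iJ iW])
    finally show ?thesis .
  qed
  obtain G where G: "0 \<le> G" "\<And>u. 0 \<le> u \<Longrightarrow> u \<le> pi \<Longrightarrow> \<bar>cw m u * g u\<bar> \<le> G"
  proof -
    have "compact ((\<lambda>u. cw m u * g u) ` {0..pi})" by (intro compact_continuous_image continuous_intros cg compact_Icc)
    then obtain B where "0 < B" "\<forall>y\<in>(\<lambda>u. cw m u * g u) ` {0..pi}. norm y \<le> B" using compact_imp_bounded bounded_pos by metis
    then show ?thesis using that[of B] by auto
  qed
  have Jb: "\<bar>J s\<bar> \<le> G * (1 - cos s)" if "0 < s" "s < pi" for s
    unfolding J_def using that G by (intro abs_integral_sin_le continuous_intros cg) auto
  have out1: "outer1 m t ?\<phi> x = b t * ?\<phi> x" if t: "0 < t" "t < pi" and x: "x \<in> Iv" for t x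
  proof -
    have "outer1 m t ?\<phi> x = (\<integral>s. (out_w m t s * J s) * ?\<phi> x \<partial>lborel)"
      unfolding outer1_def
      by (intro Bochner_Integration.integral_cong refl) (use t x in1 in \<open>auto simp: out_w_def indicator_def\<close>)
    then show ?thesis by (simp add: b_def)
  qed
  have sm: "smooth_op m t ?\<phi> x = b t * ?\<phi> x" if t: "0 < t" "t < pi" and x: "x \<in> Iv" for t x
  proof -
    have "outer2 m t ?\<phi> x = (\<integral>s. (out_w m t s * J s - out_w m t s * w_mass m s) * ?\<phi> x \<partial>lborel)"
      unfolding outer2_def
    proof (intro Bochner_Integration.integral_cong refl)
      fix s
      show "out_w m t s * inner2 m s ?\<phi> x = (out_w m t s * J s - out_w m t s * w_mass m s) * ?\<phi> x"
      proof (cases "s \<in> {0<..<t}")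
        case True
        then have "inner2 m s ?\<phi> x = (J s - w_mass m s) * ?\<phi> x" using t x by (intro in2) auto
        then show ?thesis by (simp only:) (simp add: algebra_simps)
      qed (simp add: out_w_def)
    qed
    also have "\<dots> = (\<integral>s. out_w m t s * J s - out_w m t s * w_mass m s \<partial>lborel) * ?\<phi> x" by simp
    also have "(\<integral>s. out_w m t s * J s - out_w m t s * w_mass m s \<partial>lborel) = b t - kap m t"
      unfolding b_def kap_def
      by (rule Bochner_Integration.integral_diff[OF out_w_integrable[OF t _ Jb G(1)] out_w_mass_integrable[OF t]]) (use t in auto)
    finally show ?thesis by (simp add: smooth_op_def algebra_simps)
  qed
  have bk: "b t = (1 - \<psi> t) / lam m k" if "0 < k" "0 < t" "t < pi" for t
    using g(2)[OF that] by (simp add: b_def out_w_def J_def \<psi>_def mult.assoc)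
  have comm: "(\<psi> t - 1) * b s = (\<psi> s - 1) * b t" if "0 < s" "s < pi" "0 < t" "t < pi" for s t
  proof (cases "k = 0")
    case True
    have "\<psi> t = 1" "\<psi> s = 1" using g(3)[OF True] that cw_pos[of t m] cw_pos[of s m] by (auto simp: \<psi>_def)
    then show ?thesis by simp
  next
    case False
    then show ?thesis using bk that by (simp add: field_simps)
  qed
  \<comment> \<open>The eigenvalue is the integral of K w psi minus that of K w; the former vanishes
    for degree below k by orthogonality, the latter is 1 after normalisation.\<close>
  have ker: "kernel_op m K ?\<phi> x = ((\<integral>t. indicator {0<..<pi} t * (poly K (cos t) * (sin t * cw m t * g t)) \<partial>lborel)
     - (\<integral>t. indicator {0<..<pi} t * (poly K (cos t) * (sin t * (cw m t)\<^sup>2)) \<partial>lborel)) * ?\<phi> x" if x: "x \<in> Iv" for K x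
  proof -
    have "kernel_op m K ?\<phi> x = (\<integral>t. (indicator {0<..<pi} t * (poly K (cos t) * (sin t * cw m t * g t))
       - indicator {0<..<pi} t * (poly K (cos t) * (sin t * (cw m t)\<^sup>2))) * ?\<phi> x \<partial>lborel)"
      unfolding kernel_op_def
    proof (intro Bochner_Integration.integral_cong refl)
      fix t
      show "(indicator {0<..<pi} t * (poly K (cos t) * (sin t * (cw m t)\<^sup>2))) * dif m t ?\<phi> x
        = (indicator {0<..<pi} t * (poly K (cos t) * (sin t * cw m t * g t))
           - indicator {0<..<pi} t * (poly K (cos t) * (sin t * (cw m t)\<^sup>2))) * ?\<phi> x"
      proof (cases "t \<in> {0<..<pi}")
        case True
        have "poly K (cos t) * (sin t * (cw m t)\<^sup>2) * ((\<psi> t - 1) * ?\<phi> x)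
          = (poly K (cos t) * (sin t * (cw m t)\<^sup>2 * \<psi> t) - poly K (cos t) * (sin t * (cw m t)\<^sup>2)) * ?\<phi> x"
          by (simp add: algebra_simps)
        also have "sin t * (cw m t)\<^sup>2 * \<psi> t = sin t * cw m t * g t" using wg[of t] True by (simp only: mult.assoc) auto
        finally have e: "poly K (cos t) * (sin t * (cw m t)\<^sup>2) * ((\<psi> t - 1) * ?\<phi> x)
          = (poly K (cos t) * (sin t * cw m t * g t) - poly K (cos t) * (sin t * (cw m t)\<^sup>2)) * ?\<phi> x" .
        have D: "dif m t ?\<phi> x = (\<psi> t - 1) * ?\<phi> x" using dif[of t x] x True by auto
        have "indicator {0<..<pi} t = (1::real)" using True by simp
        then show ?thesis unfolding D using e by (simp only: mult_1_left)
      qed simp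
    qed
    also have "\<dots> = (\<integral>t. indicator {0<..<pi} t * (poly K (cos t) * (sin t * cw m t * g t))
       - indicator {0<..<pi} t * (poly K (cos t) * (sin t * (cw m t)\<^sup>2)) \<partial>lborel) * ?\<phi> x" by simp
    also have "(\<integral>t. indicator {0<..<pi} t * (poly K (cos t) * (sin t * cw m t * g t))
       - indicator {0<..<pi} t * (poly K (cos t) * (sin t * (cw m t)\<^sup>2)) \<partial>lborel)
       = (\<integral>t. indicator {0<..<pi} t * (poly K (cos t) * (sin t * cw m t * g t)) \<partial>lborel)
       - (\<integral>t. indicator {0<..<pi} t * (poly K (cos t) * (sin t * (cw m t)\<^sup>2)) \<partial>lborel)"
      by (intro Bochner_Integration.integral_diff lborel_integral_continuous(2) continuous_intros cg)
    finally show ?thesis .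
  qed
  show ?thesis
    by (rule that[of \<psi> b]) (use dif out1 sm comm ker g(4) in auto)
qed

lemma bop_eig_cong:
  assumes A: "bop m A C" and h: "h \<in> L1_space m" and e: "\<And>x. x \<in> Iv \<Longrightarrow> h x = c * poly P x"
    and AP: "AE x in lborel. x \<in> Iv \<longrightarrow> A (poly P) x = d * poly P x"
  shows "AE x in lborel. x \<in> Iv \<longrightarrow> A h x = c * d * poly P x"
proof -
  have "AE x in lborel. x \<in> Iv \<longrightarrow> A h x = A (\<lambda>x. c * poly P x + 0 * poly P x) x"
    by (rule bop_cong[OF A h]) (use e in \<open>auto intro: L1_space_cmult poly_in_L1_space\<close>)
  with bop_linear[OF A poly_in_L1_space[of P] poly_in_L1_space[of P], of c 0] AP
  show ?thesis by eventually_elim auto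
qed

text \<open>On eigenpolynomials the sides are b(d) (psi(t) - 1) and (psi(d) - 1) b(t), equal by
  symmetry. The point is the exchange of parameters: on the right the modulus of f enters only at d,
  and the smallness in t comes from \<open>outer1\<close> alone.\<close>

lemma translate_smooth_op:
  assumes d: "0 < d" "d < pi" and t: "0 < t" "t < pi" and f: "f \<in> L1_space m"
  shows "AE x in lborel. x \<in> Iv \<longrightarrow> dif m t (smooth_op m d f) x = outer1 m t (dif m d f) x"
proof (rule bop_agree[OF bop_compose[OF bop_dif bop_smooth_op[OF d]] bop_compose[OF bop_outer1[OF t] bop_dif] _ f])
  note A = bop_compose[OF bop_dif[of t] bop_smooth_op[OF d]]
  note B = bop_compose[OF bop_outer1[OF t] bop_dif[of d]]
  fix P
  show "AE x in lborel. x \<in> Iv \<longrightarrow> dif m t (smooth_op m d (poly P)) x = outer1 m t (dif m d (poly P)) x"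
  proof (induction P rule: eigpoly_induct[of _ m])
    case zero
    \<comment> \<open>Zero is written as a linear combination so that almost everywhere linearity
      yields the value 0 at it.\<close>
    have z: "poly 0 = (\<lambda>x. 0 * poly 0 x + 0 * poly 0 x)" by (simp add: fun_eq_iff)
    show ?case
      using bop_linear[OF A poly_in_L1_space[of 0] poly_in_L1_space[of 0], of 0 0]
        bop_linear[OF B poly_in_L1_space[of 0] poly_in_L1_space[of 0], of 0 0]
      unfolding z[symmetric] by eventually_elim (auto simp only: mult_zero_left add_0_left)
  next
    case (step P c k)
    let ?\<phi> = "poly (eigpoly m k)"
    have z: "poly (P + smult c (eigpoly m k)) = (\<lambda>x. 1 * poly P x + c * ?\<phi> x)" by (simp add: fun_eq_iff)
    obtain b \<psi> where ev: "\<And>t x. 0 \<le> t \<Longrightarrow> t < pi \<Longrightarrow> x \<in> Iv \<Longrightarrow> dif m t ?\<phi> x = (\<psi> t - 1) * ?\<phi> x"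
      "\<And>t x. 0 < t \<Longrightarrow> t < pi \<Longrightarrow> x \<in> Iv \<Longrightarrow> outer1 m t ?\<phi> x = b t * ?\<phi> x"
      "\<And>t x. 0 < t \<Longrightarrow> t < pi \<Longrightarrow> x \<in> Iv \<Longrightarrow> smooth_op m t ?\<phi> x = b t * ?\<phi> x"
      "\<And>s t. 0 < s \<Longrightarrow> s < pi \<Longrightarrow> 0 < t \<Longrightarrow> t < pi \<Longrightarrow> (\<psi> t - 1) * b s = (\<psi> s - 1) * b t"
      by (rule eigen_values[of k]) (rule that, assumption+)
    have "AE x in lborel. x \<in> Iv \<longrightarrow> dif m t (smooth_op m d ?\<phi>) x = b d * (\<psi> t - 1) * ?\<phi> x"
      by (rule bop_eig_cong[OF bop_dif bop_in[OF bop_smooth_op[OF d] poly_in_L1_space]]) (use ev d t in auto)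
    moreover have "AE x in lborel. x \<in> Iv \<longrightarrow> outer1 m t (dif m d ?\<phi>) x = (\<psi> d - 1) * b t * ?\<phi> x"
      by (rule bop_eig_cong[OF bop_outer1[OF t] bop_in[OF bop_dif poly_in_L1_space]]) (use ev d t in auto)
    ultimately have "AE x in lborel. x \<in> Iv \<longrightarrow> dif m t (smooth_op m d ?\<phi>) x = outer1 m t (dif m d ?\<phi>) x"
      by eventually_elim (use ev(4)[OF d t] in \<open>auto simp: mult.commute\<close>)
    with step bop_linear[OF A poly_in_L1_space[of P] poly_in_L1_space[of "eigpoly m k"], of 1 c]
      bop_linear[OF B poly_in_L1_space[of P] poly_in_L1_space[of "eigpoly m k"], of 1 c]
    show ?case unfolding z by eventually_elim auto
  qed
qed

text \<open>Identity plus kernel average kills the eigenpolynomials of degree above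
  \<open>degree K\<close>, by orthogonality, and multiplies the others by scalars. So polynomials
  are mapped to degree at most n, and closedness of that space extends this to f.\<close>

lemma kernel_op_polynomial:
  assumes d: "0 < d" "d < pi" and K: "\<And>t. 0 \<le> poly K (cos t)" "degree K \<le> n"
    "(\<integral>t. indicator {0<..<pi} t * (poly K (cos t) * (sin t * (cw m t)\<^sup>2)) \<partial>lborel) = 1" and f: "f \<in> L1_space m"
  shows "\<exists>Q. degree Q \<le> n \<and> (AE x in lborel. x \<in> Iv \<longrightarrow> 1 * smooth_op m d f x + 1 * kernel_op m K (smooth_op m d f) x = poly Q x)"
proof -
  obtain D where D: "bop m (kernel_op m K) D" using bop_kernel_op[OF K(1)] by blast
  note S = bop_lincomb[OF bop_id[of m] D, of 1 1]
  note A = bop_compose[OF S bop_smooth_op[OF d]]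
  show ?thesis
  proof (rule bop_limit_poly[OF A _ f])
    fix P
    show "\<exists>Q. degree Q \<le> n \<and> (AE x in lborel. x \<in> Iv \<longrightarrow> 1 * smooth_op m d (poly P) x + 1 * kernel_op m K (smooth_op m d (poly P)) x = poly Q x)"
    proof (induction P rule: eigpoly_induct[of _ m])
      case zero
      have z: "poly 0 = (\<lambda>x. 0 * poly 0 x + 0 * poly 0 x)" by (simp add: fun_eq_iff)
      have "AE x in lborel. x \<in> Iv \<longrightarrow> 1 * smooth_op m d (poly 0) x + 1 * kernel_op m K (smooth_op m d (poly 0)) x = poly 0 x"
        using bop_linear[OF A poly_in_L1_space[of 0] poly_in_L1_space[of 0], of 0 0]
        unfolding z[symmetric] by eventually_elim (auto simp only: mult_zero_left add_0_left poly_0)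
      then show ?case by (intro exI[of _ 0]) (simp only: degree_0 le0 simp_thms)
    next
      case (step P c k)
      let ?\<phi> = "poly (eigpoly m k)"
      have z: "poly (P + smult c (eigpoly m k)) = (\<lambda>x. 1 * poly P x + c * ?\<phi> x)" by (simp add: fun_eq_iff)
      obtain Q where Q: "degree Q \<le> n" "AE x in lborel. x \<in> Iv \<longrightarrow> 1 * smooth_op m d (poly P) x + 1 * kernel_op m K (smooth_op m d (poly P)) x = poly Q x"
        using step by blast
      obtain b where ev: "\<And>x. x \<in> Iv \<Longrightarrow> smooth_op m d ?\<phi> x = b * ?\<phi> x"
        "degree K < k \<Longrightarrow> \<forall>x\<in>Iv. kernel_op m K ?\<phi> x = - ?\<phi> x" "\<exists>e. \<forall>x\<in>Iv. kernel_op m K ?\<phi> x = e * ?\<phi> x"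
      proof (rule eigen_values[of k])
        fix b \<psi>
        assume "\<And>t x. 0 < t \<Longrightarrow> t < pi \<Longrightarrow> x \<in> Iv \<Longrightarrow> smooth_op m t ?\<phi> x = b t * ?\<phi> x"
          "\<And>K x. x \<in> Iv \<Longrightarrow> (\<integral>t. indicator {0<..<pi} t * (poly K (cos t) * (sin t * (cw m t)\<^sup>2)) \<partial>lborel) = 1 \<Longrightarrow>
            degree K < k \<Longrightarrow> kernel_op m K ?\<phi> x = - ?\<phi> x"
          "\<And>K. \<exists>e. \<forall>x\<in>Iv. kernel_op m K ?\<phi> x = e * ?\<phi> x"
        then show thesis using that[of "b d"] d K(3) by blast
      qed
      obtain e where e: "\<And>x. x \<in> Iv \<Longrightarrow> kernel_op m K ?\<phi> x = e * ?\<phi> x" "degree K < k \<Longrightarrow> e = - 1"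
      proof (cases "degree K < k")
        case True
        then show ?thesis using that[of "- 1"] ev(2) by auto
      next
        case False
        then show ?thesis using that ev(3) by blast
      qed
      define Q' where "Q' = Q + smult (c * (b * (1 + e))) (eigpoly m k)"
      have "degree Q' \<le> n"
      proof (cases "k \<le> n")
        case True
        then show ?thesis unfolding Q'_def using Q(1) degree_eigpoly[of m k]
          by (intro degree_add_le order_trans[OF degree_smult_le]) auto
      next
        case False
        then have "e = - 1" using e(2) K(2) by auto
        then show ?thesis using Q(1) by (simp add: Q'_def)
      qed
      moreover have "AE x in lborel. x \<in> Iv \<longrightarrow> kernel_op m K (smooth_op m d ?\<phi>) x = b * e * ?\<phi> x"
        by (rule bop_eig_cong[OF D bop_in[OF bop_smooth_op[OF d] poly_in_L1_space]]) (use ev(1) e(1) in auto)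
      then have "AE x in lborel. x \<in> Iv \<longrightarrow> 1 * smooth_op m d (poly (P + smult c (eigpoly m k))) x + 1 * kernel_op m K (smooth_op m d (poly (P + smult c (eigpoly m k)))) x = poly Q' x"
        using Q(2) bop_linear[OF A poly_in_L1_space[of P] poly_in_L1_space[of "eigpoly m k"], of 1 c]
        unfolding z by eventually_elim (use ev(1) in \<open>auto simp: Q'_def algebra_simps\<close>)
      ultimately show ?case by blast
    qed
  qed
qed

end

subsection \<open>Direct and inverse estimates\<close>

text \<open>The error f - Q / kappa equals - (\<open>outer2\<close> + kernel average) / kappa. The
  first part averages (tau_u - 1) f over u <= 1 / n with total mass kappa, hence costs W. The second
  is at most a multiple of W / n^2 over kappa, and kappa >= c / n^2.\<close>

lemma direct_estimate:
  assumes adm: "admissible p m a"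
  obtains C where "0 < C" "\<And>f n W M. f \<in> borel_measurable borel \<Longrightarrow> norm_le p a f M \<Longrightarrow> 0 < n \<Longrightarrow> 0 < W \<Longrightarrow>
     (\<And>u. 0 < u \<Longrightarrow> u \<le> 1 / real n \<Longrightarrow> norm_le p a (dif m u f) W) \<Longrightarrow>
     \<exists>Q. degree Q \<le> n - 1 \<and> norm_le p a (\<lambda>x. f x - poly Q x) (C * W)"
proof -
  have p1: "1 \<le> p" using adm by (simp add: admissible_def)
  obtain C0 where C0: "0 < C0" "\<And>t. bop m (spin_avg m t) C0" using bop_spin_avg by blast
  obtain Cp where Cp: "0 < Cp" "\<And>t f M. f \<in> borel_measurable borel \<Longrightarrow> 0 \<le> M \<Longrightarrow>
     norm_le p a f M \<Longrightarrow> norm_le p a (spin_avg m t f) (Cp * M)"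
    using spin_avg_bound[OF adm] by blast
  obtain c where c: "0 < c" "\<And>t. 0 < t \<Longrightarrow> t \<le> 1 \<Longrightarrow> c * t\<^sup>2 \<le> kap m t" using kap_ge by blast
  obtain CJ where CJ: "0 < CJ" "\<And>n. 0 < n \<Longrightarrow> \<exists>K :: real poly. degree K \<le> n - 1 \<and> (\<forall>t. 0 \<le> poly K (cos t))
    \<and> (\<integral>t. indicator {0<..<pi} t * (poly K (cos t) * (sin t * (cw m t)\<^sup>2)) \<partial>lborel) = 1
    \<and> (\<integral>t. indicator {0<..<pi} t * (poly K (cos t) * (4 * sin (t / 2) ^ 3)) \<partial>lborel) \<le> CJ / (real n)\<^sup>2"
    using jackson_kernel by blast
  define C where "C = 1 + Cp * CJ / c"
  have "\<exists>Q. degree Q \<le> n - 1 \<and> norm_le p a (\<lambda>x. f x - poly Q x) (C * W)"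
    if [measurable]: "f \<in> borel_measurable borel" and fM: "norm_le p a f M" and n: "0 < n" and W: "0 < W"
      and om: "\<And>u. 0 < u \<Longrightarrow> u \<le> 1 / real n \<Longrightarrow> norm_le p a (dif m u f) W" for f n W M
  proof -
    define d where "d = 1 / real n"
    have d: "0 < d" "d \<le> 1" "d < pi" using n pi_ge_two by (auto simp: d_def divide_le_eq) (smt (verit) Suc_leI divide_le_eq_1 of_nat_1 of_nat_le_iff One_nat_def)
    have f1: "f \<in> L1_space m" by (rule admissible_in_L1_space[OF adm _ fM]) measurable
    obtain K :: "real poly" where K: "degree K \<le> n - 1" "\<And>t. 0 \<le> poly K (cos t)"
      "(\<integral>t. indicator {0<..<pi} t * (poly K (cos t) * (sin t * (cw m t)\<^sup>2)) \<partial>lborel) = 1"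
      "(\<integral>t. indicator {0<..<pi} t * (poly K (cos t) * (4 * sin (t / 2) ^ 3)) \<partial>lborel) \<le> CJ / (real n)\<^sup>2"
      using CJ(2)[OF n] by blast
    define h where "h = dif m d f"
    have [measurable]: "h \<in> borel_measurable borel" unfolding h_def by measurable
    have hW: "norm_le p a h W" unfolding h_def using om d by (simp add: d_def)
    have CW: "0 < Cp * W" using Cp W by simp
    have s1: "norm_le p a (spin_avg m u h) (Cp * W)" for u by (rule Cp(2)) (use hW W in auto)
    have in1: "norm_le p a (inner1 m s h) (Cp * W * (1 - cos s))" if s: "0 < s" "s < pi" for s
      unfolding inner1_def[abs_def]
    proof (rule norm_le_integral[OF p1, where m = "\<lambda>_. Cp * W"])
      have "(\<integral>\<^sup>+u. ennreal (in_w1 m s u * (Cp * W)) \<partial>lborel) \<le> (\<integral>\<^sup>+u. ennreal (indicator {0<..<s} u * (sin u * (Cp * W))) \<partial>lborel)"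
      proof (intro nn_integral_mono ennreal_leI)
        fix u
        show "in_w1 m s u * (Cp * W) \<le> indicator {0<..<s} u * (sin u * (Cp * W))"
        proof (cases "u \<in> {0<..<s}")
          case True
          then have "sin u * cw m u \<le> sin u * 1" using s cw_le_1[of m u] sin_ge_zero[of u] by (intro mult_left_mono) auto
          then have "(sin u * cw m u) * (Cp * W) \<le> (sin u * 1) * (Cp * W)" using CW by (intro mult_right_mono) auto
          then show ?thesis using True by (simp add: in_w1_def)
        qed (simp add: in_w1_def)
      qed
      also have "\<dots> = ennreal ((1 - cos s) * (Cp * W))" using s CW by (intro nn_integral_sin_const) auto
      finally show "(\<integral>\<^sup>+u. ennreal (in_w1 m s u * (Cp * W)) \<partial>lborel) \<le> ennreal (Cp * W * (1 - cos s))" by (simp add: mult.commute)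
    qed (use s s1 CW one_minus_cos_pos[OF s] in_w_nonneg in \<open>auto simp: case_prod_beta'\<close>)
    have out1: "norm_le p a (outer1 m t h) (Cp * W * rho m t)" if t: "0 < t" "t < pi" for t
      unfolding outer1_def[abs_def]
    proof (rule norm_le_integral[OF p1, where m = "\<lambda>s. Cp * W * (1 - cos s)"])
      show "(\<integral>\<^sup>+s. ennreal (out_w m t s * (Cp * W * (1 - cos s))) \<partial>lborel) \<le> ennreal (Cp * W * rho m t)"
        by (rule out_w_integral[OF t]) (use CW in simp)
      show "norm_le p a (inner1 m s h) (Cp * W * (1 - cos s))" "0 < Cp * W * (1 - cos s)" if "out_w m t s \<noteq> 0" for s
        using out_w_nonzero[OF t(2) that] in1 CW one_minus_cos_pos[of s] by auto
    qed (use t CW rho_pos[OF t] out_w_nonneg[OF t(2)] in \<open>auto simp: case_prod_beta'\<close>)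
    have sm_meas [measurable]: "smooth_op m d f \<in> borel_measurable borel"
      unfolding smooth_op_def[abs_def] by measurable
    have difs: "norm_le p a (dif m t (smooth_op m d f)) (Cp * W * rho m t)" if t: "0 < t" "t < pi" for t
      by (rule norm_le_cong_AE[OF p1 out1[OF t]])
         (use translate_smooth_op[OF C0 d(1,3) t f1] CW rho_pos[OF t, of m] in \<open>auto simp: h_def\<close>)
    have ker: "norm_le p a (kernel_op m K (smooth_op m d f)) (Cp * W * (CJ / (real n)\<^sup>2))"
      unfolding kernel_op_def[abs_def]
    proof (rule norm_le_integral[OF p1, where m = "\<lambda>t. Cp * W * rho m t"])
      \<comment> \<open>The singular factors of \<open>rho\<close> at pi cancel against w, and what
        remains is the moment that the Jackson kernel controls.\<close>
      have "(\<integral>\<^sup>+t. ennreal (indicator {0<..<pi} t * (poly K (cos t) * (sin t * (cw m t)\<^sup>2)) * (Cp * W * rho m t)) \<partial>lborel)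
        = (\<integral>\<^sup>+t. ennreal (Cp * W) * ennreal (indicator {0<..<pi} t * (poly K (cos t) * (4 * sin (t / 2) ^ 3))) \<partial>lborel)"
      proof (rule nn_integral_cong)
        fix t
        show "ennreal (indicator {0<..<pi} t * (poly K (cos t) * (sin t * (cw m t)\<^sup>2)) * (Cp * W * rho m t))
          = ennreal (Cp * W) * ennreal (indicator {0<..<pi} t * (poly K (cos t) * (4 * sin (t / 2) ^ 3)))"
        proof (cases "t \<in> {0<..<pi}")
          case True
          then have z: "0 < cos (t / 2)" "0 < cw m t" using cos_half_pos[of t] cw_pos[of t m] by auto
          have "sin t = 2 * sin (t / 2) * cos (t / 2)" using sin_double[of "t / 2"] by simp
          then have "sin t * (cw m t)\<^sup>2 * rho m t = 4 * sin (t / 2) ^ 3"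
            using z by (simp add: rho_def power2_eq_square power3_eq_cube)
          moreover have "poly K (cos t) * (sin t * (cw m t)\<^sup>2) * (Cp * W * rho m t) = Cp * W * (poly K (cos t) * (sin t * (cw m t)\<^sup>2 * rho m t))"
            by (simp only: mult_ac)
          ultimately have e: "poly K (cos t) * (sin t * (cw m t)\<^sup>2) * (Cp * W * rho m t) = Cp * W * (poly K (cos t) * (4 * sin (t / 2) ^ 3))"
            by (simp only:)
          have i: "indicator {0<..<pi} t = (1::real)" using True by simp
          show ?thesis unfolding i mult_1_left e by (rule ennreal_mult'[OF less_imp_le[OF CW]])
        qed simp
      qed
      also have "\<dots> = ennreal (Cp * W) * (\<integral>\<^sup>+t. ennreal (indicator {0<..<pi} t * (poly K (cos t) * (4 * sin (t / 2) ^ 3))) \<partial>lborel)"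
        by (rule nn_integral_cmult) measurable
      also have "(\<integral>\<^sup>+t. ennreal (indicator {0<..<pi} t * (poly K (cos t) * (4 * sin (t / 2) ^ 3))) \<partial>lborel)
        = ennreal (\<integral>t. indicator {0<..<pi} t * (poly K (cos t) * (4 * sin (t / 2) ^ 3)) \<partial>lborel)"
        using K(2) by (intro nn_integral_indicator_continuous) (auto intro!: continuous_intros mult_nonneg_nonneg sin_ge_zero zero_le_power)
      also have "ennreal (Cp * W) * \<dots> \<le> ennreal (Cp * W) * ennreal (CJ / (real n)\<^sup>2)"
        by (intro mult_left_mono ennreal_leI K(4)) simp
      also have "\<dots> = ennreal (Cp * W * (CJ / (real n)\<^sup>2))" using CW by (simp only: ennreal_mult'[OF less_imp_le])
      finally show "(\<integral>\<^sup>+t. ennreal (indicator {0<..<pi} t * (poly K (cos t) * (sin t * (cw m t)\<^sup>2)) * (Cp * W * rho m t)) \<partial>lborel)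
        \<le> ennreal (Cp * W * (CJ / (real n)\<^sup>2))" .
      show "0 \<le> indicator {0<..<pi} t * (poly K (cos t) * (sin t * (cw m t)\<^sup>2))" for t
        using K(2)[of t] sin_ge_zero[of t] by (auto simp: indicator_def)
      show "norm_le p a (dif m t (smooth_op m d f)) (Cp * W * rho m t)" "0 < Cp * W * rho m t"
        if "indicator {0<..<pi} t * (poly K (cos t) * (sin t * (cw m t)\<^sup>2)) \<noteq> 0" for t
      proof -
        have "0 < t" "t < pi" using that by (auto simp: indicator_def split: if_splits)
        then show "norm_le p a (dif m t (smooth_op m d f)) (Cp * W * rho m t)" "0 < Cp * W * rho m t"
          using difs CW rho_pos[of t m] by auto
      qed
      show "(\<lambda>t. Cp * W * rho m t) \<in> borel_measurable borel" unfolding rho_def by measurable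
    qed (use CW CJ n in \<open>auto simp: case_prod_beta'\<close>)
    have kd: "c * d\<^sup>2 \<le> kap m d" by (rule c(2)) (use d in auto)
    then have kpos: "0 < kap m d" using c(1) d by (smt (verit) mult_pos_pos zero_less_power)
    have wpos: "0 < w_mass m s" if "0 < s" "s \<le> 1" for s
    proof -
      have "s < pi" using that pi_ge_two by simp
      then have "0 < (cw m 1)\<^sup>2 * (1 - cos s)"
        using one_minus_cos_pos[of s] that cw_pos[of 1 m] pi_ge_two by (intro mult_pos_pos) auto
      also have "\<dots> \<le> w_mass m s" using that \<open>s < pi\<close> by (intro w_mass_bounds(3)) auto
      finally show ?thesis .
    qed
    \<comment> \<open>Only translations by u <= d enter, which is where the hypothesis on W applies;
      the bound keeps the exact mass so that the outer integral gives exactly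
      \<open>kap m d * W\<close>.\<close>
    have in2: "norm_le p a (inner2 m s f) (w_mass m s * W)" if s: "0 < s" "s \<le> d" for s
      unfolding inner2_def[abs_def]
    proof (rule norm_le_integral[OF p1, where m = "\<lambda>_. W"])
      have sp: "s \<le> pi" using s d by simp
      have "(\<integral>\<^sup>+u. ennreal (in_w2 m s u * W) \<partial>lborel) = (\<integral>\<^sup>+u. ennreal (in_w2 m s u) * ennreal W \<partial>lborel)"
        using W in_w_nonneg(2)[OF sp] by (intro nn_integral_cong) (simp add: ennreal_mult')
      also have "\<dots> = (\<integral>\<^sup>+u. ennreal (in_w2 m s u) \<partial>lborel) * ennreal W" by (rule nn_integral_multc) measurable
      also have "(\<integral>\<^sup>+u. ennreal (in_w2 m s u) \<partial>lborel) = ennreal (w_mass m s)"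
        unfolding w_mass_def
      proof (rule nn_integral_eq_integral)
        show "integrable lborel (in_w2 m s)"
          unfolding in_w2_def by (intro lborel_integral_continuous(2) continuous_intros)
      qed (use in_w_nonneg(2)[OF sp] in auto)
      finally show "(\<integral>\<^sup>+u. ennreal (in_w2 m s u * W) \<partial>lborel) \<le> ennreal (w_mass m s * W)"
        using wpos[of s] s d by (simp add: ennreal_mult')
      show "norm_le p a (dif m u f) W" if "in_w2 m s u \<noteq> 0" for u
        using that om[of u] s by (auto simp: in_w2_def indicator_def d_def split: if_splits)
    qed (use s d W wpos[of s] in_w_nonneg in \<open>auto simp: case_prod_beta'\<close>)
    have out2: "norm_le p a (outer2 m d f) (kap m d * W)"
      unfolding outer2_def[abs_def]
    proof (rule norm_le_integral[OF p1, where m = "\<lambda>s. w_mass m s * W"])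
      have nn: "0 \<le> out_w m d s * w_mass m s" for s
        using out_w_nonneg[OF d(3), of m s] w_mass_bounds(1)[of s m] d by (cases "s \<in> {0<..<d}") (auto simp: out_w_def)
      have "(\<integral>\<^sup>+s. ennreal (out_w m d s * (w_mass m s * W)) \<partial>lborel) = (\<integral>\<^sup>+s. ennreal (out_w m d s * w_mass m s) * ennreal W \<partial>lborel)"
        using W nn by (intro nn_integral_cong) (simp add: ennreal_mult'[symmetric] mult.assoc)
      also have "\<dots> = (\<integral>\<^sup>+s. ennreal (out_w m d s * w_mass m s) \<partial>lborel) * ennreal W" by (rule nn_integral_multc) measurable
      also have "(\<integral>\<^sup>+s. ennreal (out_w m d s * w_mass m s) \<partial>lborel) = ennreal (kap m d)"
        unfolding kap_def by (rule nn_integral_eq_integral[OF out_w_mass_integrable[OF d(1,3)]]) (use nn in auto)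
      finally show "(\<integral>\<^sup>+s. ennreal (out_w m d s * (w_mass m s * W)) \<partial>lborel) \<le> ennreal (kap m d * W)"
        using kpos by (simp add: ennreal_mult')
      show "norm_le p a (inner2 m s f) (w_mass m s * W)" "0 < w_mass m s * W" if "out_w m d s \<noteq> 0" for s
      proof -
        have "0 < s" "s < d" using that by (auto simp: out_w_def indicator_def split: if_splits)
        then show "norm_le p a (inner2 m s f) (w_mass m s * W)" "0 < w_mass m s * W"
          using in2[of s] wpos[of s] d W by auto
      qed
    qed (use kpos W d out_w_nonneg[OF d(3)] in \<open>auto simp: case_prod_beta'\<close>)
    obtain Q where Q: "degree Q \<le> n - 1"
      "AE x in lborel. x \<in> Iv \<longrightarrow> 1 * smooth_op m d f x + 1 * kernel_op m K (smooth_op m d f) x = poly Q x"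
      using kernel_op_polynomial[OF C0 d(1,3) K(2,1,3) f1] by blast
    define Q' where "Q' = smult (1 / kap m d) Q"
    have ker_meas [measurable]: "kernel_op m K (smooth_op m d f) \<in> borel_measurable borel"
      unfolding kernel_op_def[abs_def] by measurable
    have "norm_le p a (\<lambda>x. (- 1 / kap m d) * outer2 m d f x + (- 1 / kap m d) * kernel_op m K (smooth_op m d f) x)
       (\<bar>- 1 / kap m d\<bar> * (kap m d * W) + \<bar>- 1 / kap m d\<bar> * (Cp * W * (CJ / (real n)\<^sup>2)))"
      using kpos W CW CJ by (intro norm_le_add[OF p1] norm_le_cmult[OF p1] out2 ker) auto
    then have "norm_le p a (\<lambda>x. f x - poly Q' x) (\<bar>- 1 / kap m d\<bar> * (kap m d * W) + \<bar>- 1 / kap m d\<bar> * (Cp * W * (CJ / (real n)\<^sup>2)))"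
    proof (rule norm_le_cong_AE[OF p1])
      show "AE x in lborel. x \<in> Iv \<longrightarrow> f x - poly Q' x = (- 1 / kap m d) * outer2 m d f x + (- 1 / kap m d) * kernel_op m K (smooth_op m d f) x"
        using Q(2)
      proof eventually_elim
        case (elim x)
        show ?case
        proof
          assume "x \<in> Iv"
          then have "poly Q x = kap m d * f x + outer2 m d f x + kernel_op m K (smooth_op m d f) x"
            using elim by (simp add: smooth_op_def)
          then show "f x - poly Q' x = (- 1 / kap m d) * outer2 m d f x + (- 1 / kap m d) * kernel_op m K (smooth_op m d f) x"
            using kpos by (simp add: Q'_def field_simps)
        qed
      qed
    qed (use kpos W CW CJ in auto)
    then have "norm_le p a (\<lambda>x. f x - poly Q' x) (C * W)"
    proof (rule norm_le_mono[OF p1])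
      have "(Cp * W * (CJ / (real n)\<^sup>2)) / kap m d \<le> (Cp * W * (CJ / (real n)\<^sup>2)) / (c * d\<^sup>2)"
        using kd c(1) d CW CJ kpos by (intro divide_left_mono) auto
      also have "\<dots> = Cp * CJ / c * W" using n by (simp add: d_def power_divide)
      finally show "\<bar>- 1 / kap m d\<bar> * (kap m d * W) + \<bar>- 1 / kap m d\<bar> * (Cp * W * (CJ / (real n)\<^sup>2)) \<le> C * W"
        using kpos by (simp add: C_def algebra_simps)
    qed (use kpos W CW CJ in auto)
    moreover have "degree Q' \<le> n - 1" unfolding Q'_def using Q(1) degree_smult_le order_trans by blast
    ultimately show ?thesis by blast
  qed
  moreover have "0 < C" using Cp CJ c by (simp add: C_def add_pos_pos)
  ultimately show ?thesis using that by blast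
qed

text \<open>Constants are eigenpolynomials of degree 0 and their multiplier is c itself: dividing by
  c is what makes the translation preserve constants.\<close>

lemma dif_const: "0 \<le> t \<Longrightarrow> t < pi \<Longrightarrow> x \<in> Iv \<Longrightarrow> dif m t (poly [:c:]) x = 0"
proof -
  assume t: "0 \<le> t" "t < pi" and x: "x \<in> Iv"
  obtain g where g: "multiplier m 0 g" "\<And>t. 0 \<le> t \<Longrightarrow> t < pi \<Longrightarrow> g t = cw m t"
    by (rule eigen_multiplier[of m 0]) (rule that, assumption, simp)
  have 1: "spin_avg m t (poly 1) x = cw m t"
    using g t x unfolding multiplier_def eigpoly_0 by auto
  have "spin_avg m t (poly [:c:]) x = c * spin_avg m t (poly 1) x"
  proof -
    have "[:c:] = smult c 1" by simp
    then show ?thesis unfolding spin_avg_poly by (simp only: spin_int_smult times_divide_eq_right)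
  qed
  then show ?thesis using 1 cw_pos[OF t, of m] by (simp add: dif_def tau_def)
qed

lemma one_minus_cw_le: "1 - cw m s \<le> real m * s\<^sup>2"
proof -
  have b: "(sin (s / 2))\<^sup>2 \<le> s\<^sup>2"
  proof -
    have "\<bar>sin (s / 2)\<bar> \<le> \<bar>s / 2\<bar>" by (rule abs_sin_x_le_abs_x)
    also have "\<dots> \<le> \<bar>s\<bar>" by simp
    finally show ?thesis by (simp add: abs_le_square_iff)
  qed
  have "1 + real m * (- (sin (s / 2))\<^sup>2) \<le> (1 + - (sin (s / 2))\<^sup>2) ^ m"
    by (rule Bernoulli_inequality) (simp add: abs_square_le_1)
  also have "1 + - (sin (s / 2))\<^sup>2 = (cos (s / 2))\<^sup>2" by (simp add: cos_squared_eq)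
  finally have "1 - cw m s \<le> real m * (sin (s / 2))\<^sup>2" by (simp add: cw_def power_mult)
  also have "\<dots> \<le> real m * s\<^sup>2" using b by (intro mult_left_mono) auto
  finally show ?thesis .
qed

text \<open>For s <= 1 the divisor c is at least its value at 1. For polynomials, tau P - P is (G P
  - P) / c plus (1 / c - 1) P; the second term is of order s^2 and hence, as N >= 1, of order (s
  N)^2.\<close>

lemma dif_bounds:
  assumes adm: "admissible p m a"
  obtains D B where "0 < D" "0 < B"
    "\<And>f s M. f \<in> borel_measurable borel \<Longrightarrow> 0 < s \<Longrightarrow> s \<le> 1 \<Longrightarrow> 0 \<le> M \<Longrightarrow> norm_le p a f M \<Longrightarrow> norm_le p a (dif m s f) (D * M)"
    "\<And>P N s M. degree P \<le> N \<Longrightarrow> 0 < N \<Longrightarrow> 0 < s \<Longrightarrow> s \<le> 1 \<Longrightarrow> 0 \<le> M \<Longrightarrow> norm_le p a (poly P) M \<Longrightarrow>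
       norm_le p a (dif m s (poly P)) (B * (s * real N)\<^sup>2 * M)"
proof -
  have p1: "1 \<le> p" using adm by (simp add: admissible_def)
  obtain Cp where Cp: "0 < Cp" "\<And>t f M. f \<in> borel_measurable borel \<Longrightarrow> 0 \<le> M \<Longrightarrow>
     norm_le p a f M \<Longrightarrow> norm_le p a (spin_avg m t f) (Cp * M)"
    using spin_avg_bound[OF adm] by blast
  obtain Cb where Cb: "0 < Cb" "\<And>P n t B. degree P \<le> n \<Longrightarrow> 0 < n \<Longrightarrow> 0 < t \<Longrightarrow> 0 \<le> B \<Longrightarrow> norm_le p a (poly P) B \<Longrightarrow>
     norm_le p a (\<lambda>x. spin_avg m t (poly P) x - poly P x) (Cb * (t * real n)\<^sup>2 * B)"
    using bernstein_spin_avg[OF adm] by blast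
  define e where "e = cw m 1"
  have e: "0 < e" "e \<le> 1" unfolding e_def using cw_pos[of 1 m] cw_le_1 pi_ge_two by auto
  have ce: "e \<le> cw m s" if "0 < s" "s \<le> 1" for s
    unfolding e_def using that pi_ge_two by (intro cw_antimono) auto
  define D where "D = Cp / e + 1"
  define B where "B = (Cb + real m) / e"
  have 1: "norm_le p a (dif m s f) (D * M)"
    if [measurable]: "f \<in> borel_measurable borel" and s: "0 < s" "s \<le> 1" and M: "0 \<le> M" "norm_le p a f M" for f s M
  proof -
    have c: "0 < cw m s" using ce[OF s] e by simp
    have "norm_le p a (\<lambda>x. (1 / cw m s) * spin_avg m s f x - f x) (\<bar>1 / cw m s\<bar> * (Cp * M) + M)"
      using M Cp by (intro norm_le_diff[OF p1] norm_le_cmult[OF p1] Cp(2)) auto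
    then have "norm_le p a (dif m s f) (\<bar>1 / cw m s\<bar> * (Cp * M) + M)"
      by (simp add: dif_def[abs_def] tau_def)
    then show ?thesis
    proof (rule norm_le_mono[OF p1])
      have "1 / cw m s \<le> 1 / e" using ce[OF s] e by (intro divide_left_mono) auto
      then have "1 / cw m s * (Cp * M) \<le> 1 / e * (Cp * M)" using Cp M by (intro mult_right_mono) auto
      then show "\<bar>1 / cw m s\<bar> * (Cp * M) + M \<le> D * M" using c by (simp add: D_def algebra_simps)
    qed (use Cp M in auto)
  qed
  have 2: "norm_le p a (dif m s (poly P)) (B * (s * real N)\<^sup>2 * M)"
    if P: "degree P \<le> N" "0 < N" and s: "0 < s" "s \<le> 1" and M: "0 \<le> M" "norm_le p a (poly P) M" for P N s M
  proof -
    have c: "0 < cw m s" using ce[OF s] e by simp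
    have c1: "cw m s \<le> 1" by (rule cw_le_1)
    have [measurable]: "poly P \<in> borel_measurable borel" by (rule borel_measurable_poly) simp
    have "norm_le p a (\<lambda>x. (1 / cw m s) * (spin_avg m s (poly P) x - poly P x) + (1 / cw m s - 1) * poly P x)
      (\<bar>1 / cw m s\<bar> * (Cb * (s * real N)\<^sup>2 * M) + \<bar>1 / cw m s - 1\<bar> * M)"
      using M Cb by (intro norm_le_add[OF p1] norm_le_cmult[OF p1] Cb(2) P s) auto
    moreover have "(\<lambda>x. (1 / cw m s) * (spin_avg m s (poly P) x - poly P x) + (1 / cw m s - 1) * poly P x) = dif m s (poly P)"
      by (simp add: fun_eq_iff dif_def tau_def algebra_simps diff_divide_distrib)
    ultimately have "norm_le p a (dif m s (poly P)) (\<bar>1 / cw m s\<bar> * (Cb * (s * real N)\<^sup>2 * M) + \<bar>1 / cw m s - 1\<bar> * M)" by simp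
    then show ?thesis
    proof (rule norm_le_mono[OF p1])
      have "1 / cw m s \<le> 1 / e" using ce[OF s] e by (intro divide_left_mono) auto
      then have a1: "1 / cw m s * (Cb * (s * real N)\<^sup>2 * M) \<le> 1 / e * (Cb * (s * real N)\<^sup>2 * M)"
        using Cb M by (intro mult_right_mono) auto
      have "1 / cw m s - 1 = (1 - cw m s) / cw m s" using c by (simp add: field_simps)
      also have "\<dots> \<le> real m * s\<^sup>2 / e"
        using ce[OF s] e one_minus_cw_le[of m s] c1 by (intro frac_le) auto
      also have "\<dots> \<le> real m * (s * real N)\<^sup>2 / e"
        using P(2) e by (intro divide_right_mono mult_left_mono) (auto simp: power_mult_distrib mult_le_cancel_left1)
      finally have "(1 / cw m s - 1) * M \<le> real m * (s * real N)\<^sup>2 / e * M" using M by (intro mult_right_mono) auto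
      moreover have "0 \<le> 1 / cw m s - 1" using c c1 by simp
      ultimately show "\<bar>1 / cw m s\<bar> * (Cb * (s * real N)\<^sup>2 * M) + \<bar>1 / cw m s - 1\<bar> * M \<le> B * (s * real N)\<^sup>2 * M"
        using a1 c by (simp add: B_def add_divide_distrib algebra_simps)
    qed (use Cb M in auto)
  qed
  have "0 < D" "0 < B" using Cp Cb e by (auto simp: D_def B_def intro!: add_pos_pos divide_pos_pos add_pos_nonneg)
  then show ?thesis using that 1 2 by blast
qed

text \<open>Cauchy condensation: the block from 2^J + 1 to 2^(J+1) has 2^J terms, each at least 2^J
  E(2^(J+1)).\<close>

lemma dyadic_sum_le:
  fixes E :: "nat \<Rightarrow> real"
  assumes E0: "\<And>k. 0 \<le> E k" and anti: "\<And>i j. 1 \<le> i \<Longrightarrow> i \<le> j \<Longrightarrow> E j \<le> E i"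
  shows "(\<Sum>j\<le>J. 4 ^ j * E (2 ^ j)) \<le> 4 * (\<Sum>k=1..2^J. real k * E k)"
proof (induction J)
  case 0
  then show ?case using E0[of 1] by simp
next
  case (Suc J)
  have "4 ^ J * E (2 ^ Suc J) = (\<Sum>k=2^J+1..(2::nat)^Suc J. 2 ^ J * E (2 ^ Suc J))"
  proof -
    have "card {2^J+1..(2::nat)^Suc J} = 2 ^ J" by simp
    then show ?thesis by (simp add: power_mult_distrib[symmetric])
  qed
  also have "\<dots> \<le> (\<Sum>k=2^J+1..(2::nat)^Suc J. real k * E k)"
  proof (intro sum_mono mult_mono anti)
    fix k assume k: "k \<in> {2^J+1..2^Suc J::nat}"
    then show "(2::real) ^ J \<le> real k" by (metis Suc_eq_plus1 Suc_leD atLeastAtMost_iff of_nat_le_iff of_nat_numeral of_nat_power)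
    show "1 \<le> k" "k \<le> 2 ^ Suc J" using k by auto
  qed (use E0 in auto)
  finally have "4 ^ Suc J * E (2 ^ Suc J) \<le> 4 * (\<Sum>k=2^J+1..(2::nat)^Suc J. real k * E k)" by simp
  moreover have "(\<Sum>k=1..2^Suc J. real k * E k) = (\<Sum>k=1..2^J. real k * E k) + (\<Sum>k=2^J+1..(2::nat)^Suc J. real k * E k)"
    by (subst sum.union_disjoint[symmetric]) (auto intro!: sum.cong)
  ultimately show ?case using Suc by simp
qed

text \<open>Telescoping over approximants of degree below 2^j: the first is a constant and is
  preserved, each difference falls under the Bernstein bound, and the last approximant, with 2^J <=
  n < 2^(J+1), leaves an error of size E(2^J). E is any decreasing majorant with approximants
  attaining it, since an infimum may not be attained.\<close>

lemma inverse_estimate: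
  assumes adm: "admissible p m a"
  obtains C where "0 < C" "\<And>f n s M E. f \<in> borel_measurable borel \<Longrightarrow> norm_le p a f M \<Longrightarrow> 0 < n \<Longrightarrow> 0 < s \<Longrightarrow> s \<le> 1 / real n \<Longrightarrow>
     (\<And>k. 0 \<le> E k) \<Longrightarrow> (\<And>i j. 1 \<le> i \<Longrightarrow> i \<le> j \<Longrightarrow> E j \<le> E i) \<Longrightarrow>
     (\<And>k. 1 \<le> k \<Longrightarrow> \<exists>P. degree P \<le> k - 1 \<and> norm_le p a (\<lambda>x. f x - poly P x) (E k)) \<Longrightarrow>
     norm_le p a (dif m s f) (C / (real n)\<^sup>2 * (\<Sum>k=1..n. real k * E k))"
proof -
  have p1: "1 \<le> p" using adm by (simp add: admissible_def)
  obtain C0 where C0: "0 < C0" "\<And>t. bop m (spin_avg m t) C0" using bop_spin_avg by blast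
  obtain D B where D: "0 < D" and B: "0 < B" and
    dD: "\<And>f s M. f \<in> borel_measurable borel \<Longrightarrow> 0 < s \<Longrightarrow> s \<le> 1 \<Longrightarrow> 0 \<le> M \<Longrightarrow> norm_le p a f M \<Longrightarrow> norm_le p a (dif m s f) (D * M)" and
    dB: "\<And>P N s M. degree P \<le> N \<Longrightarrow> 0 < N \<Longrightarrow> 0 < s \<Longrightarrow> s \<le> 1 \<Longrightarrow> 0 \<le> M \<Longrightarrow> norm_le p a (poly P) M \<Longrightarrow>
       norm_le p a (dif m s (poly P)) (B * (s * real N)\<^sup>2 * M)"
    using dif_bounds[OF adm] by metis
  \<comment> \<open>Condensation costs 4 in both terms. The first carries another 4 from n^2 <= 4 *
    4^J; the second carries 8, from (2^(j+1))^2 = 4 * 4^j and from E(2^(j+1)) + E(2^j) <= 2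
    E(2^j).\<close>
  define C where "C = 16 * D + 32 * B"
  have main: "norm_le p a (dif m s f) (C / (real n)\<^sup>2 * (\<Sum>k=1..n. real k * E k))"
    if [measurable]: "f \<in> borel_measurable borel" and fM: "norm_le p a f M" and n: "0 < n" and s: "0 < s" "s \<le> 1 / real n"
      and E0: "\<And>k. 0 \<le> E k" and anti: "\<And>i j. 1 \<le> i \<Longrightarrow> i \<le> j \<Longrightarrow> E j \<le> E i"
      and ex: "\<And>k. 1 \<le> k \<Longrightarrow> \<exists>P. degree P \<le> k - 1 \<and> norm_le p a (\<lambda>x. f x - poly P x) (E k)" for f n s M and E :: "nat \<Rightarrow> real"
  proof -
    have s1: "s \<le> 1" using s n by (smt (verit) Suc_leI divide_le_eq_1 of_nat_1 of_nat_le_iff One_nat_def)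
    have spi: "s < pi" using s1 pi_ge_two by simp
    have f1: "f \<in> L1_space m" by (rule admissible_in_L1_space[OF adm _ fM]) measurable
    have polym [measurable]: "poly P \<in> borel_measurable borel" for P :: "real poly" by (rule borel_measurable_poly) simp
    have "\<forall>j. \<exists>P. degree P \<le> 2 ^ j - 1 \<and> norm_le p a (\<lambda>x. f x - poly P x) (E (2 ^ j))"
      using ex by simp
    then obtain P where P: "\<And>j. degree (P j) \<le> 2 ^ j - 1" "\<And>j. norm_le p a (\<lambda>x. f x - poly (P j) x) (E (2 ^ j))"
      by metis
    have lin: "AE x in lborel. x \<in> Iv \<longrightarrow> dif m s (\<lambda>x. g x + h x) x = dif m s g x + dif m s h x"
      if "g \<in> L1_space m" "h \<in> L1_space m" for g h
      using bop_linear[OF bop_dif[OF C0, of s] that, of 1 1] by simp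
    have poly_bound: "norm_le p a (dif m s (poly (P J))) (\<Sum>j<J. B * (s * 2 ^ Suc j)\<^sup>2 * (E (2 ^ Suc j) + E (2 ^ j)))" for J
    proof (induction J)
      case 0
      obtain c where c: "P 0 = [:c:]" using P(1)[of 0] by (auto elim: degree_eq_zeroE)
      have "norm_le p a (dif m s (poly (P 0))) 0"
        by (rule norm_le_cong_AE[OF p1 norm_le_zero[OF p1]]) (use s spi in \<open>auto simp: c dif_const\<close>)
      then show ?case by simp
    next
      case (Suc J)
      let ?Q = "P (Suc J) - P J"
      have "norm_le p a (\<lambda>x. (f x - poly (P J) x) - (f x - poly (P (Suc J)) x)) (E (2 ^ J) + E (2 ^ Suc J))"
        by (intro norm_le_diff[OF p1] P E0) auto
      moreover have "(\<lambda>x. (f x - poly (P J) x) - (f x - poly (P (Suc J)) x)) = poly ?Q" by (simp add: fun_eq_iff)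
      ultimately have nQ: "norm_le p a (poly ?Q) (E (2 ^ Suc J) + E (2 ^ J))" by (simp only: add.commute)
      have "(2::nat) ^ J \<le> 2 ^ Suc J" by simp
      then have "degree ?Q \<le> 2 ^ Suc J" using P(1)[of J] P(1)[of "Suc J"] by (intro degree_diff_le) linarith+
      from dB[OF this _ s(1) s1 _ nQ]
      have b: "norm_le p a (dif m s (poly ?Q)) (B * (s * 2 ^ Suc J)\<^sup>2 * (E (2 ^ Suc J) + E (2 ^ J)))"
        using E0 by simp
      have "norm_le p a (\<lambda>x. dif m s (poly (P J)) x + dif m s (poly ?Q) x)
         ((\<Sum>j<J. B * (s * 2 ^ Suc j)\<^sup>2 * (E (2 ^ Suc j) + E (2 ^ j))) + B * (s * 2 ^ Suc J)\<^sup>2 * (E (2 ^ Suc J) + E (2 ^ J)))"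
        using B E0 by (intro norm_le_add[OF p1] Suc b sum_nonneg mult_nonneg_nonneg) auto
      then have "norm_le p a (dif m s (poly (P (Suc J))))
         ((\<Sum>j<J. B * (s * 2 ^ Suc j)\<^sup>2 * (E (2 ^ Suc j) + E (2 ^ j))) + B * (s * 2 ^ Suc J)\<^sup>2 * (E (2 ^ Suc J) + E (2 ^ J)))"
      proof (rule norm_le_cong_AE[OF p1])
        have "(\<lambda>x. poly (P J) x + poly ?Q x) = poly (P (Suc J))" by (simp add: fun_eq_iff)
        then show "AE x in lborel. x \<in> Iv \<longrightarrow> dif m s (poly (P (Suc J))) x = dif m s (poly (P J)) x + dif m s (poly ?Q) x"
          using lin[OF poly_in_L1_space[of "P J"] poly_in_L1_space[of ?Q]] by simp
      qed (use B E0 in \<open>auto intro!: add_nonneg_nonneg sum_nonneg mult_nonneg_nonneg\<close>)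
      then show ?case by simp
    qed
    obtain J where J: "2 ^ J \<le> n" "n < 2 ^ Suc J"
    proof -
      define J where "J = floor_log n"
      show ?thesis using that[of J] n floor_log_exp2_le[of n] floor_log_exp2_gt[of n] by (simp add: J_def)
    qed
    have "norm_le p a (\<lambda>x. dif m s (\<lambda>x. f x - poly (P J) x) x + dif m s (poly (P J)) x)
       (D * E (2 ^ J) + (\<Sum>j<J. B * (s * 2 ^ Suc j)\<^sup>2 * (E (2 ^ Suc j) + E (2 ^ j))))"
      using B D E0 by (intro norm_le_add[OF p1] dD poly_bound P s s1 sum_nonneg mult_nonneg_nonneg) auto
    then have "norm_le p a (dif m s f) (D * E (2 ^ J) + (\<Sum>j<J. B * (s * 2 ^ Suc j)\<^sup>2 * (E (2 ^ Suc j) + E (2 ^ j))))"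
    proof (rule norm_le_cong_AE[OF p1])
      show "AE x in lborel. x \<in> Iv \<longrightarrow> dif m s f x = dif m s (\<lambda>x. f x - poly (P J) x) x + dif m s (poly (P J)) x"
        using lin[OF L1_space_diff[OF f1 poly_in_L1_space[of "P J"]] poly_in_L1_space[of "P J"]] by simp
    qed (use B D E0 in \<open>auto intro!: add_nonneg_nonneg sum_nonneg mult_nonneg_nonneg\<close>)
    then show ?thesis
    proof (rule norm_le_mono[OF p1])
      let ?S = "\<Sum>k=1..n. real k * E k"
      have S0: "0 \<le> ?S" using E0 by (intro sum_nonneg) auto
      have dy: "(\<Sum>j\<le>J. 4 ^ j * E (2 ^ j)) \<le> 4 * ?S"
      proof -
        have "(\<Sum>j\<le>J. 4 ^ j * E (2 ^ j)) \<le> 4 * (\<Sum>k=1..2^J. real k * E k)" by (rule dyadic_sum_le[OF E0 anti])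
        also have "(\<Sum>k=1..2^J. real k * E k) \<le> ?S" using J(1) E0 by (intro sum_mono2) auto
        finally show ?thesis by simp
      qed
      have n2: "(real n)\<^sup>2 \<le> 4 * 4 ^ J"
      proof -
        have "real n \<le> 2 ^ Suc J" using J(2) by (metis less_imp_le of_nat_le_iff of_nat_numeral of_nat_power)
        then have "(real n)\<^sup>2 \<le> (2 ^ Suc J)\<^sup>2" by (intro power_mono) auto
        also have "(2 ^ Suc J)\<^sup>2 = (4::real) * 4 ^ J" by (induction J) (auto simp: power2_eq_square)
        finally show ?thesis .
      qed
      have a1: "(real n)\<^sup>2 * (D * E (2 ^ J)) \<le> 16 * D * ?S"
      proof -
        have "4 ^ J * E (2 ^ J) \<le> (\<Sum>j\<le>J. 4 ^ j * E (2 ^ j))" using E0 by (intro member_le_sum) auto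
        with dy have "4 ^ J * E (2 ^ J) \<le> 4 * ?S" by simp
        then have "4 * D * (4 ^ J * E (2 ^ J)) \<le> 4 * D * (4 * ?S)" using D by (intro mult_left_mono) auto
        moreover have "(real n)\<^sup>2 * (D * E (2 ^ J)) \<le> 4 * 4 ^ J * (D * E (2 ^ J))" using n2 D E0 by (intro mult_right_mono) auto
        ultimately show ?thesis by (simp add: mult_ac)
      qed
      have a2: "(real n)\<^sup>2 * (\<Sum>j<J. B * (s * 2 ^ Suc j)\<^sup>2 * (E (2 ^ Suc j) + E (2 ^ j))) \<le> 32 * B * ?S"
      proof -
        have ns: "(real n * s)\<^sup>2 \<le> 1"
        proof -
          have "real n * s \<le> 1" using s n by (simp add: field_simps)
          then show ?thesis using s by (intro power_le_one) auto
        qed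
        have "(real n)\<^sup>2 * (\<Sum>j<J. B * (s * 2 ^ Suc j)\<^sup>2 * (E (2 ^ Suc j) + E (2 ^ j)))
          = (\<Sum>j<J. (real n * s)\<^sup>2 * (B * (4 * 4 ^ j) * (E (2 ^ Suc j) + E (2 ^ j))))"
        proof -
          have "((2::real) ^ Suc j)\<^sup>2 = 4 * 4 ^ j" for j
            by (induction j) (auto simp: power2_eq_square)
          then show ?thesis by (simp only: sum_distrib_left power_mult_distrib mult_ac)
        qed
        also have "\<dots> \<le> (\<Sum>j<J. 1 * (B * (4 * 4 ^ j) * (E (2 ^ j) + E (2 ^ j))))"
        proof (intro sum_mono mult_mono ns mult_left_mono add_mono anti)
          fix j assume "j \<in> {..<J}"
          show "1 \<le> (2::nat) ^ j" by simp
          show "(2::nat) ^ j \<le> 2 ^ Suc j" by simp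
        qed (use B E0 in auto)
        also have "\<dots> = 8 * B * (\<Sum>j<J. 4 ^ j * E (2 ^ j))" by (simp add: sum_distrib_left mult_ac)
        also have "\<dots> \<le> 8 * B * (\<Sum>j\<le>J. 4 ^ j * E (2 ^ j))" using B E0 by (intro mult_left_mono sum_mono2) auto
        also have "\<dots> \<le> 8 * B * (4 * ?S)" using B dy by (intro mult_left_mono) simp_all
        finally show ?thesis by (simp only: mult.assoc[symmetric])
      qed
      have "(real n)\<^sup>2 * (D * E (2 ^ J) + (\<Sum>j<J. B * (s * 2 ^ Suc j)\<^sup>2 * (E (2 ^ Suc j) + E (2 ^ j)))) \<le> C * ?S"
        using a1 a2 by (simp only: distrib_left C_def distrib_right)
      then show "D * E (2 ^ J) + (\<Sum>j<J. B * (s * 2 ^ Suc j)\<^sup>2 * (E (2 ^ Suc j) + E (2 ^ j))) \<le> C / (real n)\<^sup>2 * ?S"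
        using n by (simp only: times_divide_eq_left pos_le_divide_eq mult.commute[of _ "(real n)\<^sup>2"] zero_less_power of_nat_0_less_iff)
    qed (use B D E0 in \<open>auto intro!: add_nonneg_nonneg sum_nonneg mult_nonneg_nonneg\<close>)
  qed
  have "0 < C" using B D by (simp add: C_def)
  then show ?thesis
  proof (rule that)
    fix f n s M and E :: "nat \<Rightarrow> real"
    assume h: "f \<in> borel_measurable borel" "norm_le p a f M" "0 < n" "0 < s" "s \<le> 1 / real n"
      "\<And>k. 0 \<le> E k" "\<And>i j. 1 \<le> i \<Longrightarrow> i \<le> j \<Longrightarrow> E j \<le> E i"
      "\<And>k. 1 \<le> k \<Longrightarrow> \<exists>P. degree P \<le> k - 1 \<and> norm_le p a (\<lambda>x. f x - poly P x) (E k)"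
    show "norm_le p a (dif m s f) (C / (real n)\<^sup>2 * (\<Sum>k=1..n. real k * E k))"
      by (rule main[OF h])
  qed
qed

subsection \<open>Translations and norms of the statement\<close>

text \<open>Whatever solution phi is chosen, q is sin theta e^(-i phi), and De Moivre's formula
  turns its m-th power into the cosine of the statement.\<close>

lemma sqrt_cos_trans_phi:
  assumes x: "x \<in> Iv"
  shows "trans_R (arccos x) t \<phi> = rot_R x t \<phi>"
    and "sqrt (1 - (rot_R x t \<phi>)\<^sup>2) ^ m * cos (real m * (\<phi> - trans_phi (arccos x) t \<phi>)) = spin_ker m x t \<phi>"
proof -
  have x': "\<bar>x\<bar> \<le> 1" using x by auto
  show R: "trans_R (arccos x) t \<phi> = rot_R x t \<phi>"
    using x' by (simp add: trans_R_def rot_R_def cos_arccos_abs sin_arccos_abs)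
  define \<psi> where "\<psi> = trans_phi (arccos x) t \<phi>"
  define S where "S = sqrt (1 - (rot_R x t \<phi>)\<^sup>2)"
  have "\<bar>rot_R x t \<phi>\<bar> \<le> 1" using Iv_sq[OF x] by (intro rot_R_bound) simp
  then have S: "sin (arccos (rot_R x t \<phi>)) = S" by (simp add: S_def sin_arccos_abs)
  have "rot_q x t \<phi> = complex_of_real S * cis (- \<psi>)"
    using trans_phi(2,3)[of "arccos x" t \<phi>] x'
    by (simp add: R S \<psi>_def[symmetric] rot_q_def complex_eq_iff cos_arccos_abs sin_arccos_abs)
  then have "spin_ker m x t \<phi> = Re (cis (real m * \<phi>) * (complex_of_real (S ^ m) * cis (real m * (- \<psi>))))"
    by (simp add: spin_ker_def power_mult_distrib Complex.DeMoivre)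
  also have "\<dots> = S ^ m * Re (cis (real m * \<phi>) * cis (real m * (- \<psi>)))" by (simp add: algebra_simps)
  also have "\<dots> = S ^ m * cos (real m * (\<phi> - \<psi>))" by (simp only: cis_mult cis.sel right_diff_distrib) simp
  finally show "S ^ m * cos (real m * (\<phi> - \<psi>)) = spin_ker m x t \<phi>" by simp
qed

text \<open>Agreement of f with its Borel representative is asked for only almost everywhere along
  the circle through x. This serves finite p, where it holds for almost every x, and p = infinity,
  where it holds for every x.\<close>

lemma gen_translation_eq_tau:
  assumes x: "x \<in> Iv" and [measurable]: "g \<in> borel_measurable borel"
    and fg: "AE \<phi> in lborel. \<phi> \<in> {0<..<pi} \<longrightarrow> f (rot_R x \<bar>t\<bar> \<phi>) = g (rot_R x \<bar>t\<bar> \<phi>)"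
  shows "gen_translation m t f x = tau m \<bar>t\<bar> g x"
proof -
  let ?F = "\<lambda>\<phi>. indicat_real {0..pi} \<phi> *\<^sub>R (spin_ker m x \<bar>t\<bar> \<phi> * f (rot_R x \<bar>t\<bar> \<phi>))"
  let ?G = "\<lambda>\<phi>. indicat_real {0<..<pi} \<phi> * (spin_ker m x \<bar>t\<bar> \<phi> * g (rot_R x \<bar>t\<bar> \<phi>))"
  have "AE \<phi> in lborel. ?G \<phi> = ?F \<phi>"
    using fg AE_lborel_singleton[of 0] AE_lborel_singleton[of pi]
    by eventually_elim (auto simp: indicator_def)
  then have AEFG: "AE \<phi> in lebesgue. ?G \<phi> = ?F \<phi>" by (rule AE_completion)
  have "?G \<in> borel_measurable lborel" by measurable
  then have G: "?G \<in> borel_measurable lebesgue" by (rule measurable_completion)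
  have "integral\<^sup>L lebesgue ?F = integral\<^sup>L lebesgue ?G"
    by (rule integral_cong_AE[OF borel_measurable_AE[OF G AEFG] G]) (use AEFG in \<open>auto elim: eventually_mono\<close>)
  also have "\<dots> = integral\<^sup>L lborel ?G" by (rule integral_completion) measurable
  finally have i: "integral\<^sup>L lebesgue ?F = integral\<^sup>L lborel ?G" .
  have e: "sqrt (1 - (trans_R (arccos x) \<bar>t\<bar> \<phi>)\<^sup>2) ^ m * f (trans_R (arccos x) \<bar>t\<bar> \<phi>)
      * cos (real m * (\<phi> - trans_phi (arccos x) \<bar>t\<bar> \<phi>))
    = spin_ker m x \<bar>t\<bar> \<phi> * f (rot_R x \<bar>t\<bar> \<phi>)" for \<phi>
    unfolding sqrt_cos_trans_phi(1)[OF x] sqrt_cos_trans_phi(2)[OF x, symmetric] by (simp only: mult_ac)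
  show ?thesis
    unfolding gen_translation_def Let_def set_lebesgue_integral_def e i tau_def spin_avg_def cw_def by simp
qed

text \<open>A violation at one point would spread to a nonempty open set, which is not
  negligible.\<close>

lemma AE_lborel_open_imp:
  assumes AE: "AE x in lborel. x \<in> S \<longrightarrow> h x \<le> M" and S: "open S"
    and h: "continuous_on S h" and x: "x \<in> S"
  shows "(h :: real \<Rightarrow> real) x \<le> M"
proof (rule ccontr)
  assume "\<not> h x \<le> M"
  define U where "U = h -` {M<..} \<inter> S"
  have U: "open U" "x \<in> U"
    using h S x \<open>\<not> h x \<le> M\<close> by (auto simp: U_def continuous_on_open_vimage)
  from AE obtain N where N: "{y. \<not> (y \<in> S \<longrightarrow> h y \<le> M)} \<subseteq> N" "N \<in> null_sets lborel"
    by (auto elim!: AE_E simp: null_sets_def)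
  have "negligible N" using N(2) by (simp add: negligible_iff_null_sets null_sets_completionI)
  moreover have "U \<subseteq> N" using N(1) by (auto simp: U_def)
  ultimately have "negligible U" by (rule negligible_subset)
  then show False using open_not_negligible[of U] U by auto
qed

text \<open>At p = infinity one side is a genuine supremum and the other an essential one; they
  agree for continuous functions, so in that case g must be continuous and equal to h at every
  point.\<close>

lemma Lp_weighted_norm_le_iff:
  assumes p: "1 \<le> p" and M: "0 \<le> M"
    and eq: "AE x in lborel. x \<in> Iv \<longrightarrow> h x = g x"
    and inf: "p = \<infinity> \<Longrightarrow> continuous_on Iv g \<and> (\<forall>x\<in>Iv. h x = g x)"
  shows "Lp_weighted_norm p a h \<le> ennreal M \<longleftrightarrow> norm_le p a g M"
proof (cases rule: exponent_cases[OF p])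
  case 1
  have "Lp_weighted_norm p a h \<le> ennreal M \<longleftrightarrow> (\<forall>x\<in>Iv. \<bar>g x\<bar> * (1 - x\<^sup>2) powr a \<le> M)"
    using inf M 1 by (auto simp: Lp_weighted_norm_def Lp_norm_def SUP_le_iff abs_mult)
  also have "\<dots> \<longleftrightarrow> norm_le p a g M"
  proof
    assume "norm_le p a g M"
    then have AE: "AE x in lborel. x \<in> Iv \<longrightarrow> \<bar>g x\<bar> * (1 - x\<^sup>2) powr a \<le> M" by (simp add: norm_le_def 1)
    have "continuous_on Iv (\<lambda>x. \<bar>g x\<bar> * (1 - x\<^sup>2) powr a)"
      using inf 1 Iv_weight_pos by (intro continuous_intros) fastforce+
    from AE_lborel_open_imp[OF AE _ this] show "\<forall>x\<in>Iv. \<bar>g x\<bar> * (1 - x\<^sup>2) powr a \<le> M" by simp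
  qed (simp add: norm_le_def 1)
  finally show ?thesis .
next
  case (2 r)
  define I where "I = (\<integral>\<^sup>+ x\<in>Iv. ennreal ((\<bar>g x\<bar> * (1 - x\<^sup>2) powr a) powr r) \<partial>lborel)"
  have "(\<integral>\<^sup>+ x\<in>{-1..1}. ennreal (\<bar>h x * (1 - x\<^sup>2) powr a\<bar> powr r) \<partial>lebesgue) = I"
    unfolding nn_integral_completion I_def
  proof (rule nn_integral_cong_AE)
    show "AE x in lborel. ennreal (\<bar>h x * (1 - x\<^sup>2) powr a\<bar> powr r) * indicator {-1..1} x
      = ennreal ((\<bar>g x\<bar> * (1 - x\<^sup>2) powr a) powr r) * indicator Iv x"
      using eq AE_lborel_singleton[of "-1"] AE_lborel_singleton[of 1]
      by eventually_elim (auto simp: indicator_def abs_mult)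
  qed
  then have n: "Lp_weighted_norm p a h = (if I = \<infinity> then \<infinity> else ennreal (enn2real I powr (1 / r)))"
    using 2 by (simp add: Lp_weighted_norm_def Lp_norm_def)
  have "norm_le p a g M \<longleftrightarrow> I \<le> ennreal (M powr r)" using 2 by (simp add: norm_le_def I_def)
  also have "\<dots> \<longleftrightarrow> Lp_weighted_norm p a h \<le> ennreal M"
  proof (cases I rule: ennreal_cases)
    case (real i)
    have "i \<le> M powr r \<longleftrightarrow> i powr (1 / r) \<le> M"
    proof
      assume "i \<le> M powr r"
      then have "i powr (1 / r) \<le> (M powr r) powr (1 / r)" using real 2(2) by (intro powr_mono2) auto
      also have "\<dots> = M" using 2(2) M by (simp add: powr_powr)
      finally show "i powr (1 / r) \<le> M" .
    next
      assume "i powr (1 / r) \<le> M"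
      then have "(i powr (1 / r)) powr r \<le> M powr r" using 2(2) by (intro powr_mono2) auto
      then show "i \<le> M powr r" using 2(2) real by (simp add: powr_powr)
    qed
    then show ?thesis using real M by (simp add: n)
  next
    case top
    then show ?thesis by (simp add: n top_unique)
  qed
  finally show ?thesis by simp
qed

text \<open>Dominated convergence on each (-r, r), with majorant a multiple of (sin phi)^(-2 g),
  integrable as g < 1/2. The constant degenerates as r tends to 1, so continuity is obtained
  locally.\<close>

lemma continuous_spin_avg:
  assumes adm: "admissible \<infinity> m a" and [measurable]: "f \<in> borel_measurable borel"
    and f: "continuous_on Iv f" and M: "\<And>y. y \<in> Iv \<Longrightarrow> \<bar>f y\<bar> * (1 - y\<^sup>2) powr a \<le> M"
  shows "continuous_on Iv (spin_avg m t f)"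
proof -
  define g where "g = a - real m / 2"
  have g: "0 \<le> g" "g < 1 / 2" using adm by (auto simp: admissible_def g_def)
  have M0: "0 \<le> M" using M[of 0] by simp
  define N where "N x = (\<integral>\<phi>. indicator {0<..<pi} \<phi> * (spin_ker m x t \<phi> * f (rot_R x t \<phi>)) \<partial>lborel)" for x
  have int: "integrable lborel (\<lambda>\<phi>. indicator {0<..<pi} \<phi> * (sin \<phi>)\<^sup>2 powr (- g))"
  proof (rule integrableI_nonneg)
    obtain C where C: "0 < C" "\<And>x t. x \<in> Iv \<Longrightarrow>
      (\<integral>\<^sup>+\<phi>\<in>{0<..<pi}. ennreal ((1 - (rot_R x t \<phi>)\<^sup>2) powr (- g)) \<partial>lborel) \<le> ennreal (C * (1 - x\<^sup>2) powr (- g))"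
      using circ_avg_weight[OF g] by blast
    \<comment> \<open>At x = 0 and t = pi / 2 the point R is - cos phi, so the integral of the
      majorant is an instance of the weight estimate.\<close>
    have "(\<integral>\<^sup>+\<phi>. ennreal (indicator {0<..<pi} \<phi> * (sin \<phi>)\<^sup>2 powr (- g)) \<partial>lborel)
      = (\<integral>\<^sup>+\<phi>\<in>{0<..<pi}. ennreal ((1 - (rot_R 0 (pi / 2) \<phi>)\<^sup>2) powr (- g)) \<partial>lborel)"
      by (intro nn_integral_cong) (auto simp: indicator_def rot_R_def sin_squared_eq)
    also have "\<dots> < \<infinity>" by (rule le_less_trans[OF C(2)]) auto
    finally show "(\<integral>\<^sup>+\<phi>. ennreal (indicator {0<..<pi} \<phi> * (sin \<phi>)\<^sup>2 powr (- g)) \<partial>lborel) < \<infinity>" .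
  qed auto
  have "continuous_on {-r<..<r} N" if r: "r \<in> {0<..<1}" for r
  proof (rule continuous_on_sequentiallyI)
    fix u y assume u: "\<forall>n. u n \<in> {-r<..<r}" "y \<in> {-r<..<r}" "u \<longlonglongrightarrow> y"
    show "(\<lambda>n. N (u n)) \<longlonglongrightarrow> N y"
      unfolding N_def
    proof (rule integral_dominated_convergence)
      show "integrable lborel (\<lambda>\<phi>. (M * (1 - r\<^sup>2) powr (- g)) * (indicator {0<..<pi} \<phi> * (sin \<phi>)\<^sup>2 powr (- g)))"
        by (intro integrable_mult_right int)
      show "AE \<phi> in lborel. (\<lambda>n. indicator {0<..<pi} \<phi> * (spin_ker m (u n) t \<phi> * f (rot_R (u n) t \<phi>)))
          \<longlonglongrightarrow> indicator {0<..<pi} \<phi> * (spin_ker m y t \<phi> * f (rot_R y t \<phi>))"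
      proof (rule AE_I2)
        fix \<phi>
        show "(\<lambda>n. indicator {0<..<pi} \<phi> * (spin_ker m (u n) t \<phi> * f (rot_R (u n) t \<phi>)))
          \<longlonglongrightarrow> indicator {0<..<pi} \<phi> * (spin_ker m y t \<phi> * f (rot_R y t \<phi>))"
        proof (cases "\<phi> \<in> {0<..<pi}")
          case True
          have y: "y \<in> Iv" using u(2) r by auto
          have R: "(\<lambda>n. rot_R (u n) t \<phi>) \<longlonglongrightarrow> rot_R y t \<phi>"
            unfolding rot_R_def by (intro tendsto_intros u(3))
          have "isCont f (rot_R y t \<phi>)"
            using f rot_R_Iv[OF y True] by (simp add: continuous_on_eq_continuous_at)
          from isCont_tendsto_compose[OF this R]
          have "(\<lambda>n. f (rot_R (u n) t \<phi>)) \<longlonglongrightarrow> f (rot_R y t \<phi>)" .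
          moreover have "(\<lambda>n. spin_ker m (u n) t \<phi>) \<longlonglongrightarrow> spin_ker m y t \<phi>"
            unfolding spin_ker_def rot_q_def Complex_eq by (intro tendsto_intros u(3))
          ultimately show ?thesis by (intro tendsto_intros)
        qed simp
      qed
      show "AE \<phi> in lborel. norm (indicator {0<..<pi} \<phi> * (spin_ker m (u n) t \<phi> * f (rot_R (u n) t \<phi>)))
        \<le> (M * (1 - r\<^sup>2) powr (- g)) * (indicator {0<..<pi} \<phi> * (sin \<phi>)\<^sup>2 powr (- g))" for n
      proof (rule AE_I2)
        fix \<phi>
        show "norm (indicator {0<..<pi} \<phi> * (spin_ker m (u n) t \<phi> * f (rot_R (u n) t \<phi>)))
          \<le> (M * (1 - r\<^sup>2) powr (- g)) * (indicator {0<..<pi} \<phi> * (sin \<phi>)\<^sup>2 powr (- g))"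
        proof (cases "\<phi> \<in> {0<..<pi}")
          case True
          have un: "u n \<in> Iv" "(u n)\<^sup>2 \<le> r\<^sup>2"
            using u(1)[rule_format, of n] r by (auto simp: abs_le_square_iff[symmetric])
          let ?v = "1 - (rot_R (u n) t \<phi>)\<^sup>2"
          have R: "rot_R (u n) t \<phi> \<in> Iv" by (rule rot_R_Iv[OF un(1) True])
          then have v: "0 < ?v" by (rule Iv_weight_pos)
          have s: "0 < sin \<phi>" using True by (simp add: sin_gt_zero)
          have r2: "0 < 1 - r\<^sup>2" using r by (simp add: abs_square_less_1)
          have "\<bar>spin_ker m (u n) t \<phi> * f (rot_R (u n) t \<phi>)\<bar> \<le> ?v powr (real m / 2) * \<bar>f (rot_R (u n) t \<phi>)\<bar>"
            using spin_ker_le[of "u n" m t \<phi>] Iv_sq[OF un(1)] v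
            by (simp add: abs_mult sqrt_power_powr mult_right_mono)
          also have "?v powr (real m / 2) = ?v powr (- g) * ?v powr a"
            using v by (simp add: powr_add[symmetric] g_def)
          also have "?v powr (- g) * ?v powr a * \<bar>f (rot_R (u n) t \<phi>)\<bar> = ?v powr (- g) * (\<bar>f (rot_R (u n) t \<phi>)\<bar> * ?v powr a)"
            by (simp only: mult_ac)
          also have "\<dots> \<le> ((1 - r\<^sup>2) * (sin \<phi>)\<^sup>2) powr (- g) * M"
          proof (intro mult_mono M[OF R] powr_mono2')
            have "(1 - r\<^sup>2) * (sin \<phi>)\<^sup>2 \<le> (1 - (u n)\<^sup>2) * (sin \<phi>)\<^sup>2" using un by (intro mult_right_mono) auto
            also have "\<dots> \<le> ?v" using Iv_sq[OF un(1)] by (intro rot_R_weight_ge) simp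
            finally show "(1 - r\<^sup>2) * (sin \<phi>)\<^sup>2 \<le> ?v" .
          qed (use g r2 s in auto)
          also have "\<dots> = (M * (1 - r\<^sup>2) powr (- g)) * (sin \<phi>)\<^sup>2 powr (- g)"
            using r2 s by (simp add: powr_mult)
          finally show ?thesis using True by simp
        qed simp
      qed
    qed measurable
  qed
  then have c: "continuous_on (\<Union>r\<in>{0<..<1}. {-r<..<r}) N" by (intro continuous_on_open_UN) auto
  have "Iv \<subseteq> (\<Union>r\<in>{0<..<1}. {-r<..<r})"
  proof
    fix x :: real assume "x \<in> Iv"
    then show "x \<in> (\<Union>r\<in>{0<..<1}. {-r<..<r})"
      by (intro UN_I[of "(1 + \<bar>x\<bar>) / 2"]) (auto simp: field_simps)
  qed
  then have N: "continuous_on Iv N" by (rule continuous_on_subset[OF c])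
  have "continuous_on Iv (\<lambda>x. N x / (pi * sqrt (1 - x\<^sup>2) ^ m))"
    using Iv_weight_pos by (intro continuous_intros N) fastforce
  then show ?thesis by (simp add: N_def spin_avg_def[abs_def])
qed

text \<open>Composition with R preserves measurability for Borel functions, so a Lebesgue measurable
  f is replaced by a Borel function equal almost everywhere. Values outside the open interval are
  cut off first, since membership says nothing about them.\<close>

lemma Lp_weighted_borel_representative:
  assumes p: "1 \<le> p" and f: "f \<in> Lp_weighted p a"
  obtains g M where "g \<in> borel_measurable borel" "0 \<le> M" "norm_le p a g M"
    "AE x in lborel. x \<in> Iv \<longrightarrow> f x = g x"
    "p = \<infinity> \<longrightarrow> continuous_on Iv g \<and> (\<forall>x\<in>Iv. f x = g x)"
proof -
  from f obtain k where k: "k \<in> Lp_space p" "\<And>x. x \<in> Iv \<Longrightarrow> k x = f x * (1 - x\<^sup>2) powr a"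
    by (auto simp: Lp_weighted_def)
  define f1 where "f1 x = indicator Iv x * (k x / (1 - x\<^sup>2) powr a)" for x
  have f1: "f1 x = f x" if "x \<in> Iv" for x
    using that k(2) Iv_weight_pos[OF that] by (simp add: f1_def)
  show ?thesis
  proof (cases "p = \<infinity>")
    case True
    then have ck: "continuous_on {-1..1} k" using k(1) by (simp add: Lp_space_def)
    have c: "continuous_on Iv (\<lambda>x. k x / (1 - x\<^sup>2) powr a)"
      using Iv_weight_pos by (intro continuous_intros continuous_on_subset[OF ck]) fastforce+
    have "compact (k ` {-1..1})" using ck by (intro compact_continuous_image) auto
    then obtain M where M: "\<And>x. x \<in> {-1..1} \<Longrightarrow> \<bar>k x\<bar> \<le> M"
      by (metis compact_imp_bounded bounded_iff imageI real_norm_def)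
    have "f1 \<in> borel_measurable borel"
      using borel_measurable_continuous_on_indicator[OF _ c] by (simp add: f1_def[abs_def])
    moreover have "0 \<le> M" using M[of 0] by simp
    moreover have "norm_le p a f1 M"
    proof -
      have "\<bar>f1 x\<bar> * (1 - x\<^sup>2) powr a \<le> M" if "x \<in> Iv" for x
      proof -
        have "\<bar>f1 x\<bar> * (1 - x\<^sup>2) powr a = \<bar>k x\<bar>" using k(2)[OF that] f1[OF that] by (simp add: abs_mult)
        then show ?thesis using M[of x] that by simp
      qed
      then show ?thesis by (simp add: norm_le_def True)
    qed
    moreover have "continuous_on Iv f1" by (rule continuous_on_eq[OF c]) (simp add: f1_def)
    ultimately show ?thesis using that[of f1 M] f1 by simp
  next
    case False
    then have kL: "k \<in> borel_measurable (lebesgue_on {-1..1})" "Lp_norm p k < \<infinity>"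
      using k(1) by (auto simp: Lp_space_def)
    have "(\<lambda>x. indicator {-1..1} x *\<^sub>R k x) \<in> borel_measurable lebesgue"
      using kL(1) by (simp add: borel_measurable_restrict_space_iff)
    moreover have "(\<lambda>x. indicator Iv x / (1 - x\<^sup>2) powr a) \<in> borel_measurable lebesgue"
      by (rule measurable_completion) measurable
    ultimately have "(\<lambda>x. (indicator {-1..1} x *\<^sub>R k x) * (indicator Iv x / (1 - x\<^sup>2) powr a)) \<in> borel_measurable lebesgue"
      by (rule borel_measurable_times)
    moreover have "(indicator {-1..1} x *\<^sub>R k x) * (indicator Iv x / (1 - x\<^sup>2) powr a) = f1 x" for x
      by (auto simp: f1_def indicator_def)
    ultimately have "f1 \<in> borel_measurable lebesgue" by simp
    from completion_ex_borel_measurable_real[OF this]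
    obtain g where [measurable]: "g \<in> borel_measurable borel" and g: "AE x in lborel. f1 x = g x" by auto
    have fg: "AE x in lborel. x \<in> Iv \<longrightarrow> f x = g x" using g by eventually_elim (use f1 in auto)
    have "Lp_norm p k = Lp_weighted_norm p a f1"
    proof -
      have "(\<integral>\<^sup>+ x\<in>{-1..1}. ennreal (\<bar>k x\<bar> powr enn2real p) \<partial>lebesgue)
        = (\<integral>\<^sup>+ x\<in>{-1..1}. ennreal (\<bar>f1 x * (1 - x\<^sup>2) powr a\<bar> powr enn2real p) \<partial>lebesgue)"
        unfolding nn_integral_completion
      proof (rule nn_integral_cong_AE)
        show "AE x in lborel. ennreal (\<bar>k x\<bar> powr enn2real p) * indicator {-1..1} x
          = ennreal (\<bar>f1 x * (1 - x\<^sup>2) powr a\<bar> powr enn2real p) * indicator {-1..1} x"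
          using AE_lborel_singleton[of "-1"] AE_lborel_singleton[of 1]
          by eventually_elim (use k(2) f1 in \<open>auto simp: indicator_def\<close>)
      qed
      then show ?thesis using False by (simp add: Lp_norm_def Lp_weighted_norm_def)
    qed
    then obtain M where M: "0 \<le> M" "Lp_weighted_norm p a f1 = ennreal M"
      using kL(2) by (cases "Lp_norm p k" rule: ennreal_cases) auto
    have "norm_le p a g M"
    proof -
      have "AE x in lborel. x \<in> Iv \<longrightarrow> f1 x = g x" using g by eventually_elim simp
      from Lp_weighted_norm_le_iff[OF p M(1) this, of a] show ?thesis using M(2) False by simp
    qed
    then show ?thesis using that[of g M] M(1) fg False by simp
  qed
qed

section \<open>Transfer to best approximations and moduli of smoothness\<close>

lemma best_approx_antimono: "i \<le> j \<Longrightarrow> best_approx j p a f \<le> best_approx i p a f"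
  unfolding best_approx_def by (intro INF_superset_mono) auto

theorem mainTheorem1:
  fixes p :: ennreal and \<mu> :: nat and \<alpha> :: real
  assumes "1 \<le> p"
    and "p = 1 \<Longrightarrow> - 1 / 2 < \<alpha> - real \<mu> / 2 \<and> \<alpha> - real \<mu> / 2 \<le> 0"
    and "1 < p \<Longrightarrow> p < \<infinity> \<Longrightarrow> - 1 / (2 * enn2real p) < \<alpha> - real \<mu> / 2
           \<and> \<alpha> - real \<mu> / 2 < 1 / 2 - 1 / (2 * enn2real p)"
    and "p = \<infinity> \<Longrightarrow> 0 \<le> \<alpha> - real \<mu> / 2 \<and> \<alpha> - real \<mu> / 2 < 1 / 2"
  shows "\<exists>C\<^sub>1 C\<^sub>2 :: real. C\<^sub>1 > 0 \<and> C\<^sub>2 > 0 \<and>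
    (\<forall>f\<in>Lp_weighted p \<alpha>. \<forall>n\<ge>1.
       ennreal C\<^sub>1 * best_approx n p \<alpha> f \<le> gen_modulus \<mu> p \<alpha> f (1 / real n) \<and>
       gen_modulus \<mu> p \<alpha> f (1 / real n)
         \<le> ennreal C\<^sub>2 * ennreal (1 / (real n)\<^sup>2) * (\<Sum>\<nu>=1..n. of_nat \<nu> * best_approx \<nu> p \<alpha> f))"
proof -
  note p = assms(1)
  have adm: "admissible p \<mu> \<alpha>" unfolding admissible_def using assms by blast
  show ?thesis
  proof (rule direct_estimate[OF adm], rule inverse_estimate[OF adm], goal_cases)
  case (1 A B)
  note A = 1(1) and direct = 1(2) and B = 1(3) and inverse = 1(4)
  have "ennreal (1 / A) * best_approx n p \<alpha> f \<le> gen_modulus \<mu> p \<alpha> f (1 / real n) \<and>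
       gen_modulus \<mu> p \<alpha> f (1 / real n)
         \<le> ennreal B * ennreal (1 / (real n)\<^sup>2) * (\<Sum>\<nu>=1..n. of_nat \<nu> * best_approx \<nu> p \<alpha> f)"
    if f: "f \<in> Lp_weighted p \<alpha>" and n: "1 \<le> n" for f n
  proof -
    obtain g M where g [measurable]: "g \<in> borel_measurable borel" and M: "0 \<le> M" "norm_le p \<alpha> g M"
      and fg: "AE x in lborel. x \<in> Iv \<longrightarrow> f x = g x"
      and rep: "p = \<infinity> \<longrightarrow> continuous_on Iv g \<and> (\<forall>x\<in>Iv. f x = g x)"
      by (rule Lp_weighted_borel_representative[OF p f])
    have inf: "continuous_on Iv g \<and> (\<forall>x\<in>Iv. f x = g x)" if "p = \<infinity>" using rep that by blast
    have poly_norm: "Lp_weighted_norm p \<alpha> (\<lambda>x. f x - poly Q x) \<le> ennreal W \<longleftrightarrow> norm_le p \<alpha> (\<lambda>x. g x - poly Q x) W"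
      if "0 \<le> W" for Q W
      by (rule Lp_weighted_norm_le_iff[OF p that])
         (use fg inf in \<open>auto elim!: eventually_mono intro!: continuous_intros\<close>)
    have dif_norm: "Lp_weighted_norm p \<alpha> (\<lambda>x. gen_translation \<mu> t f x - f x) \<le> ennreal W \<longleftrightarrow> norm_le p \<alpha> (dif \<mu> \<bar>t\<bar> g) W"
      if W: "0 \<le> W" for t W
    proof (rule Lp_weighted_norm_le_iff[OF p W])
      show "AE x in lborel. x \<in> Iv \<longrightarrow> gen_translation \<mu> t f x - f x = dif \<mu> \<bar>t\<bar> g x"
        using AE_rot_R[OF fg, of "\<bar>t\<bar>"] fg
        by eventually_elim (simp add: dif_def gen_translation_eq_tau[OF _ g])
    next
      \<comment> \<open>Suprema are at stake here, so the translate must be continuous and given by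
        \<open>dif\<close> at every x. For this the essential bound on g is first turned into a
        pointwise one.\<close>
      assume top: "p = \<infinity>"
      have "\<bar>g y\<bar> * (1 - y\<^sup>2) powr \<alpha> \<le> M" if y: "y \<in> Iv" for y
      proof -
        have "continuous_on Iv (\<lambda>x. \<bar>g x\<bar> * (1 - x\<^sup>2) powr \<alpha>)"
          using inf[OF top] Iv_weight_pos by (intro continuous_intros) fastforce+
        moreover have "AE x in lborel. x \<in> Iv \<longrightarrow> \<bar>g x\<bar> * (1 - x\<^sup>2) powr \<alpha> \<le> M"
          using M(2) by (simp add: norm_le_def top)
        ultimately show ?thesis by (intro AE_lborel_open_imp[OF _ _ _ y, where h = "\<lambda>x. \<bar>g x\<bar> * (1 - x\<^sup>2) powr \<alpha>"]) auto
      qed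
      then have "continuous_on Iv (spin_avg \<mu> \<bar>t\<bar> g)"
        using adm inf[OF top] by (intro continuous_spin_avg[of \<mu> \<alpha> g M]) (auto simp: top)
      then have "continuous_on Iv (\<lambda>x. 1 / cw \<mu> \<bar>t\<bar> * spin_avg \<mu> \<bar>t\<bar> g x - g x)"
        using inf[OF top] by (intro continuous_intros) auto
      moreover have "gen_translation \<mu> t f x - f x = dif \<mu> \<bar>t\<bar> g x" if "x \<in> Iv" for x
        using that inf[OF top] rot_R_Iv[OF that] by (simp add: dif_def gen_translation_eq_tau[OF that g])
      ultimately show "continuous_on Iv (dif \<mu> \<bar>t\<bar> g) \<and> (\<forall>x\<in>Iv. gen_translation \<mu> t f x - f x = dif \<mu> \<bar>t\<bar> g x)"
        by (simp add: dif_def[abs_def] tau_def)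
    qed
    have n1: "1 / real n \<le> 1" "1 / real n < pi" using n pi_ge_two by (auto simp: divide_le_eq intro: le_less_trans[of _ 1])
    show ?thesis
    proof
      show "ennreal (1 / A) * best_approx n p \<alpha> f \<le> gen_modulus \<mu> p \<alpha> f (1 / real n)"
      \<comment> \<open>An infinite modulus bounds everything; otherwise it is a real number
        w.\<close>
      proof (cases "gen_modulus \<mu> p \<alpha> f (1 / real n)" rule: ennreal_cases)
        case (real w)
        have le: "best_approx n p \<alpha> f \<le> ennreal (A * w) + ennreal e" if e: "0 < e" for e
        proof -
          \<comment> \<open>The direct estimate asks for W > 0; raising w by e / A costs e after
            multiplication by A.\<close>
          define W where "W = w + e / A"
          have W: "0 < W" using e A real(1) by (simp add: W_def add_nonneg_pos)
          have "norm_le p \<alpha> (dif \<mu> u g) W" if u: "0 < u" "u \<le> 1 / real n" for u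
          proof -
            have "Lp_weighted_norm p \<alpha> (\<lambda>x. gen_translation \<mu> u f x - f x) \<le> gen_modulus \<mu> p \<alpha> f (1 / real n)"
              unfolding gen_modulus_def using u n1 by (intro SUP_upper) auto
            also have "\<dots> \<le> ennreal W" unfolding real(2) using e A by (intro ennreal_leI) (simp add: W_def)
            finally show ?thesis using dif_norm[of W u] W u by simp
          qed
          from direct[OF g M(2) _ W this, of n] n
          obtain Q where Q: "degree Q \<le> n - 1" "norm_le p \<alpha> (\<lambda>x. g x - poly Q x) (A * W)" by auto
          have "best_approx n p \<alpha> f \<le> Lp_weighted_norm p \<alpha> (\<lambda>x. f x - poly Q x)"
            unfolding best_approx_def using Q(1) by (intro INF_lower) simp
          also have "\<dots> \<le> ennreal (A * W)" using poly_norm[of "A * W" Q] Q(2) A W by simp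
          also have "A * W = A * w + e" using A by (simp add: W_def distrib_left)
          also have "ennreal \<dots> = ennreal (A * w) + ennreal e" using A e real(1) by simp
          finally show ?thesis .
        qed
        have "best_approx n p \<alpha> f \<le> ennreal (A * w)" by (rule ennreal_le_epsilon) (rule le)
        then have "ennreal (1 / A) * best_approx n p \<alpha> f \<le> ennreal (1 / A) * ennreal (A * w)" by (rule mult_left_mono) simp
        also have "\<dots> = ennreal w" using A by (simp add: ennreal_mult'[symmetric])
        finally show ?thesis by (simp add: real(2))
      qed simp
      define E where "E k = enn2real (best_approx k p \<alpha> f)" for k
      \<comment> \<open>Approximating by 0 shows finiteness, so the best approximations may be
        treated as real numbers.\<close>
      have E: "best_approx k p \<alpha> f = ennreal (E k)" for k
      proof -
        have "best_approx k p \<alpha> f \<le> Lp_weighted_norm p \<alpha> (\<lambda>x. f x - poly 0 x)"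
          unfolding best_approx_def by (intro INF_lower) simp
        also have "\<dots> \<le> ennreal M" using poly_norm[of M 0] M by simp
        finally have "best_approx k p \<alpha> f < top" by (rule le_less_trans) simp
        then show ?thesis by (simp add: E_def)
      qed
      have E0: "0 \<le> E k" for k by (simp add: E_def)
      define S where "S = B / (real n)\<^sup>2 * (\<Sum>k=1..n. real k * E k)"
      \<comment> \<open>T is the factor by which the right-hand side grows when every E k is raised
        by the same amount. Raising each by e / T makes room for near-best polynomials and costs e
        in total.\<close>
      define T where "T = B / (real n)\<^sup>2 * (\<Sum>k=1..n. real k)"
      have T: "0 < T" unfolding T_def using n B by (intro mult_pos_pos divide_pos_pos sum_pos) auto
      have S: "0 \<le> S" unfolding S_def using B E0 by (intro mult_nonneg_nonneg sum_nonneg) auto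
      have "gen_modulus \<mu> p \<alpha> f (1 / real n) \<le> ennreal S"
        unfolding gen_modulus_def
      proof (rule SUP_least)
        fix t assume "t \<in> {t. - pi < t \<and> t < pi \<and> \<bar>t\<bar> \<le> 1 / real n}"
        then have t: "\<bar>t\<bar> \<le> 1 / real n" by simp
        have "norm_le p \<alpha> (dif \<mu> \<bar>t\<bar> g) S"
        \<comment> \<open>The inverse estimate concerns positive parameters; at t = 0 the
          translation is the identity.\<close>
        proof (cases "t = 0")
          case True
          have "norm_le p \<alpha> (dif \<mu> 0 g) 0"
            by (rule norm_le_cong_AE[OF p norm_le_zero[OF p]]) (auto simp: dif_def tau_def cw_def spin_avg_0)
          then show ?thesis using norm_le_mono[OF p _ S] True by simp
        next
          case False
          show ?thesis
          proof (rule norm_le_closed[OF p S])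
            fix e :: real assume e: "0 < e"
            have "norm_le p \<alpha> (dif \<mu> \<bar>t\<bar> g) (B / (real n)\<^sup>2 * (\<Sum>k=1..n. real k * (E k + e / T)))"
            proof (rule inverse[OF g M(2)])
              show "0 < n" "0 < \<bar>t\<bar>" "\<bar>t\<bar> \<le> 1 / real n" using n False t by auto
              show "0 \<le> E k + e / T" for k using E0 e T by simp
              show "E j + e / T \<le> E i + e / T" if "i \<le> j" for i j
                using best_approx_antimono[OF that, of p \<alpha> f] E0 by (simp add: E)
              fix k :: nat
              have "best_approx k p \<alpha> f < ennreal (E k + e / T)" using E0 e T by (simp add: E ennreal_less_iff)
              then obtain P where P: "degree P \<le> k - 1" "Lp_weighted_norm p \<alpha> (\<lambda>x. f x - poly P x) < ennreal (E k + e / T)"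
                unfolding best_approx_def INF_less_iff by auto
              have "0 \<le> E k + e / T" using E0 e T by simp
              with P show "\<exists>P. degree P \<le> k - 1 \<and> norm_le p \<alpha> (\<lambda>x. g x - poly P x) (E k + e / T)"
                using poly_norm less_imp_le by blast
            qed
            also have "B / (real n)\<^sup>2 * (\<Sum>k=1..n. real k * (E k + e / T)) = S + T * (e / T)"
              unfolding S_def T_def by (simp only: distrib_left sum.distrib sum_distrib_right[symmetric] mult.assoc)
            also have "T * (e / T) = e" using T by simp
            finally show "norm_le p \<alpha> (dif \<mu> \<bar>t\<bar> g) (S + e)" .
          qed
        qed
        then show "Lp_weighted_norm p \<alpha> (\<lambda>x. gen_translation \<mu> t f x - f x) \<le> ennreal S" using dif_norm[OF S] by simp
      qed
      also have "ennreal S = ennreal B * ennreal (1 / (real n)\<^sup>2) * (\<Sum>\<nu>=1..n. of_nat \<nu> * best_approx \<nu> p \<alpha> f)"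
      proof -
        have "(\<Sum>\<nu>=1..n. of_nat \<nu> * best_approx \<nu> p \<alpha> f) = ennreal (\<Sum>k=1..n. real k * E k)"
          using E0 by (simp add: E ennreal_of_nat_eq_real_of_nat ennreal_mult'[symmetric] sum_ennreal)
        then show ?thesis using B by (simp add: S_def ennreal_mult'[symmetric])
      qed
      finally show "gen_modulus \<mu> p \<alpha> f (1 / real n)
         \<le> ennreal B * ennreal (1 / (real n)\<^sup>2) * (\<Sum>\<nu>=1..n. of_nat \<nu> * best_approx \<nu> p \<alpha> f)" .
    qed
  qed
  then show ?thesis using A B by (intro exI[of _ "1 / A"] exI[of _ B]) simp
  qed
qed

end
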